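(* Let $0<\alpha<1$, let $n,N,b$ be positive integers, and let $A_0(D_x)$ be a homogeneous differential operator of order $2b$ with constant complex $N\times N$ matrix coefficients satisfying the strong parabolicity condition $\operatorname{Re}\langle A_0(\eta)z,z\rangle\le-\delta|\eta|^{2b}|z|^2$ for all $\eta\in\mathbb R^n$, $z\in\mathbb C^N$, with some $\delta>0$. Let $Z_\alpha(t,x)$, $Y_\alpha(t,x)$ be the matrix kernels associated with the system $\mathbb D_t^{(\alpha)}u=A_0(D_x)u$, as defined in the context. Then $Z_\alpha(t,x)$ and $Y_\alpha(t,x)$ are infinitely differentiable for $t>0$, $x\ne0$, and satisfy the following estimates for $t>0$, $x\neq 0$ and every multi-index $\beta$. Denote $R=t^{-\alpha}|x|^{2b}$ and $\rho(t,x)=\left(t^{-\alpha}|x|^{2b}\right)^{\frac1{2b-\alpha}}$. (i) If $R\ge1$, then, with some $\sigma>0$, $$|D_x^\beta Z_\alpha(t,x)|\le Ct^{-\alpha\frac{n+|\beta|}{2b}}\exp(-\sigma\rho(t,x)),\qquad |D_x^\beta Y_\alpha(t,x)|\le Ct^{-\alpha\frac{n+|\beta|}{2b}+\alpha-1}\exp(-\sigma\rho(t,x)).$$ (ii) If $R\le1$ and $n+|\beta|<2b$, then $$|D_x^\beta Z_\alpha(t,x)|\le Ct^{-\alpha\frac{n+|\beta|}{2b}},\qquad |D_x^\beta Y_\alpha(t,x)|\le Ct^{-\alpha\frac{n+|\beta|}{2b}+\alpha-1}.$$ (iii) If $R\le1$ and $n+|\beta|>2b$, then $$|D_x^\beta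 Z_\alpha(t,x)|\le Ct^{-\alpha}|x|^{-n+2b-|\beta|},\qquad |D_x^\beta Y_\alpha(t,x)|\le Ct^{-1}|x|^{-n+2b-|\beta|}.$$ (iv) If $R\le1$ and $n+|\beta|=2b$, then $$|D_x^\beta Z_\alpha(t,x)|\le Ct^{-\alpha}\ \text{ if } n=1;\qquad |D_x^\beta Z_\alpha(t,x)|\le Ct^{-\alpha}\left[\left|\log(t^{-\alpha}|x|^{2b})\right|+1\right]\ \text{ if } n\ge2;$$ $$|D_x^\beta Y_\alpha(t,x)|\le Ct^{-1}.$$ (v) If $R\ge1$, then $$\left|\frac{\partial Z_\alpha(t,x)}{\partial t}\right|\le Ct^{-\frac{\alpha n}{2b}-1}\exp(-\sigma\rho(t,x)).$$ (vi) If $R\le1$, then $$\left|\frac{\partial Z_\alpha(t,x)}{\partial t}\right|\le\begin{cases}Ct^{-\frac{\alpha n}{2b}-1},& n<2b,\\ Ct^{-\alpha-1}|x|^{-n+2b},& n>2b,\\ Ct^{-\alpha-1}\left[\left|\log(t^{-\alpha}|x|^{2b})\right|+1\right],& n=2b.\end{cases}$$ In all these estimates (for given $\alpha,b,\beta$) the constants depend only on $N$, $n$, $\max|a_\mu^{ij}|$ (the maximum of the absolute values of the coefficients of $A_0$) and the strong parabolicity constant $\delta$.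
   Context: Notation: $D_{x_j}=\frac1{\sqrt{-1}}\frac{\partial}{\partial x_j}$, $D_x^\beta=D_{x_1}^{\beta_1}\cdots D_{x_n}^{\beta_n}$, $|\beta|=\beta_1+\dots+\beta_n$; $|\cdot|$ denotes norms of finite vectors and matrices; $C,\sigma$ denote positive constants. The operator is $(A_0(D_x)u)_i=\sum_{j=1}^N\sum_{|\mu|=2b}a_\mu^{ij}D_x^\mu u_j$, $i=1,\dots,N$, $a_\mu^{ij}\in\mathbb C$, and $A_0(\eta)$ is the $N\times N$ matrix with entries $\sum_{|\mu|=2b}a_\mu^{ij}\eta^\mu$. For $0<\alpha<1$ the Caputo–Dzhrbashyan derivative is $$(\mathbb D_t^{(\alpha)}u)(t)=\frac1{\Gamma(1-\alpha)}\left[\frac{d}{dt}\int_0^t(t-\tau)^{-\alpha}u(\tau)\,d\tau-t^{-\alpha}u(0)\right].$$ Let $Z(t,x)=(2\pi)^{-n}\int_{\mathbb R^n}e^{ix\cdot\xi}e^{tA_0(\xi)}\,d\xi$, $t>0$, be the fundamental solution of the Cauchy problem for the parabolic system $\partial u/\partial t=A_0(D_x)u$. Let $$\Phi_\alpha(\zeta)=\sum_{k=0}^\infty\frac{(-\zeta)^k}{k!\,\Gamma(-\alpha k+1-\alpha)}$$ and $\varphi_{t,\alpha}(s)=t^{-\alpha}\Phi_\alpha(st^{-\alpha})$. Define $$Z_\alpha(t,x)=\int_0^\infty\varphi_{t,\alpha}(s)Z(s,x)\,ds,\qquad Y_\alpha(t,x)=\left(\mathbb D_t^{(1-\alpha)}Z_\alpha\right)(t,x),\qquad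 t>0,\ x\ne0,$$ where for $x\neq0$ one takes $Z_\alpha(0,x)=0$. *)

theory Defs
  imports "HOL-Analysis.Analysis"
begin

section \<open>Matrices\<close>

text \<open>
  On \<open>complex ^ 'N ^ 'N\<close> the library product \<open>(*)\<close> is componentwise, so the matrix exponential
  is not \<open>exp\<close>; it is the power series taken with respect to \<open>(**)\<close>. The norm of a matrix is
  the library \<open>norm\<close>, i.e. the Euclidean (Frobenius) norm.
\<close>

definition cscale :: "complex \<Rightarrow> complex ^ 'm ^ 'n \<Rightarrow> complex ^ 'm ^ 'n" where
  "cscale c A = (\<chi> i j. c * A $ i $ j)"

definition matrix_exp :: "complex ^ 'N ^ 'N \<Rightarrow> complex ^ 'N ^ ('N::finite)" where
  "matrix_exp A = (\<Sum>k. (1 / fact k) *\<^sub>R (((**) A ^^ k) (mat 1)))"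

definition hermitian_inner :: "complex ^ 'N \<Rightarrow> complex ^ ('N::finite) \<Rightarrow> complex" where
  "hermitian_inner w z = (\<Sum>i\<in>UNIV. w $ i * cnj (z $ i))"

section \<open>Multi-indices and differentiation\<close>

definition mi_size :: "('n::finite \<Rightarrow> nat) \<Rightarrow> nat" where
  "mi_size \<beta> = (\<Sum>j\<in>UNIV. \<beta> j)"

definition monomial :: "real ^ 'n \<Rightarrow> ('n::finite \<Rightarrow> nat) \<Rightarrow> real" where
  "monomial \<eta> \<mu> = (\<Prod>j\<in>UNIV. (\<eta> $ j) ^ \<mu> j)"

definition partial_D ::
  "'n \<Rightarrow> (real ^ 'n \<Rightarrow> complex ^ 'N ^ 'N) \<Rightarrow> real ^ ('n::finite) \<Rightarrow> complex ^ 'N ^ ('N::finite)" where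
  "partial_D j F x =
     cscale (1 / \<i>) (vector_derivative (\<lambda>h. F (x + h *\<^sub>R axis j 1)) (at 0))"

text \<open>
  The linear order on the index type only fixes the order in which the partial derivatives
  are composed, \<open>D\<^sub>1\<close> being the outermost one.
\<close>

definition multi_D ::
  "('n::{finite,linorder} \<Rightarrow> nat) \<Rightarrow> (real ^ ('n::{finite,linorder}) \<Rightarrow> complex ^ 'N ^ 'N) \<Rightarrow>
   real ^ ('n::{finite,linorder}) \<Rightarrow> complex ^ 'N ^ ('N::finite)" where
  "multi_D \<beta> F = foldr (\<lambda>j. partial_D j ^^ \<beta> j) (sorted_list_of_set UNIV) F"

text \<open>\<open>k\<close> times continuously differentiable on \<open>S\<close>; meant for open \<open>S\<close>.\<close>

fun C_k_on :: "nat \<Rightarrow> 'a::real_normed_vector set \<Rightarrow> ('a \<Rightarrow> 'b::real_normed_vector) \<Rightarrow> bool" where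
  "C_k_on 0 S f \<longleftrightarrow> continuous_on S f"
| "C_k_on (Suc k) S f \<longleftrightarrow>
     (\<forall>x\<in>S. f differentiable (at x)) \<and>
     (\<forall>v. C_k_on k S (\<lambda>x. frechet_derivative f (at x) v))"

definition C_infinity_on :: "'a::real_normed_vector set \<Rightarrow> ('a \<Rightarrow> 'b::real_normed_vector) \<Rightarrow> bool" where
  "C_infinity_on S f \<longleftrightarrow> (\<forall>k. C_k_on k S f)"

definition caputo :: "real \<Rightarrow> (real \<Rightarrow> 'b::{banach,second_countable_topology}) \<Rightarrow> real \<Rightarrow> 'b" where
  "caputo \<alpha> u t =
     (1 / Gamma (1 - \<alpha>)) *\<^sub>R
       (vector_derivative (\<lambda>s. LINT \<tau>:{0<..<s}|lborel. (s - \<tau>) powr (- \<alpha>) *\<^sub>R u \<tau>) (at t)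
        - t powr (- \<alpha>) *\<^sub>R u 0)"

section \<open>The operator\<close>

text \<open>
  A homogeneous operator of order \<open>2 * b\<close> is given by its coefficients, \<open>a \<mu> $ i $ j\<close> being the
  coefficient of \<open>D\<^sup>\<mu> u\<^sub>j\<close> in the \<open>i\<close>-th equation; only the multi-indices with
  \<open>mi_size \<mu> = 2 * b\<close> matter.
\<close>

definition A0_symbol ::
  "nat \<Rightarrow> (('n::finite \<Rightarrow> nat) \<Rightarrow> complex ^ 'N ^ 'N) \<Rightarrow> real ^ 'n \<Rightarrow> complex ^ 'N ^ ('N::finite)" where
  "A0_symbol b a \<eta> =
     (\<chi> i j. \<Sum>\<mu> | mi_size \<mu> = 2 * b. a \<mu> $ i $ j * complex_of_real (monomial \<eta> \<mu>))"

definition strongly_parabolic ::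
  "nat \<Rightarrow> real \<Rightarrow> (('n::finite \<Rightarrow> nat) \<Rightarrow> complex ^ 'N ^ ('N::finite)) \<Rightarrow> bool" where
  "strongly_parabolic b \<delta> a \<longleftrightarrow>
     (\<forall>\<eta> z. Re (hermitian_inner (A0_symbol b a \<eta> *v z) z) \<le> - \<delta> * norm \<eta> ^ (2 * b) * (norm z)\<^sup>2)"

definition coeff_max :: "nat \<Rightarrow> (('n::finite \<Rightarrow> nat) \<Rightarrow> complex ^ 'N ^ ('N::finite)) \<Rightarrow> real" where
  "coeff_max b a = Max {cmod (a \<mu> $ i $ j) | \<mu> i j. mi_size \<mu> = 2 * b}"

section \<open>The kernels\<close>

definition Z_kernel ::
  "nat \<Rightarrow> (('n::finite \<Rightarrow> nat) \<Rightarrow> complex ^ 'N ^ 'N) \<Rightarrow> real \<Rightarrow> real ^ 'n \<Rightarrow>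
   complex ^ 'N ^ ('N::finite)" where
  "Z_kernel b a t x =
     (1 / (2 * pi) ^ CARD('n)) *\<^sub>R
       (LINT \<xi>|lborel. cscale (cis (x \<bullet> \<xi>)) (matrix_exp (t *\<^sub>R A0_symbol b a \<xi>)))"

text \<open>\<open>rGamma\<close> is the entire function \<open>1 / \<Gamma>\<close>, which vanishes at the poles of \<open>\<Gamma>\<close>.\<close>

definition Phi :: "real \<Rightarrow> real \<Rightarrow> real" where
  "Phi \<alpha> \<zeta> = (\<Sum>k. (- \<zeta>) ^ k / fact k * rGamma (- \<alpha> * real k + 1 - \<alpha>))"

definition phi :: "real \<Rightarrow> real \<Rightarrow> real \<Rightarrow> real" where
  "phi \<alpha> t s = t powr (- \<alpha>) * Phi \<alpha> (s * t powr (- \<alpha>))"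

definition Z_frac ::
  "real \<Rightarrow> nat \<Rightarrow> (('n::finite \<Rightarrow> nat) \<Rightarrow> complex ^ 'N ^ 'N) \<Rightarrow> real \<Rightarrow> real ^ 'n \<Rightarrow>
   complex ^ 'N ^ ('N::finite)" where
  "Z_frac \<alpha> b a t x =
     (if t = 0 then 0 else LINT s:{0<..}|lborel. phi \<alpha> t s *\<^sub>R Z_kernel b a s x)"

definition Y_frac ::
  "real \<Rightarrow> nat \<Rightarrow> (('n::finite \<Rightarrow> nat) \<Rightarrow> complex ^ 'N ^ 'N) \<Rightarrow> real \<Rightarrow> real ^ 'n \<Rightarrow>
   complex ^ 'N ^ ('N::finite)" where
  "Y_frac \<alpha> b a t x = caputo (1 - \<alpha>) (\<lambda>\<tau>. Z_frac \<alpha> b a \<tau> x) t"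

definition Z_frac_dt ::
  "real \<Rightarrow> nat \<Rightarrow> (('n::finite \<Rightarrow> nat) \<Rightarrow> complex ^ 'N ^ 'N) \<Rightarrow> real \<Rightarrow> real ^ 'n \<Rightarrow>
   complex ^ 'N ^ ('N::finite)" where
  "Z_frac_dt \<alpha> b a t x = vector_derivative (\<lambda>s. Z_frac \<alpha> b a s x) (at t)"

definition R_var :: "real \<Rightarrow> nat \<Rightarrow> real \<Rightarrow> real ^ ('n::finite) \<Rightarrow> real" where
  "R_var \<alpha> b t x = t powr (- \<alpha>) * norm x ^ (2 * b)"

definition rho :: "real \<Rightarrow> nat \<Rightarrow> real \<Rightarrow> real ^ ('n::finite) \<Rightarrow> real" where
  "rho \<alpha> b t x = (t powr (- \<alpha>) * norm x ^ (2 * b)) powr (1 / (2 * real b - \<alpha>))"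

end

theory Submission
  imports Defs "HOL-Complex_Analysis.Complex_Analysis" "HOL-Real_Asymp.Real_Asymp"
begin

text \<open>
  Let \<open>wright \<gamma> t s\<close> be the inverse Laplace transform, taken at time \<open>t\<close>, of
  \<open>p powr \<gamma> * exp (- s * p powr \<alpha>)\<close>, and let \<open>weighted_Z b a \<beta> s\<close> be the derivative
  \<open>D\<^sup>\<beta> Z(s, \<cdot>)\<close> of the parabolic kernel, written as a Fourier integral. The proof rests on the family
  \<open>frac_kernel b a \<gamma> \<beta> t x\<close>, the integral of \<open>wright \<gamma> t s *\<^sub>R weighted_Z b a \<beta> s x\<close> over \<open>s > 0\<close>.

  \<^bold>\<open>Everything lies in the family.\<close> Differentiation in \<open>t\<close> raises \<open>\<gamma>\<close> by one and \<open>D\<^sub>j\<close> raises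
  \<open>\<beta> j\<close> by one, so the family is closed under differentiation and all its members are smooth for
  \<open>t > 0\<close>, \<open>x \<noteq> 0\<close> (\<open>frac_kernel_has_derivative\<close>). Expanding the exponential in the contour
  integral and applying Hankel's formula to each term gives the series of \<open>phi\<close>, which is thus
  \<open>wright (\<alpha> - 1)\<close> (\<open>Phi_eq_wright\<close>); hence \<open>Z_frac\<close> is the member \<open>\<gamma> = \<alpha> - 1\<close> and its time
  derivative the member \<open>\<gamma> = \<alpha>\<close>. On the Laplace side the fractional integral of order \<open>\<alpha>\<close> is
  multiplication by \<open>p powr (- \<alpha>)\<close>, so it leads from \<open>\<gamma> = \<alpha> - 1\<close> to \<open>\<gamma> = - 1\<close>
  (\<open>fractional_integral_wright\<close>); one time derivative later, \<open>Y_frac\<close> is the member \<open>\<gamma> = 0\<close>.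

  \<^bold>\<open>Decay of the two factors.\<close> Both are integrals whose value does not change when the path is moved
  into the complex domain, and the decay comes from the best choice of the path. For \<open>wright\<close> the base
  point of the contour is taken proportional to \<open>z powr (1 / (1 - \<alpha>))\<close> with \<open>z = s * t powr (- \<alpha>)\<close>, which yields
  the factor \<open>exp (- c * z powr (1 / (1 - \<alpha>)))\<close> (\<open>wright_bound\<close>). For \<open>weighted_Z\<close> the frequency
  \<open>\<xi>\<close> is replaced by \<open>\<xi> + \<i>\<mu>e\<close> with \<open>e = x / |x|\<close>; strong parabolicity bounds the matrix exponential there by
  \<open>exp (- (\<delta>/2) * |\<xi>| ^ (2 * b) + K * \<mu> ^ (2 * b))\<close>, and the best \<open>\<mu>\<close> yields the factor
  \<open>exp (- c * (|x| ^ (2 * b) / s) powr (1 / (2 * b - 1)))\<close> (\<open>weighted_Z_bound\<close>). The coefficients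
  enter only through \<open>K\<close>, which depends on \<open>N\<close>, \<open>n\<close>, \<open>b\<close>, \<open>\<delta>\<close> and a bound for the coefficients;
  hence the uniformity of all constants.

  \<^bold>\<open>The estimates.\<close> The substitution \<open>s = t powr \<alpha> * z\<close> leaves a one-dimensional integral
  \<open>subord_integral\<close>, a function of \<open>R\<close> alone with the parameters \<open>q = 1 / (1 - \<alpha>)\<close>, \<open>p = 1 / (2 * b - 1)\<close> and
  \<open>\<nu> = (n + |\<beta>|) / (2 * b)\<close>. It decays like \<open>exp (- \<sigma> * R powr (q * p / (q + p)))\<close>, and
  \<open>q * p / (q + p) = 1 / (2 * b - \<alpha>)\<close> is the exponent of \<open>rho\<close>. As \<open>R\<close> tends to \<open>0\<close> it is bounded,
  of order \<open>R powr (1 - \<nu>)\<close>, or logarithmic, according as \<open>\<nu> < 1\<close>, \<open>\<nu> > 1\<close> or \<open>\<nu> = 1\<close>. The two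
  logarithm-free bounds for \<open>\<nu> = 1\<close> come from cancellations: \<open>wright 0\<close> is divisible by \<open>s\<close>, which
  lowers \<open>\<nu>\<close> to \<open>0\<close> (\<open>frac_kernel_critical_gamma_0\<close>); and in dimension one \<open>|\<beta>| = 2 * b - 1\<close> is odd,
  so \<open>weighted_Z\<close> vanishes at \<open>x = 0\<close> (\<open>frac_kernel_critical_odd\<close>).
\<close>

section \<open>Parameter integrals\<close>

text \<open>
  A Bochner integral that does not converge is \<open>0\<close>, so the bound holds whether or not \<open>f\<close> is measurable.
\<close>

lemma norm_integral_le:
  fixes f :: "'a \<Rightarrow> 'b::{banach, second_countable_topology}"
  assumes g: "integrable M g" and le: "\<And>x. x \<in> space M \<Longrightarrow> norm (f x) \<le> g x"
  shows "norm (\<integral>x. f x \<partial>M) \<le> (\<integral>x. g x \<partial>M)"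
proof (cases "integrable M f")
  case True
  have "norm (\<integral>x. f x \<partial>M) \<le> (\<integral>x. norm (f x) \<partial>M)" by (rule integral_norm_bound)
  also have "\<dots> \<le> (\<integral>x. g x \<partial>M)" using True g le by (intro integral_mono) auto
  finally show ?thesis .
next
  case False
  then show ?thesis
    using integral_nonneg_AE[of g M] order_trans[OF norm_ge_zero le] by (auto simp: not_integrable_integral_eq)
qed

text \<open>
  By the mean value inequality the domination of the derivative passes to the remainder of the
  first-order expansion divided by \<open>norm (y - y0)\<close>, which is at most \<open>2 * g\<close> and tends to \<open>0\<close> pointwise; dominated
  convergence along sequences finishes. The derivative is measurable in \<open>s\<close> as a pointwise limit of
  difference quotients.
\<close>

lemma integral_has_derivative_dominated:
  fixes F :: "'a \<Rightarrow> 'b::real_normed_vector \<Rightarrow> 'c::{banach, second_countable_topology}"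
  assumes r: "r > 0"
    and int: "\<And>y. y \<in> ball y0 r \<Longrightarrow> integrable M (\<lambda>s. F s y)"
    and der: "\<And>s y. s \<in> space M \<Longrightarrow> y \<in> ball y0 r \<Longrightarrow> (F s has_derivative F' s y) (at y)"
    and bd: "\<And>s y h. s \<in> space M \<Longrightarrow> y \<in> ball y0 r \<Longrightarrow> norm (F' s y h) \<le> g s * norm h"
    and g0: "\<And>s. s \<in> space M \<Longrightarrow> g s \<ge> 0"
    and g: "integrable M g"
  shows "((\<lambda>y. \<integral>s. F s y \<partial>M) has_derivative (\<lambda>h. \<integral>s. F' s y0 h \<partial>M)) (at y0)"
    and "\<And>h. integrable M (\<lambda>s. F' s y0 h)"
proof -
  have y0: "y0 \<in> ball y0 r" using r by simp
  have lin: "bounded_linear (F' s y0)" if "s \<in> space M" for s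
    using der[OF that y0] by (rule has_derivative_bounded_linear)
  have lip: "norm (F s y - F s y0) \<le> g s * norm (y - y0)" if "s \<in> space M" "y \<in> ball y0 r" for s y
  proof (rule differentiable_bound[where S = "ball y0 r" and f = "F s" and f' = "F' s" and B = "g s"])
    show "(F s has_derivative F' s x) (at x within ball y0 r)" if "x \<in> ball y0 r" for x
      using der[OF \<open>s \<in> space M\<close> that] by (rule has_derivative_at_withinI)
    show "onorm (F' s x) \<le> g s" if "x \<in> ball y0 r" for x
      by (intro onorm_bound g0 bd \<open>s \<in> space M\<close> that)
    show "y \<in> ball y0 r" "y0 \<in> ball y0 r" "convex (ball y0 r)"
      using that y0 by simp_all
  qed
  have meas: "(\<lambda>s. F' s y0 h) \<in> borel_measurable M" for h
  proof (cases "h = 0")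
    case True
    then show ?thesis
      using linear_0[OF bounded_linear.linear[OF lin]] by (simp cong: measurable_cong)
  next
    case h: False
    define c where "c = r / (2 * norm h + 2)"
    have c: "c > 0" "c * norm h < r"
    proof -
      have h1: "2 * norm h + 2 > 0" by (simp add: add_nonneg_pos)
      then show "c > 0" using r by (simp add: c_def)
      have "r * norm h < r * (2 * norm h + 2)" 
        using r norm_ge_zero[of h] by (intro mult_strict_left_mono) linarith+
      then show "c * norm h < r" using h1 by (simp add: c_def pos_divide_less_eq)
    qed
    define X where "X i = c / real (Suc i)" for i
    have X: "X i > 0" "X i \<le> c" for i using c by (auto simp: X_def divide_simps)
    have X0: "X \<longlonglongrightarrow> 0"
      unfolding X_def using tendsto_mult[OF tendsto_const[of c] LIMSEQ_inverse_real_of_nat]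
      by (simp add: divide_inverse)
    have Xb: "y0 + X i *\<^sub>R h \<in> ball y0 r" for i
    proof -
      have "X i * norm h \<le> c * norm h" using X by (intro mult_right_mono) auto
      then show ?thesis using c X(1)[of i] by (simp add: dist_norm)
    qed
    have "(\<lambda>s. (F s (y0 + X i *\<^sub>R h) - F s y0) /\<^sub>R X i) \<in> borel_measurable M" for i
      using int[OF Xb[of i]] int[OF y0] by auto
    moreover have "(\<lambda>i. (F s (y0 + X i *\<^sub>R h) - F s y0) /\<^sub>R X i) \<longlonglongrightarrow> F' s y0 h" if s: "s \<in> space M" for s
    proof -
      define Q where "Q y = (F s y - F s y0 - F' s y0 (y - y0)) /\<^sub>R norm (y - y0)" for y
      have "(Q \<longlongrightarrow> 0) (at y0)"
        using der[OF s y0] by (simp add: has_derivative_at_within Q_def[abs_def])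
      moreover have "(\<lambda>i. y0 + X i *\<^sub>R h) \<longlonglongrightarrow> y0"
        using tendsto_add[OF tendsto_const tendsto_scaleR[OF X0 tendsto_const]] by fastforce
      moreover have "\<forall>\<^sub>F i in sequentially. y0 + X i *\<^sub>R h \<noteq> y0"
      proof (intro always_eventually allI)
        show "y0 + X i *\<^sub>R h \<noteq> y0" for i using X(1)[of i] h by simp
      qed
      ultimately have "(\<lambda>i. Q (y0 + X i *\<^sub>R h)) \<longlonglongrightarrow> 0"
        using filterlim_compose[OF _ filterlim_atI, of Q "nhds 0" y0 "\<lambda>i. y0 + X i *\<^sub>R h" sequentially] by blast
      then have "(\<lambda>i. norm h *\<^sub>R Q (y0 + X i *\<^sub>R h) + F' s y0 h) \<longlonglongrightarrow> norm h *\<^sub>R 0 + F' s y0 h"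
        by (intro tendsto_intros)
      moreover have "norm h *\<^sub>R Q (y0 + X i *\<^sub>R h) + F' s y0 h = (F s (y0 + X i *\<^sub>R h) - F s y0) /\<^sub>R X i" for i
      proof -
        have "F' s y0 (X i *\<^sub>R h) = X i *\<^sub>R F' s y0 h"
          using linear_cmul[OF bounded_linear.linear[OF lin[OF s]]] .
        then have "norm h *\<^sub>R Q (y0 + X i *\<^sub>R h) =
            (norm h * inverse (X i * norm h)) *\<^sub>R (F s (y0 + X i *\<^sub>R h) - F s y0 - X i *\<^sub>R F' s y0 h)"
          using X(1)[of i] unfolding Q_def scaleR_scaleR by simp
        also have "norm h * inverse (X i * norm h) = inverse (X i)"
          using h by simp
        finally show ?thesis
          using X(1)[of i] by (simp add: scaleR_diff_right)
      qed
      ultimately show ?thesis by simp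
    qed
    ultimately show ?thesis by (rule borel_measurable_LIMSEQ_metric)
  qed
  show int': "integrable M (\<lambda>s. F' s y0 h)" for h
  proof (rule Bochner_Integration.integrable_bound)
    show "integrable M (\<lambda>s. g s * norm h)" using g by simp
    show "AE s in M. norm (F' s y0 h) \<le> norm (g s * norm h)"
      using bd[OF _ y0, of _ h] g0 by (intro AE_I2) (auto simp: abs_mult)
  qed (rule meas)
  show "((\<lambda>y. \<integral>s. F s y \<partial>M) has_derivative (\<lambda>h. \<integral>s. F' s y0 h \<partial>M)) (at y0)"
    unfolding has_derivative_at_within
  proof
    show "bounded_linear (\<lambda>h. \<integral>s. F' s y0 h \<partial>M)"
    proof (rule bounded_linear_intro)
      show "(\<integral>s. F' s y0 (x + y) \<partial>M) = (\<integral>s. F' s y0 x \<partial>M) + (\<integral>s. F' s y0 y \<partial>M)" for x y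
      proof -
        have "(\<integral>s. F' s y0 (x + y) \<partial>M) = (\<integral>s. F' s y0 x + F' s y0 y \<partial>M)"
          by (intro Bochner_Integration.integral_cong refl linear_add[OF bounded_linear.linear[OF lin]])
        then show ?thesis by (simp add: int')
      qed
      show "(\<integral>s. F' s y0 (c *\<^sub>R x) \<partial>M) = c *\<^sub>R (\<integral>s. F' s y0 x \<partial>M)" for c x
      proof -
        have "(\<integral>s. F' s y0 (c *\<^sub>R x) \<partial>M) = (\<integral>s. c *\<^sub>R F' s y0 x \<partial>M)"
          by (intro Bochner_Integration.integral_cong refl linear_cmul[OF bounded_linear.linear[OF lin]])
        then show ?thesis by simp
      qed
      show "norm (\<integral>s. F' s y0 h \<partial>M) \<le> norm h * (\<integral>s. g s \<partial>M)" for h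
      proof -
        have "norm (\<integral>s. F' s y0 h \<partial>M) \<le> (\<integral>s. g s * norm h \<partial>M)"
          using g bd[OF _ y0, of _ h] by (intro norm_integral_le) auto
        then show ?thesis by (simp add: mult.commute)
      qed
    qed
    show "((\<lambda>y. ((\<integral>s. F s y \<partial>M) - (\<integral>s. F s y0 \<partial>M) - (\<integral>s. F' s y0 (y - y0) \<partial>M)) /\<^sub>R norm (y - y0)) \<longlongrightarrow> 0) (at y0)"
      unfolding tendsto_at_iff_sequentially o_def
    proof (intro allI impI)
      fix X :: "nat \<Rightarrow> 'b" assume X: "\<forall>i. X i \<in> UNIV - {y0}" and lim: "X \<longlonglongrightarrow> y0"
      obtain N where N: "\<And>i. i \<ge> N \<Longrightarrow> X i \<in> ball y0 r"
        using tendstoD[OF lim r] by (auto simp: eventually_sequentially dist_commute)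
      define Q where "Q i s = (F s (X i) - F s y0 - F' s y0 (X i - y0)) /\<^sub>R norm (X i - y0)" for i s
      have Qint: "integrable M (Q (i + N))" for i
        unfolding Q_def using N[of "i + N"] by (intro integrable_scaleR_right Bochner_Integration.integrable_diff int int' y0) simp
      have eq: "((\<integral>s. F s (X (i+N)) \<partial>M) - (\<integral>s. F s y0 \<partial>M) - (\<integral>s. F' s y0 (X (i+N) - y0) \<partial>M)) /\<^sub>R norm (X (i+N) - y0)
          = (\<integral>s. Q (i+N) s \<partial>M)" for i
      proof -
        have Xi: "X (i+N) \<in> ball y0 r" using N[of "i + N"] by simp
        have "(\<integral>s. F s (X (i+N)) - F s y0 - F' s y0 (X (i+N) - y0) \<partial>M) =
            (\<integral>s. F s (X (i+N)) \<partial>M) - (\<integral>s. F s y0 \<partial>M) - (\<integral>s. F' s y0 (X (i+N) - y0) \<partial>M)"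
          by (simp only: Bochner_Integration.integral_diff Bochner_Integration.integrable_diff
              int[OF Xi] int[OF y0] int')
        then show ?thesis unfolding Q_def by simp
      qed
      define G where "G i = ((\<integral>s. F s (X i) \<partial>M) - (\<integral>s. F s y0 \<partial>M) - (\<integral>s. F' s y0 (X i - y0) \<partial>M)) /\<^sub>R norm (X i - y0)" for i
      have Geq: "G (i + N) = (\<integral>s. Q (i+N) s \<partial>M)" for i
        unfolding G_def by (rule eq)
      have "(\<lambda>i. \<integral>s. Q (i+N) s \<partial>M) \<longlonglongrightarrow> (\<integral>s. 0 \<partial>M)"
      proof (rule integral_dominated_convergence[where w = "\<lambda>s. 2 * g s"])
        show "(\<lambda>s. 0) \<in> borel_measurable M" by simp
        show "integrable M (\<lambda>s. 2 * g s)" using g by simp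
        show "Q (i + N) \<in> borel_measurable M" for i using Qint by auto
        show "AE s in M. (\<lambda>i. Q (i + N) s) \<longlonglongrightarrow> 0"
        proof (rule AE_I2)
          fix s assume s: "s \<in> space M"
          have "((\<lambda>y. (F s y - F s y0 - F' s y0 (y - y0)) /\<^sub>R norm (y - y0)) \<longlongrightarrow> 0) (at y0)"
            using der[OF s y0] by (simp add: has_derivative_at_within)
          moreover have "filterlim X (at y0) sequentially"
            using X lim by (intro filterlim_atI) auto
          ultimately have "(\<lambda>i. Q i s) \<longlonglongrightarrow> 0"
            unfolding Q_def by (rule filterlim_compose)
          then show "(\<lambda>i. Q (i + N) s) \<longlonglongrightarrow> 0" by (rule LIMSEQ_ignore_initial_segment)
        qed
        show "AE s in M. norm (Q (i + N) s) \<le> 2 * g s" for i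
        proof (rule AE_I2)
          fix s assume s: "s \<in> space M"
          have Xi: "X (i + N) \<in> ball y0 r" "norm (X (i + N) - y0) > 0" using N[of "i+N"] X by auto
          define D where "D = norm (F s (X (i+N)) - F s y0 - F' s y0 (X (i+N) - y0))"
          have "D \<le> g s * norm (X (i+N) - y0) + g s * norm (X (i+N) - y0)"
            unfolding D_def
            by (rule order_trans[OF norm_triangle_ineq4]) (intro add_mono lip bd s Xi y0)
          then have "D / norm (X (i+N) - y0) \<le> 2 * g s"
            using Xi(2) by (simp add: pos_divide_le_eq)
          moreover have "norm (Q (i + N) s) = D / norm (X (i+N) - y0)"
            unfolding Q_def D_def by (simp only: norm_scaleR) (simp add: divide_inverse mult.commute)
          ultimately show "norm (Q (i + N) s) \<le> 2 * g s" by simp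
        qed
      qed
      then show "(\<lambda>i. ((\<integral>s. F s (X i) \<partial>M) - (\<integral>s. F s y0 \<partial>M) - (\<integral>s. F' s y0 (X i - y0) \<partial>M)) /\<^sub>R norm (X i - y0)) \<longlonglongrightarrow> 0"
        unfolding G_def[symmetric] using LIMSEQ_offset[of G N 0] by (simp add: Geq)
    qed
  qed
qed

lemma integral_has_vector_derivative_dominated:
  fixes F :: "'a \<Rightarrow> real \<Rightarrow> 'c::{banach, second_countable_topology}"
  assumes r: "r > 0"
    and int: "\<And>y. \<bar>y - y0\<bar> < r \<Longrightarrow> integrable M (\<lambda>s. F s y)"
    and der: "\<And>s y. s \<in> space M \<Longrightarrow> \<bar>y - y0\<bar> < r \<Longrightarrow> (F s has_vector_derivative F' s y) (at y)"
    and bd: "\<And>s y. s \<in> space M \<Longrightarrow> \<bar>y - y0\<bar> < r \<Longrightarrow> norm (F' s y) \<le> g s"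
    and g: "integrable M g"
  shows "((\<lambda>y. \<integral>s. F s y \<partial>M) has_vector_derivative (\<integral>s. F' s y0 \<partial>M)) (at y0)"
    and "integrable M (\<lambda>s. F' s y0)"
proof -
  have d: "\<bar>y - y0\<bar> < r" if "y \<in> ball y0 r" for y
    using that by (simp add: dist_real_def abs_minus_commute)
  have g0: "g s \<ge> 0" if "s \<in> space M" for s
    using order_trans[OF norm_ge_zero bd[OF that, of y0]] r by simp
  have b: "norm (h *\<^sub>R F' s y) \<le> g s * norm h" if "s \<in> space M" "y \<in> ball y0 r" for s y h
    using mult_left_mono[OF bd[OF that(1) d[OF that(2)]], of "\<bar>h\<bar>"] by (simp add: mult.commute)
  have i: "integrable M (\<lambda>s. F s y)" if "y \<in> ball y0 r" for y
    using int[OF d[OF that]] .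
  have dd: "(F s has_derivative (\<lambda>h. h *\<^sub>R F' s y)) (at y)" if "s \<in> space M" "y \<in> ball y0 r" for s y
    using der[OF that(1) d[OF that(2)]] by (simp add: has_vector_derivative_def)
  have "integrable M (\<lambda>s. 1 *\<^sub>R F' s y0)"
    using r i dd b g0 g by (rule integral_has_derivative_dominated(2))
  then show "integrable M (\<lambda>s. F' s y0)" by simp
  have "((\<lambda>y. \<integral>s. F s y \<partial>M) has_derivative (\<lambda>h. \<integral>s. h *\<^sub>R F' s y0 \<partial>M)) (at y0)"
    using r i dd b g0 g by (rule integral_has_derivative_dominated(1))
  then show "((\<lambda>y. \<integral>s. F s y \<partial>M) has_vector_derivative (\<integral>s. F' s y0 \<partial>M)) (at y0)"
    by (simp add: has_vector_derivative_def)
qed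

text \<open>
  Only the integrand has to be dominated: Cauchy's inequality turns a local majorant into one for the
  derivative.
\<close>

lemma holomorphic_on_integral_dominated:
  fixes F :: "'a \<Rightarrow> complex \<Rightarrow> complex"
  assumes S: "open S"
    and hol: "\<And>s. s \<in> space M \<Longrightarrow> F s holomorphic_on S"
    and meas: "\<And>z. z \<in> S \<Longrightarrow> (\<lambda>s. F s z) \<in> borel_measurable M"
    and dom: "\<And>z. z \<in> S \<Longrightarrow> \<exists>r>0. \<exists>g. integrable M g \<and> cball z r \<subseteq> S \<and>
      (\<forall>s\<in>space M. \<forall>w\<in>cball z r. norm (F s w) \<le> g s)"
  shows "(\<lambda>z. \<integral>s. F s z \<partial>M) holomorphic_on S"
  unfolding holomorphic_on_open[OF S]
proof (intro ballI)
  fix z assume "z \<in> S"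
  then obtain r g where r: "r > 0" and g: "integrable M g" and sub: "cball z r \<subseteq> S"
    and bd: "\<And>s w. s \<in> space M \<Longrightarrow> w \<in> cball z r \<Longrightarrow> norm (F s w) \<le> g s"
    using dom[OF \<open>z \<in> S\<close>] by blast
  have g0: "g s \<ge> 0" if "s \<in> space M" for s
    using order_trans[OF norm_ge_zero bd[OF that, of z]] r by simp
  have ball: "cball y (r/2) \<subseteq> cball z r" if "y \<in> ball z (r/2)" for y
  proof
    fix w assume "w \<in> cball y (r/2)"
    then show "w \<in> cball z r" using that dist_triangle[of z w y] by auto
  qed
  have der: "(F s has_field_derivative deriv (F s) y) (at y)" if "s \<in> space M" "y \<in> ball z (r/2)" for s y
  proof -
    have "y \<in> cball y (r/2)" using r by simp
    then have "y \<in> S" using ball[OF that(2)] sub by blast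
    then show ?thesis by (rule holomorphic_derivI[OF hol[OF that(1)] S])
  qed
  have dbd: "norm (deriv (F s) y) \<le> g s / (r/2)" if s: "s \<in> space M" and y: "y \<in> ball z (r/2)" for s y
  proof -
    have sub': "cball y (r/2) \<subseteq> S" using ball[OF y] sub by blast
    have h: "F s holomorphic_on cball y (r/2)" by (rule holomorphic_on_subset[OF hol[OF s] sub'])
    have "norm ((deriv ^^ 1) (F s) y) \<le> fact 1 * g s / (r/2)^1"
    proof (rule Cauchy_inequality)
      show "F s holomorphic_on ball y (r/2)" 
        by (rule holomorphic_on_subset[OF h ball_subset_cball])
      show "continuous_on (cball y (r/2)) (F s)" using h by (rule holomorphic_on_imp_continuous_on)
      show "norm (F s x) \<le> g s" if "norm (y - x) = r/2" for x
        using bd[OF s] ball[OF y] that by (auto simp: dist_norm)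
    qed (use r in auto)
    then show ?thesis by simp
  qed
  have int_der: "((\<lambda>y. \<integral>s. F s y \<partial>M) has_derivative (\<lambda>h. \<integral>s. deriv (F s) z * h \<partial>M)) (at z)"
  proof -
    have 1: "integrable M (\<lambda>s. F s y)" if "y \<in> ball z (r/2)" for y
    proof (rule Bochner_Integration.integrable_bound[OF g])
      have "y \<in> cball y (r/2)" using r by simp
      then have "y \<in> cball z r" using ball[OF that] by blast
      then show "(\<lambda>s. F s y) \<in> borel_measurable M" "AE s in M. norm (F s y) \<le> norm (g s)"
        using sub meas bd g0 by (auto intro!: AE_I2)
    qed
    have 2: "norm (deriv (F s) y * h) \<le> (g s / (r/2)) * norm h" if "s \<in> space M" "y \<in> ball z (r/2)" for s y h
      using mult_right_mono[OF dbd[OF that] norm_ge_zero[of h]] by (simp add: norm_mult)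
    have 3: "g s / (r/2) \<ge> 0" if "s \<in> space M" for s using g0[OF that] r by simp
    have 4: "integrable M (\<lambda>s. g s / (r/2))" using g by simp
    have 0: "r / 2 > 0" using r by simp
    have 5: "(F s has_derivative (\<lambda>h. deriv (F s) y * h)) (at y)" if "s \<in> space M" "y \<in> ball z (r/2)" for s y
      using der[OF that] by (simp add: has_field_derivative_def)
    show "((\<lambda>y. \<integral>s. F s y \<partial>M) has_derivative (\<lambda>h. \<integral>s. deriv (F s) z * h \<partial>M)) (at z)"
      using 0 1 5 2 3 4 by (rule integral_has_derivative_dominated(1))
  qed
  have "(\<lambda>h. \<integral>s. deriv (F s) z * h \<partial>M) = (*) (\<integral>s. deriv (F s) z \<partial>M)" by (auto simp: fun_eq_iff)
  then have "((\<lambda>y. \<integral>s. F s y \<partial>M) has_field_derivative (\<integral>s. deriv (F s) z \<partial>M)) (at z)"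
    using int_der by (simp add: has_field_derivative_def)
  then show "\<exists>f'. ((\<lambda>z. \<integral>s. F s z \<partial>M) has_field_derivative f') (at z)" by blast
qed

section \<open>Integrals over the half-line\<close>

text \<open>
  With the restriction built into the measure, pointwise bounds are needed for positive arguments
  only.
\<close>

definition halfline :: "real measure" where
  "halfline = restrict_space lborel {0<..}"

lemma space_halfline [simp]: "space halfline = {0<..}"
  by (simp add: halfline_def space_restrict_space)

lemma sets_halfline: "sets halfline = sets (restrict_space borel {0<..})"
  by (simp add: halfline_def sets_restrict_space)

lemma sigma_finite_halfline: "sigma_finite_measure halfline"
  unfolding halfline_def by (rule sigma_finite_measure_restrict_space) (auto intro: sigma_finite_lborel)

lemma borel_measurable_halflineI:
  assumes "continuous_on {0<..} f"
  shows "f \<in> borel_measurable halfline"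
  using borel_measurable_continuous_on_restrict[OF assms] measurable_cong_sets[OF sets_halfline refl] by blast

lemma borel_measurable_halfline:
  "f \<in> borel_measurable borel \<Longrightarrow> f \<in> borel_measurable halfline"
  unfolding halfline_def by (rule measurable_restrict_space1) simp

lemma integral_halfline:
  fixes f :: "real \<Rightarrow> 'a::{banach, second_countable_topology}"
  shows "(\<integral>s. f s \<partial>halfline) = (LINT s:{0<..}|lborel. f s)"
  by (simp add: halfline_def integral_restrict_space set_lebesgue_integral_def)

lemma integrable_halfline:
  fixes f :: "real \<Rightarrow> 'a::{banach, second_countable_topology}"
  shows "integrable halfline f \<longleftrightarrow> set_integrable lborel {0<..} f"
  by (simp add: halfline_def integrable_restrict_space set_integrable_def)

lemma
  fixes f :: "real \<Rightarrow> 'a::{banach, second_countable_topology}"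
  assumes c: "c > 0"
  shows integral_halfline_scale: "(\<integral>s. f s \<partial>halfline) = c *\<^sub>R (\<integral>s. f (c * s) \<partial>halfline)"
    and integrable_halfline_scale: "integrable halfline (\<lambda>s. f (c * s)) \<longleftrightarrow> integrable halfline f"
proof -
  have i: "indicator {0<..} (c * s) = (indicator {0<..} s :: real)" for s :: real
    using c by (simp add: indicator_def zero_less_mult_iff)
  show "(\<integral>s. f s \<partial>halfline) = c *\<^sub>R (\<integral>s. f (c * s) \<partial>halfline)"
    unfolding integral_halfline set_lebesgue_integral_def
    using lborel_integral_real_affine[of c "\<lambda>s. indicator {0<..} s *\<^sub>R f s" 0] c by (simp add: i)
  show "integrable halfline (\<lambda>s. f (c * s)) \<longleftrightarrow> integrable halfline f"
    unfolding integrable_halfline set_integrable_def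
    using lborel_integrable_real_affine_iff[of c "\<lambda>s. indicator {0<..} s *\<^sub>R f s" 0] c by (simp add: i)
qed

lemma integrable_halfline_absolutely:
  fixes f :: "real \<Rightarrow> real"
  assumes "f absolutely_integrable_on {0<..}" and m: "f \<in> borel_measurable borel"
  shows "integrable halfline f"
proof -
  have "(\<lambda>x. indicator {0<..} x *\<^sub>R f x) \<in> borel_measurable lborel"
    unfolding measurable_lborel2 by (rule borel_measurable_scaleR[OF borel_measurable_indicator m]) simp
  from integrable_completion[OF this]
  show ?thesis
    using assms(1) unfolding integrable_halfline set_integrable_def by simp
qed

lemma integrable_halfline_Gamma:
  assumes q: "q > 0" and a: "a > 0"
  shows "integrable halfline (\<lambda>t. t powr (q - 1) * exp (- a * t))"
proof -
  have "(\<lambda>t. complex_of_real t powr (complex_of_real q - 1) / of_real (exp (a * t))) absolutely_integrable_on {0<..}"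
    using absolutely_integrable_Gamma_integral[of "complex_of_real q" a] q a by simp
  then have "(\<lambda>t. norm (complex_of_real t powr (complex_of_real q - 1) / of_real (exp (a * t)))) absolutely_integrable_on {0<..}"
    by (rule absolutely_integrable_norm[unfolded o_def])
  also have "?this \<longleftrightarrow> (\<lambda>t. t powr (q - 1) * exp (- a * t)) absolutely_integrable_on {0<..}"
    by (intro set_integrable_cong) (auto simp: norm_divide norm_powr_real_powr exp_minus divide_inverse norm_mult norm_inverse)
  finally show ?thesis by (rule integrable_halfline_absolutely) measurable
qed

lemma integrable_halfline_exp: "a > 0 \<Longrightarrow> integrable halfline (\<lambda>t. exp (- a * t))"
  using integrable_halfline_Gamma[of 1 a]
  by (subst Bochner_Integration.integrable_cong[OF refl, of halfline _ "\<lambda>t. t powr (1 - 1) * exp (- a * t)"]) auto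

text \<open>
  The standard majorant for integrands that are bounded near \<open>0\<close> and decay like a power.
\<close>

lemma integrable_halfline_tail:
  assumes nu: "\<nu> > (1::real)"
  shows "integrable halfline (\<lambda>x. if x \<le> 1 then 1 else x powr (- \<nu>))"
proof -
  have "(\<lambda>x. x powr (- \<nu>)) integrable_on {1..}"
    using has_integral_powr_to_inf[of "- \<nu>" 1] nu by (auto simp: integrable_on_def)
  then have "(\<lambda>x. x powr (- \<nu>)) absolutely_integrable_on {1..}"
    by (rule nonnegative_absolutely_integrable_1) auto
  then have "(\<lambda>x. indicator {1..} x *\<^sub>R x powr (- \<nu>)) absolutely_integrable_on {0<..}"
    unfolding set_integrable_def by (rule back_subst[of "integrable lebesgue"]) (auto simp: indicator_def)
  then have 1: "integrable halfline (\<lambda>x. indicator {1..} x *\<^sub>R x powr (- \<nu>))"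
    by (rule integrable_halfline_absolutely) measurable
  have 2: "integrable halfline (\<lambda>x. exp 1 * exp (- 1 * x))"
    using integrable_halfline_exp[of 1] by simp
  show ?thesis
  proof (rule Bochner_Integration.integrable_bound[OF Bochner_Integration.integrable_add[OF 1 2]])
    show "(\<lambda>x. if x \<le> 1 then 1 else x powr (- \<nu>)) \<in> borel_measurable halfline" by (rule borel_measurable_halfline) measurable
    show "AE x in halfline. norm (if x \<le> 1 then 1 else x powr (- \<nu>)) \<le>
       norm (indicator {1..} x *\<^sub>R x powr (- \<nu>) + exp 1 * exp (- 1 * x))"
    proof (rule AE_I2)
      fix x :: real assume x: "x \<in> space halfline"
      show "norm (if x \<le> 1 then 1 else x powr (- \<nu>)) \<le>
         norm (indicator {1..} x *\<^sub>R x powr (- \<nu>) + exp 1 * exp (- 1 * x))"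
      proof (cases "x \<le> 1")
        case True
        have "1 \<le> exp 1 * exp (- 1 * x)" using True by (simp add: mult_exp_exp)
        moreover have "0 \<le> indicator {1..} x *\<^sub>R x powr (- \<nu>)" by simp
        ultimately have "1 \<le> indicator {1..} x *\<^sub>R x powr (- \<nu>) + exp 1 * exp (- 1 * x)" by linarith
        then show ?thesis using True by simp
      next
        case False
        then show ?thesis by simp
      qed
    qed
  qed
qed

text \<open>
  Lets \<open>exp (- c * y)\<close> replace \<open>exp (- c * y powr q)\<close> as a majorant, at the price of a constant factor.
\<close>

lemma diff_one_le_powr:
  assumes q: "q \<ge> (1::real)"
  shows "y - 1 \<le> y powr q"
proof (cases "y \<le> 1")
  case True
  then show ?thesis using powr_ge_zero[of y q] by linarith
next
  case False
  then have "y powr 1 \<le> y powr q" using q by (intro powr_mono) auto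
  then show ?thesis using False by simp
qed

text \<open>
  One term of the exponential series, of degree at least \<open>\<nu> / p\<close> in \<open>y powr p\<close>, dominates \<open>y powr \<nu>\<close> for
  \<open>y \<ge> 1\<close>.
\<close>

lemma powr_mult_exp_powr_bounded:
  fixes \<nu> c p :: real
  assumes nu: "\<nu> \<ge> 0" and c: "c > 0" and p: "p > 0"
  shows "\<exists>C>0. \<forall>y\<ge>0. y powr \<nu> * exp (- c * y powr p) \<le> C"
proof -
  obtain m :: nat where m: "\<nu> / p \<le> real m" using real_arch_simple by blast
  define C where "C = 1 + fact m / c ^ m"
  have "y powr \<nu> * exp (- c * y powr p) \<le> C" if y: "y \<ge> 0" for y
  proof (cases "y \<le> 1")
    case True
    have "y powr \<nu> * exp (- c * y powr p) \<le> 1 * 1"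
      using True y nu c by (intro mult_mono) (auto simp: powr_le1)
    also have "1 * 1 \<le> C" using c by (simp add: C_def)
    finally show ?thesis .
  next
    case False
    have "y powr \<nu> \<le> y powr (p * real m)"
      using False m p by (intro powr_mono) (auto simp: field_simps)
    also have "\<dots> = (y powr p) ^ m"
      using False by (simp add: powr_powr[symmetric] powr_realpow)
    finally have 1: "y powr \<nu> \<le> (y powr p) ^ m" .
    have "(c * y powr p) ^ m / fact m \<le> exp (c * y powr p)"
    proof -
      define x where "x = c * y powr p"
      have "x \<ge> 0" using c by (simp add: x_def)
      then have "(\<Sum>n\<in>{m}. x ^ n /\<^sub>R fact n) \<le> (\<Sum>n. x ^ n /\<^sub>R fact n)"
        by (intro sum_le_suminf summable_exp_generic) auto
      then show ?thesis by (simp add: exp_def x_def divide_inverse mult.commute)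
    qed
    then have 2: "(y powr p) ^ m \<le> fact m / c ^ m * exp (c * y powr p)"
      using c by (simp add: power_mult_distrib field_simps)
    have "y powr \<nu> * exp (- c * y powr p) \<le> (fact m / c ^ m * exp (c * y powr p)) * exp (- c * y powr p)"
      using order_trans[OF 1 2] by (intro mult_right_mono) auto
    also have "\<dots> = fact m / c ^ m" by (simp add: mult_exp_exp)
    also have "\<dots> \<le> C" by (simp add: C_def)
    finally show ?thesis .
  qed
  moreover have "C > 0" using c by (simp add: C_def add_pos_nonneg)
  ultimately show ?thesis by blast
qed

lemma powr_mult_exp_powr_inverse_bounded:
  fixes \<nu> c p :: real
  assumes nu: "\<nu> \<ge> 0" and c: "c > 0" and p: "p > 0"
  shows "\<exists>C>0. \<forall>x>0. x powr (- \<nu>) * exp (- c * (1 / x) powr p) \<le> C"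
proof -
  obtain C where C: "C > 0" "\<And>y. y \<ge> 0 \<Longrightarrow> y powr \<nu> * exp (- c * y powr p) \<le> C"
    using powr_mult_exp_powr_bounded[OF assms] by blast
  have "x powr (- \<nu>) * exp (- c * (1 / x) powr p) \<le> C" if "x > 0" for x
    using C(2)[of "1/x"] that by (simp add: powr_divide powr_minus_divide)
  then show ?thesis using C(1) by blast
qed

lemma integrable_halfline_exp_powr:
  fixes c a :: real
  assumes c: "c > 0" and a: "a > 0"
  shows "integrable halfline (\<lambda>r. exp (- c * r powr a))"
proof -
  obtain C where C: "C > 0" "\<And>y. y \<ge> 0 \<Longrightarrow> y powr 2 * exp (- c * y powr a) \<le> C"
    using powr_mult_exp_powr_bounded[of 2 c a] assms by auto
  show ?thesis
  proof (rule Bochner_Integration.integrable_bound)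
    show "integrable halfline (\<lambda>x. (1 + C) * (if x \<le> 1 then 1 else x powr (- 2)))"
    proof (rule integrable_mult_right)
      show "integrable halfline (\<lambda>x. if x \<le> 1 then 1 else x powr (- 2))"
        by (rule integrable_halfline_tail) simp
    qed
    show "AE x in halfline. norm (exp (- c * x powr a)) \<le> norm ((1 + C) * (if x \<le> 1 then 1 else x powr (- 2)))"
    proof (rule AE_I2)
      fix x :: real assume "x \<in> space halfline"
      then have x: "x > 0" by simp
      have "exp (- c * x powr a) \<le> 1 + C" using c C(1) by (smt (verit) exp_le_one_iff mult_nonneg_nonneg powr_ge_zero mult_minus_left)
      moreover have "exp (- c * x powr a) \<le> (1 + C) * x powr (- 2)" 
      proof -
        have "exp (- c * x powr a) = (x powr 2 * exp (- c * x powr a)) * x powr (- 2)"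
          using x by (simp add: powr_minus field_simps)
        also have "\<dots> \<le> (1 + C) * x powr (- 2)"
          using C(2)[of x] x by (intro mult_right_mono) auto
        finally show ?thesis .
      qed
      ultimately show "norm (exp (- c * x powr a)) \<le> norm ((1 + C) * (if x \<le> 1 then 1 else x powr (- 2)))"
        using C(1) by (cases "x \<le> 1") (simp_all add: abs_mult)
    qed
  qed (rule borel_measurable_halfline, measurable)
qed

text \<open>
  Half of the exponential absorbs the power, the other half remains.
\<close>

lemma shift_powr_exp_le:
  fixes a m k :: real
  assumes a: "a \<ge> 0" and m: "m \<ge> 0" and k: "k > 0"
  shows "\<exists>C>0. \<forall>r\<ge>0. (a + r) powr m * exp (- k * r) \<le> C * exp (- (k/2) * r)"
proof -
  obtain C where C: "C > 0" "\<And>y. y \<ge> 0 \<Longrightarrow> y powr m * exp (- (k/2) * y powr 1) \<le> C"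
    using powr_mult_exp_powr_bounded[of m "k/2" 1] m k by auto
  have "(a + r) powr m * exp (- k * r) \<le> (C * exp (k * a / 2)) * exp (- (k/2) * r)" if r: "r \<ge> 0" for r
  proof -
    have "- k * r = - (k/2) * (a + r) + (k * a / 2 + - (k/2) * r)" by argo
    then have "exp (- k * r) = exp (- (k/2) * (a + r)) * (exp (k * a / 2) * exp (- (k/2) * r))"
      by (simp only: exp_add)
    then have "(a + r) powr m * exp (- k * r) =
        ((a + r) powr m * exp (- (k/2) * (a + r))) * (exp (k * a / 2) * exp (- (k/2) * r))"
      by (simp only: mult.assoc)
    also have "\<dots> \<le> C * (exp (k * a / 2) * exp (- (k/2) * r))"
      using C(2)[of "a + r"] a r by (intro mult_right_mono) auto
    finally show ?thesis by (simp only: mult.assoc)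
  qed
  then show ?thesis using C(1) by (intro exI[of _ "C * exp (k * a / 2)"]) auto
qed

lemma integrable_halfline_shift_powr_exp:
  fixes a m k :: real
  assumes a: "a \<ge> 0" and m: "m \<ge> 0" and k: "k > 0"
  shows "integrable halfline (\<lambda>r. (a + r) powr m * exp (- k * r))"
proof -
  obtain C where C: "C > 0" "\<And>r. r \<ge> 0 \<Longrightarrow> (a + r) powr m * exp (- k * r) \<le> C * exp (- (k/2) * r)"
    using shift_powr_exp_le[OF assms] by blast
  show ?thesis
  proof (rule Bochner_Integration.integrable_bound)
    show "integrable halfline (\<lambda>r. C * exp (- (k/2) * r))"
      using k by (intro integrable_mult_right integrable_halfline_exp) simp
    show "AE r in halfline. norm ((a + r) powr m * exp (- k * r)) \<le> norm (C * exp (- (k/2) * r))"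
      using C by (intro AE_I2) (auto simp: abs_mult)
  qed (rule borel_measurable_halfline, measurable)
qed

lemma halfline_FTC:
  fixes f F :: "real \<Rightarrow> 'a::euclidean_space"
  assumes F: "\<And>r. r > 0 \<Longrightarrow> (F has_vector_derivative f r) (at r)"
    and f: "continuous_on {0<..} f" and i: "integrable halfline f"
    and A: "(F \<longlongrightarrow> A) (at_right 0)" and B: "(F \<longlongrightarrow> B) at_top"
  shows "(\<integral>r. f r \<partial>halfline) = B - A"
proof -
  have e: "einterval (ereal 0) \<infinity> = {0<..}" by (auto simp: einterval_def)
  have "(LBINT x=ereal 0..\<infinity>. f x) = B - A"
  proof (rule interval_integral_FTC_integrable)
    show "isCont f x" if "ereal 0 < ereal x" "ereal x < \<infinity>" for x
      using f that continuous_on_eq_continuous_at[of "{0<..}" f] by simp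
    show "set_integrable lborel (einterval (ereal 0) \<infinity>) f"
      using i by (simp only: e integrable_halfline)
    show "((F \<circ> real_of_ereal) \<longlongrightarrow> A) (at_right (ereal 0))"
      unfolding ereal_tendsto_simps1 using A by simp
    show "((F \<circ> real_of_ereal) \<longlongrightarrow> B) (at_left \<infinity>)"
      unfolding ereal_tendsto_simps1 using B by simp
  qed (use F in auto)
  moreover have "(LBINT x=ereal 0..\<infinity>. f x) = (LINT x:einterval (ereal 0) \<infinity>|lborel. f x)"
    unfolding interval_lebesgue_integral_def by (rule if_P) simp
  ultimately show ?thesis unfolding e integral_halfline by simp
qed

section \<open>Wright functions as contour integrals\<close>

lemma divide_of_real_powr:
  fixes q :: complex
  assumes "t > 0" "q \<noteq> 0"
  shows "(q / of_real t) powr of_real g = of_real (t powr (- g)) * q powr of_real g"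
proof -
  have "(q / of_real t) powr of_real g = exp (of_real g * (Ln q - of_real (ln t)))"
    using assms by (simp add: powr_def Ln_divide_of_real)
  also have "\<dots> = exp (of_real (- g * ln t)) * exp (of_real g * Ln q)"
    by (simp add: exp_add[symmetric] algebra_simps)
  also have "\<dots> = of_real (t powr (- g)) * q powr of_real g"
    using assms by (simp only: exp_of_real) (simp add: powr_def)
  finally show ?thesis .
qed

locale fractional_order =
  fixes \<alpha> :: real
  assumes alpha_pos: "0 < \<alpha>" and alpha_less: "\<alpha> < 1"
begin

text \<open>
  The direction of the contour has to satisfy two requirements: \<open>\<omega> > pi / 2\<close> makes \<open>exp (t * p)\<close> decay
  along it, and \<open>\<alpha> * \<omega> < pi / 2\<close> makes \<open>exp (- s * p powr \<alpha>)\<close> decay. This value meets both for every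
  \<open>\<alpha>\<close> between \<open>0\<close> and \<open>1\<close>.
\<close>

definition \<omega> :: real where "\<omega> = pi / (1 + \<alpha>)"

text \<open>
  The upper half of a Hankel contour that crosses the positive real axis at \<open>l\<close>. The kernels below take
  conjugate values at conjugate points, so the lower half contributes the conjugate and the inverse
  Laplace integral becomes an imaginary part divided by \<open>pi\<close>.
\<close>

definition contour :: "real \<Rightarrow> real \<Rightarrow> complex" where
  "contour l r = of_real l + of_real r * cis \<omega>"

definition kern :: "real \<Rightarrow> real \<Rightarrow> real \<Rightarrow> complex \<Rightarrow> complex" where
  "kern \<gamma> t s p = exp (of_real t * p) * p powr of_real \<gamma> * exp (- of_real s * p powr of_real \<alpha>)"

definition wrightc :: "real \<Rightarrow> real \<Rightarrow> real \<Rightarrow> real \<Rightarrow> real" where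
  "wrightc l \<gamma> t s = Im (\<integral>r. kern \<gamma> t s (contour l r) * cis \<omega> \<partial>halfline) / pi"

text \<open>
  The base point \<open>1\<close> is arbitrary, by \<open>wrightc_shift\<close>. Up to scaling these are Wright functions; for
  \<open>\<gamma> = \<alpha> - 1\<close> and \<open>t = 1\<close> this is the M-Wright function, the probability density of the subordination.
\<close>

definition wright :: "real \<Rightarrow> real \<Rightarrow> real \<Rightarrow> real" where
  "wright \<gamma> t s = wrightc 1 \<gamma> t s"

lemma omega_bounds: "pi / 2 < \<omega>" "\<omega> < pi" "\<alpha> * \<omega> < pi / 2"
proof -
  show "pi / 2 < \<omega>" unfolding \<omega>_def using alpha_pos alpha_less pi_gt_zero
    by (intro divide_strict_left_mono) auto
  show "\<omega> < pi" using alpha_pos pi_gt_zero by (simp add: \<omega>_def divide_less_eq)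
  have "pi * (2 * \<alpha>) < pi * (1 + \<alpha>)" using alpha_less by (intro mult_strict_left_mono) auto
  then show "\<alpha> * \<omega> < pi / 2" using alpha_pos by (simp add: \<omega>_def divide_less_eq field_simps)
qed

lemma omega_pos: "\<omega> > 0" using omega_bounds(1) pi_gt_zero by linarith

lemma trig_omega: "sin \<omega> > 0" "cos \<omega> < 0" "cos (\<alpha> * \<omega>) > 0"
proof -
  show "sin \<omega> > 0" using omega_bounds omega_pos by (intro sin_gt_zero) auto
  have "cos \<omega> < cos (pi / 2)" using omega_bounds by (intro cos_monotone_0_pi) auto
  then show "cos \<omega> < 0" by simp
  show "cos (\<alpha> * \<omega>) > 0"
    using omega_bounds omega_pos alpha_pos mult_pos_pos[OF alpha_pos omega_pos] by (intro cos_gt_zero) auto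
qed

lemma contour_Re_Im [simp]: "Re (contour l r) = l + r * cos \<omega>" "Im (contour l r) = r * sin \<omega>"
  by (simp_all add: contour_def)

lemma contour_not_nonpos:
  assumes "l > 0" "r \<ge> 0"
  shows "contour l r \<notin> \<real>\<^sub>\<le>\<^sub>0"
proof
  assume "contour l r \<in> \<real>\<^sub>\<le>\<^sub>0"
  then have "l + r * cos \<omega> \<le> 0" "r * sin \<omega> = 0" by (simp_all add: complex_nonpos_Reals_iff)
  then show False using assms trig_omega(1) by simp
qed

lemma contour_nonzero: "l > 0 \<Longrightarrow> r \<ge> 0 \<Longrightarrow> contour l r \<noteq> 0"
  using contour_not_nonpos[of l r] by auto

lemma norm_contour_ge:
  assumes "l > 0" "r \<ge> 0"
  shows "l * sin \<omega> \<le> norm (contour l r)" "r * sin \<omega> \<le> norm (contour l r)"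
proof -
  have "Im (contour l r * cis (- \<omega>)) = - l * sin \<omega>"
    by (simp add: algebra_simps)
  then have "l * sin \<omega> \<le> \<bar>Im (contour l r * cis (- \<omega>))\<bar>" by simp
  also have "\<dots> \<le> norm (contour l r * cis (- \<omega>))" by (rule abs_Im_le_cmod)
  finally show "l * sin \<omega> \<le> norm (contour l r)" by (simp add: norm_mult)
  show "r * sin \<omega> \<le> norm (contour l r)"
    using abs_Im_le_cmod[of "contour l r"] by simp
qed

lemma norm_contour_le: "l > 0 \<Longrightarrow> r \<ge> 0 \<Longrightarrow> norm (contour l r) \<le> l + r"
  unfolding contour_def by (rule order_trans[OF norm_triangle_ineq]) (simp add: norm_mult)

text \<open>
  The whole contour lies in the sector of arguments between \<open>0\<close> and \<open>\<omega>\<close>, where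
  \<open>p powr \<alpha>\<close> has argument at most \<open>\<alpha> * \<omega> < pi / 2\<close>.
\<close>

lemma Re_contour_powr_ge:
  assumes l: "l > 0" and r: "r \<ge> 0"
  shows "cos (\<alpha> * \<omega>) * norm (contour l r) powr \<alpha> \<le> Re (contour l r powr of_real \<alpha>)"
proof -
  define p where "p = contour l r"
  define \<theta> where "\<theta> = Im (Ln p)"
  have p0: "p \<noteq> 0" using contour_nonzero[OF l r] by (simp add: p_def)
  have "Im p \<ge> 0" using r trig_omega(1) by (simp add: p_def)
  then have th: "0 \<le> \<theta>" "\<theta> \<le> pi" using Im_Ln_pos_le[OF p0] by (simp_all add: \<theta>_def)
  have pe: "p = exp (Ln p)" using p0 by simp
  have re: "Re p = norm p * cos \<theta>" "Im p = norm p * sin \<theta>"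
    using p0 by (subst pe, simp only: Re_exp Im_exp, simp add: \<theta>_def)+
  have "norm p * sin (\<omega> - \<theta>) = sin \<omega> * (norm p * cos \<theta>) - cos \<omega> * (norm p * sin \<theta>)"
    by (simp add: sin_diff algebra_simps)
  also have "\<dots> = sin \<omega> * Re p - cos \<omega> * Im p" by (simp only: re)
  also have "\<dots> = l * sin \<omega>" by (simp add: p_def algebra_simps)
  finally have "norm p * sin (\<omega> - \<theta>) > 0" using l trig_omega(1) by simp
  then have s: "sin (\<omega> - \<theta>) > 0" using p0 by (simp add: zero_less_mult_iff)
  have "\<theta> \<le> \<omega>"
  proof (rule ccontr)
    assume "\<not> \<theta> \<le> \<omega>"
    then have "sin (\<theta> - \<omega>) \<ge> 0" using th omega_pos by (intro sin_ge_zero) auto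
    moreover have "sin (\<omega> - \<theta>) = - sin (\<theta> - \<omega>)" by (metis minus_diff_eq sin_minus)
    ultimately show False using s by linarith
  qed
  then have c: "cos (\<alpha> * \<omega>) \<le> cos (\<alpha> * \<theta>)"
    using th alpha_pos omega_bounds pi_gt_zero by (intro cos_monotone_0_pi_le mult_left_mono) auto
  have "Re (p powr of_real \<alpha>) = norm p powr \<alpha> * cos (\<alpha> * \<theta>)"
    using p0 by (simp add: powr_def Re_exp \<theta>_def)
  then show ?thesis using mult_right_mono[OF c, of "norm p powr \<alpha>"] by (simp add: p_def mult.commute)
qed

lemma norm_kern_le:
  assumes l: "l > 0" and r: "r \<ge> 0" and s: "s \<ge> 0"
  shows "norm (kern \<gamma> t s (contour l r)) \<le>
    exp (t * (l + r * cos \<omega>)) * norm (contour l r) powr \<gamma> * exp (- s * (cos (\<alpha> * \<omega>) * norm (contour l r) powr \<alpha>))"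
proof -
  have "norm (kern \<gamma> t s (contour l r)) = exp (t * (l + r * cos \<omega>)) * norm (contour l r) powr \<gamma> *
      exp (- s * Re (contour l r powr of_real \<alpha>))"
    by (simp add: kern_def norm_mult norm_powr_real_powr')
  also have "\<dots> \<le> exp (t * (l + r * cos \<omega>)) * norm (contour l r) powr \<gamma> * exp (- s * (cos (\<alpha> * \<omega>) * norm (contour l r) powr \<alpha>))"
    using mult_left_mono[OF Re_contour_powr_ge[OF l r] s] by (intro mult_left_mono) auto
  finally show ?thesis .
qed

lemma norm_kern_le':
  assumes l: "l > 0" and r: "r \<ge> 0" and s: "s \<ge> 0"
  shows "norm (kern \<gamma> t s (contour l r)) \<le> exp (t * (l + r * cos \<omega>)) * norm (contour l r) powr \<gamma>"
proof -
  have "exp (- s * (cos (\<alpha> * \<omega>) * norm (contour l r) powr \<alpha>)) \<le> 1"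
    using s trig_omega(3) by (simp add: mult_nonneg_nonneg)
  then have "exp (t * (l + r * cos \<omega>)) * norm (contour l r) powr \<gamma> * exp (- s * (cos (\<alpha> * \<omega>) * norm (contour l r) powr \<alpha>))
      \<le> exp (t * (l + r * cos \<omega>)) * norm (contour l r) powr \<gamma> * 1"
    by (intro mult_left_mono) auto
  then show ?thesis using norm_kern_le[OF assms, of \<gamma> t] by linarith
qed

lemma norm_contour_powr_le:
  assumes l: "0 < l0" "l0 \<le> l" "l \<le> l1" and r: "r \<ge> 0"
  shows "norm (contour l r) powr \<gamma> \<le> (l0 * sin \<omega>) powr (- \<bar>\<gamma>\<bar>) + (l1 + r) powr \<bar>\<gamma>\<bar>"
proof (cases "\<gamma> \<ge> 0")
  case True
  have "norm (contour l r) powr \<gamma> \<le> (l1 + r) powr \<gamma>"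
    using True norm_contour_le[of l r] l r by (intro powr_mono2) auto
  then show ?thesis using True by (simp add: add_increasing)
next
  case False
  have "l0 * sin \<omega> \<le> l * sin \<omega>" using l trig_omega(1) by (intro mult_right_mono) auto
  also have "\<dots> \<le> norm (contour l r)" using norm_contour_ge(1)[of l r] l r by auto
  finally have "norm (contour l r) powr \<gamma> \<le> (l0 * sin \<omega>) powr \<gamma>"
    using False l trig_omega(1) by (intro powr_mono2') auto
  then show ?thesis using False by (simp add: add_increasing2)
qed

lemma kern_dominated:
  assumes l: "0 < l0" "l0 \<le> l1" and t: "0 < t0" "t0 \<le> t1"
  shows "\<exists>G>0. \<forall>l t s r. l0 \<le> l \<and> l \<le> l1 \<and> t0 \<le> t \<and> t \<le> t1 \<and> 0 \<le> s \<and> 0 \<le> r \<longrightarrow>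
    norm (kern \<gamma> t s (contour l r)) \<le> G * exp (t0 * cos \<omega> / 2 * r)"
proof -
  define k where "k = - t0 * cos \<omega>"
  have k: "k > 0" using t trig_omega(2) by (simp add: k_def mult_pos_neg)
  obtain C where C: "C > 0" "\<And>r. r \<ge> 0 \<Longrightarrow> (l1 + r) powr \<bar>\<gamma>\<bar> * exp (- k * r) \<le> C * exp (- (k/2) * r)"
    using shift_powr_exp_le[of l1 "\<bar>\<gamma>\<bar>" k] k l by auto
  define A where "A = (l0 * sin \<omega>) powr (- \<bar>\<gamma>\<bar>)"
  have A: "A \<ge> 0" by (simp add: A_def)
  define G where "G = exp (t1 * l1) * (A + C)"
  have G: "G > 0" using A C(1) by (simp add: G_def)
  have "norm (kern \<gamma> t s (contour l r)) \<le> G * exp (t0 * cos \<omega> / 2 * r)"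
    if h: "l0 \<le> l" "l \<le> l1" "t0 \<le> t" "t \<le> t1" "0 \<le> s" "0 \<le> r" for l t s r
  proof -
    have lp: "l > 0" using h l by simp
    have tl: "t * l \<le> t1 * l1" using h l t by (intro mult_mono) auto
    have "t0 * (r * - cos \<omega>) \<le> t * (r * - cos \<omega>)" using h trig_omega(2) by (intro mult_right_mono) (auto simp: mult_nonneg_nonpos)
    then have e: "exp (t * (l + r * cos \<omega>)) \<le> exp (t1 * l1 + - k * r)"
      using tl by (simp add: k_def algebra_simps)
    have "norm (kern \<gamma> t s (contour l r)) \<le> exp (t * (l + r * cos \<omega>)) * norm (contour l r) powr \<gamma>"
      using lp h by (intro norm_kern_le')
    also have "\<dots> \<le> exp (t1 * l1 + - k * r) * (A + (l1 + r) powr \<bar>\<gamma>\<bar>)"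
      using e norm_contour_powr_le[of l0 l l1 r \<gamma>] h l by (intro mult_mono) (auto simp: A_def)
    also have "\<dots> = exp (t1 * l1) * (A * exp (- k * r) + (l1 + r) powr \<bar>\<gamma>\<bar> * exp (- k * r))"
      unfolding exp_add by (simp only: algebra_simps)
    also have "\<dots> \<le> exp (t1 * l1) * (A * exp (- (k/2) * r) + C * exp (- (k/2) * r))"
      using C(2)[of r] A k h by (intro mult_left_mono add_mono) auto
    also have "\<dots> = G * exp (- (k/2) * r)" unfolding G_def by (simp only: algebra_simps)
    also have "- (k/2) * r = t0 * cos \<omega> / 2 * r" by (simp add: k_def)
    finally show ?thesis .
  qed
  then show ?thesis using G by blast
qed

lemma continuous_on_kern: "continuous_on (- \<real>\<^sub>\<le>\<^sub>0) (kern \<gamma> t s)"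
  unfolding kern_def by (intro continuous_intros) (auto simp: complex_nonpos_Reals_iff)

lemma continuous_on_kern_contour: "l > 0 \<Longrightarrow> continuous_on {0..} (\<lambda>r. kern \<gamma> t s (contour l r))"
proof (rule continuous_on_compose2[OF continuous_on_kern])
  show "continuous_on {0..} (contour l)" unfolding contour_def by (intro continuous_intros)
  show "l > 0 \<Longrightarrow> contour l ` {0..} \<subseteq> - \<real>\<^sub>\<le>\<^sub>0" using contour_not_nonpos by auto
qed

lemma integrable_kern:
  assumes l: "l > 0" and t: "t > 0" and s: "s \<ge> 0"
  shows "integrable halfline (\<lambda>r. kern \<gamma> t s (contour l r))"
proof -
  obtain G where G: "G > 0" "\<And>r. r \<ge> 0 \<Longrightarrow> norm (kern \<gamma> t s (contour l r)) \<le> G * exp (t * cos \<omega> / 2 * r)"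
    using kern_dominated[of l l t t \<gamma>] l t s by auto
  show ?thesis
  proof (rule Bochner_Integration.integrable_bound)
    show "integrable halfline (\<lambda>r. G * exp (t * cos \<omega> / 2 * r))"
      using integrable_halfline_exp[of "- (t * cos \<omega> / 2)"] t trig_omega(2) by (simp add: mult_pos_neg)
    show "(\<lambda>r. kern \<gamma> t s (contour l r)) \<in> borel_measurable halfline"
      using continuous_on_kern_contour[OF l] by (intro borel_measurable_halflineI) (rule continuous_on_subset, auto)
    show "AE r in halfline. norm (kern \<gamma> t s (contour l r)) \<le> norm (G * exp (t * cos \<omega> / 2 * r))"
      using G by (intro AE_I2) (auto simp: abs_mult)
  qed
qed

lemma kern_has_field_derivative:
  assumes "p \<notin> \<real>\<^sub>\<le>\<^sub>0"
  shows "(kern \<gamma> t s has_field_derivative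
    of_real t * kern \<gamma> t s p + of_real \<gamma> * kern (\<gamma> - 1) t s p - of_real (s * \<alpha>) * kern (\<gamma> + \<alpha> - 1) t s p) (at p)"
proof -
  have a: "p powr (of_real \<gamma> + of_real \<alpha> - 1) = p powr of_real \<gamma> * p powr (of_real \<alpha> - 1)"
    "p powr (of_real \<alpha> + of_real \<gamma> - 1) = p powr of_real \<gamma> * p powr (of_real \<alpha> - 1)"
    using powr_add[of p "of_real \<gamma>" "of_real \<alpha> - 1"] by (simp_all add: algebra_simps)
  show ?thesis unfolding kern_def[abs_def]
    by (rule derivative_eq_intros refl assms)+ (simp add: a algebra_simps)
qed

lemma kern_of_real: "l > 0 \<Longrightarrow> kern \<gamma> t s (of_real l) = of_real (exp (t * l) * l powr \<gamma> * exp (- s * l powr \<alpha>))"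
  by (simp add: kern_def powr_of_real flip: exp_of_real)

text \<open>
  The integrand is the derivative of \<open>kern \<gamma> t s\<close> along the contour; only the value at the base point
  survives.
\<close>

lemma integral_kern_derivative:
  assumes l: "l > 0" and t: "t > 0" and s: "s \<ge> 0"
  shows "(\<integral>r. (of_real t * kern \<gamma> t s (contour l r) + of_real \<gamma> * kern (\<gamma> - 1) t s (contour l r)
      - of_real (s * \<alpha>) * kern (\<gamma> + \<alpha> - 1) t s (contour l r)) * cis \<omega> \<partial>halfline) = - kern \<gamma> t s (of_real l)"
proof -
  obtain G where G: "G > 0" "\<And>r. r \<ge> 0 \<Longrightarrow> norm (kern \<gamma> t s (contour l r)) \<le> G * exp (t * cos \<omega> / 2 * r)"
    using kern_dominated[of l l t t \<gamma>] l t s by auto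
  have "(\<integral>r. (of_real t * kern \<gamma> t s (contour l r) + of_real \<gamma> * kern (\<gamma> - 1) t s (contour l r)
      - of_real (s * \<alpha>) * kern (\<gamma> + \<alpha> - 1) t s (contour l r)) * cis \<omega> \<partial>halfline) = 0 - kern \<gamma> t s (of_real l)"
  proof (rule halfline_FTC[where F = "\<lambda>r. kern \<gamma> t s (contour l r)"])
    fix r :: real assume r: "r > 0"
    have "(contour l has_vector_derivative cis \<omega>) (at r)"
      unfolding contour_def[abs_def] has_vector_derivative_def
      by (auto intro!: derivative_eq_intros simp: scaleR_conv_of_real)
    from field_vector_diff_chain_at[OF this kern_has_field_derivative[OF contour_not_nonpos], of \<gamma> t s]
    show "((\<lambda>r. kern \<gamma> t s (contour l r)) has_vector_derivative
      (of_real t * kern \<gamma> t s (contour l r) + of_real \<gamma> * kern (\<gamma> - 1) t s (contour l r)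
      - of_real (s * \<alpha>) * kern (\<gamma> + \<alpha> - 1) t s (contour l r)) * cis \<omega>) (at r)"
      using l r by (simp add: o_def mult.commute)
  next
    show "continuous_on {0<..} (\<lambda>r. (of_real t * kern \<gamma> t s (contour l r) + of_real \<gamma> * kern (\<gamma> - 1) t s (contour l r)
      - of_real (s * \<alpha>) * kern (\<gamma> + \<alpha> - 1) t s (contour l r)) * cis \<omega>)"
      by (intro continuous_intros continuous_on_subset[OF continuous_on_kern_contour[OF l]]) auto
    show "integrable halfline (\<lambda>r. (of_real t * kern \<gamma> t s (contour l r) + of_real \<gamma> * kern (\<gamma> - 1) t s (contour l r)
      - of_real (s * \<alpha>) * kern (\<gamma> + \<alpha> - 1) t s (contour l r)) * cis \<omega>)"
      by (intro integrable_mult_left integrable_mult_right Bochner_Integration.integrable_add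
          Bochner_Integration.integrable_diff integrable_kern l t s)
    have "((\<lambda>r. kern \<gamma> t s (contour l r)) \<longlongrightarrow> kern \<gamma> t s (contour l 0)) (at 0 within {0..})"
      using continuous_on_kern_contour[OF l] by (simp add: continuous_on_def)
    then have "((\<lambda>r. kern \<gamma> t s (contour l r)) \<longlongrightarrow> kern \<gamma> t s (contour l 0)) (at_right 0)"
      by (rule tendsto_within_subset) auto
    then show "((\<lambda>r. kern \<gamma> t s (contour l r)) \<longlongrightarrow> kern \<gamma> t s (of_real l)) (at_right 0)"
      by (simp add: contour_def)
    have lim: "((\<lambda>r. G * exp (- k * r)) \<longlongrightarrow> 0) at_top" if "k > 0" for k
      using that by real_asymp
    have "((\<lambda>r. G * exp (t * cos \<omega> / 2 * r)) \<longlongrightarrow> 0) at_top"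
      using lim[of "- (t * cos \<omega> / 2)"] t trig_omega(2) by (simp add: mult_pos_neg)
    then show "((\<lambda>r. kern \<gamma> t s (contour l r)) \<longlongrightarrow> 0) at_top"
    proof (rule Lim_null_comparison[rotated])
      show "\<forall>\<^sub>F r in at_top. norm (kern \<gamma> t s (contour l r)) \<le> G * exp (t * cos \<omega> / 2 * r)"
        using eventually_ge_at_top[of 0] by (rule eventually_mono) (rule G(2))
    qed
  qed
  then show ?thesis by simp
qed

text \<open>
  Integration by parts along the contour. The boundary term is the value of the kernel at a positive real
  point, which is real and therefore invisible to the imaginary part.
\<close>

lemma wrightc_recurrence:
  assumes l: "l > 0" and t: "t > 0" and s: "s \<ge> 0"
  shows "t * wrightc l \<gamma> t s + \<gamma> * wrightc l (\<gamma> - 1) t s = s * \<alpha> * wrightc l (\<gamma> + \<alpha> - 1) t s"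
proof -
  define J where "J g = (\<integral>r. kern g t s (contour l r) * cis \<omega> \<partial>halfline)" for g
  have J: "integrable halfline (\<lambda>r. kern g t s (contour l r) * cis \<omega>)" for g
    by (intro integrable_mult_left integrable_kern l t s)
  have "(\<integral>r. of_real t * (kern \<gamma> t s (contour l r) * cis \<omega>) + of_real \<gamma> * (kern (\<gamma> - 1) t s (contour l r) * cis \<omega>)
      - of_real (s * \<alpha>) * (kern (\<gamma> + \<alpha> - 1) t s (contour l r) * cis \<omega>) \<partial>halfline) = - kern \<gamma> t s (of_real l)"
    using integral_kern_derivative[OF assms, of \<gamma>] by (simp add: algebra_simps)
  then have "of_real t * J \<gamma> + of_real \<gamma> * J (\<gamma> - 1) - of_real (s * \<alpha>) * J (\<gamma> + \<alpha> - 1) = - kern \<gamma> t s (of_real l)"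
    unfolding J_def
    by (subst (asm) Bochner_Integration.integral_diff, (intro integrable_mult_right Bochner_Integration.integrable_add J)+)
       (subst (asm) Bochner_Integration.integral_add, (intro integrable_mult_right J)+, simp)
  then have "Im (of_real t * J \<gamma> + of_real \<gamma> * J (\<gamma> - 1) - of_real (s * \<alpha>) * J (\<gamma> + \<alpha> - 1)) = 0"
    using l by (simp add: kern_of_real)
  then have "t * Im (J \<gamma>) + \<gamma> * Im (J (\<gamma> - 1)) = s * \<alpha> * Im (J (\<gamma> + \<alpha> - 1))" by simp
  moreover have "wrightc l g t s = Im (J g) / pi" for g
    by (simp only: wrightc_def J_def)
  moreover have "t * (a / pi) + \<gamma> * (b / pi) = (t * a + \<gamma> * b) / pi" for a b
    by (simp add: add_divide_distrib)
  ultimately show ?thesis by simp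
qed

text \<open>
  Cauchy's theorem in infinitesimal form: the derivative of the contour integral with respect to \<open>l\<close> is the
  integral of the derivative of the kernel along the contour, that is, minus the value of the kernel
  at \<open>l\<close>. This is real, so the imaginary part does not depend on \<open>l\<close>.
\<close>

lemma wrightc_shift:
  assumes l: "l > 0" "l' > 0" and t: "t > 0" and s: "s \<ge> 0"
  shows "wrightc l \<gamma> t s = wrightc l' \<gamma> t s"
proof -
  define J where "J l = (\<integral>r. kern \<gamma> t s (contour l r) * cis \<omega> \<partial>halfline)" for l
  define h' where "h' p = of_real t * kern \<gamma> t s p + of_real \<gamma> * kern (\<gamma> - 1) t s p
      - of_real (s * \<alpha>) * kern (\<gamma> + \<alpha> - 1) t s p" for p
  have J': "(J has_vector_derivative - kern \<gamma> t s (of_real l)) (at l)" if l: "l > 0" for l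
  proof -
    have l2: "0 < l/2" "l/2 \<le> 2*l" using l by auto
    obtain G1 where G1: "G1 > 0" "\<And>y r. l/2 \<le> y \<Longrightarrow> y \<le> 2*l \<Longrightarrow> r \<ge> 0 \<Longrightarrow> norm (kern \<gamma> t s (contour y r)) \<le> G1 * exp (t * cos \<omega> / 2 * r)"
      using kern_dominated[OF l2 t order_refl, of \<gamma>] s by auto
    obtain G2 where G2: "G2 > 0" "\<And>y r. l/2 \<le> y \<Longrightarrow> y \<le> 2*l \<Longrightarrow> r \<ge> 0 \<Longrightarrow> norm (kern (\<gamma>-1) t s (contour y r)) \<le> G2 * exp (t * cos \<omega> / 2 * r)"
      using kern_dominated[OF l2 t order_refl, of "\<gamma> - 1"] s by auto
    obtain G3 where G3: "G3 > 0" "\<And>y r. l/2 \<le> y \<Longrightarrow> y \<le> 2*l \<Longrightarrow> r \<ge> 0 \<Longrightarrow> norm (kern (\<gamma>+\<alpha>-1) t s (contour y r)) \<le> G3 * exp (t * cos \<omega> / 2 * r)"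
      using kern_dominated[OF l2 t order_refl, of "\<gamma> + \<alpha> - 1"] s by auto
    have "(J has_vector_derivative (\<integral>r. h' (contour l r) * cis \<omega> \<partial>halfline)) (at l)"
      unfolding J_def[abs_def]
    proof (rule integral_has_vector_derivative_dominated(1)
        [where r = "l/2" and g = "\<lambda>r. (t * G1 + \<bar>\<gamma>\<bar> * G2 + s * \<alpha> * G3) * exp (t * cos \<omega> / 2 * r)"])
      show "l/2 > 0" by fact
      show "integrable halfline (\<lambda>r. (t * G1 + \<bar>\<gamma>\<bar> * G2 + s * \<alpha> * G3) * exp (t * cos \<omega> / 2 * r))"
        using integrable_halfline_exp[of "- (t * cos \<omega> / 2)"] t trig_omega(2) by (simp add: mult_pos_neg)
      fix y assume y: "\<bar>y - l\<bar> < l/2"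
      then have yb: "l/2 \<le> y" "y \<le> 2*l" "y > 0" using l by linarith+
      show "integrable halfline (\<lambda>r. kern \<gamma> t s (contour y r) * cis \<omega>)"
        by (intro integrable_mult_left integrable_kern yb t s)
      fix r assume "r \<in> space halfline"
      then have r: "r \<ge> 0" by simp
      have "((\<lambda>y. contour y r) has_vector_derivative 1) (at y)"
        unfolding contour_def has_vector_derivative_def
        by (auto intro!: derivative_eq_intros simp: scaleR_conv_of_real)
      from field_vector_diff_chain_at[OF this kern_has_field_derivative[OF contour_not_nonpos], of \<gamma> t s]
      have "((\<lambda>y. kern \<gamma> t s (contour y r)) has_vector_derivative h' (contour y r)) (at y)"
        using yb r by (simp add: o_def h'_def)
      then show "((\<lambda>y. kern \<gamma> t s (contour y r) * cis \<omega>) has_vector_derivative h' (contour y r) * cis \<omega>) (at y)"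
        by (intro has_vector_derivative_mult_left)
      have "norm (h' (contour y r)) \<le> t * norm (kern \<gamma> t s (contour y r)) + \<bar>\<gamma>\<bar> * norm (kern (\<gamma>-1) t s (contour y r))
          + s * \<alpha> * norm (kern (\<gamma>+\<alpha>-1) t s (contour y r))"
        unfolding h'_def using t s alpha_pos
        by (intro order_trans[OF norm_triangle_ineq4] add_mono order_trans[OF norm_triangle_ineq]) (simp_all add: norm_mult)
      also have "\<dots> \<le> t * (G1 * exp (t * cos \<omega> / 2 * r)) + \<bar>\<gamma>\<bar> * (G2 * exp (t * cos \<omega> / 2 * r)) + s * \<alpha> * (G3 * exp (t * cos \<omega> / 2 * r))"
        using t s alpha_pos G1(2)[OF yb(1,2) r] G2(2)[OF yb(1,2) r] G3(2)[OF yb(1,2) r]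
        by (intro add_mono mult_left_mono) auto
      finally show "norm (h' (contour y r) * cis \<omega>) \<le> (t * G1 + \<bar>\<gamma>\<bar> * G2 + s * \<alpha> * G3) * exp (t * cos \<omega> / 2 * r)"
        by (simp add: norm_mult algebra_simps)
    qed
    also have "(\<integral>r. h' (contour l r) * cis \<omega> \<partial>halfline) = - kern \<gamma> t s (of_real l)"
      unfolding h'_def by (rule integral_kern_derivative[OF l t s])
    finally show ?thesis .
  qed
  have "\<exists>c. \<forall>l\<in>{0<..}. Im (J l) = c"
  proof (rule has_derivative_zero_constant)
    fix l :: real assume "l \<in> {0<..}"
    then have l: "l > 0" by simp
    have "((\<lambda>l. Im (J l)) has_vector_derivative Im (- kern \<gamma> t s (of_real l))) (at l)"
      by (rule bounded_linear.has_vector_derivative[OF bounded_linear_Im J'[OF l]])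
    moreover have "Im (- kern \<gamma> t s (of_real l)) = 0"
      unfolding kern_of_real[OF l] by simp
    ultimately have "((\<lambda>l. Im (J l)) has_vector_derivative 0) (at l)"
      by simp
    then have "((\<lambda>l. Im (J l)) has_derivative (\<lambda>h. 0)) (at l)"
      by (simp add: has_vector_derivative_def)
    then show "((\<lambda>l. Im (J l)) has_derivative (\<lambda>h. 0)) (at l within {0<..})"
      by (rule has_derivative_at_withinI)
  qed simp
  then show ?thesis using l by (auto simp: wrightc_def J_def)
qed

lemma wrightc_scale:
  assumes l: "l > 0" and t: "t > 0"
  shows "wrightc l \<gamma> t s = t powr (- \<gamma> - 1) * wrightc (t * l) \<gamma> 1 (s * t powr (- \<alpha>))"
proof -
  have eq: "kern \<gamma> t s (contour l (1/t * r)) = of_real (t powr (- \<gamma>)) * kern \<gamma> 1 (s * t powr (- \<alpha>)) (contour (t * l) r)"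
    if r: "r \<in> space halfline" for r
  proof -
    have c: "contour l (1/t * r) = contour (t * l) r / of_real t"
      using t by (simp add: contour_def field_simps)
    have nz: "contour (t * l) r \<noteq> 0" using contour_nonzero[of "t * l" r] l t r by simp
    show ?thesis unfolding kern_def c
      using t nz by (simp add: divide_of_real_powr mult_ac)
  qed
  have "(\<integral>r. kern \<gamma> t s (contour l r) * cis \<omega> \<partial>halfline) = (1/t) *\<^sub>R (\<integral>r. kern \<gamma> t s (contour l (1/t * r)) * cis \<omega> \<partial>halfline)"
    using integral_halfline_scale[of "1/t" "\<lambda>r. kern \<gamma> t s (contour l r) * cis \<omega>"] t by simp
  also have "(\<integral>r. kern \<gamma> t s (contour l (1/t * r)) * cis \<omega> \<partial>halfline) =
     (\<integral>r. of_real (t powr (- \<gamma>)) * (kern \<gamma> 1 (s * t powr (- \<alpha>)) (contour (t * l) r) * cis \<omega>) \<partial>halfline)"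
    by (intro Bochner_Integration.integral_cong refl) (simp only: eq mult.assoc)
  also have "\<dots> = of_real (t powr (- \<gamma>)) * (\<integral>r. kern \<gamma> 1 (s * t powr (- \<alpha>)) (contour (t * l) r) * cis \<omega> \<partial>halfline)"
    by simp
  finally show ?thesis using t
    by (simp add: wrightc_def powr_diff)
qed

lemma wright_scale:
  assumes t: "t > 0" and s: "s \<ge> 0"
  shows "wright \<gamma> t s = t powr (- \<gamma> - 1) * wright \<gamma> 1 (s * t powr (- \<alpha>))"
  using wrightc_scale[of 1 t \<gamma> s] wrightc_shift[of t 1 1 "s * t powr (- \<alpha>)" \<gamma>] t s by (simp add: wright_def)

lemma wright_has_derivative:
  assumes t: "t > 0" and s: "s \<ge> 0"
  shows "((\<lambda>t. wright \<gamma> t s) has_vector_derivative wright (\<gamma> + 1) t s) (at t)"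
proof -
  have t2: "0 < t/2" "t/2 \<le> 2*t" using t by auto
  obtain G where G: "G > 0" "\<And>y r. t/2 \<le> y \<Longrightarrow> y \<le> 2*t \<Longrightarrow> r \<ge> 0 \<Longrightarrow>
      norm (kern (\<gamma>+1) y s (contour 1 r)) \<le> G * exp ((t/2) * cos \<omega> / 2 * r)"
    using kern_dominated[OF zero_less_one order_refl t2, of "\<gamma> + 1"] s by auto
  have "((\<lambda>t. \<integral>r. kern \<gamma> t s (contour 1 r) * cis \<omega> \<partial>halfline) has_vector_derivative
      (\<integral>r. kern (\<gamma>+1) t s (contour 1 r) * cis \<omega> \<partial>halfline)) (at t)"
  proof (rule integral_has_vector_derivative_dominated(1)
      [where r = "t/2" and g = "\<lambda>r. G * exp ((t/2) * cos \<omega> / 2 * r)"])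
    show "t/2 > 0" by fact
    show "integrable halfline (\<lambda>r. G * exp ((t/2) * cos \<omega> / 2 * r))"
      using integrable_halfline_exp[of "- ((t/2) * cos \<omega> / 2)"] t trig_omega(2) by (simp add: mult_pos_neg)
    fix y assume y: "\<bar>y - t\<bar> < t/2"
    then have yb: "t/2 \<le> y" "y \<le> 2*t" "y > 0" using t by linarith+
    show "integrable halfline (\<lambda>r. kern \<gamma> y s (contour 1 r) * cis \<omega>)"
      by (intro integrable_mult_left integrable_kern yb s) simp
    fix r assume "r \<in> space halfline"
    then have r: "r \<ge> 0" by simp
    define p where "p = contour 1 r"
    have p0: "p \<noteq> 0" using contour_nonzero[of 1 r] r by (simp add: p_def)
    have "((\<lambda>z. exp (z * p) * p powr of_real \<gamma> * exp (- of_real s * p powr of_real \<alpha>) * cis \<omega>)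
        has_field_derivative kern (\<gamma>+1) y s p * cis \<omega>) (at (of_real y))"
      unfolding kern_def using p0 by (auto intro!: derivative_eq_intros simp: powr_add)
    then have "((\<lambda>t. kern \<gamma> t s p * cis \<omega>) has_vector_derivative kern (\<gamma>+1) y s p * cis \<omega>) (at y)"
      unfolding kern_def by (rule has_vector_derivative_real_field)
    then show "((\<lambda>t. kern \<gamma> t s (contour 1 r) * cis \<omega>) has_vector_derivative kern (\<gamma>+1) y s (contour 1 r) * cis \<omega>) (at y)"
      by (simp add: p_def)
    show "norm (kern (\<gamma>+1) y s (contour 1 r) * cis \<omega>) \<le> G * exp ((t/2) * cos \<omega> / 2 * r)"
      using G(2)[OF yb(1,2) r] by (simp add: norm_mult)
  qed
  from bounded_linear.has_vector_derivative[OF bounded_linear_compose[OF bounded_linear_divide bounded_linear_Im] this, of pi]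
  show ?thesis by (simp add: wright_def[abs_def] wrightc_def[abs_def])
qed

text \<open>
  The case \<open>\<gamma> = 0\<close> of the recurrence, in which its middle term drops out. The extra factor \<open>s\<close> is what
  removes the logarithm from the critical estimate of \<open>Y_frac\<close>.
\<close>

lemma wright_0: "t > 0 \<Longrightarrow> s \<ge> 0 \<Longrightarrow> wright 0 t s = \<alpha> * s / t * wright (\<alpha> - 1) t s"
  using wrightc_recurrence[of 1 t s 0] by (simp add: wright_def field_simps)

text \<open>
  On the contour \<open>exp p\<close> contributes \<open>exp l\<close>, and the power of \<open>p\<close> costs at most another factor of
  this size; this is the \<open>2 * l\<close>. The negative term is the decay of \<open>exp (- z * p powr \<alpha>)\<close>, estimated at the
  distance \<open>l * sin \<omega>\<close> of the contour from the origin.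
\<close>

lemma wrightc_unit_bound:
  "\<exists>C>0. \<forall>l\<ge>1. \<forall>z\<ge>0. \<bar>wrightc l \<gamma> 1 z\<bar> \<le>
    C * exp (2 * l - z * (cos (\<alpha> * \<omega>) * (l * sin \<omega>) powr \<alpha>))"
proof -
  define g where "g = \<bar>\<gamma>\<bar>"
  define k where "k = - cos \<omega>"
  have k: "k > 0" using trig_omega(2) by (simp add: k_def)
  obtain C1 where C1: "C1 > 0" "\<And>y. y \<ge> 0 \<Longrightarrow> y powr g * exp (- 1 * y powr 1) \<le> C1"
    using powr_mult_exp_powr_bounded[of g 1 1] by (auto simp: g_def)
  obtain C2 where C2: "C2 > 0" "\<And>r. r \<ge> 0 \<Longrightarrow> (1 + r) powr g * exp (- k * r) \<le> C2 * exp (- (k/2) * r)"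
    using shift_powr_exp_le[of 1 g k] k by (auto simp: g_def)
  define A where "A = sin \<omega> powr (- g)"
  have A: "A \<ge> 0" by (simp add: A_def)
  define B where "B = (\<integral>r. exp (- (k/2) * r) \<partial>halfline)"
  have B: "B \<ge> 0" unfolding B_def by (rule integral_nonneg_AE) simp
  have Bi: "integrable halfline (\<lambda>r. exp (- (k/2) * r))" using k by (intro integrable_halfline_exp) auto
  define C where "C = (A + C1 * C2) * B / pi + 1"
  have "\<bar>wrightc l \<gamma> 1 z\<bar> \<le> C * exp (2 * l - z * (cos (\<alpha> * \<omega>) * (l * sin \<omega>) powr \<alpha>))"
    if l: "l \<ge> 1" and z: "z \<ge> 0" for l z
  proof -
    define E where "E = exp (2 * l - z * (cos (\<alpha> * \<omega>) * (l * sin \<omega>) powr \<alpha>))"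
    have E0: "E \<ge> 0" by (simp add: E_def)
    have bd: "norm (kern \<gamma> 1 z (contour l r) * cis \<omega>) \<le> E * (A + C1 * C2) * exp (- (k/2) * r)"
      if "r \<in> space halfline" for r
    proof -
      have r: "r \<ge> 0" using that by simp
      have lp: "l > 0" using l by simp
      have 1: "norm (contour l r) powr \<gamma> \<le> exp l * (A + C1 * (1 + r) powr g)"
      proof -
        have "norm (contour l r) powr \<gamma> \<le> (l * sin \<omega>) powr (- g) + (l + r) powr g"
          using norm_contour_powr_le[OF lp order_refl order_refl r, of \<gamma>] by (simp add: g_def)
        also have "(l * sin \<omega>) powr (- g) \<le> A"
          unfolding A_def using l trig_omega(1) by (intro powr_mono2') (auto simp: g_def)
        also have "(l + r) powr g \<le> (l * (1 + r)) powr g"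
        proof (rule powr_mono2)
          have "r \<le> l * r" using l r mult_right_mono[of 1 l r] by simp
          then show "l + r \<le> l * (1 + r)" by (simp add: distrib_left)
        qed (use l r in \<open>auto simp: g_def\<close>)
        also have "\<dots> = l powr g * (1 + r) powr g" using l r by (simp add: powr_mult)
        also have "l powr g \<le> C1 * exp l"
          using C1(2)[of l] l by (simp add: exp_minus field_simps)
        also have "A \<le> exp l * A" using A l by (simp add: mult_le_cancel_right1)
        finally have "norm (contour l r) powr \<gamma> \<le> exp l * A + C1 * exp l * (1 + r) powr g"
          by (simp add: mult_right_mono)
        then show ?thesis by (simp add: algebra_simps)
      qed
      have "l * sin \<omega> \<le> norm (contour l r)" using norm_contour_ge[OF lp r] by simp
      then have "(l * sin \<omega>) powr \<alpha> \<le> norm (contour l r) powr \<alpha>"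
        using alpha_pos l trig_omega(1) by (intro powr_mono2) auto
      then have 2: "exp (- z * (cos (\<alpha> * \<omega>) * norm (contour l r) powr \<alpha>)) \<le> exp (- z * (cos (\<alpha> * \<omega>) * (l * sin \<omega>) powr \<alpha>))"
        using z trig_omega(3) by (simp add: mult_left_mono)
      have "norm (kern \<gamma> 1 z (contour l r) * cis \<omega>) = norm (kern \<gamma> 1 z (contour l r))"
        by (simp add: norm_mult)
      also have "\<dots> \<le> exp (1 * (l + r * cos \<omega>)) * norm (contour l r) powr \<gamma> * exp (- z * (cos (\<alpha> * \<omega>) * norm (contour l r) powr \<alpha>))"
        by (rule norm_kern_le[OF lp r z])
      also have "\<dots> \<le> exp (1 * (l + r * cos \<omega>)) * (exp l * (A + C1 * (1 + r) powr g)) * exp (- z * (cos (\<alpha> * \<omega>) * (l * sin \<omega>) powr \<alpha>))"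
        using 1 2 A C1(1) by (intro mult_mono) auto
      also have "\<dots> = E * (A * exp (- k * r) + C1 * ((1 + r) powr g * exp (- k * r)))"
      proof -
        have "2 * l - z * (cos (\<alpha> * \<omega>) * (l * sin \<omega>) powr \<alpha>) = l + l + - z * (cos (\<alpha> * \<omega>) * (l * sin \<omega>) powr \<alpha>)"
          by simp
        then have EE: "E = exp l * exp l * exp (- z * (cos (\<alpha> * \<omega>) * (l * sin \<omega>) powr \<alpha>))"
          unfolding E_def by (simp only: exp_add)
        have kk: "exp (1 * (l + r * cos \<omega>)) = exp l * exp (- k * r)"
          by (simp add: k_def exp_add[symmetric] mult.commute)
        show ?thesis unfolding EE kk by (simp only: algebra_simps)
      qed
      also have "\<dots> \<le> E * (A * exp (- (k/2) * r) + C1 * (C2 * exp (- (k/2) * r)))"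
        using C2(2)[OF r] A C1(1) E0 k r by (intro mult_left_mono add_mono) auto
      also have "\<dots> = E * (A + C1 * C2) * exp (- (k/2) * r)" by (simp only: algebra_simps)
      finally show ?thesis .
    qed
    have "norm (\<integral>r. kern \<gamma> 1 z (contour l r) * cis \<omega> \<partial>halfline) \<le> (\<integral>r. E * (A + C1 * C2) * exp (- (k/2) * r) \<partial>halfline)"
      using Bi bd by (intro norm_integral_le) auto
    also have "\<dots> = E * (A + C1 * C2) * B" by (simp add: B_def)
    finally have "\<bar>Im (\<integral>r. kern \<gamma> 1 z (contour l r) * cis \<omega> \<partial>halfline)\<bar> \<le> E * (A + C1 * C2) * B"
      using abs_Im_le_cmod order_trans by blast
    then have "\<bar>wrightc l \<gamma> 1 z\<bar> \<le> E * (A + C1 * C2) * B / pi"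
      unfolding wrightc_def abs_divide by (simp add: divide_right_mono)
    also have "\<dots> = ((A + C1 * C2) * B / pi) * E" by simp
    also have "\<dots> \<le> C * E" unfolding C_def using E0 by (intro mult_right_mono) auto
    finally show ?thesis by (simp add: E_def)
  qed
  moreover have "C > 0" using A B C1(1) C2(1) by (simp add: C_def add_nonneg_pos)
  ultimately show ?thesis by blast
qed

text \<open>
  The left side does not depend on the base point \<open>l\<close>, so \<open>l\<close> may be chosen to make the bound of
  \<open>wrightc_unit_bound\<close> small.
\<close>

lemma wright_bound:
  "\<exists>C>0. \<exists>c>0. \<forall>t>0. \<forall>s\<ge>0. \<bar>wright \<gamma> t s\<bar> \<le> C * t powr (- \<gamma> - 1) * exp (- c * (s * t powr (- \<alpha>)) powr (1 / (1 - \<alpha>)))"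
proof -
  obtain C where C: "C > 0" "\<And>l z. l \<ge> 1 \<Longrightarrow> z \<ge> 0 \<Longrightarrow> \<bar>wrightc l \<gamma> 1 z\<bar> \<le>
    C * exp (2 * l - z * (cos (\<alpha> * \<omega>) * (l * sin \<omega>) powr \<alpha>))"
    using wrightc_unit_bound[of \<gamma>] by blast
  define k where "k = cos (\<alpha> * \<omega>) * sin \<omega> powr \<alpha>"
  have k: "k > 0" using trig_omega by (simp add: k_def)
  define c where "c = (k / 4) powr (1 / (1 - \<alpha>))"
  have c: "c > 0" using k by (simp add: c_def)
  have unit: "\<bar>wright \<gamma> 1 z\<bar> \<le> C * exp 3 * exp (- c * z powr (1 / (1 - \<alpha>)))" if z: "z \<ge> 0" for z
  proof -
    \<comment> \<open>With this \<open>L\<close> the gain \<open>k * z * L powr \<alpha>\<close> equals \<open>4 * L\<close>, twice the loss \<open>2 * L\<close>; the maximum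
      with \<open>1\<close> and the constant \<open>3\<close> below take care of small \<open>z\<close>.\<close>
    define L where "L = c * z powr (1 / (1 - \<alpha>))"
    have L: "L = (k * z / 4) powr (1 / (1 - \<alpha>))" using k z by (simp add: L_def c_def powr_mult[symmetric])
    define l where "l = max 1 L"
    have l: "l \<ge> 1" by (simp add: l_def)
    have e: "z * (cos (\<alpha> * \<omega>) * (l * sin \<omega>) powr \<alpha>) = k * z * l powr \<alpha>"
      using l trig_omega(1) by (simp add: k_def powr_mult)
    have "\<bar>wright \<gamma> 1 z\<bar> = \<bar>wrightc l \<gamma> 1 z\<bar>"
      using wrightc_shift[of 1 l 1 z \<gamma>] l z by (simp add: wright_def)
    also have "\<dots> \<le> C * exp (2 * l - k * z * l powr \<alpha>)" using C(2)[OF l z] by (simp only: e)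
    also have "\<dots> \<le> C * exp (3 - L)"
    proof -
      have "2 * l - k * z * l powr \<alpha> \<le> 3 - L"
      proof (cases "L \<ge> 1")
        case True
        then have lL: "l = L" by (simp add: l_def)
        have kz: "k * z > 0"
        proof (rule ccontr)
          assume "\<not> k * z > 0"
          then have "k * z = 0" using k z by (simp add: not_less mult_le_0_iff)
          then have "L = 0" unfolding L by (simp only: div_0) simp
          then show False using True by simp
        qed
        have "L powr (1 - \<alpha>) = k * z / 4"
          using kz alpha_less by (simp add: L powr_powr)
        then have "k * z * L powr \<alpha> = 4 * (L powr (1 - \<alpha>) * L powr \<alpha>)" by simp
        also have "L powr (1 - \<alpha>) * L powr \<alpha> = L" using True by (simp add: powr_add[symmetric])
        finally show ?thesis using True by (simp add: lL)
      next
        case False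
        moreover have "k * z \<ge> 0" using k z by simp
        ultimately show ?thesis by (simp add: l_def)
      qed
      then show ?thesis using C(1) by simp
    qed
    also have "\<dots> = C * exp 3 * exp (- L)" by (simp add: exp_diff exp_minus divide_inverse)
    finally show ?thesis by (simp add: L_def)
  qed
  have "\<bar>wright \<gamma> t s\<bar> \<le> (C * exp 3) * t powr (- \<gamma> - 1) * exp (- c * (s * t powr (- \<alpha>)) powr (1 / (1 - \<alpha>)))"
    if t: "t > 0" and s: "s \<ge> 0" for t s
  proof -
    have "\<bar>wright \<gamma> t s\<bar> = t powr (- \<gamma> - 1) * \<bar>wright \<gamma> 1 (s * t powr (- \<alpha>))\<bar>"
      using wright_scale[OF t s, of \<gamma>] by (simp add: abs_mult)
    also have "\<dots> \<le> t powr (- \<gamma> - 1) * (C * exp 3 * exp (- c * (s * t powr (- \<alpha>)) powr (1 / (1 - \<alpha>))))"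
      using unit[of "s * t powr (- \<alpha>)"] s by (intro mult_left_mono) auto
    finally show ?thesis by (simp only: mult_ac)
  qed
  then show ?thesis using c C(1) by (intro exI[of _ "C * exp 3"]) auto
qed

end

section \<open>Hankel's formula and the function Phi\<close>

lemma Gamma_integral_halfline:
  assumes q: "q > (0::real)"
  shows "(\<integral>u. u powr (q - 1) * exp (- u) \<partial>halfline) = Gamma q"
proof -
  have "integrable halfline (\<lambda>u. u powr (q - 1) * exp (- u))"
    using integrable_halfline_Gamma[OF q, of 1] by simp
  then have si: "set_integrable lborel {0<..} (\<lambda>u. u powr (q - 1) * exp (- u))"
    by (simp add: integrable_halfline)
  have "((\<lambda>u. u powr (q - 1) * exp (- u)) has_integral Gamma q) {0..}"
    using Gamma_integral_real[OF q] by (simp add: exp_minus divide_inverse)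
  moreover have "((\<lambda>u. u powr (q - 1) * exp (- u)) has_integral Gamma q) {0..} \<longleftrightarrow>
      ((\<lambda>u. u powr (q - 1) * exp (- u)) has_integral Gamma q) {0<..}"
  proof (rule has_integral_spike_set_eq)
    show "negligible {x \<in> {0..} - {0<..}. x powr (q - 1) * exp (- x) \<noteq> 0}"
      by (rule negligible_subset[of "{0}"]) auto
    show "negligible {x \<in> {0<..} - {0..}. x powr (q - 1) * exp (- x) \<noteq> 0}"
      by (rule negligible_subset[of "{0}"]) auto
  qed
  ultimately have "integral {0<..} (\<lambda>u. u powr (q - 1) * exp (- u)) = Gamma q"
    by (simp add: integral_unique)
  then show ?thesis
    using set_borel_integral_eq_integral(2)[OF si] by (simp add: integral_halfline)
qed

lemma Gamma_integral_halfline_real: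
  assumes q: "q > (0::real)" and x: "x > 0"
  shows "(\<integral>u. u powr (q - 1) * exp (- x * u) \<partial>halfline) = Gamma q * x powr (- q)"
proof -
  define I where "I = (\<integral>u. u powr (q - 1) * exp (- x * u) \<partial>halfline)"
  have "Gamma q = x * (\<integral>u. (x * u) powr (q - 1) * exp (- (x * u)) \<partial>halfline)"
    using integral_halfline_scale[OF x, of "\<lambda>u. u powr (q - 1) * exp (- u)"]
    by (simp only: Gamma_integral_halfline[OF q] real_scaleR_def)
  also have "(\<integral>u. (x * u) powr (q - 1) * exp (- (x * u)) \<partial>halfline) =
      (\<integral>u. x powr (q - 1) * (u powr (q - 1) * exp (- x * u)) \<partial>halfline)"
    using x by (intro Bochner_Integration.integral_cong refl) (simp add: powr_mult)
  also have "\<dots> = x powr (q - 1) * I" unfolding I_def by (rule integral_mult_right_zero)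
  also have "x * (x powr (q - 1) * I) = x powr q * I" using x by (simp add: powr_diff)
  finally have "I = Gamma q * x powr (- q)" using x by (simp add: powr_minus field_simps)
  then show ?thesis by (simp only: I_def)
qed

text \<open>
  Both sides are holomorphic in the right half-plane and agree on the positive reals.
\<close>

lemma Gamma_integral_halfline_complex:
  assumes q: "q > (0::real)" and z: "Re z > 0"
  shows "(\<integral>u. of_real (u powr (q - 1)) * exp (- z * of_real u) \<partial>halfline) = of_real (Gamma q) * z powr (- of_real q)"
proof -
  define S where "S = {z. Re z > 0}"
  define f where "f z = (\<integral>u. of_real (u powr (q - 1)) * exp (- z * of_real u) \<partial>halfline)" for z :: complex
  define g where "g z = of_real (Gamma q) * z powr (- of_real q)" for z :: complex
  have S: "open S" "connected S"
    unfolding S_def by (rule open_halfspace_Re_gt, intro convex_connected convex_halfspace_Re_gt)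
  have hf: "f holomorphic_on S"
    unfolding f_def[abs_def]
  proof (rule holomorphic_on_integral_dominated[OF S(1)])
    show "(\<lambda>z. of_real (u powr (q - 1)) * exp (- z * of_real u)) holomorphic_on S" for u :: real
      by (intro holomorphic_intros)
    show "(\<lambda>u. of_real (u powr (q - 1)) * exp (- z * of_real u)) \<in> borel_measurable halfline" for z :: complex
      by (rule borel_measurable_halfline) measurable
    fix z :: complex assume "z \<in> S"
    then have z: "Re z > 0" by (simp add: S_def)
    show "\<exists>r>0. \<exists>g. integrable halfline g \<and> cball z r \<subseteq> S \<and>
       (\<forall>u\<in>space halfline. \<forall>w\<in>cball z r. norm (of_real (u powr (q - 1)) * exp (- w * of_real u)) \<le> g u)"
    proof (intro exI conjI ballI)
      show "Re z / 2 > 0" using z by simp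
      show "integrable halfline (\<lambda>u. u powr (q - 1) * exp (- (Re z / 2) * u))"
        using z by (intro integrable_halfline_Gamma q) simp
      have w: "Re w \<ge> Re z / 2" if "w \<in> cball z (Re z / 2)" for w
        using that abs_Re_le_cmod[of "z - w"] by (simp add: dist_norm)
      show "cball z (Re z / 2) \<subseteq> S" using w z unfolding S_def by (auto dest!: w)
      fix u w assume "u \<in> space halfline" and wz: "w \<in> cball z (Re z / 2)"
      then have u: "u > 0" by simp
      have "- Re w * u \<le> - (Re z / 2) * u" using w[OF wz] u by (intro mult_right_mono) auto
      then have "exp (- Re w * u) \<le> exp (- (Re z / 2) * u)" by (simp only: exp_le_cancel_iff)
      then have "u powr (q - 1) * exp (- Re w * u) \<le> u powr (q - 1) * exp (- (Re z / 2) * u)"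
        by (rule mult_left_mono) simp
      then show "norm (of_real (u powr (q - 1)) * exp (- w * of_real u)) \<le> u powr (q - 1) * exp (- (Re z / 2) * u)"
        by (simp add: norm_mult)
    qed
  qed
  have hg: "g holomorphic_on S"
    unfolding g_def[abs_def] S_def by (intro holomorphic_intros) (auto simp: complex_nonpos_Reals_iff)
  have "f z - g z = 0"
  proof (rule analytic_continuation[of "\<lambda>z. f z - g z" S "of_real ` {0<..}" 1 z])
    show "(\<lambda>z. f z - g z) holomorphic_on S" by (intro holomorphic_intros hf hg)
    show "of_real ` {0<..} \<subseteq> S" by (auto simp: S_def)
    show "(1::complex) \<in> S" "z \<in> S" using z by (simp_all add: S_def)
    show "(1::complex) islimpt of_real ` {0<..}"
      unfolding islimpt_approachable
    proof (intro allI impI)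
      fix e :: real assume e: "e > 0"
      have "complex_of_real (1 + e/2) \<in> of_real ` {0<..}" using e by (intro imageI) simp
      moreover have "complex_of_real (1 + e/2) \<noteq> 1" using e by (simp add: complex_eq_iff)
      moreover have "dist (complex_of_real (1 + e/2)) 1 < e" using e by (simp add: dist_norm norm_divide)
      ultimately show "\<exists>x'\<in>of_real ` {0<..}. x' \<noteq> (1::complex) \<and> dist x' 1 < e" by blast
    qed
    fix w :: complex assume "w \<in> of_real ` {0<..}"
    then obtain x where x: "x > 0" "w = of_real x" by auto
    have "f w = (\<integral>u. complex_of_real (u powr (q - 1) * exp (- x * u)) \<partial>halfline)"
      unfolding f_def x(2) by (simp flip: exp_of_real)
    also have "\<dots> = of_real (Gamma q * x powr (- q))"
      by (simp only: integral_complex_of_real Gamma_integral_halfline_real[OF q x(1)])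
    also have "\<dots> = g w"
      using x(1) powr_of_real[of x "- q"] by (simp add: g_def x(2))
    finally show "f w - g w = 0" by simp
  qed (use S in auto)
  then show ?thesis by (simp add: f_def g_def)
qed

context fractional_order begin

text \<open>
  Hankel's formula. Since \<open>q > 0\<close>, the base point can be moved into the origin; the contour becomes a ray and
  the integral a rotated Gamma integral, and the imaginary part is \<open>Gamma q * sin (pi * q)\<close>. The
  reflection formula does the rest.
\<close>

lemma wrightc_Hankel:
  assumes q: "q > 0" and l: "l > 0"
  shows "wrightc l (q - 1) 1 0 = rGamma (1 - q)"
proof -
  define J where "J l = (\<integral>r. kern (q - 1) 1 0 (contour l r) * cis \<omega> \<partial>halfline)" for l
  define J0 where "J0 = (\<integral>r. kern (q - 1) 1 0 (contour 0 r) * cis \<omega> \<partial>halfline)"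
  define k where "k = - cos \<omega>"
  have k: "k > 0" using trig_omega(2) by (simp add: k_def)
  have c0: "contour 0 r \<notin> \<real>\<^sub>\<le>\<^sub>0" if "r > 0" for r
    using that trig_omega(1) by (auto simp: complex_nonpos_Reals_iff)
  define L where "L n = inverse (real (Suc n))" for n
  have L: "L n > 0" "L n \<le> 1" for n by (auto simp: L_def field_simps)
  have L0: "L \<longlonglongrightarrow> 0" unfolding L_def by (rule LIMSEQ_inverse_real_of_nat)
  define w where "w r = exp 1 * (sin \<omega> powr (q - 1) * (r powr (q - 1) * exp (- k * r)) + (1 + r) powr \<bar>q - 1\<bar> * exp (- k * r))" for r
  have "(\<lambda>n. J (L n)) \<longlonglongrightarrow> J0"
    unfolding J_def J0_def
  proof (rule integral_dominated_convergence[where w = w])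
    show "integrable halfline w" unfolding w_def
      by (intro integrable_mult_right Bochner_Integration.integrable_add integrable_halfline_Gamma
          integrable_halfline_shift_powr_exp q k) auto
    show "(\<lambda>r. kern (q - 1) 1 0 (contour (L n) r) * cis \<omega>) \<in> borel_measurable halfline" for n
      using integrable_kern[OF L(1) zero_less_one order_refl] by (intro borel_measurable_times) auto
    show "(\<lambda>r. kern (q - 1) 1 0 (contour 0 r) * cis \<omega>) \<in> borel_measurable halfline"
    proof (intro borel_measurable_halflineI continuous_intros continuous_on_compose2[OF continuous_on_kern])
      show "continuous_on {0<..} (contour 0)" unfolding contour_def by (intro continuous_intros)
      show "contour 0 ` {0<..} \<subseteq> - \<real>\<^sub>\<le>\<^sub>0" using c0 by auto
    qed
    show "AE r in halfline. (\<lambda>n. kern (q - 1) 1 0 (contour (L n) r) * cis \<omega>) \<longlonglongrightarrow> kern (q - 1) 1 0 (contour 0 r) * cis \<omega>"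
    proof (rule AE_I2)
      fix r assume "r \<in> space halfline"
      then have r: "r > 0" by simp
      have "isCont (kern (q - 1) 1 0) (contour 0 r)"
        using kern_has_field_derivative[OF c0[OF r]] by (rule DERIV_isCont)
      moreover have "(\<lambda>n. contour (L n) r) \<longlonglongrightarrow> contour 0 r"
        unfolding contour_def by (intro tendsto_intros tendsto_of_real L0)
      ultimately show "(\<lambda>n. kern (q - 1) 1 0 (contour (L n) r) * cis \<omega>) \<longlonglongrightarrow> kern (q - 1) 1 0 (contour 0 r) * cis \<omega>"
        by (intro tendsto_intros isCont_tendsto_compose[of _ "kern (q - 1) 1 0"])
    qed
    show "AE r in halfline. norm (kern (q - 1) 1 0 (contour (L n) r) * cis \<omega>) \<le> w r" for n
    proof (rule AE_I2)
      fix r assume "r \<in> space halfline"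
      then have r: "r > 0" by simp
      have p: "norm (contour (L n) r) powr (q - 1) \<le> sin \<omega> powr (q - 1) * r powr (q - 1) + (1 + r) powr \<bar>q - 1\<bar>"
      proof (cases "q \<ge> 1")
        case True
        have "norm (contour (L n) r) powr (q - 1) \<le> (1 + r) powr (q - 1)"
          using True norm_contour_le[of "L n" r] L[of n] r by (intro powr_mono2) auto
        then show ?thesis using True by (simp add: add_increasing)
      next
        case False
        have "norm (contour (L n) r) powr (q - 1) \<le> (r * sin \<omega>) powr (q - 1)"
          using False norm_contour_ge(2)[of "L n" r] L[of n] r trig_omega(1) by (intro powr_mono2') auto
        also have "\<dots> = sin \<omega> powr (q - 1) * r powr (q - 1)" using r trig_omega(1) by (simp add: powr_mult)
        finally show ?thesis by (simp add: add_increasing2)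
      qed
      have "norm (kern (q - 1) 1 0 (contour (L n) r) * cis \<omega>) \<le> exp (1 * (L n + r * cos \<omega>)) * norm (contour (L n) r) powr (q - 1)"
        using norm_kern_le'[of "L n" r 0 "q - 1" 1] L[of n] r by (simp add: norm_mult)
      also have "\<dots> \<le> exp (1 + - k * r) * (sin \<omega> powr (q - 1) * r powr (q - 1) + (1 + r) powr \<bar>q - 1\<bar>)"
        using p L[of n] by (intro mult_mono) (auto simp: k_def)
      also have "\<dots> = w r" unfolding w_def exp_add by (simp only: algebra_simps)
      finally show "norm (kern (q - 1) 1 0 (contour (L n) r) * cis \<omega>) \<le> w r" .
    qed
  qed
  then have "(\<lambda>n. Im (J (L n)) / pi) \<longlonglongrightarrow> Im J0 / pi" by (intro tendsto_intros) auto
  moreover have "Im (J (L n)) / pi = wrightc l (q - 1) 1 0" for n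
    using wrightc_shift[OF L(1) l zero_less_one order_refl, of n "q - 1"] by (simp only: wrightc_def J_def)
  ultimately have lim: "wrightc l (q - 1) 1 0 = Im J0 / pi"
    using LIMSEQ_unique[OF tendsto_const] by simp
  have "J0 = (\<integral>r. cis (\<omega> * q) * (of_real (r powr (q - 1)) * exp (- (- cis \<omega>) * of_real r)) \<partial>halfline)"
    unfolding J0_def
  proof (intro Bochner_Integration.integral_cong refl)
    fix r assume "r \<in> space halfline"
    then have r: "r > 0" by simp
    have "Ln (of_real r * cis \<omega>) = of_real (ln r) + \<i> * of_real \<omega>"
      using r omega_bounds omega_pos Ln_times_of_real[OF r, of "cis \<omega>"] by (simp add: Ln_cis Ln_of_real)
    then have "(of_real r * cis \<omega>) powr (of_real (q - 1)) = exp (of_real ((q - 1) * ln r)) * cis (\<omega> * (q - 1))"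
      using r by (simp add: powr_def cis_conv_exp exp_add[symmetric] algebra_simps)
    also have "exp (complex_of_real ((q - 1) * ln r)) = of_real (r powr (q - 1))"
      unfolding exp_of_real using r by (simp add: powr_def)
    finally have "(of_real r * cis \<omega>) powr (of_real (q - 1)) * cis \<omega> = of_real (r powr (q - 1)) * cis (\<omega> * q)"
      by (simp add: cis_mult algebra_simps)
    then have "kern (q - 1) 1 0 (contour 0 r) * cis \<omega> = exp (of_real r * cis \<omega>) * (of_real (r powr (q - 1)) * cis (\<omega> * q))"
      by (simp add: kern_def contour_def mult.assoc)
    then show "kern (q - 1) 1 0 (contour 0 r) * cis \<omega> = cis (\<omega> * q) * (of_real (r powr (q - 1)) * exp (- (- cis \<omega>) * of_real r))"
      by (simp add: mult_ac)
  qed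
  also have "\<dots> = cis (\<omega> * q) * (of_real (Gamma q) * (- cis \<omega>) powr (- of_real q))"
    using Gamma_integral_halfline_complex[OF q, of "- cis \<omega>"] trig_omega(2) by simp
  also have "(- cis \<omega>) powr (- of_real q) = cis (- q * (\<omega> - pi))"
  proof -
    have "- cis \<omega> = cis (\<omega> - pi)" by (simp add: complex_eq_iff cos_diff sin_diff)
    then show ?thesis using omega_bounds omega_pos
      by (simp add: powr_def Ln_cis cis_conv_exp algebra_simps)
  qed
  also have "cis (\<omega> * q) * (of_real (Gamma q) * cis (- q * (\<omega> - pi))) = of_real (Gamma q) * cis (pi * q)"
    by (simp add: cis_mult algebra_simps)
  finally have J0: "Im J0 = Gamma q * sin (pi * q)" by simp
  have "rGamma (of_real q) * rGamma (1 - complex_of_real q) = of_real (rGamma q * rGamma (1 - q))"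
    using rGamma_complex_of_real[of q] rGamma_complex_of_real[of "1 - q"] by simp
  moreover have "sin (of_real pi * of_real q) / of_real pi = complex_of_real (sin (pi * q) / pi)"
    using sin_of_real[of "pi * q", where 'a = complex] by simp
  ultimately have "complex_of_real (rGamma q * rGamma (1 - q)) = of_real (sin (pi * q) / pi)"
    using rGamma_reflection_complex[of "of_real q"] by simp
  then have "rGamma q * rGamma (1 - q) = sin (pi * q) / pi" by (simp only: of_real_eq_iff)
  then have "Gamma q * (rGamma q * rGamma (1 - q)) = Gamma q * (sin (pi * q) / pi)" by simp
  moreover have "Gamma q * rGamma q = 1" using Gamma_real_pos[OF q] by (simp add: rGamma_inverse_Gamma)
  ultimately show ?thesis by (simp add: lim J0 mult.assoc[symmetric])
qed

text \<open>
  As \<open>\<alpha> < 1\<close>, the growth of \<open>exp (z * |p| powr \<alpha>)\<close> is beaten by the linear decay of \<open>exp p\<close> along the contour.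
  This makes the termwise integration of the exponential series legitimate.
\<close>

lemma powr_alpha_le_linear:
  assumes z: "z \<ge> 0" and e: "e > 0"
  shows "\<exists>C. \<forall>y\<ge>0. z * y powr \<alpha> \<le> e * y + C"
proof -
  define Y where "Y = (z / e) powr (1 / (1 - \<alpha>))"
  have "z * y powr \<alpha> \<le> e * y + z * Y powr \<alpha>" if y: "y \<ge> 0" for y
  proof (cases "y \<le> Y")
    case True
    then have "z * y powr \<alpha> \<le> z * Y powr \<alpha>"
      using y z alpha_pos by (intro mult_left_mono powr_mono2) auto
    then show ?thesis using e y by (simp add: add_increasing)
  next
    case False
    then have y0: "y > 0" using powr_ge_zero[of "z / e" "1 / (1 - \<alpha>)"] unfolding Y_def by linarith
    have "z / e = Y powr (1 - \<alpha>)"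
      using z e alpha_less by (cases "z = 0") (auto simp: Y_def powr_powr)
    also have "\<dots> \<le> y powr (1 - \<alpha>)"
      using False alpha_less by (intro powr_mono2) (auto simp: Y_def)
    finally have "z \<le> e * y powr (1 - \<alpha>)" using e by (simp add: field_simps)
    then have "z * y powr \<alpha> \<le> (e * y powr (1 - \<alpha>)) * y powr \<alpha>" by (intro mult_right_mono) auto
    also have "\<dots> = e * y" using y0 by (simp add: mult.assoc powr_add[symmetric])
    also have "e * y \<le> e * y + z * Y powr \<alpha>" using z by simp
    finally show ?thesis .
  qed
  then show ?thesis by blast
qed

text \<open>
  The factor \<open>exp (- z * p powr \<alpha>)\<close> of the kernel is expanded into its series; the \<open>j\<close>-th term is a Hankel integral with
  \<open>q = \<alpha> * (j + 1)\<close> and produces the reciprocal Gamma value in the definition of \<open>Phi\<close>.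
\<close>

lemma Phi_eq_wright:
  assumes z: "z \<ge> 0"
  shows "Phi \<alpha> z = wright (\<alpha> - 1) 1 z"
proof -
  define k where "k = - cos \<omega>"
  have k: "k > 0" using trig_omega(2) by (simp add: k_def)
  obtain C where C: "\<And>y. y \<ge> 0 \<Longrightarrow> z * y powr \<alpha> \<le> (k/2) * y + C"
    using powr_alpha_le_linear[OF z, of "k/2"] k by auto
  define T where "T j r = kern (\<alpha> * (real j + 1) - 1) 1 0 (contour 1 r) * cis \<omega>" for j r
  define c where "c j = (- z) ^ j / fact j" for j
  define g where "g r = (exp 1 * exp (k/2 + C)) *
      (sin \<omega> powr (- \<bar>\<alpha> - 1\<bar>) * exp (- (k/2) * r) + (1 + r) powr \<bar>\<alpha> - 1\<bar> * exp (- (k/2) * r))" for r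
  have Tint: "integrable halfline (T j)" for j
    unfolding T_def by (intro integrable_mult_left integrable_kern) auto
  have summand: "of_real (c j) * T j r = (exp (contour 1 r) * contour 1 r powr of_real (\<alpha> - 1) * cis \<omega>) *
      ((- of_real z * contour 1 r powr of_real \<alpha>) ^ j / fact j)" if r: "r \<ge> 0" for j r
  proof -
    have p0: "contour 1 r \<noteq> 0" using contour_nonzero[of 1 r] r by simp
    have "contour 1 r powr of_real (\<alpha> * (real j + 1) - 1) = contour 1 r powr (of_real (\<alpha> - 1) + of_nat j * of_real \<alpha>)"
      by (simp add: algebra_simps)
    also have "\<dots> = contour 1 r powr of_real (\<alpha> - 1) * contour 1 r powr (of_nat j * of_real \<alpha>)"
      by (rule powr_add)
    also have "contour 1 r powr (of_nat j * of_real \<alpha>) = (contour 1 r powr of_real \<alpha>) ^ j"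
      using p0 by (simp add: powr_def exp_of_nat_mult[symmetric] mult_ac)
    finally show ?thesis
      using power_minus[of "of_real z * contour 1 r powr of_real \<alpha>" j] power_minus[of "complex_of_real z" j]
      by (simp add: T_def kern_def c_def power_mult_distrib mult_ac)
  qed
  have "(\<lambda>n. \<integral>r. (\<Sum>j<n. of_real (c j) * T j r) \<partial>halfline) \<longlonglongrightarrow> (\<integral>r. kern (\<alpha> - 1) 1 z (contour 1 r) * cis \<omega> \<partial>halfline)"
  proof (rule integral_dominated_convergence[where w = g])
    show "integrable halfline g"
      unfolding g_def using k
      by (intro integrable_mult_right Bochner_Integration.integrable_add integrable_halfline_exp integrable_halfline_shift_powr_exp) auto
    show "(\<lambda>r. kern (\<alpha> - 1) 1 z (contour 1 r) * cis \<omega>) \<in> borel_measurable halfline"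
      using integrable_kern[of 1 1 z "\<alpha> - 1"] z by (intro borel_measurable_times) auto
    show "(\<lambda>r. \<Sum>j<n. of_real (c j) * T j r) \<in> borel_measurable halfline" for n
      using Tint by (intro borel_measurable_sum borel_measurable_times) auto
    show "AE r in halfline. (\<lambda>n. \<Sum>j<n. of_real (c j) * T j r) \<longlonglongrightarrow> kern (\<alpha> - 1) 1 z (contour 1 r) * cis \<omega>"
    proof (rule AE_I2)
      fix r assume "r \<in> space halfline"
      then have r: "r \<ge> 0" by simp
      define x where "x = - of_real z * contour 1 r powr of_real \<alpha>"
      define a where "a = exp (contour 1 r) * contour 1 r powr of_real (\<alpha> - 1) * cis \<omega>"
      have "(\<lambda>j. x ^ j / fact j) sums exp x"
        using exp_converges[of x] by (simp add: scaleR_conv_of_real divide_inverse mult.commute)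
      then have "(\<lambda>j. a * (x ^ j / fact j)) sums (a * exp x)" by (rule sums_mult)
      then have "(\<lambda>j. of_real (c j) * T j r) sums (a * exp x)"
        by (simp only: summand[OF r] x_def a_def)
      moreover have "a * exp x = kern (\<alpha> - 1) 1 z (contour 1 r) * cis \<omega>"
        by (simp add: a_def x_def kern_def)
      ultimately show "(\<lambda>n. \<Sum>j<n. of_real (c j) * T j r) \<longlonglongrightarrow> kern (\<alpha> - 1) 1 z (contour 1 r) * cis \<omega>"
        by (simp add: sums_def)
    qed
    show "AE r in halfline. norm (\<Sum>j<n. of_real (c j) * T j r) \<le> g r" for n
    proof (rule AE_I2)
      fix r assume "r \<in> space halfline"
      then have r: "r \<ge> 0" by simp
      define x where "x = - of_real z * contour 1 r powr of_real \<alpha>"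
      define a where "a = exp (contour 1 r) * contour 1 r powr of_real (\<alpha> - 1) * cis \<omega>"
      have nx: "norm x = z * norm (contour 1 r) powr \<alpha>"
        using z by (simp add: x_def norm_mult norm_powr_real_powr')
      have na: "norm a = exp (1 + r * cos \<omega>) * norm (contour 1 r) powr (\<alpha> - 1)"
        by (simp add: a_def norm_mult norm_powr_real_powr')
      have "(\<Sum>j<n. of_real (c j) * T j r) = a * (\<Sum>j<n. x ^ j / fact j)"
        by (simp only: summand[OF r] x_def a_def sum_distrib_left)
      then have "norm (\<Sum>j<n. of_real (c j) * T j r) = norm a * norm (\<Sum>j<n. x ^ j / fact j)"
        by (simp add: norm_mult)
      also have "norm (\<Sum>j<n. x ^ j / fact j) \<le> (\<Sum>j<n. norm (x ^ j / fact j))" by (rule norm_sum)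
      also have "\<dots> = (\<Sum>j<n. norm x ^ j /\<^sub>R fact j)"
        by (simp add: norm_mult norm_inverse norm_power divide_inverse mult.commute)
      also have "\<dots> \<le> exp (norm x)"
        unfolding exp_def by (intro sum_le_suminf summable_exp_generic) auto
      also have "exp (norm x) \<le> exp ((k/2) * (1 + r) + C)"
      proof -
        have "norm x \<le> z * (1 + r) powr \<alpha>"
          unfolding nx using z alpha_pos norm_contour_le[of 1 r] r by (intro mult_left_mono powr_mono2) auto
        also have "\<dots> \<le> (k/2) * (1 + r) + C" using C[of "1 + r"] r by simp
        finally show ?thesis by simp
      qed
      finally have "norm (\<Sum>j<n. of_real (c j) * T j r) \<le> norm a * exp ((k/2) * (1 + r) + C)"
        by (simp add: mult_left_mono)
      also have "\<dots> \<le> (exp (1 + r * cos \<omega>) * (sin \<omega> powr (- \<bar>\<alpha> - 1\<bar>) + (1 + r) powr \<bar>\<alpha> - 1\<bar>)) * exp ((k/2) * (1 + r) + C)"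
        unfolding na using norm_contour_powr_le[of 1 1 1 r "\<alpha> - 1"] r
        by (intro mult_right_mono mult_left_mono) auto
      also have "\<dots> = (exp (1 + r * cos \<omega>) * exp ((k/2) * (1 + r) + C)) * (sin \<omega> powr (- \<bar>\<alpha> - 1\<bar>) + (1 + r) powr \<bar>\<alpha> - 1\<bar>)"
        by (simp only: mult_ac)
      also have "exp (1 + r * cos \<omega>) * exp ((k/2) * (1 + r) + C) = (exp 1 * exp (k/2 + C)) * exp (- (k/2) * r)"
        unfolding mult_exp_exp by (simp add: k_def algebra_simps add_divide_distrib)
      also have "(exp 1 * exp (k/2 + C)) * exp (- (k/2) * r) * (sin \<omega> powr (- \<bar>\<alpha> - 1\<bar>) + (1 + r) powr \<bar>\<alpha> - 1\<bar>) = g r"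
        unfolding g_def by (simp only: distrib_left mult_ac)
      finally show "norm (\<Sum>j<n. of_real (c j) * T j r) \<le> g r" .
    qed
  qed
  moreover have "(\<integral>r. (\<Sum>j<n. of_real (c j) * T j r) \<partial>halfline) = (\<Sum>j<n. of_real (c j) * (\<integral>r. T j r \<partial>halfline))" for n
    by (subst Bochner_Integration.integral_sum) (auto intro!: integrable_mult_right Tint)
  ultimately have "(\<lambda>n. Im (\<Sum>j<n. of_real (c j) * (\<integral>r. T j r \<partial>halfline)) / pi) \<longlonglongrightarrow> wright (\<alpha> - 1) 1 z"
    unfolding wright_def wrightc_def by (intro tendsto_intros) auto
  moreover have "Im (\<Sum>j<n. of_real (c j) * (\<integral>r. T j r \<partial>halfline)) / pi = (\<Sum>j<n. c j * rGamma (- \<alpha> * real j + 1 - \<alpha>))" for n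
  proof -
    have "Im (\<integral>r. T j r \<partial>halfline) / pi = rGamma (- \<alpha> * real j + 1 - \<alpha>)" for j
    proof -
      have "\<alpha> * (real j + 1) > 0" using alpha_pos by simp
      from wrightc_Hankel[OF this zero_less_one] show ?thesis
        by (simp add: wrightc_def T_def algebra_simps)
    qed
    then show ?thesis by (simp add: sum_divide_distrib times_divide_eq_right[symmetric] del: times_divide_eq_right)
  qed
  ultimately have "(\<lambda>j. c j * rGamma (- \<alpha> * real j + 1 - \<alpha>)) sums wright (\<alpha> - 1) 1 z"
    by (simp add: sums_def)
  then show ?thesis unfolding Phi_def c_def by (simp add: sums_iff)
qed

lemma phi_eq_wright: "t > 0 \<Longrightarrow> s \<ge> 0 \<Longrightarrow> phi \<alpha> t s = wright (\<alpha> - 1) t s"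
  by (simp add: phi_def Phi_eq_wright wright_scale[of t s])

end

section \<open>The fractional integral of the Wright function\<close>

lemma integrable_pair_mult:
  fixes g :: "'a \<Rightarrow> real" and h :: "'b \<Rightarrow> real"
  assumes "sigma_finite_measure M" "sigma_finite_measure N"
    and g: "integrable M g" and h: "integrable N h"
  shows "integrable (M \<Otimes>\<^sub>M N) (\<lambda>(x, y). g x * h y)"
proof -
  interpret pair_sigma_finite M N using assms(1,2) by (rule pair_sigma_finite.intro)
  have [measurable]: "g \<in> borel_measurable M" "h \<in> borel_measurable N" using g h by auto
  show ?thesis
  proof (rule Fubini_integrable)
    show "(\<lambda>(x, y). g x * h y) \<in> borel_measurable (M \<Otimes>\<^sub>M N)" by measurable
    have "(\<lambda>x. \<integral>y. norm (g x * h y) \<partial>N) = (\<lambda>x. \<bar>g x\<bar> * (\<integral>y. \<bar>h y\<bar> \<partial>N))"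
      by (simp add: abs_mult)
    then show "integrable M (\<lambda>x. \<integral>y. norm (case (x, y) of (x, y) \<Rightarrow> g x * h y) \<partial>N)"
      using g by simp
    show "AE x in M. integrable N (\<lambda>y. case (x, y) of (x, y) \<Rightarrow> g x * h y)"
      using h by simp
  qed
qed

lemma integrable_powr_left_of:
  assumes q: "q > (0::real)" and t: "t > 0"
  shows "integrable lborel (\<lambda>\<tau>. indicator {0<..<t} \<tau> * (t - \<tau>) powr (q - 1))"
proof -
  have 1: "integrable halfline (\<lambda>u. exp t * (u powr (q - 1) * exp (- 1 * u)))"
    by (intro integrable_mult_right integrable_halfline_Gamma q) simp
  have 2: "integrable lborel (\<lambda>u. indicator {0<..} u *\<^sub>R (exp t * (u powr (q - 1) * exp (- 1 * u))))"
    using 1 unfolding integrable_halfline set_integrable_def .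
  have "integrable lborel (\<lambda>u. indicator {0<..<t} u * u powr (q - 1))"
  proof (rule Bochner_Integration.integrable_bound[OF 2])
    show "(\<lambda>u. indicator {0<..<t} u * u powr (q - 1)) \<in> borel_measurable lborel" by measurable
    show "AE u in lborel. norm (indicator {0<..<t} u * u powr (q - 1)) \<le>
        norm (indicator {0<..} u *\<^sub>R (exp t * (u powr (q - 1) * exp (- 1 * u))))"
    proof (rule AE_I2)
      fix u :: real
      show "norm (indicator {0<..<t} u * u powr (q - 1)) \<le>
        norm (indicator {0<..} u *\<^sub>R (exp t * (u powr (q - 1) * exp (- 1 * u))))"
      proof (cases "u \<in> {0<..<t}")
        case True
        have "1 * u powr (q - 1) \<le> exp (t - u) * u powr (q - 1)"
          using True by (intro mult_right_mono) auto
        then show ?thesis using True by (simp add: exp_diff exp_minus field_simps)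
      qed simp
    qed
  qed
  then have "integrable lborel (\<lambda>u. indicator {0<..<t} (t + (-1) * u) * (t + (-1) * u) powr (q - 1))"
    by (rule lborel_integrable_real_affine) simp
  moreover have "indicator {0<..<t} (t + (-1) * u) = (indicator {0<..<t} u :: real)" for u
    by (auto simp: indicator_def)
  ultimately show ?thesis by simp
qed

context fractional_order begin

text \<open>
  Integrated over all \<open>\<tau> < t\<close>, this would be \<open>Gamma \<alpha> * p powr (- \<alpha>) * exp (t * p)\<close>, the multiplier of the
  fractional integral; the part \<open>\<tau> < 0\<close> is missing.
\<close>

definition laplace_cut :: "real \<Rightarrow> complex \<Rightarrow> complex" where
  "laplace_cut t p = (\<integral>\<tau>. of_real (indicator {0<..<t} \<tau> * (t - \<tau>) powr (\<alpha> - 1)) * exp (of_real \<tau> * p) \<partial>lborel)"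

lemma laplace_cut_approx_right:
  assumes t: "t > 0" and p: "Re p \<ge> 1"
  shows "norm (laplace_cut t p - of_real (Gamma \<alpha>) * p powr (- of_real \<alpha>) * exp (of_real t * p))
    \<le> t powr (\<alpha> - 1) * exp t * (\<integral>u. exp (- 1 * u) \<partial>halfline)"
proof -
  define F where "F u = complex_of_real (u powr (\<alpha> - 1)) * exp (- p * of_real u)" for u
  have Fi: "integrable halfline F"
  proof (rule Bochner_Integration.integrable_bound)
    show "integrable halfline (\<lambda>u. u powr (\<alpha> - 1) * exp (- 1 * u))"
      by (intro integrable_halfline_Gamma alpha_pos) simp
    show "F \<in> borel_measurable halfline" unfolding F_def by (rule borel_measurable_halfline) measurable
    show "AE u in halfline. norm (F u) \<le> norm (u powr (\<alpha> - 1) * exp (- 1 * u))"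
      using p by (intro AE_I2) (auto simp: F_def norm_mult intro!: mult_left_mono)
  qed
  have "laplace_cut t p = (\<integral>u. of_real (indicator {0<..<t} (t + (-1) * u) * (t - (t + (-1) * u)) powr (\<alpha> - 1)) * exp (of_real (t + (-1) * u) * p) \<partial>lborel)"
    unfolding laplace_cut_def
    by (subst lborel_integral_real_affine[where c = "-1" and t = t]) auto
  also have "\<dots> = (\<integral>u. indicator {0<..} u *\<^sub>R (indicator {..<t} u *\<^sub>R (exp (of_real t * p) * F u)) \<partial>lborel)"
    by (intro Bochner_Integration.integral_cong refl)
       (auto simp: indicator_def F_def exp_diff[symmetric] exp_add[symmetric] algebra_simps)
  also have "\<dots> = (\<integral>u. indicator {..<t} u *\<^sub>R (exp (of_real t * p) * F u) \<partial>halfline)"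
    by (simp add: integral_halfline set_lebesgue_integral_def)
  finally have 1: "laplace_cut t p = (\<integral>u. indicator {..<t} u *\<^sub>R (exp (of_real t * p) * F u) \<partial>halfline)" .
  have 2: "of_real (Gamma \<alpha>) * p powr (- of_real \<alpha>) * exp (of_real t * p) = (\<integral>u. exp (of_real t * p) * F u \<partial>halfline)"
    using Gamma_integral_halfline_complex[OF alpha_pos, of p] p by (simp add: F_def[abs_def])
  have i: "integrable halfline (\<lambda>u. exp (of_real t * p) * F u)" using Fi by simp
  have i': "integrable halfline (\<lambda>u. indicator {..<t} u *\<^sub>R (exp (of_real t * p) * F u))"
  proof (rule Bochner_Integration.integrable_bound[OF i])
    have [measurable]: "F \<in> borel_measurable halfline" using Fi by auto
    have [measurable]: "(\<lambda>u. indicator {..<t} u :: real) \<in> borel_measurable halfline"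
      by (intro borel_measurable_halfline) simp
    show "(\<lambda>u. indicator {..<t} u *\<^sub>R (exp (of_real t * p) * F u)) \<in> borel_measurable halfline"
      by measurable
    show "AE u in halfline. norm (indicator {..<t} u *\<^sub>R (exp (of_real t * p) * F u)) \<le> norm (exp (of_real t * p) * F u)"
      by (intro AE_I2) (auto simp: indicator_def)
  qed
  have "norm (laplace_cut t p - of_real (Gamma \<alpha>) * p powr (- of_real \<alpha>) * exp (of_real t * p)) =
      norm (\<integral>u. indicator {..<t} u *\<^sub>R (exp (of_real t * p) * F u) - exp (of_real t * p) * F u \<partial>halfline)"
    unfolding 1 2 by (subst Bochner_Integration.integral_diff[OF i' i]) simp
  also have "\<dots> \<le> (\<integral>u. t powr (\<alpha> - 1) * exp t * exp (- 1 * u) \<partial>halfline)"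
  proof (rule norm_integral_le)
    show "integrable halfline (\<lambda>u. t powr (\<alpha> - 1) * exp t * exp (- 1 * u))"
      by (intro integrable_mult_right integrable_halfline_exp) simp
    fix u assume "u \<in> space halfline"
    then have u: "u > 0" by simp
    show "norm (indicator {..<t} u *\<^sub>R (exp (of_real t * p) * F u) - exp (of_real t * p) * F u) \<le> t powr (\<alpha> - 1) * exp t * exp (- 1 * u)"
    proof (cases "u < t")
      case False
      have "norm (exp (of_real t * p) * F u) = u powr (\<alpha> - 1) * exp ((t - u) * Re p)"
        by (simp add: F_def norm_mult exp_add[symmetric] algebra_simps)
      also have "\<dots> \<le> t powr (\<alpha> - 1) * exp ((t - u) * 1)"
      proof (intro mult_mono)
        show "u powr (\<alpha> - 1) \<le> t powr (\<alpha> - 1)" using False t alpha_less by (intro powr_mono2') auto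
        have "(t - u) * Re p \<le> (t - u) * 1" using False p by (intro mult_left_mono_neg) auto
        then show "exp ((t - u) * Re p) \<le> exp ((t - u) * 1)" by simp
      qed auto
      also have "\<dots> = t powr (\<alpha> - 1) * exp t * exp (- 1 * u)" by (simp add: exp_diff exp_minus divide_inverse)
      finally show ?thesis using False by simp
    qed (use u in simp)
  qed
  finally show ?thesis by simp
qed

text \<open>
  Where \<open>Re p \<ge> 1\<close> the missing part is estimated directly. Elsewhere on the contour \<open>exp (\<tau> * p)\<close> is
  bounded for \<open>0 \<le> \<tau> \<le> t\<close> and \<open>p\<close> stays away from \<open>0\<close>, so both quantities are bounded. What matters is that
  the bound is the same for all base points \<open>l \<ge> 1\<close>.
\<close>

lemma laplace_cut_approx:
  assumes t: "t > 0"
  shows "\<exists>B\<ge>0. \<forall>l\<ge>1. \<forall>r\<ge>0. norm (laplace_cut t (contour l r) -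
    of_real (Gamma \<alpha>) * contour l r powr (- of_real \<alpha>) * exp (of_real t * contour l r)) \<le> B"
proof -
  define I where "I = (\<integral>\<tau>. indicator {0<..<t} \<tau> * (t - \<tau>) powr (\<alpha> - 1) \<partial>lborel)"
  have Ii: "integrable lborel (\<lambda>\<tau>. indicator {0<..<t} \<tau> * (t - \<tau>) powr (\<alpha> - 1))"
    by (rule integrable_powr_left_of[OF alpha_pos t])
  have I: "I \<ge> 0" unfolding I_def by (intro integral_nonneg_AE AE_I2) auto
  define B1 where "B1 = t powr (\<alpha> - 1) * exp t * (\<integral>u. exp (- 1 * u) \<partial>halfline)"
  have B1: "B1 \<ge> 0" unfolding B1_def by (intro mult_nonneg_nonneg integral_nonneg_AE AE_I2) auto
  define B2 where "B2 = I * exp t + Gamma \<alpha> * sin \<omega> powr (- \<alpha>) * exp t"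
  have G: "Gamma \<alpha> > 0" using alpha_pos by (rule Gamma_real_pos)
  have B2: "B2 \<ge> 0" using I G by (simp add: B2_def)
  have "norm (laplace_cut t (contour l r) -
    of_real (Gamma \<alpha>) * contour l r powr (- of_real \<alpha>) * exp (of_real t * contour l r)) \<le> B1 + B2"
    if l: "l \<ge> 1" and r: "r \<ge> 0" for l r
  proof (cases "Re (contour l r) \<ge> 1")
    case True
    then show ?thesis using laplace_cut_approx_right[OF t True] B2 unfolding B1_def by linarith
  next
    case False
    define p where "p = contour l r"
    have p: "Re p \<le> 1" using False by (simp add: p_def)
    have e: "exp (\<tau> * Re p) \<le> exp t" if "0 \<le> \<tau>" "\<tau> \<le> t" for \<tau>
      using mult_left_mono[OF p that(1)] that by simp
    have "norm (laplace_cut t p) \<le> (\<integral>\<tau>. (indicator {0<..<t} \<tau> * (t - \<tau>) powr (\<alpha> - 1)) * exp t \<partial>lborel)"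
      unfolding laplace_cut_def
    proof (rule norm_integral_le)
      show "integrable lborel (\<lambda>\<tau>. (indicator {0<..<t} \<tau> * (t - \<tau>) powr (\<alpha> - 1)) * exp t)"
        by (intro integrable_mult_left Ii)
      show "norm (of_real (indicator {0<..<t} \<tau> * (t - \<tau>) powr (\<alpha> - 1)) * exp (of_real \<tau> * p)) \<le>
          (indicator {0<..<t} \<tau> * (t - \<tau>) powr (\<alpha> - 1)) * exp t" for \<tau>
        using e[of \<tau>] by (cases "\<tau> \<in> {0<..<t}") (auto simp: norm_mult intro!: mult_left_mono)
    qed
    also have "\<dots> = I * exp t" unfolding I_def by (rule integral_mult_left_zero)
    finally have 1: "norm (laplace_cut t p) \<le> I * exp t" .
    have "l * sin \<omega> \<le> norm p" using norm_contour_ge(1)[of l r] l r by (simp add: p_def)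
    moreover have "1 * sin \<omega> \<le> l * sin \<omega>" using l trig_omega(1) by (intro mult_right_mono) auto
    ultimately have "sin \<omega> \<le> norm p" by linarith
    then have "norm p powr (- \<alpha>) \<le> sin \<omega> powr (- \<alpha>)"
      using trig_omega(1) alpha_pos by (intro powr_mono2') auto
    then have "Gamma \<alpha> * norm p powr (- \<alpha>) * exp (t * Re p) \<le> Gamma \<alpha> * sin \<omega> powr (- \<alpha>) * exp t"
      using e[of t] t G by (intro mult_mono mult_left_mono) auto
    moreover have "norm (of_real (Gamma \<alpha>) * p powr (- of_real \<alpha>) * exp (of_real t * p)) = Gamma \<alpha> * norm p powr (- \<alpha>) * exp (t * Re p)"
      using G norm_powr_real_powr'[of "- of_real \<alpha>" p] by (simp add: norm_mult)
    ultimately have 2: "norm (of_real (Gamma \<alpha>) * p powr (- of_real \<alpha>) * exp (of_real t * p)) \<le> Gamma \<alpha> * sin \<omega> powr (- \<alpha>) * exp t"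
      by simp
    show ?thesis
      using norm_triangle_ineq4[of "laplace_cut t p" "of_real (Gamma \<alpha>) * p powr (- of_real \<alpha>) * exp (of_real t * p)"] 1 2 B1
      unfolding p_def[symmetric] B2_def by linarith
  qed
  then show ?thesis using B1 B2 by (intro exI[of _ "B1 + B2"]) auto
qed

text \<open>
  After exchanging the integrals, the left side is a contour integral with \<open>laplace_cut\<close> in place of the
  exact multiplier. By \<open>laplace_cut_approx\<close> the error is at most a constant times the integral of
  \<open>|p powr (\<alpha> - 1) * exp (- s * p powr \<alpha>)|\<close>, which is \<open>O(l powr (\<alpha> - 1))\<close> because \<open>|p| \<ge> l * sin \<omega>\<close>. Neither side of the
  identity depends on \<open>l\<close>, so the error vanishes as \<open>l\<close> tends to infinity.
\<close>

lemma fractional_integral_wright: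
  assumes t: "t > 0" and s: "s > 0"
  shows "(\<integral>\<tau>. indicator {0<..<t} \<tau> * (t - \<tau>) powr (\<alpha> - 1) * wright (\<alpha> - 1) \<tau> s \<partial>lborel) = Gamma \<alpha> * wright (- 1) t s"
proof -
  obtain B where B: "B \<ge> 0" "\<And>l r. l \<ge> 1 \<Longrightarrow> r \<ge> 0 \<Longrightarrow> norm (laplace_cut t (contour l r) -
    of_real (Gamma \<alpha>) * contour l r powr (- of_real \<alpha>) * exp (of_real t * contour l r)) \<le> B"
    using laplace_cut_approx[OF t] by blast
  define g where "g \<tau> = indicator {0<..<t} \<tau> * (t - \<tau>) powr (\<alpha> - 1)" for \<tau>
  have gi: "integrable lborel g" unfolding g_def by (rule integrable_powr_left_of[OF alpha_pos t])
  define X where "X = (\<integral>\<tau>. g \<tau> * wright (\<alpha> - 1) \<tau> s \<partial>lborel)"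
  define k where "k = s * (cos (\<alpha> * \<omega>) * sin \<omega> powr \<alpha>)"
  have k: "k > 0" using s trig_omega by (simp add: k_def)
  define D where "D = B * sin \<omega> powr (\<alpha> - 1) * (\<integral>r. exp (- k * r powr \<alpha>) \<partial>halfline) / pi"
  have ei: "integrable halfline (\<lambda>r. exp (- k * r powr \<alpha>))" by (rule integrable_halfline_exp_powr[OF k alpha_pos])
  have hb: "norm (kern (\<alpha> - 1) 0 s (contour l r)) \<le> (l * sin \<omega>) powr (\<alpha> - 1) * exp (- k * r powr \<alpha>)"
    if l: "l > 0" and r: "r \<ge> 0" for l r
  proof -
    note ge = norm_contour_ge[OF l r]
    have n: "norm (contour l r) powr (\<alpha> - 1) \<le> (l * sin \<omega>) powr (\<alpha> - 1)"
      using ge(1) alpha_less l trig_omega(1) by (intro powr_mono2') auto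
    have "(r * sin \<omega>) powr \<alpha> \<le> norm (contour l r) powr \<alpha>"
      using ge(2) alpha_pos r trig_omega(1) by (intro powr_mono2) auto
    then have "- s * (cos (\<alpha> * \<omega>) * norm (contour l r) powr \<alpha>) \<le> - s * (cos (\<alpha> * \<omega>) * (r * sin \<omega>) powr \<alpha>)"
      using s trig_omega(3) by (intro mult_left_mono_neg mult_left_mono) auto
    moreover have "- s * (cos (\<alpha> * \<omega>) * (r * sin \<omega>) powr \<alpha>) = - k * r powr \<alpha>"
      using r trig_omega(1) by (simp add: k_def powr_mult)
    ultimately have "exp (- s * (cos (\<alpha> * \<omega>) * norm (contour l r) powr \<alpha>)) \<le> exp (- k * r powr \<alpha>)"
      by simp
    then have "norm (contour l r) powr (\<alpha> - 1) * exp (- s * (cos (\<alpha> * \<omega>) * norm (contour l r) powr \<alpha>)) \<le>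
        (l * sin \<omega>) powr (\<alpha> - 1) * exp (- k * r powr \<alpha>)"
      using n by (intro mult_mono) auto
    moreover have "norm (kern (\<alpha> - 1) 0 s (contour l r)) \<le>
        norm (contour l r) powr (\<alpha> - 1) * exp (- s * (cos (\<alpha> * \<omega>) * norm (contour l r) powr \<alpha>))"
      using norm_kern_le[OF l r, of s "\<alpha> - 1" 0] s by simp
    ultimately show ?thesis by linarith
  qed
  have key: "\<bar>X - Gamma \<alpha> * wright (- 1) t s\<bar> \<le> D * l powr (\<alpha> - 1)" if l: "l \<ge> 1" for l
  proof -
    have lp: "l > 0" using l by simp
    define f where "f \<tau> r = of_real (g \<tau>) * (kern (\<alpha> - 1) \<tau> s (contour l r) * cis \<omega>)" for \<tau> r
    have ksplit: "kern \<gamma> \<tau> s p = exp (of_real \<tau> * p) * kern \<gamma> 0 s p" for \<gamma> \<tau> p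
      by (simp add: kern_def)
    have fs: "f \<tau> r = of_real (g \<tau>) * (exp (of_real \<tau> * contour l r) * kern (\<alpha> - 1) 0 s (contour l r) * cis \<omega>)" for \<tau> r
      unfolding f_def by (subst ksplit) (rule refl)
    interpret P: pair_sigma_finite "lborel :: real measure" halfline
      by (intro pair_sigma_finite.intro sigma_finite_lborel sigma_finite_halfline)
    have fi: "integrable (lborel \<Otimes>\<^sub>M halfline) (\<lambda>(\<tau>, r). f \<tau> r)"
    proof (rule Bochner_Integration.integrable_bound)
      show "integrable (lborel \<Otimes>\<^sub>M halfline) (\<lambda>(\<tau>, r). g \<tau> * (exp (t * l) * ((l * sin \<omega>) powr (\<alpha> - 1) * exp (- k * r powr \<alpha>))))"
        by (intro integrable_pair_mult sigma_finite_lborel sigma_finite_halfline gi integrable_mult_right ei)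
      have [measurable]: "g \<in> borel_measurable lborel" using gi by auto
      have [measurable]: "contour l \<in> borel_measurable halfline"
        unfolding contour_def[abs_def] by (rule borel_measurable_halfline) measurable
      have [measurable]: "(\<lambda>r. kern (\<alpha> - 1) 0 s (contour l r)) \<in> borel_measurable halfline"
        using continuous_on_kern_contour[OF lp] by (intro borel_measurable_halflineI) (rule continuous_on_subset, auto)
      show "(\<lambda>(\<tau>, r). f \<tau> r) \<in> borel_measurable (lborel \<Otimes>\<^sub>M halfline)"
        unfolding fs by measurable
      show "AE x in (lborel :: real measure) \<Otimes>\<^sub>M halfline. norm (case x of (\<tau>, r) \<Rightarrow> f \<tau> r) \<le>
          norm (case x of (\<tau>, r) \<Rightarrow> g \<tau> * (exp (t * l) * ((l * sin \<omega>) powr (\<alpha> - 1) * exp (- k * r powr \<alpha>))))"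
      proof (rule AE_I2)
        fix x assume "x \<in> space ((lborel :: real measure) \<Otimes>\<^sub>M halfline)"
        then obtain \<tau> r where x: "x = (\<tau>, r)" and r: "r > 0" by (auto simp: space_pair_measure)
        have "norm (f \<tau> r) \<le> g \<tau> * (exp (t * l) * ((l * sin \<omega>) powr (\<alpha> - 1) * exp (- k * r powr \<alpha>)))"
        proof (cases "\<tau> \<in> {0<..<t}")
          case True
          have "\<tau> * (l + r * cos \<omega>) \<le> \<tau> * l" using True r trig_omega(2) by (intro mult_left_mono) (auto simp: mult_nonneg_nonpos)
          also have "\<dots> \<le> t * l" using True lp by (intro mult_right_mono) auto
          finally have "exp (\<tau> * (l + r * cos \<omega>)) \<le> exp (t * l)" by simp
          then have "norm (exp (of_real \<tau> * contour l r)) * norm (kern (\<alpha> - 1) 0 s (contour l r)) \<le>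
              exp (t * l) * ((l * sin \<omega>) powr (\<alpha> - 1) * exp (- k * r powr \<alpha>))"
            using hb[OF lp, of r] r by (intro mult_mono) auto
          moreover have "g \<tau> \<ge> 0" by (simp add: g_def)
          ultimately have "g \<tau> * (norm (exp (of_real \<tau> * contour l r)) * norm (kern (\<alpha> - 1) 0 s (contour l r))) \<le>
              g \<tau> * (exp (t * l) * ((l * sin \<omega>) powr (\<alpha> - 1) * exp (- k * r powr \<alpha>)))"
            by (rule mult_left_mono)
          then show ?thesis
            unfolding fs norm_mult norm_of_real norm_cis abs_of_nonneg[OF \<open>g \<tau> \<ge> 0\<close>] mult_1_right .
        next
          case False
          then show ?thesis by (simp add: f_def g_def)
        qed
        then show "norm (case x of (\<tau>, r) \<Rightarrow> f \<tau> r) \<le>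
          norm (case x of (\<tau>, r) \<Rightarrow> g \<tau> * (exp (t * l) * ((l * sin \<omega>) powr (\<alpha> - 1) * exp (- k * r powr \<alpha>))))"
          unfolding x by (simp add: order_trans[OF _ abs_ge_self])
      qed
    qed
    have "g \<tau> * wright (\<alpha> - 1) \<tau> s = Im (\<integral>r. f \<tau> r \<partial>halfline) / pi" for \<tau>
    proof (cases "\<tau> \<in> {0<..<t}")
      case True
      define J where "J = (\<integral>r. kern (\<alpha> - 1) \<tau> s (contour l r) * cis \<omega> \<partial>halfline)"
      have "wright (\<alpha> - 1) \<tau> s = Im J / pi"
        using wrightc_shift[of 1 l \<tau> s "\<alpha> - 1"] True lp s by (simp only: wright_def wrightc_def J_def) simp
      moreover have "(\<integral>r. f \<tau> r \<partial>halfline) = of_real (g \<tau>) * J"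
        unfolding f_def J_def by (rule integral_mult_right_zero)
      ultimately show ?thesis by simp
    next
      case False
      then show ?thesis by (simp add: f_def g_def)
    qed
    then have "X = (\<integral>\<tau>. Im (\<integral>r. f \<tau> r \<partial>halfline) \<partial>lborel) / pi"
      unfolding X_def by simp
    also have "(\<integral>\<tau>. Im (\<integral>r. f \<tau> r \<partial>halfline) \<partial>lborel) = Im (\<integral>\<tau>. (\<integral>r. f \<tau> r \<partial>halfline) \<partial>lborel)"
      using P.integrable_fst'[OF fi] by (intro integral_Im) simp
    also have "(\<integral>\<tau>. (\<integral>r. f \<tau> r \<partial>halfline) \<partial>lborel) = (\<integral>r. (\<integral>\<tau>. f \<tau> r \<partial>lborel) \<partial>halfline)"
      using P.Fubini_integral[OF fi] by simp
    also have "(\<integral>r. (\<integral>\<tau>. f \<tau> r \<partial>lborel) \<partial>halfline) = (\<integral>r. laplace_cut t (contour l r) * (kern (\<alpha> - 1) 0 s (contour l r) * cis \<omega>) \<partial>halfline)"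
    proof (intro Bochner_Integration.integral_cong refl)
      fix r
      have "f \<tau> r = (of_real (g \<tau>) * exp (of_real \<tau> * contour l r)) * (kern (\<alpha> - 1) 0 s (contour l r) * cis \<omega>)" for \<tau>
        unfolding fs by (simp only: mult.assoc)
      then show "(\<integral>\<tau>. f \<tau> r \<partial>lborel) = laplace_cut t (contour l r) * (kern (\<alpha> - 1) 0 s (contour l r) * cis \<omega>)"
        unfolding laplace_cut_def g_def[symmetric] by (simp only: integral_mult_left_zero)
    qed
    finally have X: "X = Im (\<integral>r. laplace_cut t (contour l r) * (kern (\<alpha> - 1) 0 s (contour l r) * cis \<omega>) \<partial>halfline) / pi" .
    have Xi: "integrable halfline (\<lambda>r. laplace_cut t (contour l r) * (kern (\<alpha> - 1) 0 s (contour l r) * cis \<omega>))"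
    proof -
      have "integrable halfline (\<lambda>r. \<integral>\<tau>. f \<tau> r \<partial>lborel)"
        using P.integrable_snd[of f] fi by simp
      moreover have "(\<integral>\<tau>. f \<tau> r \<partial>lborel) = laplace_cut t (contour l r) * (kern (\<alpha> - 1) 0 s (contour l r) * cis \<omega>)" for r
      proof -
        have "f \<tau> r = (of_real (g \<tau>) * exp (of_real \<tau> * contour l r)) * (kern (\<alpha> - 1) 0 s (contour l r) * cis \<omega>)" for \<tau>
          unfolding fs by (simp only: mult.assoc)
        then show ?thesis
          unfolding laplace_cut_def g_def[symmetric] by (simp only: integral_mult_left_zero)
      qed
      ultimately show ?thesis by simp
    qed
    have Wi: "integrable halfline (\<lambda>r. of_real (Gamma \<alpha>) * (kern (- 1) t s (contour l r) * cis \<omega>))"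
      using s by (intro integrable_mult_right integrable_mult_left integrable_kern lp t) simp
    have W: "Gamma \<alpha> * wright (- 1) t s = Im (\<integral>r. of_real (Gamma \<alpha>) * (kern (- 1) t s (contour l r) * cis \<omega>) \<partial>halfline) / pi"
      using wrightc_shift[of 1 l t s "- 1"] lp t s unfolding integral_mult_right_zero by (simp add: wright_def wrightc_def)
    define E where "E = (\<integral>r. laplace_cut t (contour l r) * (kern (\<alpha> - 1) 0 s (contour l r) * cis \<omega>) -
        of_real (Gamma \<alpha>) * (kern (- 1) t s (contour l r) * cis \<omega>) \<partial>halfline)"
    have XE: "X - Gamma \<alpha> * wright (- 1) t s = Im E / pi"
      unfolding X W E_def Bochner_Integration.integral_diff[OF Xi Wi] by (simp add: diff_divide_distrib)
    have "norm E \<le> (\<integral>r. B * (l * sin \<omega>) powr (\<alpha> - 1) * exp (- k * r powr \<alpha>) \<partial>halfline)"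
      unfolding E_def
    proof (rule norm_integral_le)
      show "integrable halfline (\<lambda>r. B * (l * sin \<omega>) powr (\<alpha> - 1) * exp (- k * r powr \<alpha>))"
        by (intro integrable_mult_right ei)
      fix r assume "r \<in> space halfline"
      then have r: "r \<ge> 0" by simp
      define p where "p = contour l r"
      have "p powr (- of_real \<alpha>) * p powr of_real (\<alpha> - 1) = p powr (of_real (- 1))"
        by (simp add: powr_add[symmetric])
      then have k1: "kern (- 1) t s p = p powr (- of_real \<alpha>) * exp (of_real t * p) * kern (\<alpha> - 1) 0 s p"
        by (simp add: kern_def mult_ac)
      have "laplace_cut t p * (kern (\<alpha> - 1) 0 s p * cis \<omega>) - of_real (Gamma \<alpha>) * (kern (- 1) t s p * cis \<omega>) =
        (laplace_cut t p - of_real (Gamma \<alpha>) * p powr (- of_real \<alpha>) * exp (of_real t * p)) * kern (\<alpha> - 1) 0 s p * cis \<omega>"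
        unfolding k1 by (simp add: algebra_simps)
      then have "norm (laplace_cut t p * (kern (\<alpha> - 1) 0 s p * cis \<omega>) - of_real (Gamma \<alpha>) * (kern (- 1) t s p * cis \<omega>)) =
        norm (laplace_cut t p - of_real (Gamma \<alpha>) * p powr (- of_real \<alpha>) * exp (of_real t * p)) * norm (kern (\<alpha> - 1) 0 s p)"
        by (simp only: norm_mult norm_cis mult_1_right)
      also have "\<dots> \<le> B * ((l * sin \<omega>) powr (\<alpha> - 1) * exp (- k * r powr \<alpha>))"
        using B hb[OF lp r] l r unfolding p_def by (intro mult_mono) auto
      finally show "norm (laplace_cut t (contour l r) * (kern (\<alpha> - 1) 0 s (contour l r) * cis \<omega>) -
        of_real (Gamma \<alpha>) * (kern (- 1) t s (contour l r) * cis \<omega>)) \<le> B * (l * sin \<omega>) powr (\<alpha> - 1) * exp (- k * r powr \<alpha>)"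
        by (simp add: p_def mult.assoc)
    qed
    also have "\<dots> = D * l powr (\<alpha> - 1) * pi"
      using lp trig_omega(1) by (simp add: D_def powr_mult)
    finally have "norm E \<le> D * l powr (\<alpha> - 1) * pi" .
    then have "\<bar>Im E\<bar> \<le> D * l powr (\<alpha> - 1) * pi" using abs_Im_le_cmod[of E] by linarith
    then show ?thesis unfolding XE by (simp add: divide_le_eq)
  qed
  have "((\<lambda>l. D * l powr (\<alpha> - 1)) \<longlongrightarrow> D * 0) at_top"
    using alpha_less by (intro tendsto_intros tendsto_neg_powr filterlim_ident) auto
  then have "\<bar>X - Gamma \<alpha> * wright (- 1) t s\<bar> \<le> D * 0"
    by (rule tendsto_lowerbound) (auto intro!: eventually_at_top_linorderI[of 1] key)
  then show ?thesis by (simp add: X_def g_def)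
qed

end

section \<open>The matrix exponential\<close>

abbreviation matpow :: "complex ^ 'N ^ 'N \<Rightarrow> nat \<Rightarrow> complex ^ 'N ^ ('N::finite)" where
  "matpow A k \<equiv> ((**) A ^^ k) (mat 1)"

lemma matpow_Suc_nth: "matpow A (Suc k) $ i $ j = (\<Sum>l\<in>UNIV. A $ i $ l * matpow A k $ l $ j)"
  by (simp add: matrix_matrix_mult_def)

lemma norm_matpow_nth_le:
  fixes A :: "complex ^ 'N ^ ('N::finite)"
  assumes "\<And>i j. norm (A $ i $ j) \<le> m"
  shows "norm (matpow A k $ i $ j) \<le> (real CARD('N) * m) ^ k"
proof (induction k arbitrary: i)
  case 0
  show ?case by (simp add: mat_def)
next
  case (Suc k)
  have m: "m \<ge> 0" using order_trans[OF norm_ge_zero assms] .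
  have "norm (matpow A (Suc k) $ i $ j) \<le> (\<Sum>l\<in>(UNIV::'N set). norm (A $ i $ l * matpow A k $ l $ j))"
    unfolding matpow_Suc_nth by (rule norm_sum)
  also have "\<dots> \<le> (\<Sum>l\<in>(UNIV::'N set). m * (real CARD('N) * m) ^ k)"
    unfolding norm_mult using m by (intro sum_mono mult_mono assms Suc.IH) auto
  also have "\<dots> = (real CARD('N) * m) ^ Suc k" by simp
  finally show ?case .
qed

lemma matrix_entries_bounded:
  fixes A :: "complex ^ 'N ^ ('N::finite)"
  shows "norm (A $ i $ j) \<le> norm A"
  by (rule order_trans[OF Finite_Cartesian_Product.norm_nth_le Finite_Cartesian_Product.norm_nth_le])

lemma summable_norm_matrix_exp:
  fixes A :: "complex ^ 'N ^ ('N::finite)"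
  shows "summable (\<lambda>k. norm (matpow A k $ i $ j / fact k))"
proof (rule summable_comparison_test'[where N = 0])
  show "summable (\<lambda>k. (real CARD('N) * norm A) ^ k / fact k)"
    using summable_exp_generic[of "real CARD('N) * norm A"] by (simp add: divide_inverse mult.commute)
  show "norm (norm (matpow A k $ i $ j / fact k)) \<le> (real CARD('N) * norm A) ^ k / fact k" for k
    using norm_matpow_nth_le[of A "norm A", OF matrix_entries_bounded] by (simp add: norm_divide divide_right_mono)
qed

lemma matrix_exp_sums:
  fixes A :: "complex ^ 'N ^ ('N::finite)"
  shows "(\<lambda>k. (1 / fact k) *\<^sub>R matpow A k) sums matrix_exp A"
proof -
  define S :: "complex ^ 'N ^ 'N" where "S = (\<chi> i j. \<Sum>k. matpow A k $ i $ j / fact k)"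
  have "(\<lambda>k. (1 / fact k) *\<^sub>R matpow A k) sums S"
    unfolding sums_def
  proof (intro vec_tendstoI)
    fix i j
    have "(\<lambda>k. matpow A k $ i $ j / fact k) sums (S $ i $ j)"
      unfolding S_def using summable_sums[OF summable_norm_cancel[OF summable_norm_matrix_exp[of A i j]]] by simp
    then show "(\<lambda>n. (\<Sum>k<n. (1 / fact k) *\<^sub>R matpow A k) $ i $ j) \<longlonglongrightarrow> S $ i $ j"
      by (simp add: sums_def scaleR_conv_of_real[where 'a = complex])
  qed
  then show ?thesis unfolding matrix_exp_def by (simp add: sums_iff)
qed

lemma matrix_exp_nth:
  fixes A :: "complex ^ 'N ^ ('N::finite)"
  shows "matrix_exp A $ i $ j = (\<Sum>k. matpow A k $ i $ j / fact k)"
proof -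
  have "(\<lambda>n. (\<Sum>k<n. (1 / fact k) *\<^sub>R matpow A k) $ i $ j) \<longlonglongrightarrow> matrix_exp A $ i $ j"
    using matrix_exp_sums[of A, unfolded sums_def] by (intro tendsto_vec_nth)
  then have "(\<lambda>k. matpow A k $ i $ j / fact k) sums matrix_exp A $ i $ j"
    by (simp add: sums_def scaleR_conv_of_real[where 'a = complex])
  then show ?thesis by (simp add: sums_iff)
qed

lemma holomorphic_on_matrix_exp:
  fixes A :: "complex \<Rightarrow> complex ^ 'N ^ ('N::finite)"
  assumes S: "open S" and A: "\<And>i j. (\<lambda>z. A z $ i $ j) holomorphic_on S"
  shows "(\<lambda>z. matrix_exp (A z) $ i $ j) holomorphic_on S"
proof (rule holomorphic_uniform_sequence[OF S])
  have pow: "(\<lambda>z. matpow (A z) k $ i $ j) holomorphic_on S" for k i j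
  proof (induction k arbitrary: i)
    case 0
    show ?case by (simp add: holomorphic_on_const)
  next
    case (Suc k)
    show ?case unfolding matpow_Suc_nth by (intro holomorphic_intros A Suc.IH)
  qed
  show "(\<lambda>z. \<Sum>k<n. matpow (A z) k $ i $ j / fact k) holomorphic_on S" for n
    by (intro holomorphic_intros pow) auto
  fix x assume "x \<in> S"
  then obtain d where d: "d > 0" "cball x d \<subseteq> S" using S open_contains_cball by blast
  have "\<exists>B. \<forall>z\<in>cball x d. norm (A z $ i $ j) \<le> B" for i j
  proof -
    have "continuous_on (cball x d) (\<lambda>z. A z $ i $ j)"
      using holomorphic_on_imp_continuous_on[OF A] continuous_on_subset d(2) by blast
    then have "compact ((\<lambda>z. A z $ i $ j) ` cball x d)" by (intro compact_continuous_image) auto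
    then have "bounded ((\<lambda>z. A z $ i $ j) ` cball x d)" by (rule compact_imp_bounded)
    then show ?thesis by (auto simp: bounded_iff)
  qed
  then obtain B where B: "\<And>i j z. z \<in> cball x d \<Longrightarrow> norm (A z $ i $ j) \<le> B i j" by metis
  define m where "m = (\<Sum>i\<in>UNIV. \<Sum>j\<in>UNIV. \<bar>B i j\<bar>)"
  have m: "norm (A z $ i $ j) \<le> m" if "z \<in> cball x d" for z i j
  proof -
    have "norm (A z $ i $ j) \<le> \<bar>B i j\<bar>" using B[OF that, of i j] by linarith
    also have "\<dots> \<le> (\<Sum>j\<in>UNIV. \<bar>B i j\<bar>)" by (rule member_le_sum) auto
    also have "\<dots> \<le> m" unfolding m_def by (rule member_le_sum[of i UNIV "\<lambda>i. \<Sum>j\<in>UNIV. \<bar>B i j\<bar>"]) (auto intro: sum_nonneg)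
    finally show ?thesis .
  qed
  have "uniform_limit (cball x d) (\<lambda>n z. \<Sum>k<n. matpow (A z) k $ i $ j / fact k) (\<lambda>z. \<Sum>k. matpow (A z) k $ i $ j / fact k) sequentially"
  proof (rule Weierstrass_m_test)
    show "summable (\<lambda>k. (real CARD('N) * m) ^ k / fact k)"
      using summable_exp_generic[of "real CARD('N) * m"] by (simp add: divide_inverse mult.commute)
    show "norm (matpow (A z) k $ i $ j / fact k) \<le> (real CARD('N) * m) ^ k / fact k" if "z \<in> cball x d" for k z
      using norm_matpow_nth_le[of "A z" m, OF m[OF that]] by (simp add: norm_divide divide_right_mono)
  qed
  then show "\<exists>d>0. cball x d \<subseteq> S \<and>
      uniform_limit (cball x d) (\<lambda>n z. \<Sum>k<n. matpow (A z) k $ i $ j / fact k) (\<lambda>z. matrix_exp (A z) $ i $ j) sequentially"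
    unfolding matrix_exp_nth using d by blast
qed

lemma borel_measurable_matrix_exp:
  fixes A :: "'a::euclidean_space \<Rightarrow> complex ^ 'N ^ ('N::finite)"
  assumes A: "continuous_on UNIV A"
  shows "(\<lambda>x. matrix_exp (A x)) \<in> borel_measurable borel"
proof (rule borel_measurable_LIMSEQ_metric)
  have pow: "continuous_on UNIV (\<lambda>x. matpow (A x) k)" for k
  proof (induction k)
    case 0
    show ?case by simp
  next
    case (Suc k)
    have 1: "continuous_on UNIV (\<lambda>x. A x $ i $ l)" for i l
      by (intro continuous_on_component A)
    have 2: "continuous_on UNIV (\<lambda>x. matpow (A x) k $ l $ j)" for l j
      by (intro continuous_on_component Suc.IH)
    have "(\<lambda>x. matpow (A x) (Suc k)) = (\<lambda>x. \<chi> i j. \<Sum>l\<in>UNIV. A x $ i $ l * matpow (A x) k $ l $ j)"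
      by (simp add: fun_eq_iff vec_eq_iff matpow_Suc_nth del: funpow.simps)
    then show ?case
      by (simp only:) (intro continuous_on_vec_lambda continuous_on_sum continuous_on_mult 1 2)
  qed
  show "(\<lambda>x. \<Sum>k<n. (1 / fact k) *\<^sub>R matpow (A x) k) \<in> borel_measurable borel" for n
    by (intro borel_measurable_continuous_onI continuous_intros pow)
  show "(\<lambda>n. \<Sum>k<n. (1 / fact k) *\<^sub>R matpow (A x) k) \<longlonglongrightarrow> matrix_exp (A x)" for x
    using matrix_exp_sums[of "A x"] by (simp add: sums_def)
qed

text \<open>
  The energy estimate for \<open>u' = A u\<close>: the \<open>j\<close>-th column \<open>u\<close> of \<open>exp (\<tau> A)\<close> satisfies
  \<open>(|u|\<^sup>2)' = 2 * Re \<langle>A u, u\<rangle> \<le> 2 * \<kappa> * |u|\<^sup>2\<close> and \<open>|u(0)| = 1\<close>. The solution is built from the power series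
  of the entries, so that only termwise differentiation is needed.
\<close>

lemma norm_matrix_exp_nth_le:
  fixes A :: "complex ^ 'N ^ ('N::finite)"
  assumes num_range: "\<And>z. Re (hermitian_inner (A *v z) z) \<le> \<kappa> * (norm z)\<^sup>2"
  shows "norm (matrix_exp A $ i $ j) \<le> exp \<kappa>"
proof -
  define c where "c i k = matpow A k $ i $ j / fact k" for i k
  define u where "u i z = (\<Sum>k. c i k * z ^ k)" for i and z :: complex
  have summ: "summable (\<lambda>k. c i k * z ^ k)" for i and z :: complex
  proof (rule summable_norm_cancel, rule summable_comparison_test'[where N = 0])
    show "summable (\<lambda>k. (real CARD('N) * norm A * norm z) ^ k / fact k)"
      using summable_exp_generic[of "real CARD('N) * norm A * norm z"] by (simp add: divide_inverse mult.commute)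
    show "norm (norm (c i k * z ^ k)) \<le> (real CARD('N) * norm A * norm z) ^ k / fact k" for k
    proof -
      have "norm (matpow A k $ i $ j) * norm z ^ k \<le> (real CARD('N) * norm A) ^ k * norm z ^ k"
        by (intro mult_right_mono norm_matpow_nth_le matrix_entries_bounded) auto
      then show ?thesis
        by (simp add: c_def norm_mult norm_divide norm_power power_mult_distrib divide_right_mono)
    qed
  qed
  have diffs: "diffs (c i) k = (\<Sum>l\<in>UNIV. A $ i $ l * c l k)" for i k
  proof -
    have "diffs (c i) k = matpow A (Suc k) $ i $ j / fact k"
      by (simp only: diffs_def c_def fact_Suc) (simp del: of_nat_Suc funpow.simps)
    then show ?thesis unfolding matpow_Suc_nth c_def by (simp add: sum_divide_distrib)
  qed
  have du: "(u i has_field_derivative (\<Sum>l\<in>UNIV. A $ i $ l * u l z)) (at z)" for i z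
  proof -
    have "(u i has_field_derivative (\<Sum>k. diffs (c i) k * z ^ k)) (at z)"
      unfolding u_def[abs_def] by (rule termdiffs_strong_converges_everywhere[OF summ])
    also have "(\<Sum>k. diffs (c i) k * z ^ k) = (\<Sum>k. \<Sum>l\<in>UNIV. A $ i $ l * (c l k * z ^ k))"
      unfolding diffs by (simp add: sum_distrib_right mult.assoc)
    also have "\<dots> = (\<Sum>l\<in>UNIV. \<Sum>k. A $ i $ l * (c l k * z ^ k))"
      by (rule suminf_sum) (intro summable_mult summ)
    also have "\<dots> = (\<Sum>l\<in>UNIV. A $ i $ l * u l z)"
      unfolding u_def by (simp add: suminf_mult[OF summ])
    finally show ?thesis .
  qed
  define v where "v \<tau> = (\<chi> i. u i (of_real \<tau>))" for \<tau> :: real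
  define G where "G \<tau> = (\<Sum>i\<in>UNIV. (Re (u i (of_real \<tau>)))\<^sup>2 + (Im (u i (of_real \<tau>)))\<^sup>2)" for \<tau> :: real
  have G: "G \<tau> = (norm (v \<tau>))\<^sup>2" for \<tau>
    unfolding G_def v_def norm_vec_def L2_set_def by (simp add: sum_nonneg cmod_power2)
  define w where "w i \<tau> = (A *v v \<tau>) $ i" for i \<tau>
  have dG: "(G has_real_derivative 2 * Re (hermitian_inner (A *v v \<tau>) (v \<tau>))) (at \<tau>)" for \<tau>
  proof -
    have d: "((\<lambda>\<tau>. u i (of_real \<tau>)) has_vector_derivative w i \<tau>) (at \<tau>)" for i
      using has_vector_derivative_real_field[OF du[of i "of_real \<tau>"]]
      by (simp add: w_def v_def matrix_vector_mult_def)
    have re: "((\<lambda>\<tau>. Re (u i (of_real \<tau>))) has_real_derivative Re (w i \<tau>)) (at \<tau>)" for i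
      using bounded_linear.has_vector_derivative[OF bounded_linear_Re d] by (simp add: has_real_derivative_iff_has_vector_derivative)
    have im: "((\<lambda>\<tau>. Im (u i (of_real \<tau>))) has_real_derivative Im (w i \<tau>)) (at \<tau>)" for i
      using bounded_linear.has_vector_derivative[OF bounded_linear_Im d] by (simp add: has_real_derivative_iff_has_vector_derivative)
    have "(G has_real_derivative (\<Sum>i\<in>UNIV. 2 * Re (u i (of_real \<tau>)) * Re (w i \<tau>) + 2 * Im (u i (of_real \<tau>)) * Im (w i \<tau>))) (at \<tau>)"
    proof -
      have sq: "((\<lambda>\<tau>. (f \<tau>)\<^sup>2 + (g \<tau>)\<^sup>2) has_real_derivative 2 * f \<tau> * f' + 2 * g \<tau> * g') (at \<tau>)"
        if "(f has_real_derivative f') (at \<tau>)" "(g has_real_derivative g') (at \<tau>)" for f g :: "real \<Rightarrow> real" and f' g'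
        by (auto intro!: derivative_eq_intros that)
      show ?thesis unfolding G_def[abs_def] by (intro DERIV_sum sq re im)
    qed
    also have "(\<Sum>i\<in>UNIV. 2 * Re (u i (of_real \<tau>)) * Re (w i \<tau>) + 2 * Im (u i (of_real \<tau>)) * Im (w i \<tau>)) =
        2 * Re (hermitian_inner (A *v v \<tau>) (v \<tau>))"
      by (simp add: hermitian_inner_def w_def v_def sum_distrib_left algebra_simps)
    finally show ?thesis .
  qed
  have "exp (- 2 * \<kappa> * 1) * G 1 \<le> exp (- 2 * \<kappa> * 0) * G 0"
  proof (rule DERIV_nonpos_imp_nonincreasing[where f = "\<lambda>\<tau>. exp (- 2 * \<kappa> * \<tau>) * G \<tau>"])
    show "(0::real) \<le> 1" by simp
    fix \<tau> :: real
    have "((\<lambda>\<tau>. exp (- 2 * \<kappa> * \<tau>) * G \<tau>) has_real_derivative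
        exp (- 2 * \<kappa> * \<tau>) * (2 * Re (hermitian_inner (A *v v \<tau>) (v \<tau>)) - 2 * \<kappa> * G \<tau>)) (at \<tau>)"
      by (rule derivative_eq_intros dG refl | simp add: algebra_simps)+
    moreover have "exp (- 2 * \<kappa> * \<tau>) * (2 * Re (hermitian_inner (A *v v \<tau>) (v \<tau>)) - 2 * \<kappa> * G \<tau>) \<le> 0"
      using num_range[of "v \<tau>"] by (simp add: G mult_le_0_iff)
    ultimately show "\<exists>y. ((\<lambda>\<tau>. exp (- 2 * \<kappa> * \<tau>) * G \<tau>) has_real_derivative y) (at \<tau>) \<and> y \<le> 0" by blast
  qed
  moreover have "G 0 = 1"
  proof -
    have "u i 0 = (if i = j then 1 else 0)" for i
      unfolding u_def using powser_zero[of "c i"] by (simp add: c_def mat_def)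
    then have "G 0 = (\<Sum>i\<in>UNIV. if i = j then 1 else 0)" unfolding G_def by (intro sum.cong) auto
    then show ?thesis by simp
  qed
  ultimately have "exp (- 2 * \<kappa>) * (norm (v 1))\<^sup>2 \<le> 1" by (simp add: G)
  then have "(norm (v 1))\<^sup>2 \<le> (exp \<kappa>)\<^sup>2"
  proof -
    assume le: "exp (- 2 * \<kappa>) * (norm (v 1))\<^sup>2 \<le> 1"
    have "(norm (v 1))\<^sup>2 = exp (2 * \<kappa>) * (exp (- 2 * \<kappa>) * (norm (v 1))\<^sup>2)"
      by (simp add: mult.assoc[symmetric] mult_exp_exp)
    also have "\<dots> \<le> exp (2 * \<kappa>) * 1" using le by (intro mult_left_mono) auto
    also have "\<dots> = (exp \<kappa>)\<^sup>2" by (simp add: exp_double)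
    finally show ?thesis .
  qed
  then have "norm (v 1) \<le> exp \<kappa>" by (rule power2_le_imp_le) simp
  moreover have "matrix_exp A $ i $ j = v 1 $ i"
    by (simp add: matrix_exp_nth v_def u_def c_def)
  ultimately show ?thesis using Finite_Cartesian_Product.norm_nth_le[of "v 1" i] by simp
qed

section \<open>The symbol on complex frequencies\<close>

text \<open>
  The polynomial \<open>A0_symbol\<close> at complex arguments.
\<close>

definition complex_symbol ::
  "nat \<Rightarrow> (('n::finite \<Rightarrow> nat) \<Rightarrow> complex ^ 'N ^ 'N) \<Rightarrow> complex ^ 'n \<Rightarrow> complex ^ 'N ^ ('N::finite)" where
  "complex_symbol b a \<zeta> = (\<chi> i j. \<Sum>\<mu> | mi_size \<mu> = 2 * b. a \<mu> $ i $ j * (\<Prod>l\<in>UNIV. (\<zeta> $ l) ^ \<mu> l))"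

text \<open>
  The complex line through \<open>\<xi>\<close> in the direction \<open>e\<close>. Moving along a single complex variable makes one-variable function theory
  sufficient for the shift of the Fourier integral.
\<close>

definition shifted :: "real ^ 'n \<Rightarrow> real ^ 'n \<Rightarrow> complex \<Rightarrow> complex ^ ('n::finite)" where
  "shifted e \<xi> z = (\<chi> l. of_real (\<xi> $ l) + z * of_real (e $ l))"

text \<open>
  With a bound \<open>M\<close> in place of the exact maximum, constants can be chosen before the coefficients are.
\<close>

definition admissible ::
  "nat \<Rightarrow> real \<Rightarrow> real \<Rightarrow> (('n::finite \<Rightarrow> nat) \<Rightarrow> complex ^ 'N ^ ('N::finite)) \<Rightarrow> bool" where
  "admissible b \<delta> M a \<longleftrightarrow> strongly_parabolic b \<delta> a \<and> (\<forall>\<mu> i j. mi_size \<mu> = 2 * b \<longrightarrow> cmod (a \<mu> $ i $ j) \<le> M)"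

text \<open>
  The only property of the coefficients that the kernel estimates use. It holds on the complex
  strips \<open>\<xi> + \<i>\<mu>e\<close>, with real frequencies as the case \<open>\<mu> = 0\<close>.
\<close>

definition strip_bound ::
  "nat \<Rightarrow> real \<Rightarrow> real \<Rightarrow> (('n::finite \<Rightarrow> nat) \<Rightarrow> complex ^ 'N ^ ('N::finite)) \<Rightarrow> bool" where
  "strip_bound b \<delta> K a \<longleftrightarrow> (\<forall>e \<xi> \<mu> i j. norm e \<le> 1 \<and> 0 \<le> \<mu> \<longrightarrow>
      norm (matrix_exp (complex_symbol b a (shifted e \<xi> (\<i> * of_real \<mu>))) $ i $ j)
        \<le> exp (- (\<delta>/2) * norm \<xi> ^ (2 * b) + K * \<mu> ^ (2 * b)))"

lemma finite_mi_size: "finite {\<mu> :: 'n::finite \<Rightarrow> nat. mi_size \<mu> = k}"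
proof (rule finite_subset)
  have "\<mu> l \<le> k" if "mi_size \<mu> = k" for \<mu> :: "'n \<Rightarrow> nat" and l
    using member_le_sum[of l UNIV \<mu>] that by (simp add: mi_size_def)
  then show "{\<mu> :: 'n \<Rightarrow> nat. mi_size \<mu> = k} \<subseteq> PiE UNIV (\<lambda>_. {..k})" by auto
  show "finite (PiE (UNIV :: 'n set) (\<lambda>_. {..k}))" by (intro finite_PiE) auto
qed

lemma admissible_coeff_max:
  assumes "strongly_parabolic b \<delta> (a :: ('n::finite \<Rightarrow> nat) \<Rightarrow> complex ^ 'N ^ ('N::finite))"
  shows "admissible b \<delta> (coeff_max b a) a"
  unfolding admissible_def
proof (intro conjI allI impI assms)
  fix \<mu> :: "'n \<Rightarrow> nat" and i j :: 'N assume mu: "mi_size \<mu> = 2 * b"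
  let ?S = "{cmod (a \<mu> $ i $ j) | \<mu> i j. mi_size \<mu> = 2 * b}"
  have "?S = (\<lambda>(\<mu>, i, j). cmod (a \<mu> $ i $ j)) ` ({\<mu>. mi_size \<mu> = 2 * b} \<times> UNIV \<times> UNIV)"
    by (auto simp: image_iff) metis
  then have "finite ?S" by (simp add: finite_mi_size)
  then show "cmod (a \<mu> $ i $ j) \<le> coeff_max b a"
    unfolding coeff_max_def using mu by (intro Max_ge) auto
qed

lemma shifted_0: "complex_symbol b a (shifted e \<xi> 0) = A0_symbol b a \<xi>"
  by (simp add: complex_symbol_def shifted_def A0_symbol_def monomial_def vec_eq_iff)

lemma monomial_scaleR: "monomial (r *\<^sub>R \<xi>) \<beta> = r ^ mi_size \<beta> * monomial \<xi> \<beta>"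
  by (simp add: monomial_def mi_size_def power_mult_distrib prod.distrib power_sum)

lemma A0_symbol_scaleR: "A0_symbol b a (r *\<^sub>R \<xi>) = r ^ (2 * b) *\<^sub>R A0_symbol b a \<xi>"
proof -
  have "(\<Sum>\<mu> | mi_size \<mu> = 2 * b. a \<mu> $ i $ j * complex_of_real (monomial (r *\<^sub>R \<xi>) \<mu>)) =
      (\<Sum>\<mu> | mi_size \<mu> = 2 * b. of_real (r ^ (2 * b)) * (a \<mu> $ i $ j * complex_of_real (monomial \<xi> \<mu>)))" for i j
    by (intro sum.cong refl) (simp add: monomial_scaleR)
  then show ?thesis
    by (simp add: A0_symbol_def vec_eq_iff sum_distrib_left scaleR_conv_of_real[where 'a = complex])
qed

lemma abs_monomial_le: "\<bar>monomial \<xi> \<beta>\<bar> \<le> norm \<xi> ^ mi_size \<beta>"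
proof -
  have "\<bar>monomial \<xi> \<beta>\<bar> = (\<Prod>l\<in>UNIV. \<bar>\<xi> $ l\<bar> ^ \<beta> l)"
    by (simp add: monomial_def abs_prod power_abs)
  also have "\<dots> \<le> (\<Prod>l\<in>UNIV. norm \<xi> ^ \<beta> l)"
    by (intro prod_mono conjI power_mono component_le_norm_cart) auto
  also have "\<dots> = norm \<xi> ^ mi_size \<beta>" by (simp add: mi_size_def power_sum)
  finally show ?thesis .
qed

lemma norm_shifted_nth_le:
  assumes "norm e \<le> 1"
  shows "norm (shifted e \<xi> z $ l) \<le> norm \<xi> + norm z"
proof -
  have e: "\<bar>e $ l\<bar> \<le> 1" using component_le_norm_cart[of e l] assms by linarith
  have "norm (shifted e \<xi> z $ l) \<le> \<bar>\<xi> $ l\<bar> + norm z * \<bar>e $ l\<bar>"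
    unfolding shifted_def by (simp add: order_trans[OF norm_triangle_ineq] norm_mult)
  also have "\<dots> \<le> norm \<xi> + norm z * 1"
    using e by (intro add_mono component_le_norm_cart mult_left_mono) auto
  finally show ?thesis by simp
qed

text \<open>
  After division by \<open>T\<close> all factors lie in the unit disc, where differences of products are bounded by
  sums of differences.
\<close>

lemma norm_prod_power_diff_le:
  fixes z w :: "'n::finite \<Rightarrow> complex"
  assumes T: "T \<ge> 0" and D: "\<And>l. norm (z l - w l) \<le> D"
    and z: "\<And>l. norm (z l) \<le> T" and w: "\<And>l. norm (w l) \<le> T"
  shows "norm ((\<Prod>l\<in>UNIV. z l ^ \<mu> l) - (\<Prod>l\<in>UNIV. w l ^ \<mu> l)) \<le> real (mi_size \<mu>) * D * T ^ (mi_size \<mu> - 1)"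
proof (cases "T = 0 \<or> mi_size \<mu> = 0")
  case True
  have zw: "(\<Prod>l\<in>UNIV. z l ^ \<mu> l) = (\<Prod>l\<in>UNIV. w l ^ \<mu> l)"
  proof (cases "T = 0")
    case True
    then have "z l = w l" for l using z[of l] w[of l] by simp
    then show ?thesis by simp
  next
    case False
    then have "\<mu> l = 0" for l using True by (simp add: mi_size_def)
    then show ?thesis by simp
  qed
  have "D \<ge> 0" using order_trans[OF norm_ge_zero D] .
  then show ?thesis using zw T by simp
next
  case False
  then have T0: "T > 0" and m: "mi_size \<mu> > 0" using T by auto
  have scale: "(\<Prod>l\<in>UNIV. f l ^ \<mu> l) = of_real (T ^ mi_size \<mu>) * (\<Prod>l\<in>UNIV. (f l / of_real T) ^ \<mu> l)" for f :: "'n \<Rightarrow> complex"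
    using T0 by (simp add: power_divide prod_dividef mi_size_def power_sum)
  have small: "norm (f l / of_real T) \<le> 1" if "norm (f l) \<le> T" for f :: "'n \<Rightarrow> complex" and l
    using that T0 by (simp add: norm_divide)
  have "norm ((\<Prod>l\<in>UNIV. (z l / of_real T) ^ \<mu> l) - (\<Prod>l\<in>UNIV. (w l / of_real T) ^ \<mu> l)) \<le>
      (\<Sum>l\<in>UNIV. norm ((z l / of_real T) ^ \<mu> l - (w l / of_real T) ^ \<mu> l))"
    by (intro norm_prod_diff) (simp_all only: norm_power power_le_one norm_ge_zero small z w)
  also have "\<dots> \<le> (\<Sum>l\<in>UNIV. real (\<mu> l) * (D / T))"
  proof (intro sum_mono)
    fix l
    have "norm ((z l / of_real T) ^ \<mu> l - (w l / of_real T) ^ \<mu> l) \<le> real (\<mu> l) * norm (z l / of_real T - w l / of_real T)"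
      by (intro norm_power_diff small z w)
    also have "norm (z l / of_real T - w l / of_real T) = norm (z l - w l) / T"
      using T0 by (simp add: diff_divide_distrib[symmetric] norm_divide)
    also have "real (\<mu> l) * (norm (z l - w l) / T) \<le> real (\<mu> l) * (D / T)"
      using D T0 by (intro mult_left_mono divide_right_mono) auto
    finally show "norm ((z l / of_real T) ^ \<mu> l - (w l / of_real T) ^ \<mu> l) \<le> real (\<mu> l) * (D / T)" .
  qed
  also have "\<dots> = real (mi_size \<mu>) * (D / T)" by (simp only: mi_size_def of_nat_sum sum_distrib_right)
  finally have "T ^ mi_size \<mu> * norm ((\<Prod>l\<in>UNIV. (z l / of_real T) ^ \<mu> l) - (\<Prod>l\<in>UNIV. (w l / of_real T) ^ \<mu> l))
      \<le> T ^ mi_size \<mu> * (real (mi_size \<mu>) * (D / T))"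
    using T0 by (intro mult_left_mono) auto
  also have "T ^ mi_size \<mu> * (real (mi_size \<mu>) * (D / T)) = real (mi_size \<mu>) * D * T ^ (mi_size \<mu> - 1)"
    using T0 power_minus_mult[OF m, of T] by (simp add: field_simps)
  finally show ?thesis
    unfolding scale[of z] scale[of w] right_diff_distrib[symmetric] norm_mult
    using T0 by (simp add: norm_power)
qed

text \<open>
  A form of Young's inequality that absorbs the mixed term into an arbitrarily small multiple of \<open>x ^ (2 * b)\<close>.
\<close>

lemma young_power:
  fixes K d :: real
  assumes K: "K \<ge> 0" and d: "d > 0" and b: "b \<ge> 1"
  shows "\<exists>C>0. \<forall>x\<ge>0. \<forall>y\<ge>0. K * y * (x + y) ^ (2 * b - 1) \<le> d * x ^ (2 * b) + C * y ^ (2 * b)"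
proof -
  define m where "m = 2 * b - 1"
  have m2: "2 * b = Suc m" using b by (simp add: m_def)
  \<comment> \<open>The threshold between the two regimes \<open>y \<le> e * x\<close> and \<open>y > e * x\<close>.\<close>
  define e where "e = min 1 (d / ((K + 1) * 2 ^ m))"
  have e: "e > 0" "e \<le> 1" using K d by (auto simp: e_def)
  have Ke: "K * e * 2 ^ m \<le> d"
  proof -
    have "K * e * 2 ^ m \<le> (K + 1) * (d / ((K + 1) * 2 ^ m)) * 2 ^ m"
      using K e by (intro mult_right_mono mult_mono) (auto simp: e_def)
    also have "\<dots> = d"
    proof -
      have "k * (d / (k * 2 ^ m)) * 2 ^ m = d" if "k > 0" for k using that by simp
      then show ?thesis using K by simp
    qed
    finally show ?thesis .
  qed
  define C where "C = K * (1 / e + 1) ^ m + 1"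
  have C: "C > 0" using K e by (simp add: C_def add_nonneg_pos)
  have "K * y * (x + y) ^ m \<le> d * x ^ Suc m + C * y ^ Suc m" if x: "x \<ge> 0" and y: "y \<ge> 0" for x y
  proof (cases "y \<le> e * x")
    case True
    have "e * x \<le> 1 * x" using e x by (intro mult_right_mono) auto
    then have "x + y \<le> 2 * x" using True by simp
    then have "K * y * (x + y) ^ m \<le> K * (e * x) * (2 * x) ^ m"
      using True K x y by (intro mult_mono mult_left_mono power_mono) auto
    also have "\<dots> = (K * e * 2 ^ m) * x ^ Suc m" by (simp add: power_mult_distrib)
    also have "\<dots> \<le> d * x ^ Suc m" using Ke x by (intro mult_right_mono) auto
    also have "\<dots> \<le> d * x ^ Suc m + C * y ^ Suc m" using C y by simp
    finally show ?thesis .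
  next
    case False
    then have "x \<le> y / e" using e by (simp add: field_simps)
    then have "x + y \<le> (1 / e + 1) * y" by (simp add: field_simps)
    then have "K * y * (x + y) ^ m \<le> K * y * ((1 / e + 1) * y) ^ m"
      using K x y by (intro mult_left_mono power_mono) auto
    also have "\<dots> = K * (1 / e + 1) ^ m * y ^ Suc m" by (simp add: power_mult_distrib)
    also have "\<dots> \<le> C * y ^ Suc m" using y by (intro mult_right_mono) (auto simp: C_def)
    also have "\<dots> \<le> d * x ^ Suc m + C * y ^ Suc m" using d x by simp
    finally show ?thesis .
  qed
  then show ?thesis unfolding m2 using C by (intro exI[of _ C]) simp
qed

lemma norm_hermitian_inner_le:
  fixes B :: "complex ^ 'N ^ ('N::finite)"
  assumes m: "\<And>i j. norm (B $ i $ j) \<le> m"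
  shows "norm (hermitian_inner (B *v v) v) \<le> (real CARD('N))\<^sup>2 * m * (norm v)\<^sup>2"
proof -
  have v: "norm (v $ i) \<le> norm v" for i by (rule Finite_Cartesian_Product.norm_nth_le)
  have m0: "m \<ge> 0" using order_trans[OF norm_ge_zero m] .
  have "norm (hermitian_inner (B *v v) v) \<le> (\<Sum>i\<in>(UNIV::'N set). norm ((B *v v) $ i * cnj (v $ i)))"
    unfolding hermitian_inner_def by (rule norm_sum)
  also have "\<dots> \<le> (\<Sum>i\<in>(UNIV::'N set). (real CARD('N) * (m * norm v)) * norm v)"
  proof (intro sum_mono)
    fix i
    have "norm ((B *v v) $ i) \<le> (\<Sum>j\<in>(UNIV::'N set). norm (B $ i $ j * v $ j))"
      by (simp add: matrix_vector_mult_def norm_sum)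
    also have "\<dots> \<le> (\<Sum>j\<in>(UNIV::'N set). m * norm v)"
      unfolding norm_mult using m0 by (intro sum_mono mult_mono m v) auto
    finally have "norm ((B *v v) $ i) \<le> real CARD('N) * (m * norm v)" by simp
    then show "norm ((B *v v) $ i * cnj (v $ i)) \<le> (real CARD('N) * (m * norm v)) * norm v"
      unfolding norm_mult using v[of i] m0 by (intro mult_mono) auto
  qed
  also have "\<dots> = (real CARD('N))\<^sup>2 * m * (norm v)\<^sup>2" by (simp add: power2_eq_square)
  finally show ?thesis .
qed

text \<open>
  The shift changes the symbol by at most a multiple of \<open>\<mu> * (|\<xi>| + \<mu>) ^ (2 * b - 1)\<close>; Young's inequality absorbs this
  into half of the coercive term, at the price of \<open>K * \<mu> ^ (2 * b)\<close>.
\<close>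

lemma numerical_range_shifted:
  assumes b: "b \<ge> 1" and \<delta>: "\<delta> > 0"
  shows "\<exists>K>0. \<forall>a :: ('n::finite \<Rightarrow> nat) \<Rightarrow> complex ^ 'N ^ ('N::finite). admissible b \<delta> M a \<longrightarrow>
    (\<forall>e \<xi> \<mu> v. norm e \<le> 1 \<and> 0 \<le> \<mu> \<longrightarrow>
      Re (hermitian_inner (complex_symbol b a (shifted e \<xi> (\<i> * of_real \<mu>)) *v v) v)
        \<le> (- (\<delta>/2) * norm \<xi> ^ (2 * b) + K * \<mu> ^ (2 * b)) * (norm v)\<^sup>2)"
proof -
  define P where "P = real (card {\<mu> :: 'n \<Rightarrow> nat. mi_size \<mu> = 2 * b})"
  define L where "L = (real CARD('N))\<^sup>2 * (P * \<bar>M\<bar> * real (2 * b))"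
  have L: "L \<ge> 0" by (simp add: L_def P_def)
  obtain K where K: "K > 0" "\<And>x y. x \<ge> 0 \<Longrightarrow> y \<ge> 0 \<Longrightarrow> L * y * (x + y) ^ (2 * b - 1) \<le> (\<delta>/2) * x ^ (2 * b) + K * y ^ (2 * b)"
    using young_power[of L "\<delta>/2" b] L \<delta> b by auto
  have "Re (hermitian_inner (complex_symbol b a (shifted e \<xi> (\<i> * of_real \<mu>)) *v v) v)
        \<le> (- (\<delta>/2) * norm \<xi> ^ (2 * b) + K * \<mu> ^ (2 * b)) * (norm v)\<^sup>2"
    if a: "admissible b \<delta> M a" and e: "norm e \<le> 1" and mu: "0 \<le> \<mu>"
    for a :: "('n \<Rightarrow> nat) \<Rightarrow> complex ^ 'N ^ 'N" and e \<xi> \<mu> v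
  proof -
    define A where "A = complex_symbol b a (shifted e \<xi> (\<i> * of_real \<mu>))"
    define B where "B = A - A0_symbol b a \<xi>"
    have B: "norm (B $ i $ j) \<le> P * (\<bar>M\<bar> * (real (2 * b) * \<mu> * (norm \<xi> + \<mu>) ^ (2 * b - 1)))" for i j
    proof -
      have "B $ i $ j = (\<Sum>\<nu> | mi_size \<nu> = 2 * b. a \<nu> $ i $ j *
          ((\<Prod>l\<in>UNIV. (shifted e \<xi> (\<i> * of_real \<mu>) $ l) ^ \<nu> l) - (\<Prod>l\<in>UNIV. (shifted e \<xi> 0 $ l) ^ \<nu> l)))"
        unfolding B_def A_def shifted_0[of b a e \<xi>, symmetric]
        by (simp add: complex_symbol_def right_diff_distrib sum_subtractf)
      also have "norm \<dots> \<le> (\<Sum>\<nu> | mi_size (\<nu> :: 'n \<Rightarrow> nat) = 2 * b. \<bar>M\<bar> * (real (2 * b) * \<mu> * (norm \<xi> + \<mu>) ^ (2 * b - 1)))"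
      proof (rule order_trans[OF norm_sum sum_mono])
        fix \<nu> :: "'n \<Rightarrow> nat" assume "\<nu> \<in> {\<nu>. mi_size \<nu> = 2 * b}"
        then have nu: "mi_size \<nu> = 2 * b" by simp
        have 1: "cmod (a \<nu> $ i $ j) \<le> \<bar>M\<bar>"
          using a nu unfolding admissible_def by (meson abs_ge_self order_trans)
        have "norm ((\<Prod>l\<in>UNIV. (shifted e \<xi> (\<i> * of_real \<mu>) $ l) ^ \<nu> l) - (\<Prod>l\<in>UNIV. (shifted e \<xi> 0 $ l) ^ \<nu> l))
            \<le> real (mi_size \<nu>) * \<mu> * (norm \<xi> + \<mu>) ^ (mi_size \<nu> - 1)"
        proof (rule norm_prod_power_diff_le)
          show "0 \<le> norm \<xi> + \<mu>" using mu by simp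
          show "norm (shifted e \<xi> (\<i> * of_real \<mu>) $ l) \<le> norm \<xi> + \<mu>" "norm (shifted e \<xi> 0 $ l) \<le> norm \<xi> + \<mu>" for l
            using norm_shifted_nth_le[OF e, of \<xi> "\<i> * of_real \<mu>" l] norm_shifted_nth_le[OF e, of \<xi> 0 l] mu
            by (simp_all add: norm_mult)
          have "\<bar>e $ l\<bar> \<le> 1" for l using component_le_norm_cart[of e l] e by linarith
          then show "norm (shifted e \<xi> (\<i> * of_real \<mu>) $ l - shifted e \<xi> 0 $ l) \<le> \<mu>" for l
            using mu mult_left_mono[of "\<bar>e $ l\<bar>" 1 \<mu>] by (simp add: shifted_def norm_mult)
        qed
        then show "norm (a \<nu> $ i $ j * ((\<Prod>l\<in>UNIV. (shifted e \<xi> (\<i> * of_real \<mu>) $ l) ^ \<nu> l) - (\<Prod>l\<in>UNIV. (shifted e \<xi> 0 $ l) ^ \<nu> l)))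
            \<le> \<bar>M\<bar> * (real (2 * b) * \<mu> * (norm \<xi> + \<mu>) ^ (2 * b - 1))"
          unfolding norm_mult nu using 1 by (intro mult_mono) auto
      qed
      also have "\<dots> = P * (\<bar>M\<bar> * (real (2 * b) * \<mu> * (norm \<xi> + \<mu>) ^ (2 * b - 1)))" by (simp add: P_def)
      finally show ?thesis .
    qed
    have "hermitian_inner (A *v v) v = hermitian_inner (A0_symbol b a \<xi> *v v) v + hermitian_inner (B *v v) v"
      unfolding B_def by (simp add: hermitian_inner_def matrix_vector_mult_diff_rdistrib algebra_simps sum_subtractf)
    then have "Re (hermitian_inner (A *v v) v) \<le> Re (hermitian_inner (A0_symbol b a \<xi> *v v) v) + norm (hermitian_inner (B *v v) v)"
      using complex_Re_le_cmod by simp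
    also have "\<dots> \<le> - \<delta> * norm \<xi> ^ (2 * b) * (norm v)\<^sup>2 +
        (real CARD('N))\<^sup>2 * (P * (\<bar>M\<bar> * (real (2 * b) * \<mu> * (norm \<xi> + \<mu>) ^ (2 * b - 1)))) * (norm v)\<^sup>2"
      using a norm_hermitian_inner_le[OF B, of v] unfolding admissible_def strongly_parabolic_def by (intro add_mono) auto
    also have "\<dots> = (- \<delta> * norm \<xi> ^ (2 * b) + L * \<mu> * (norm \<xi> + \<mu>) ^ (2 * b - 1)) * (norm v)\<^sup>2"
      unfolding L_def by (simp only: algebra_simps)
    also have "\<dots> \<le> (- (\<delta>/2) * norm \<xi> ^ (2 * b) + K * \<mu> ^ (2 * b)) * (norm v)\<^sup>2"
      using K(2)[of "norm \<xi>" \<mu>] mu by (intro mult_right_mono) (auto simp: algebra_simps)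
    finally show ?thesis by (simp add: A_def)
  qed
  then show ?thesis using K(1) by blast
qed

lemma strip_bound_admissible:
  assumes b: "b \<ge> 1" and \<delta>: "\<delta> > 0"
  shows "\<exists>K>0. \<forall>a :: ('n::finite \<Rightarrow> nat) \<Rightarrow> complex ^ 'N ^ ('N::finite). admissible b \<delta> M a \<longrightarrow> strip_bound b \<delta> K a"
  using numerical_range_shifted[OF assms, of M, where 'n = 'n and 'N = 'N] unfolding strip_bound_def
  by (meson norm_matrix_exp_nth_le)

section \<open>Integrals over Euclidean space\<close>

lemma
  fixes f :: "'a::euclidean_space \<Rightarrow> 'b::{banach, second_countable_topology}"
  assumes c: "c \<noteq> 0" and f [measurable]: "f \<in> borel_measurable borel"
  shows integral_lborel_scaleR: "(\<integral>x. f x \<partial>lborel) = \<bar>c\<bar> ^ DIM('a) *\<^sub>R (\<integral>x. f (c *\<^sub>R x) \<partial>lborel)"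
    and integral_lborel_translate: "(\<integral>x. f (t + x) \<partial>lborel) = (\<integral>x. f x \<partial>lborel)"
proof -
  show "(\<integral>x. f x \<partial>lborel) = \<bar>c\<bar> ^ DIM('a) *\<^sub>R (\<integral>x. f (c *\<^sub>R x) \<partial>lborel)"
    by (subst lborel_affine[OF c, of 0]) (simp add: integral_density integral_distr)
  show "(\<integral>x. f (t + x) \<partial>lborel) = (\<integral>x. f x \<partial>lborel)"
    using integral_distr[of "(+) t" lborel borel f] by (simp add: lborel_distr_plus)
qed

lemma integrable_exp_neg_abs:
  assumes c: "c > (0::real)"
  shows "integrable lborel (\<lambda>x::real. exp (- c * \<bar>x\<bar>))"
proof -
  have 1: "integrable lborel (\<lambda>x. indicator {0<..} x *\<^sub>R exp (- c * x))"
    using integrable_halfline_exp[OF c] by (simp add: integrable_halfline set_integrable_def)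
  then have 2: "integrable lborel (\<lambda>x. indicator {0<..} (0 + (-1) * x) *\<^sub>R exp (- c * (0 + (-1) * x)))"
    by (rule lborel_integrable_real_affine) simp
  show ?thesis
  proof (rule Bochner_Integration.integrable_bound[OF Bochner_Integration.integrable_add[OF 1 2]])
    show "AE x in lborel. norm (exp (- c * \<bar>x\<bar>)) \<le>
      norm (indicator {0<..} x *\<^sub>R exp (- c * x) + indicator {0<..} (0 + (-1) * x) *\<^sub>R exp (- c * (0 + (-1) * x)))"
      using AE_lborel_singleton[of 0] by eventually_elim (auto simp: indicator_def)
  qed measurable
qed

lemma integrable_exp_neg_norm_power2:
  assumes c: "c > 0"
  shows "integrable lborel (\<lambda>x::'a::euclidean_space. exp (- c * (norm x)\<^sup>2))"
proof -
  have one: "(\<integral>\<^sup>+x. ennreal (exp (- c * x\<^sup>2)) \<partial>lborel) < \<infinity>"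
  proof -
    have "integrable lborel (\<lambda>x::real. exp (- c * x\<^sup>2))"
    proof (rule Bochner_Integration.integrable_bound)
      show "integrable lborel (\<lambda>x::real. exp c * exp (- c * \<bar>x\<bar>))"
        using integrable_exp_neg_abs[OF c] by simp
      show "AE x in lborel. norm (exp (- c * x\<^sup>2)) \<le> norm (exp c * exp (- c * \<bar>x\<bar>))"
      proof (rule AE_I2)
        fix x :: real
        have "0 \<le> (\<bar>x\<bar> - 1)\<^sup>2" by simp
        moreover have "(\<bar>x\<bar> - 1)\<^sup>2 = x\<^sup>2 - 2 * \<bar>x\<bar> + 1" by (simp add: power2_diff)
        ultimately have "\<bar>x\<bar> \<le> 1 + x\<^sup>2" using abs_ge_zero[of x] by linarith
        then have "c * \<bar>x\<bar> \<le> c * (1 + x\<^sup>2)" using c by (intro mult_left_mono) auto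
        then show "norm (exp (- c * x\<^sup>2)) \<le> norm (exp c * exp (- c * \<bar>x\<bar>))"
          by (simp add: mult_exp_exp algebra_simps)
      qed
    qed measurable
    then show ?thesis by (simp add: integrable_iff_bounded)
  qed
  have "(\<integral>\<^sup>+x. ennreal (exp (- c * (norm x)\<^sup>2)) \<partial>(lborel :: 'a measure)) = (\<integral>\<^sup>+x. (\<Prod>b\<in>Basis. ennreal (exp (- c * (x \<bullet> b)\<^sup>2))) \<partial>(lborel :: 'a measure))"
  proof (intro nn_integral_cong)
    fix x :: 'a
    have "(norm x)\<^sup>2 = (\<Sum>b\<in>Basis. (x \<bullet> b)\<^sup>2)"
      by (subst power2_norm_eq_inner, subst euclidean_inner) (simp add: power2_eq_square)
    then have "exp (- c * (norm x)\<^sup>2) = exp (\<Sum>b\<in>Basis. - c * (x \<bullet> b)\<^sup>2)"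
      by (simp only: sum_distrib_left)
    also have "\<dots> = (\<Prod>b\<in>Basis. exp (- c * (x \<bullet> b)\<^sup>2))" by (rule exp_sum) simp
    finally show "ennreal (exp (- c * (norm x)\<^sup>2)) = (\<Prod>b\<in>Basis. ennreal (exp (- c * (x \<bullet> b)\<^sup>2)))"
      by (simp add: prod_ennreal)
  qed
  also have "\<dots> = (\<Prod>b\<in>(Basis::'a set). (\<integral>\<^sup>+x. ennreal (exp (- c * x\<^sup>2)) \<partial>lborel))"
    by (rule nn_integral_lborel_prod) auto
  also have "\<dots> < \<infinity>" using one by (simp add: power_less_top_ennreal)
  finally show ?thesis by (simp add: integrable_iff_bounded)
qed

lemma integrable_moment_exp_neg_norm_power:
  assumes c: "c > 0" and b: "b \<ge> 1"
  shows "integrable lborel (\<lambda>x::'a::euclidean_space. (1 + norm x) ^ m * exp (- c * norm x ^ (2 * b)))"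
proof -
  obtain C where C: "C > 0" "\<And>y. y \<ge> 0 \<Longrightarrow> y powr real m * exp (- (c/8) * y powr 2) \<le> C"
    using powr_mult_exp_powr_bounded[of "real m" "c/8" 2] c by auto
  show ?thesis
  proof (rule Bochner_Integration.integrable_bound)
    show "integrable lborel (\<lambda>x::'a. (C * exp (2 * c)) * exp (- (c/2) * (norm x)\<^sup>2))"
      using c by (intro integrable_mult_right integrable_exp_neg_norm_power2) simp
    show "AE x::'a in lborel. norm ((1 + norm x) ^ m * exp (- c * norm x ^ (2 * b))) \<le>
      norm ((C * exp (2 * c)) * exp (- (c/2) * (norm x)\<^sup>2))"
    proof (rule AE_I2)
      fix x :: 'a
      define y where "y = norm x"
      have y: "y \<ge> 0" by (simp add: y_def)
      have "(1 + y) ^ m * exp (- (c/8) * (1 + y)\<^sup>2) \<le> C"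
        using C(2)[of "1 + y"] y by (simp add: powr_realpow)
      then have 1: "(1 + y) ^ m \<le> C * exp ((c/8) * (1 + y)\<^sup>2)"
        by (simp add: exp_minus field_simps)
      have "y\<^sup>2 - 1 \<le> y ^ (2 * b)"
      proof (cases "y \<le> 1")
        case True
        then have "y\<^sup>2 \<le> 1" using y by (simp add: power_le_one)
        then show ?thesis using zero_le_power[OF y, of "2 * b"] by linarith
      next
        case False
        then have "y ^ 2 \<le> y ^ (2 * b)" using b by (intro power_increasing) auto
        then show ?thesis by simp
      qed
      then have "c * (y\<^sup>2 - 1) \<le> c * y ^ (2 * b)" using c by (intro mult_left_mono) auto
      then have "c * y\<^sup>2 - c \<le> c * y ^ (2 * b)" by (simp add: right_diff_distrib)
      moreover have "c * (1 + y)\<^sup>2 \<le> c * (2 + 2 * y\<^sup>2)"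
      proof (intro mult_left_mono)
        have "0 \<le> (y - 1)\<^sup>2" by simp
        then show "(1 + y)\<^sup>2 \<le> 2 + 2 * y\<^sup>2" by (simp add: power2_eq_square algebra_simps)
      qed (use c in simp)
      then have "c * (1 + y)\<^sup>2 \<le> 2 * c + 2 * (c * y\<^sup>2)" by (simp add: distrib_left)
      moreover have "c * y\<^sup>2 \<ge> 0" using c by simp
      moreover have "(c/8) * (1 + y)\<^sup>2 = c * (1 + y)\<^sup>2 / 8" "(c/2) * y\<^sup>2 = c * y\<^sup>2 / 2" by simp_all
      ultimately have "(c/8) * (1 + y)\<^sup>2 - c * y ^ (2 * b) \<le> 2 * c - (c/2) * y\<^sup>2"
        using c by linarith
      then have "exp ((c/8) * (1 + y)\<^sup>2) * exp (- c * y ^ (2 * b)) \<le> exp (2 * c) * exp (- (c/2) * y\<^sup>2)"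
        unfolding mult_exp_exp by simp
      then have "C * (exp ((c/8) * (1 + y)\<^sup>2) * exp (- c * y ^ (2 * b))) \<le> C * (exp (2 * c) * exp (- (c/2) * y\<^sup>2))"
        using C(1) by (intro mult_left_mono) auto
      moreover have "(1 + y) ^ m * exp (- c * y ^ (2 * b)) \<le> C * exp ((c/8) * (1 + y)\<^sup>2) * exp (- c * y ^ (2 * b))"
        using 1 by (intro mult_right_mono) auto
      ultimately have "(1 + y) ^ m * exp (- c * y ^ (2 * b)) \<le> (C * exp (2 * c)) * exp (- (c/2) * y\<^sup>2)"
        by (simp only: mult.assoc)
      then show "norm ((1 + norm x) ^ m * exp (- c * norm x ^ (2 * b))) \<le> norm ((C * exp (2 * c)) * exp (- (c/2) * (norm x)\<^sup>2))"
        using C(1) by (simp add: abs_mult y_def add_nonneg_nonneg)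
    qed
  qed measurable
qed

section \<open>The parabolic kernel and its derivatives\<close>

text \<open>
  Formally \<open>D\<^sup>\<beta> Z(s, x)\<close>; the factor \<open>monomial \<xi> \<beta>\<close> is the symbol of \<open>D\<^sup>\<beta>\<close>.
\<close>

definition weighted_Z ::
  "nat \<Rightarrow> (('n::finite \<Rightarrow> nat) \<Rightarrow> complex ^ 'N ^ 'N) \<Rightarrow> ('n \<Rightarrow> nat) \<Rightarrow> real \<Rightarrow> real ^ 'n \<Rightarrow> complex ^ 'N ^ ('N::finite)" where
  "weighted_Z b a \<beta> s x = (1 / (2 * pi) ^ CARD('n)) *\<^sub>R
     (\<integral>\<xi>. cscale (cis (x \<bullet> \<xi>) * of_real (monomial \<xi> \<beta>)) (matrix_exp (s *\<^sub>R A0_symbol b a \<xi>)) \<partial>lborel)"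

lemma Z_kernel_eq_weighted_Z: "Z_kernel b a s x = weighted_Z b a (\<lambda>_. 0) s x"
  by (simp add: Z_kernel_def weighted_Z_def monomial_def)

lemma cscale_nth [simp]: "cscale c A $ i $ j = c * A $ i $ j"
  by (simp add: cscale_def)

lemma norm_cscale: "norm (cscale c A) = norm c * norm A"
  by (simp add: norm_vec_def cscale_def norm_mult L2_set_right_distrib[symmetric] L2_set_nonneg)

lemma bounded_linear_cscale_left: "bounded_linear (\<lambda>c. cscale c A)"
  by (rule bounded_linear_intro[where K = "norm A"])
     (simp_all add: norm_cscale vec_eq_iff algebra_simps scaleR_conv_of_real[where 'a = complex])

lemma bounded_linear_cscale_right: "bounded_linear (cscale c)"
  by (rule bounded_linear_intro[where K = "norm c"];
      simp add: norm_cscale vec_eq_iff algebra_simps scaleR_conv_of_real[where 'a = complex])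

lemma norm_matrix_le_sum:
  fixes A :: "complex ^ 'N ^ ('N::finite)"
  assumes "\<And>i j. norm (A $ i $ j) \<le> m"
  shows "norm A \<le> (real CARD('N))\<^sup>2 * m"
proof -
  have "norm A \<le> (\<Sum>i\<in>(UNIV::'N set). norm (A $ i))"
    unfolding norm_vec_def[of A] by (rule L2_set_le_sum) simp
  also have "\<dots> \<le> (\<Sum>i\<in>(UNIV::'N set). real CARD('N) * m)"
  proof (intro sum_mono)
    fix i
    have "norm (A $ i) \<le> (\<Sum>j\<in>(UNIV::'N set). norm (A $ i $ j))"
      unfolding norm_vec_def[of "A $ i"] by (rule L2_set_le_sum) simp
    also have "\<dots> \<le> (\<Sum>j\<in>(UNIV::'N set). m)" by (intro sum_mono assms)
    finally show "norm (A $ i) \<le> real CARD('N) * m" by simp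
  qed
  finally show ?thesis by (simp add: power2_eq_square)
qed

lemma bounded_linear_nth_nth: "bounded_linear (\<lambda>A :: complex ^ 'm ^ 'k. A $ i $ j)"
  using bounded_linear_compose[OF bounded_linear_vec_nth bounded_linear_vec_nth] .

lemma continuous_on_monomial: "continuous_on UNIV (\<lambda>\<xi>. monomial \<xi> \<beta>)"
  unfolding monomial_def by (intro continuous_intros)

lemma continuous_on_complex_symbol_shifted: "continuous_on UNIV (\<lambda>\<xi>. complex_symbol b a (shifted e \<xi> z))"
  unfolding complex_symbol_def shifted_def
  by (intro continuous_on_vec_lambda continuous_intros)

lemma continuous_on_A0_symbol: "continuous_on UNIV (A0_symbol b a)"
  using continuous_on_complex_symbol_shifted[of b a 0 0] by (simp add: shifted_0)

lemma borel_measurable_weighted_integrand: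
  "(\<lambda>\<xi>. cscale (cis (x \<bullet> \<xi>) * of_real (monomial \<xi> \<beta>)) (matrix_exp (s *\<^sub>R A0_symbol b a \<xi>))) \<in> borel_measurable borel"
proof -
  have E: "(\<lambda>\<xi>. matrix_exp (s *\<^sub>R A0_symbol b a \<xi>)) \<in> borel_measurable borel"
    by (intro borel_measurable_matrix_exp continuous_intros continuous_on_A0_symbol)
  have c: "continuous_on UNIV (\<lambda>\<xi>. cis (x \<bullet> \<xi>) * of_real (monomial \<xi> \<beta>))"
    unfolding cis_conv_exp by (intro continuous_intros continuous_on_monomial)
  have p: "(\<lambda>\<xi>. (cis (x \<bullet> \<xi>) * of_real (monomial \<xi> \<beta>), matrix_exp (s *\<^sub>R A0_symbol b a \<xi>))) \<in> borel_measurable borel"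
    using E borel_measurable_continuous_onI[OF c] by (rule borel_measurable_Pair[rotated])
  have "continuous_on UNIV (\<lambda>p. cscale (fst p) (snd p) :: complex ^ 'b ^ 'b)"
    unfolding cscale_def by (intro continuous_on_vec_lambda continuous_intros)
  from borel_measurable_continuous_on[OF this p] show ?thesis by simp
qed

lemma shifted_add_of_real: "shifted e \<xi> (z + of_real h) = shifted e (\<xi> + h *\<^sub>R e) z"
  by (simp add: shifted_def vec_eq_iff algebra_simps)

text \<open>
  The real part of \<open>z\<close> only translates \<open>\<xi>\<close>, and a negative imaginary part amounts to reversing \<open>e\<close>.
\<close>

lemma strip_bound_shifted:
  fixes a :: "('n::finite \<Rightarrow> nat) \<Rightarrow> complex ^ 'N ^ ('N::finite)"
  assumes sb: "strip_bound b \<delta> K a" and e: "norm e \<le> 1"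
  shows "norm (matrix_exp (complex_symbol b a (shifted e \<xi> z)) $ i $ j)
    \<le> exp (- (\<delta>/2) * norm (\<xi> + Re z *\<^sub>R e) ^ (2 * b) + K * \<bar>Im z\<bar> ^ (2 * b))"
proof -
  have z: "z = \<i> * of_real (Im z) + of_real (Re z)" by (simp add: complex_eq_iff)
  have "\<exists>e'. norm e' \<le> 1 \<and> shifted e \<xi> z = shifted e' (\<xi> + Re z *\<^sub>R e) (\<i> * of_real \<bar>Im z\<bar>)"
  proof (cases "Im z \<ge> 0")
    case True
    then show ?thesis using e by (subst z, unfold shifted_add_of_real) auto
  next
    case False
    then have "shifted e \<xi> z = shifted (- e) (\<xi> + Re z *\<^sub>R e) (\<i> * of_real \<bar>Im z\<bar>)"
      by (subst z, unfold shifted_add_of_real) (simp add: shifted_def vec_eq_iff)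
    then show ?thesis using e by (intro exI[of _ "- e"]) auto
  qed
  then show ?thesis using sb unfolding strip_bound_def by auto
qed

text \<open>
  One entry of the Fourier integrand at time \<open>1\<close>, at the complex frequency \<open>shifted e \<xi> z\<close>.
\<close>

definition shifted_integrand ::
  "nat \<Rightarrow> (('n::finite \<Rightarrow> nat) \<Rightarrow> complex ^ 'N ^ 'N) \<Rightarrow> ('n \<Rightarrow> nat) \<Rightarrow> 'N \<Rightarrow> 'N \<Rightarrow> real ^ 'n \<Rightarrow> real ^ 'n \<Rightarrow>
    real ^ 'n \<Rightarrow> complex \<Rightarrow> complex" where
  "shifted_integrand b a \<beta> i j x e \<xi> z =
     exp (\<i> * (of_real (x \<bullet> \<xi>) + z * of_real (x \<bullet> e))) * (\<Prod>l\<in>UNIV. (shifted e \<xi> z $ l) ^ \<beta> l)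
     * matrix_exp (complex_symbol b a (shifted e \<xi> z)) $ i $ (j :: 'N::finite)"

lemma shifted_integrand_add_of_real:
  "shifted_integrand b a \<beta> i j x e \<xi> (z + of_real h) = shifted_integrand b a \<beta> i j x e (\<xi> + h *\<^sub>R e) z"
  by (simp add: shifted_integrand_def shifted_add_of_real inner_add_right algebra_simps)

lemma shifted_integrand_0:
  "shifted_integrand b a \<beta> i j x e \<xi> 0 =
    (cscale (cis (x \<bullet> \<xi>) * of_real (monomial \<xi> \<beta>)) (matrix_exp (A0_symbol b a \<xi>))) $ i $ j"
  by (simp add: shifted_integrand_def shifted_0 cis_conv_exp monomial_def) (simp add: shifted_def)

lemma norm_shifted_integrand_le:
  assumes sb: "strip_bound b \<delta> K a" and e: "norm e \<le> 1"
  shows "norm (shifted_integrand b a \<beta> i j x e \<xi> z) \<le>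
    exp (- Im z * (x \<bullet> e)) * (norm (\<xi> + Re z *\<^sub>R e) + \<bar>Im z\<bar>) ^ mi_size \<beta>
    * exp (- (\<delta>/2) * norm (\<xi> + Re z *\<^sub>R e) ^ (2 * b) + K * \<bar>Im z\<bar> ^ (2 * b))"
proof -
  define T where "T = norm (\<xi> + Re z *\<^sub>R e) + \<bar>Im z\<bar>"
  have z: "z = \<i> * of_real (Im z) + of_real (Re z)" by (simp add: complex_eq_iff)
  have l: "norm (shifted e \<xi> z $ l) \<le> T" for l
    using norm_shifted_nth_le[OF e, of "\<xi> + Re z *\<^sub>R e" "\<i> * of_real (Im z)" l]
    by (subst z, unfold shifted_add_of_real) (simp add: T_def norm_mult)
  have "norm (\<Prod>l\<in>UNIV. (shifted e \<xi> z $ l) ^ \<beta> l) \<le> (\<Prod>l\<in>UNIV. T ^ \<beta> l)"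
    unfolding prod_norm[symmetric] norm_power by (intro prod_mono conjI power_mono l) auto
  also have "\<dots> = T ^ mi_size \<beta>" by (simp add: mi_size_def power_sum)
  finally have p: "norm (\<Prod>l\<in>UNIV. (shifted e \<xi> z $ l) ^ \<beta> l) \<le> T ^ mi_size \<beta>" .
  have T: "T \<ge> 0" by (simp add: T_def)
  have n: "norm (exp (\<i> * (of_real (x \<bullet> \<xi>) + z * of_real (x \<bullet> e)))) = exp (- Im z * (x \<bullet> e))" by simp
  show ?thesis
    unfolding shifted_integrand_def norm_mult n T_def[symmetric]
    using p T by (intro mult_mono strip_bound_shifted[OF sb e]) auto
qed

lemma norm_add_power_ge:
  fixes \<xi> v :: "'a::real_normed_vector"
  assumes "norm v \<le> R"
  shows "(norm \<xi> / 2) ^ k - R ^ k \<le> norm (\<xi> + v) ^ k"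
proof (cases "norm \<xi> / 2 \<le> R")
  case True
  have "(norm \<xi> / 2) ^ k \<le> R ^ k" using True by (intro power_mono) auto
  then show ?thesis using zero_le_power[OF norm_ge_zero, of "\<xi> + v" k] by linarith
next
  case False
  have "norm \<xi> - norm v \<le> norm (\<xi> + v)" using norm_diff_ineq[of \<xi> v] .
  then have "norm \<xi> / 2 \<le> norm (\<xi> + v)" using False assms by simp
  then have "(norm \<xi> / 2) ^ k \<le> norm (\<xi> + v) ^ k" by (intro power_mono) auto
  moreover have "R ^ k \<ge> 0" using assms order_trans[OF norm_ge_zero] by (intro zero_le_power) blast
  ultimately show ?thesis by linarith
qed

lemma borel_measurable_shifted_integrand: "(\<lambda>\<xi>. shifted_integrand b a \<beta> i j x e \<xi> z) \<in> borel_measurable borel"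
proof -
  have "(\<lambda>\<xi>. matrix_exp (complex_symbol b a (shifted e \<xi> z))) \<in> borel_measurable borel"
    by (intro borel_measurable_matrix_exp continuous_on_complex_symbol_shifted)
  then have 1: "(\<lambda>\<xi>. matrix_exp (complex_symbol b a (shifted e \<xi> z)) $ i $ j) \<in> borel_measurable borel"
    by (rule borel_measurable_continuous_on[rotated]) (intro continuous_intros)
  have "continuous_on UNIV (\<lambda>\<xi>. exp (\<i> * (of_real (x \<bullet> \<xi>) + z * of_real (x \<bullet> e))) * (\<Prod>l\<in>UNIV. (shifted e \<xi> z $ l) ^ \<beta> l))"
    unfolding shifted_def by (intro continuous_intros)
  then have 2: "(\<lambda>\<xi>. exp (\<i> * (of_real (x \<bullet> \<xi>) + z * of_real (x \<bullet> e))) * (\<Prod>l\<in>UNIV. (shifted e \<xi> z $ l) ^ \<beta> l)) \<in> borel_measurable borel"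
    by (rule borel_measurable_continuous_onI)
  show ?thesis unfolding shifted_integrand_def by (rule borel_measurable_times[OF 2 1])
qed

text \<open>
  The integral is an entire function of \<open>z\<close>. For real \<open>z\<close> the shift is a translation of \<open>\<xi>\<close>, under which
  Lebesgue measure is invariant; so the function is constant on the real line and hence everywhere.
  This replaces an \<open>n\<close>-dimensional contour deformation.
\<close>

lemma integral_shifted_integrand_const:
  fixes a :: "('n::finite \<Rightarrow> nat) \<Rightarrow> complex ^ 'N ^ ('N::finite)"
  assumes b: "b \<ge> 1" and \<delta>: "\<delta> > 0" and K: "K > 0" and sb: "strip_bound b \<delta> K a" and e: "norm e \<le> 1"
  shows "(\<integral>\<xi>. shifted_integrand b a \<beta> i j x e \<xi> z \<partial>lborel) = (\<integral>\<xi>. shifted_integrand b a \<beta> i j x e \<xi> 0 \<partial>lborel)"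
proof -
  define J where "J z = (\<integral>\<xi>. shifted_integrand b a \<beta> i j x e \<xi> z \<partial>lborel)" for z
  define m where "m = mi_size \<beta>"
  have hol: "J holomorphic_on UNIV"
    unfolding J_def[abs_def]
  proof (rule holomorphic_on_integral_dominated)
    show "open (UNIV :: complex set)" by simp
    have sh: "(\<lambda>z. shifted e \<xi> z $ l) holomorphic_on UNIV" for \<xi> l
      unfolding shifted_def by (simp, intro holomorphic_intros)
    have "(\<lambda>z. complex_symbol b a (shifted e \<xi> z) $ i $ j) holomorphic_on UNIV" for \<xi> i j
      unfolding complex_symbol_def by (simp, intro holomorphic_intros sh)
    then show "shifted_integrand b a \<beta> i j x e \<xi> holomorphic_on UNIV" for \<xi>
      unfolding shifted_integrand_def[abs_def]
      by (intro holomorphic_intros holomorphic_on_matrix_exp sh) auto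
    show "(\<lambda>\<xi>. shifted_integrand b a \<beta> i j x e \<xi> z) \<in> borel_measurable lborel" for z
      using borel_measurable_shifted_integrand by (simp add: measurable_lborel2)
    fix z0 :: complex
    define R where "R = norm z0 + 1"
    have R: "R > 0" by (simp add: R_def add_nonneg_pos)
    define G where "G \<xi> = (exp (R * \<bar>x \<bullet> e\<bar>) * (1 + 2 * R) ^ m * exp ((\<delta>/2) * R ^ (2 * b) + K * R ^ (2 * b))) *
       ((1 + norm \<xi>) ^ m * exp (- ((\<delta>/2) * (1/2) ^ (2 * b)) * norm \<xi> ^ (2 * b)))" for \<xi> :: "real ^ 'n"
    have Gi: "integrable lborel G"
      unfolding G_def using \<delta> by (intro integrable_mult_right integrable_moment_exp_neg_norm_power b) simp
    have "norm (shifted_integrand b a \<beta> i j x e \<xi> w) \<le> G \<xi>" if w: "w \<in> cball z0 1" for \<xi> w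
    proof -
      have "norm w \<le> R" using that norm_triangle_ineq2[of w z0] by (simp add: R_def dist_norm norm_minus_commute)
      then have rw: "\<bar>Re w\<bar> \<le> R" "\<bar>Im w\<bar> \<le> R" using abs_Re_le_cmod[of w] abs_Im_le_cmod[of w] by linarith+
      have v: "norm (Re w *\<^sub>R e) \<le> R"
        using mult_mono[OF rw(1) e] R by simp
      have A: "exp (- Im w * (x \<bullet> e)) \<le> exp (R * \<bar>x \<bullet> e\<bar>)"
      proof -
        have "- Im w * (x \<bullet> e) \<le> \<bar>Im w\<bar> * \<bar>x \<bullet> e\<bar>" by (metis abs_ge_self abs_minus_cancel abs_mult)
        also have "\<dots> \<le> R * \<bar>x \<bullet> e\<bar>" using rw by (intro mult_right_mono) auto
        finally show ?thesis by simp
      qed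
      have B: "(norm (\<xi> + Re w *\<^sub>R e) + \<bar>Im w\<bar>) ^ m \<le> (1 + 2 * R) ^ m * (1 + norm \<xi>) ^ m"
      proof -
        have "norm (\<xi> + Re w *\<^sub>R e) + \<bar>Im w\<bar> \<le> norm \<xi> + 2 * R"
          using norm_triangle_ineq[of \<xi> "Re w *\<^sub>R e"] v rw by linarith
        also have "\<dots> \<le> (1 + 2 * R) * (1 + norm \<xi>)" using R by (simp add: algebra_simps)
        finally show ?thesis unfolding power_mult_distrib[symmetric] by (intro power_mono) auto
      qed
      have C: "exp (- (\<delta>/2) * norm (\<xi> + Re w *\<^sub>R e) ^ (2 * b) + K * \<bar>Im w\<bar> ^ (2 * b)) \<le>
          exp ((\<delta>/2) * R ^ (2 * b) + K * R ^ (2 * b)) * exp (- ((\<delta>/2) * (1/2) ^ (2 * b)) * norm \<xi> ^ (2 * b))"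
      proof -
        have "(\<delta>/2) * ((norm \<xi> / 2) ^ (2 * b) - R ^ (2 * b)) \<le> (\<delta>/2) * norm (\<xi> + Re w *\<^sub>R e) ^ (2 * b)"
          using \<delta> by (intro mult_left_mono norm_add_power_ge v) auto
        moreover have "K * \<bar>Im w\<bar> ^ (2 * b) \<le> K * R ^ (2 * b)"
          using K rw by (intro mult_left_mono power_mono) auto
        moreover have "(\<delta>/2) * ((norm \<xi> / 2) ^ (2 * b) - R ^ (2 * b)) = ((\<delta>/2) * (1/2) ^ (2 * b)) * norm \<xi> ^ (2 * b) - (\<delta>/2) * R ^ (2 * b)"
          by (simp add: power_divide algebra_simps)
        ultimately show ?thesis unfolding mult_exp_exp by simp
      qed
      have "norm (shifted_integrand b a \<beta> i j x e \<xi> w) \<le>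
          exp (R * \<bar>x \<bullet> e\<bar>) * ((1 + 2 * R) ^ m * (1 + norm \<xi>) ^ m) *
          (exp ((\<delta>/2) * R ^ (2 * b) + K * R ^ (2 * b)) * exp (- ((\<delta>/2) * (1/2) ^ (2 * b)) * norm \<xi> ^ (2 * b)))"
        unfolding m_def
        using R by (intro order_trans[OF norm_shifted_integrand_le[OF sb e]] mult_mono A B[unfolded m_def] C) auto
      then show ?thesis unfolding G_def by (simp only: mult_ac)
    qed
    then show "\<exists>r>0. \<exists>g. integrable lborel g \<and> cball z0 r \<subseteq> UNIV \<and>
        (\<forall>\<xi>\<in>space lborel. \<forall>w\<in>cball z0 r. norm (shifted_integrand b a \<beta> i j x e \<xi> w) \<le> g \<xi>)"
      using Gi by (intro exI[of _ 1] conjI exI[of _ G]) auto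
  qed
  have real: "J (of_real h) = J 0" for h
  proof -
    have "J (of_real h) = (\<integral>\<xi>. shifted_integrand b a \<beta> i j x e (h *\<^sub>R e + \<xi>) 0 \<partial>lborel)"
      unfolding J_def using shifted_integrand_add_of_real[of b a \<beta> i j x e _ 0 h] by (simp add: add.commute)
    also have "\<dots> = J 0"
      unfolding J_def by (rule integral_lborel_translate[OF one_neq_zero borel_measurable_shifted_integrand])
    finally show ?thesis .
  qed
  have "J z - J 0 = 0"
  proof (rule analytic_continuation[of "\<lambda>z. J z - J 0" UNIV "range of_real" 0 z])
    show "(\<lambda>z. J z - J 0) holomorphic_on UNIV" by (intro holomorphic_intros hol)
    show "(0::complex) islimpt range of_real"
      unfolding islimpt_approachable
    proof (intro allI impI)
      fix d :: real assume d: "d > 0"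
      have "complex_of_real (d/2) \<in> range of_real" by (rule rangeI)
      moreover have "complex_of_real (d/2) \<noteq> 0" "dist (complex_of_real (d/2)) 0 < d"
        using d by (simp_all add: norm_divide)
      ultimately show "\<exists>x'\<in>range of_real. x' \<noteq> (0::complex) \<and> dist x' 0 < d" by blast
    qed
    show "J w - J 0 = 0" if "w \<in> range of_real" for w
      using that real by auto
  qed auto
  then show ?thesis by (simp add: J_def)
qed

lemma root_powr_power:
  assumes "b \<ge> (1::nat)" "s > (0::real)"
  shows "(s powr (1 / (2 * real b))) ^ (2 * b) = s"
proof -
  have "(s powr (1 / (2 * real b))) ^ (2 * b) = (s powr (1 / (2 * real b))) powr (real (2 * b))"
    using assms by (intro powr_realpow[symmetric]) simp
  also have "\<dots> = s" using assms by (simp add: powr_powr)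
  finally show ?thesis .
qed

lemma scaleR_A0_symbol:
  assumes "b \<ge> 1" "s > 0"
  shows "s *\<^sub>R A0_symbol b a \<xi> = A0_symbol b a (s powr (1 / (2 * real b)) *\<^sub>R \<xi>)"
  unfolding A0_symbol_scaleR using root_powr_power[OF assms] by simp

lemma norm_matrix_exp_A0_symbol_le:
  fixes a :: "('n::finite \<Rightarrow> nat) \<Rightarrow> complex ^ 'N ^ ('N::finite)"
  assumes b: "b \<ge> 1" and s: "s > 0" and sb: "strip_bound b \<delta> K a"
  shows "norm (matrix_exp (s *\<^sub>R A0_symbol b a \<xi>)) \<le> (real CARD('N))\<^sup>2 * exp (- (\<delta> * s / 2) * norm \<xi> ^ (2 * b))"
proof (rule norm_matrix_le_sum)
  fix i j
  let ?r = "s powr (1 / (2 * real b))"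
  have "norm (matrix_exp (complex_symbol b a (shifted 0 (?r *\<^sub>R \<xi>) (\<i> * of_real 0))) $ i $ j)
      \<le> exp (- (\<delta>/2) * norm (?r *\<^sub>R \<xi>) ^ (2 * b) + K * 0 ^ (2 * b))"
    using sb[unfolded strip_bound_def, rule_format, of 0 0 "?r *\<^sub>R \<xi>" i j] by simp
  also have "norm (?r *\<^sub>R \<xi>) ^ (2 * b) = s * norm \<xi> ^ (2 * b)"
    using root_powr_power[OF b s] by (simp add: power_mult_distrib)
  finally show "norm (matrix_exp (s *\<^sub>R A0_symbol b a \<xi>) $ i $ j) \<le> exp (- (\<delta> * s / 2) * norm \<xi> ^ (2 * b))"
    using b by (simp add: scaleR_A0_symbol[OF b s] shifted_0 power_0_left mult.assoc)
qed

lemma norm_weighted_integrand_le: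
  fixes a :: "('n::finite \<Rightarrow> nat) \<Rightarrow> complex ^ 'N ^ ('N::finite)"
  assumes b: "b \<ge> 1" and s: "s > 0" and sb: "strip_bound b \<delta> K a"
  shows "norm (cscale (cis (x \<bullet> \<xi>) * of_real (monomial \<xi> \<beta>)) (matrix_exp (s *\<^sub>R A0_symbol b a \<xi>))) \<le>
    (real CARD('N))\<^sup>2 * ((1 + norm \<xi>) ^ mi_size \<beta> * exp (- (\<delta> * s / 2) * norm \<xi> ^ (2 * b)))"
proof -
  have "norm (cis (x \<bullet> \<xi>) * of_real (monomial \<xi> \<beta>) :: complex) = \<bar>monomial \<xi> \<beta>\<bar>" by (simp add: norm_mult)
  also have "\<dots> \<le> norm \<xi> ^ mi_size \<beta>" by (rule abs_monomial_le)
  also have "\<dots> \<le> (1 + norm \<xi>) ^ mi_size \<beta>" by (intro power_mono) auto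
  finally have "norm (cis (x \<bullet> \<xi>) * of_real (monomial \<xi> \<beta>) :: complex) * norm (matrix_exp (s *\<^sub>R A0_symbol b a \<xi>))
      \<le> (1 + norm \<xi>) ^ mi_size \<beta> * ((real CARD('N))\<^sup>2 * exp (- (\<delta> * s / 2) * norm \<xi> ^ (2 * b)))"
    by (intro mult_mono norm_matrix_exp_A0_symbol_le[OF b s sb]) auto
  then show ?thesis unfolding norm_cscale by (simp only: mult_ac)
qed

lemma integrable_weighted_integrand:
  fixes a :: "('n::finite \<Rightarrow> nat) \<Rightarrow> complex ^ 'N ^ ('N::finite)"
  assumes b: "b \<ge> 1" and \<delta>: "\<delta> > 0" and s: "s > 0" and sb: "strip_bound b \<delta> K a"
  shows "integrable lborel (\<lambda>\<xi>. cscale (cis (x \<bullet> \<xi>) * of_real (monomial \<xi> \<beta>)) (matrix_exp (s *\<^sub>R A0_symbol b a \<xi>)))"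
proof (rule Bochner_Integration.integrable_bound)
  show "integrable lborel (\<lambda>\<xi> :: real ^ 'n. (real CARD('N))\<^sup>2 * ((1 + norm \<xi>) ^ mi_size \<beta> * exp (- (\<delta> * s / 2) * norm \<xi> ^ (2 * b))))"
    using \<delta> s by (intro integrable_mult_right integrable_moment_exp_neg_norm_power b) simp
  show "(\<lambda>\<xi>. cscale (cis (x \<bullet> \<xi>) * of_real (monomial \<xi> \<beta>)) (matrix_exp (s *\<^sub>R A0_symbol b a \<xi>))) \<in> borel_measurable lborel"
    unfolding measurable_lborel2 by (rule borel_measurable_weighted_integrand)
  show "AE \<xi> in lborel. norm (cscale (cis (x \<bullet> \<xi>) * of_real (monomial \<xi> \<beta>)) (matrix_exp (s *\<^sub>R A0_symbol b a \<xi>))) \<le>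
      norm ((real CARD('N))\<^sup>2 * ((1 + norm \<xi>) ^ mi_size \<beta> * exp (- (\<delta> * s / 2) * norm \<xi> ^ (2 * b))))"
    by (intro AE_I2 order_trans[OF norm_weighted_integrand_le[OF b s sb]]) simp
qed

text \<open>
  Homogeneity of the symbol: substitute \<open>\<xi> = s powr (- 1 / (2 * b)) * \<eta>\<close>.
\<close>

lemma weighted_Z_scale:
  fixes a :: "('n::finite \<Rightarrow> nat) \<Rightarrow> complex ^ 'N ^ ('N::finite)"
  assumes b: "b \<ge> 1" and s: "s > 0"
  shows "weighted_Z b a \<beta> s x = s powr (- (real (CARD('n) + mi_size \<beta>) / (2 * real b))) *\<^sub>R
    weighted_Z b a \<beta> 1 (s powr (- (1 / (2 * real b))) *\<^sub>R x)"
proof -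
  define r where "r = s powr (1 / (2 * real b))"
  have r: "r > 0" using s by (simp add: r_def)
  define f where "f \<xi> = cscale (cis (x \<bullet> \<xi>) * of_real (monomial \<xi> \<beta>)) (matrix_exp (s *\<^sub>R A0_symbol b a \<xi>))" for \<xi>
  have fm: "f \<in> borel_measurable borel" unfolding f_def by (rule borel_measurable_weighted_integrand)
  have "f (inverse r *\<^sub>R \<xi>) = inverse r ^ mi_size \<beta> *\<^sub>R
      cscale (cis ((inverse r *\<^sub>R x) \<bullet> \<xi>) * of_real (monomial \<xi> \<beta>)) (matrix_exp (1 *\<^sub>R A0_symbol b a \<xi>))" for \<xi>
  proof -
    have "s *\<^sub>R A0_symbol b a (inverse r *\<^sub>R \<xi>) = 1 *\<^sub>R A0_symbol b a \<xi>"
      unfolding scaleR_A0_symbol[OF b s] using r by (simp add: r_def)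
    then show ?thesis
      unfolding f_def monomial_scaleR
      by (simp only:) (simp add: vec_eq_iff scaleR_conv_of_real[where 'a = complex] mult_ac)
  qed
  then have "(\<integral>\<xi>. f (inverse r *\<^sub>R \<xi>) \<partial>lborel) = inverse r ^ mi_size \<beta> *\<^sub>R
      (\<integral>\<xi>. cscale (cis ((inverse r *\<^sub>R x) \<bullet> \<xi>) * of_real (monomial \<xi> \<beta>)) (matrix_exp (1 *\<^sub>R A0_symbol b a \<xi>)) \<partial>lborel)"
    by (simp only: integral_scaleR_right)
  moreover have "(\<integral>\<xi>. f \<xi> \<partial>lborel) = inverse r ^ CARD('n) *\<^sub>R (\<integral>\<xi>. f (inverse r *\<^sub>R \<xi>) \<partial>lborel)"
    using integral_lborel_scaleR[OF _ fm, of "inverse r"] r by simp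
  ultimately have "weighted_Z b a \<beta> s x = (inverse r ^ CARD('n) * inverse r ^ mi_size \<beta>) *\<^sub>R weighted_Z b a \<beta> 1 (inverse r *\<^sub>R x)"
    by (simp add: weighted_Z_def f_def[symmetric] mult_ac)
  also have "inverse r ^ CARD('n) * inverse r ^ mi_size \<beta> = s powr (- (real (CARD('n) + mi_size \<beta>) / (2 * real b)))"
  proof -
    have "inverse r ^ CARD('n) * inverse r ^ mi_size \<beta> = inverse (r powr real (CARD('n) + mi_size \<beta>))"
      unfolding powr_realpow[OF r] by (simp add: power_add power_inverse)
    also have "r powr real (CARD('n) + mi_size \<beta>) = s powr (real (CARD('n) + mi_size \<beta>) / (2 * real b))"
      unfolding r_def by (simp add: powr_powr)
    finally show ?thesis by (simp add: powr_minus)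
  qed
  also have "inverse r = s powr (- (1 / (2 * real b)))" by (simp add: r_def powr_minus)
  finally show ?thesis .
qed

lemma one_plus_power_le_exp:
  assumes b: "b \<ge> (1::nat)"
  shows "\<exists>C>(0::real). \<forall>\<mu>\<ge>(0::real). (1 + \<mu>) ^ m \<le> C * exp (\<mu> ^ (2 * b))"
proof -
  obtain C where C: "C > 0" "\<And>y. y \<ge> 0 \<Longrightarrow> y powr real m * exp (- 1 * y powr 1) \<le> C"
    using powr_mult_exp_powr_bounded[of "real m" 1 1] by auto
  have "(1 + \<mu>) ^ m \<le> (C * exp 2) * exp (\<mu> ^ (2 * b))" if mu: "\<mu> \<ge> 0" for \<mu> :: real
  proof -
    have "\<mu> \<le> 1 + \<mu> ^ (2 * b)"
    proof (cases "\<mu> \<le> 1")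
      case True
      then show ?thesis using zero_le_power[OF mu, of "2 * b"] by linarith
    next
      case False
      then have "\<mu> ^ 1 \<le> \<mu> ^ (2 * b)" using b by (intro power_increasing) auto
      then show ?thesis by simp
    qed
    then have "exp (1 + \<mu>) \<le> exp (2 + \<mu> ^ (2 * b))" by simp
    have "(1 + \<mu>) ^ m * exp (- (1 + \<mu>)) \<le> C" using C(2)[of "1 + \<mu>"] mu by (simp add: powr_realpow)
    then have "(1 + \<mu>) ^ m * exp (- (1 + \<mu>)) * exp (1 + \<mu>) \<le> C * exp (1 + \<mu>)" by (intro mult_right_mono) auto
    then have "(1 + \<mu>) ^ m \<le> C * exp (1 + \<mu>)" by (simp add: mult.assoc mult_exp_exp)
    also have "\<dots> \<le> C * exp (2 + \<mu> ^ (2 * b))" using C(1) \<open>exp (1 + \<mu>) \<le> _\<close> by (intro mult_left_mono) auto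
    finally show ?thesis by (simp add: exp_add mult.assoc)
  qed
  then show ?thesis using C(1) by (intro exI[of _ "C * exp 2"]) auto
qed

text \<open>
  Shifting \<open>\<xi>\<close> by \<open>\<i>\<mu>x/|x|\<close> multiplies the integrand by \<open>exp (- \<mu> * |x|)\<close> and costs \<open>exp (K * \<mu> ^ (2 * b))\<close> together with
  a polynomial in \<open>\<mu>\<close>.
\<close>

lemma weighted_Z_unit_bound:
  fixes \<beta> :: "'n::finite \<Rightarrow> nat"
  assumes b: "b \<ge> 1" and \<delta>: "\<delta> > 0" and K: "K > 0"
  shows "\<exists>C>0. \<exists>c>0. \<forall>a :: ('n \<Rightarrow> nat) \<Rightarrow> complex ^ 'N ^ ('N::finite). strip_bound b \<delta> K a \<longrightarrow>
    (\<forall>x. norm (weighted_Z b a \<beta> 1 x) \<le> C * exp (- c * (norm x ^ (2 * b)) powr (1 / (2 * real b - 1))))"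
proof -
  define m where "m = mi_size \<beta>"
  define p where "p = 1 / (2 * real b - 1)"
  have p: "p > 0" using b by (simp add: p_def)
  obtain C1 :: real where C1: "C1 > 0" "\<And>\<mu>. \<mu> \<ge> 0 \<Longrightarrow> (1 + \<mu>) ^ m \<le> C1 * exp (\<mu> ^ (2 * b))"
    using one_plus_power_le_exp[OF b, of m] by blast
  define I where "I = (\<integral>\<xi>. (1 + norm \<xi>) ^ m * exp (- (\<delta>/2) * norm \<xi> ^ (2 * b)) \<partial>(lborel :: (real ^ 'n) measure))"
  have Ii: "integrable lborel (\<lambda>\<xi> :: real ^ 'n. (1 + norm \<xi>) ^ m * exp (- (\<delta>/2) * norm \<xi> ^ (2 * b)))"
    using \<delta> by (intro integrable_moment_exp_neg_norm_power b) simp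
  have I0: "I \<ge> 0" unfolding I_def by (intro integral_nonneg_AE AE_I2) auto
  \<comment> \<open>The \<open>+ 1\<close> pays for the polynomial factor \<open>(1 + \<mu>) ^ m\<close>. With \<open>\<mu> ^ (2 * b - 1) = k * |x|\<close>, as chosen below, the cost
    \<open>(K + 1) * \<mu> ^ (2 * b)\<close> is exactly half of the gain \<open>\<mu> * |x|\<close>.\<close>
  define k where "k = 1 / (2 * (K + 1))"
  have k: "k > 0" using K by (simp add: k_def)
  define c where "c = k powr p / 2"
  have c: "c > 0" using k by (simp add: c_def)
  define C where "C = (real CARD('N))\<^sup>2 * (C1 * I) + 1"
  have C: "C > 0" using C1(1) I0 by (simp add: C_def add_nonneg_pos)
  have "norm (weighted_Z b a \<beta> 1 x) \<le> C * exp (- c * (norm x ^ (2 * b)) powr p)"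
    if sb: "strip_bound b \<delta> K a" for a :: "('n \<Rightarrow> nat) \<Rightarrow> complex ^ 'N ^ 'N" and x
  proof -
    define \<mu> where "\<mu> = (norm x * k) powr p"
    define e where "e = sgn x"
    have e: "norm e \<le> 1" by (simp add: e_def norm_sgn)
    have xe: "x \<bullet> e = norm x"
      by (cases "x = 0") (simp_all add: e_def sgn_div_norm dot_square_norm power2_eq_square)
    have mu: "\<mu> \<ge> 0" by (simp add: \<mu>_def)
    define f where "f \<xi> = cscale (cis (x \<bullet> \<xi>) * of_real (monomial \<xi> \<beta>)) (matrix_exp (A0_symbol b a \<xi>))" for \<xi>
    have fi: "integrable lborel f"
      unfolding f_def using integrable_weighted_integrand[OF b \<delta> zero_less_one sb, of x \<beta>] by simp
    have ent: "norm ((\<integral>\<xi>. f \<xi> \<partial>lborel) $ i $ j) \<le> C1 * I * exp (- \<mu> * norm x + (K + 1) * \<mu> ^ (2 * b))" for i j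
    proof -
      have "(\<integral>\<xi>. f \<xi> \<partial>lborel) $ i $ j = (\<integral>\<xi>. f \<xi> $ i $ j \<partial>lborel)"
        by (rule integral_bounded_linear[OF bounded_linear_nth_nth fi, symmetric])
      also have "\<dots> = (\<integral>\<xi>. shifted_integrand b a \<beta> i j x e \<xi> 0 \<partial>lborel)"
        by (simp only: shifted_integrand_0 f_def)
      also have "\<dots> = (\<integral>\<xi>. shifted_integrand b a \<beta> i j x e \<xi> (\<i> * of_real \<mu>) \<partial>lborel)"
        by (rule integral_shifted_integrand_const[OF b \<delta> K sb e, symmetric])
      also have "norm \<dots> \<le> (\<integral>\<xi>. (exp (- \<mu> * norm x + K * \<mu> ^ (2 * b)) * (1 + \<mu>) ^ m) *
          ((1 + norm \<xi>) ^ m * exp (- (\<delta>/2) * norm \<xi> ^ (2 * b))) \<partial>(lborel :: (real ^ 'n) measure))"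
      proof (rule norm_integral_le)
        show "integrable lborel (\<lambda>\<xi> :: real ^ 'n. (exp (- \<mu> * norm x + K * \<mu> ^ (2 * b)) * (1 + \<mu>) ^ m) *
          ((1 + norm \<xi>) ^ m * exp (- (\<delta>/2) * norm \<xi> ^ (2 * b))))"
          by (intro integrable_mult_right Ii)
        fix \<xi> :: "real ^ 'n"
        have "(norm \<xi> + \<mu>) ^ m \<le> ((1 + \<mu>) * (1 + norm \<xi>)) ^ m"
          using mu by (intro power_mono) (auto simp: algebra_simps)
        then have q: "(norm \<xi> + \<mu>) ^ m \<le> (1 + \<mu>) ^ m * (1 + norm \<xi>) ^ m" by (simp only: power_mult_distrib)
        have "norm (shifted_integrand b a \<beta> i j x e \<xi> (\<i> * of_real \<mu>)) \<le>
            exp (- \<mu> * norm x) * (norm \<xi> + \<mu>) ^ m * exp (- (\<delta>/2) * norm \<xi> ^ (2 * b) + K * \<mu> ^ (2 * b))"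
          using norm_shifted_integrand_le[OF sb e, of \<beta> i j x \<xi> "\<i> * of_real \<mu>"] mu by (simp add: xe m_def)
        also have "\<dots> \<le> exp (- \<mu> * norm x) * ((1 + \<mu>) ^ m * (1 + norm \<xi>) ^ m) * exp (- (\<delta>/2) * norm \<xi> ^ (2 * b) + K * \<mu> ^ (2 * b))"
          using q by (intro mult_right_mono mult_left_mono) auto
        also have "\<dots> = (exp (- \<mu> * norm x + K * \<mu> ^ (2 * b)) * (1 + \<mu>) ^ m) * ((1 + norm \<xi>) ^ m * exp (- (\<delta>/2) * norm \<xi> ^ (2 * b)))"
          unfolding exp_add by (simp only: mult_ac)
        finally show "norm (shifted_integrand b a \<beta> i j x e \<xi> (\<i> * of_real \<mu>)) \<le>
          (exp (- \<mu> * norm x + K * \<mu> ^ (2 * b)) * (1 + \<mu>) ^ m) * ((1 + norm \<xi>) ^ m * exp (- (\<delta>/2) * norm \<xi> ^ (2 * b)))" .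
      qed
      also have "\<dots> = (exp (- \<mu> * norm x + K * \<mu> ^ (2 * b)) * (1 + \<mu>) ^ m) * I"
        unfolding I_def by (rule integral_mult_right_zero)
      also have "\<dots> \<le> (exp (- \<mu> * norm x + K * \<mu> ^ (2 * b)) * (C1 * exp (\<mu> ^ (2 * b)))) * I"
        using C1(2)[OF mu] I0 by (intro mult_right_mono mult_left_mono) auto
      also have "\<dots> = C1 * I * exp (- \<mu> * norm x + (K + 1) * \<mu> ^ (2 * b))"
      proof -
        have "- \<mu> * norm x + (K + 1) * \<mu> ^ (2 * b) = (- \<mu> * norm x + K * \<mu> ^ (2 * b)) + \<mu> ^ (2 * b)"
          by (simp add: distrib_right)
        then have "exp (- \<mu> * norm x + (K + 1) * \<mu> ^ (2 * b)) = exp (- \<mu> * norm x + K * \<mu> ^ (2 * b)) * exp (\<mu> ^ (2 * b))"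
          by (simp only: exp_add)
        then show ?thesis by (simp only: mult_ac)
      qed
      finally show ?thesis .
    qed
    have expo: "- \<mu> * norm x + (K + 1) * \<mu> ^ (2 * b) = - c * (norm x ^ (2 * b)) powr p"
    proof (cases "x = 0")
      case True
      then show ?thesis using b by (simp add: \<mu>_def power_0_left)
    next
      case False
      then have nx: "norm x > 0" by simp
      have mu0: "\<mu> > 0" using nx k by (simp add: \<mu>_def)
      have "\<mu> ^ (2 * b) = \<mu> powr (1 + (2 * real b - 1))" using mu0 by (simp add: powr_realpow[symmetric])
      also have "\<dots> = \<mu> * \<mu> powr (2 * real b - 1)" using mu0 by (simp only: powr_add) simp
      also have "\<mu> powr (2 * real b - 1) = norm x * k"
        using b nx k by (simp add: \<mu>_def powr_powr p_def)
      finally have "(K + 1) * \<mu> ^ (2 * b) = \<mu> * norm x * ((K + 1) * k)" by (simp only: mult_ac)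
      also have "(K + 1) * k = 1 / 2" using K by (simp add: k_def)
      finally have 1: "- \<mu> * norm x + (K + 1) * \<mu> ^ (2 * b) = - (\<mu> * norm x) / 2" by simp
      have "(norm x ^ (2 * b)) powr p = norm x powr (real (2 * b) * p)"
        using nx by (simp only: powr_powr[symmetric] powr_realpow)
      also have "real (2 * b) * p = p + 1" using b by (simp add: p_def field_simps)
      also have "norm x powr (p + 1) = norm x powr p * norm x" using nx by (simp add: powr_add)
      finally have "\<mu> * norm x = k powr p * (norm x ^ (2 * b)) powr p"
        using k nx by (simp add: \<mu>_def powr_mult)
      then show ?thesis unfolding 1 by (simp add: c_def)
    qed
    define E where "E = exp (- c * (norm x ^ (2 * b)) powr p)"
    have "norm (\<integral>\<xi>. f \<xi> \<partial>lborel) \<le> (real CARD('N))\<^sup>2 * (C1 * I * E)"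
      by (rule norm_matrix_le_sum) (use ent in \<open>simp only: expo E_def\<close>)
    moreover have "norm (weighted_Z b a \<beta> 1 x) = norm (\<integral>\<xi>. f \<xi> \<partial>lborel) / (2 * pi) ^ CARD('n)"
      by (simp add: weighted_Z_def f_def)
    moreover have "\<dots> \<le> norm (\<integral>\<xi>. f \<xi> \<partial>lborel) / 1"
    proof (intro divide_left_mono)
      show "1 \<le> (2 * pi) ^ CARD('n)" using pi_ge_two by (intro one_le_power) simp
    qed auto
    ultimately have "norm (weighted_Z b a \<beta> 1 x) \<le> (real CARD('N))\<^sup>2 * (C1 * I) * E" by (simp add: mult_ac)
    also have "\<dots> \<le> C * E" by (intro mult_right_mono) (auto simp: C_def E_def)
    finally show ?thesis by (simp add: E_def)
  qed
  then show ?thesis unfolding p_def using C c by blast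
qed

lemma norm_root_scaled_power:
  assumes "b \<ge> 1" "s > 0"
  shows "norm (s powr (- (1 / (2 * real b))) *\<^sub>R x) ^ (2 * b) = norm x ^ (2 * b) / s"
proof -
  have "(s powr (- (1 / (2 * real b)))) ^ (2 * b) = inverse s"
    by (simp only: powr_minus power_inverse root_powr_power[OF assms])
  then have "(s powr (- (1 / (2 * real b))) * norm x) ^ (2 * b) = inverse s * norm x ^ (2 * b)"
    by (simp only: power_mult_distrib)
  moreover have "norm (s powr (- (1 / (2 * real b))) *\<^sub>R x) = s powr (- (1 / (2 * real b))) * norm x"
    by simp
  ultimately show ?thesis by (simp only: divide_inverse mult.commute)
qed

lemma weighted_Z_bound:
  fixes \<beta> :: "'n::finite \<Rightarrow> nat"
  assumes b: "b \<ge> 1" and \<delta>: "\<delta> > 0" and K: "K > 0"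
  shows "\<exists>C>0. \<exists>c>0. \<forall>a :: ('n \<Rightarrow> nat) \<Rightarrow> complex ^ 'N ^ ('N::finite). strip_bound b \<delta> K a \<longrightarrow>
    (\<forall>s>0. \<forall>x. norm (weighted_Z b a \<beta> s x) \<le> C * s powr (- (real (CARD('n) + mi_size \<beta>) / (2 * real b))) *
      exp (- c * (norm x ^ (2 * b) / s) powr (1 / (2 * real b - 1))))"
proof -
  obtain C c where Cc: "C > 0" "c > 0" and bd: "\<forall>a :: ('n \<Rightarrow> nat) \<Rightarrow> complex ^ 'N ^ 'N. strip_bound b \<delta> K a \<longrightarrow>
    (\<forall>x. norm (weighted_Z b a \<beta> 1 x) \<le> C * exp (- c * (norm x ^ (2 * b)) powr (1 / (2 * real b - 1))))"
    using weighted_Z_unit_bound[OF b \<delta> K, of \<beta>, where 'N = 'N] by blast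
  have "norm (weighted_Z b a \<beta> s x) \<le> C * s powr (- (real (CARD('n) + mi_size \<beta>) / (2 * real b))) *
      exp (- c * (norm x ^ (2 * b) / s) powr (1 / (2 * real b - 1)))"
    if sb: "strip_bound b \<delta> K a" and s: "s > 0" for a :: "('n \<Rightarrow> nat) \<Rightarrow> complex ^ 'N ^ 'N" and s x
  proof -
    define X where "X = s powr (- (1 / (2 * real b))) *\<^sub>R x"
    define S where "S = s powr (- (real (CARD('n) + mi_size \<beta>) / (2 * real b)))"
    have "norm (weighted_Z b a \<beta> s x) = S * norm (weighted_Z b a \<beta> 1 X)"
      unfolding weighted_Z_scale[OF b s, of a \<beta> x] X_def S_def by simp
    also have "\<dots> \<le> S * (C * exp (- c * (norm X ^ (2 * b)) powr (1 / (2 * real b - 1))))"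
      by (intro mult_left_mono bd[rule_format, OF sb]) (simp add: S_def)
    also have "norm X ^ (2 * b) = norm x ^ (2 * b) / s"
      unfolding X_def by (rule norm_root_scaled_power[OF b s])
    finally show ?thesis by (simp add: S_def mult_ac)
  qed
  then show ?thesis using Cc by blast
qed

lemma monomial_Suc: "monomial \<xi> (\<beta>(l := Suc (\<beta> l))) = \<xi> $ l * monomial \<xi> \<beta>"
proof -
  have "monomial \<xi> (\<beta>(l := Suc (\<beta> l))) = (\<Prod>j\<in>UNIV. (if j = l then \<xi> $ l else 1) * (\<xi> $ j) ^ \<beta> j)"
    unfolding monomial_def by (intro prod.cong) auto
  then show ?thesis by (simp add: prod.distrib monomial_def)
qed

lemma weighted_Z_has_derivative:
  fixes a :: "('n::finite \<Rightarrow> nat) \<Rightarrow> complex ^ 'N ^ ('N::finite)"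
  assumes b: "b \<ge> 1" and \<delta>: "\<delta> > 0" and s: "s > 0" and sb: "strip_bound b \<delta> K a"
  shows "(weighted_Z b a \<beta> s has_derivative
    (\<lambda>h. \<Sum>l\<in>UNIV. h $ l *\<^sub>R cscale \<i> (weighted_Z b a (\<beta>(l := Suc (\<beta> l))) s x))) (at x)"
proof -
  define E where "E \<xi> = matrix_exp (s *\<^sub>R A0_symbol b a \<xi>)" for \<xi>
  define F where "F \<xi> x = cscale (cis (x \<bullet> \<xi>) * of_real (monomial \<xi> \<beta>)) (E \<xi>)" for \<xi> x
  define F' where "F' \<xi> x h = cscale (of_real (h \<bullet> \<xi>) * (\<i> * cis (x \<bullet> \<xi>)) * of_real (monomial \<xi> \<beta>)) (E \<xi>)" for \<xi> x h
  define G where "G \<xi> = (real CARD('N))\<^sup>2 * ((1 + norm \<xi>) ^ (mi_size \<beta> + 1) * exp (- (\<delta> * s / 2) * norm \<xi> ^ (2 * b)))" for \<xi> :: "real ^ 'n"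
  have Gi: "integrable lborel G"
    unfolding G_def using \<delta> s by (intro integrable_mult_right integrable_moment_exp_neg_norm_power b) simp
  have der: "(F \<xi> has_derivative F' \<xi> y) (at y)" for \<xi> y
  proof -
    have "((\<lambda>y. cis (y \<bullet> \<xi>)) has_derivative (\<lambda>h. of_real (h \<bullet> \<xi>) * (\<i> * cis (y \<bullet> \<xi>)))) (at y)"
      by (auto intro!: derivative_eq_intros simp: scaleR_conv_of_real)
    then have "((\<lambda>y. cis (y \<bullet> \<xi>) * of_real (monomial \<xi> \<beta>)) has_derivative
        (\<lambda>h. of_real (h \<bullet> \<xi>) * (\<i> * cis (y \<bullet> \<xi>)) * of_real (monomial \<xi> \<beta>))) (at y)"
      by (rule has_derivative_mult_left)
    from bounded_linear.has_derivative[OF bounded_linear_cscale_left[where A = "E \<xi>"] this]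
    show ?thesis unfolding F_def F'_def .
  qed
  have bd: "norm (F' \<xi> y h) \<le> G \<xi> * norm h" for \<xi> y h
  proof -
    have "norm (F' \<xi> y h) = \<bar>h \<bullet> \<xi>\<bar> * norm (F \<xi> y)"
      by (simp add: F'_def F_def norm_cscale norm_mult)
    also have "\<dots> \<le> (norm h * (1 + norm \<xi>)) *
        ((real CARD('N))\<^sup>2 * ((1 + norm \<xi>) ^ mi_size \<beta> * exp (- (\<delta> * s / 2) * norm \<xi> ^ (2 * b))))"
    proof (rule mult_mono)
      have "\<bar>h \<bullet> \<xi>\<bar> \<le> norm h * norm \<xi>" by (rule Cauchy_Schwarz_ineq2)
      also have "\<dots> \<le> norm h * (1 + norm \<xi>)" by (intro mult_left_mono) auto
      finally show "\<bar>h \<bullet> \<xi>\<bar> \<le> norm h * (1 + norm \<xi>)" .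
      show "norm (F \<xi> y) \<le> (real CARD('N))\<^sup>2 * ((1 + norm \<xi>) ^ mi_size \<beta> * exp (- (\<delta> * s / 2) * norm \<xi> ^ (2 * b)))"
        unfolding F_def E_def by (rule norm_weighted_integrand_le[OF b s sb])
    qed auto
    also have "\<dots> = G \<xi> * norm h" by (simp add: G_def)
    finally show ?thesis .
  qed
  have int: "integrable lborel (\<lambda>\<xi>. F \<xi> y)" for y
    unfolding F_def E_def by (rule integrable_weighted_integrand[OF b \<delta> s sb])
  have D: "((\<lambda>y. \<integral>\<xi>. F \<xi> y \<partial>lborel) has_derivative (\<lambda>h. \<integral>\<xi>. F' \<xi> x h \<partial>lborel)) (at x)"
    by (rule integral_has_derivative_dominated(1)[where r = 1 and g = G]) (use int der bd Gi in \<open>auto simp: G_def\<close>)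
  have F'_eq: "(\<integral>\<xi>. F' \<xi> x h \<partial>lborel) = (\<Sum>l\<in>UNIV. h $ l *\<^sub>R cscale \<i>
      (\<integral>\<xi>. cscale (cis (x \<bullet> \<xi>) * of_real (monomial \<xi> (\<beta>(l := Suc (\<beta> l))))) (E \<xi>) \<partial>lborel))" for h
  proof -
    have i: "integrable lborel (\<lambda>\<xi>. cscale (cis (x \<bullet> \<xi>) * of_real (monomial \<xi> (\<beta>(l := Suc (\<beta> l))))) (E \<xi>))" for l
      unfolding E_def by (rule integrable_weighted_integrand[OF b \<delta> s sb])
    have "F' \<xi> x h = (\<Sum>l\<in>UNIV. h $ l *\<^sub>R cscale \<i> (cscale (cis (x \<bullet> \<xi>) * of_real (monomial \<xi> (\<beta>(l := Suc (\<beta> l))))) (E \<xi>)))" for \<xi>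
    proof -
      have "h \<bullet> \<xi> = (\<Sum>l\<in>UNIV. h $ l * \<xi> $ l)" by (simp add: inner_vec_def)
      then show ?thesis
        by (simp add: F'_def vec_eq_iff monomial_Suc sum_distrib_left sum_distrib_right
            scaleR_conv_of_real[where 'a = complex] mult_ac)
    qed
    then have "(\<integral>\<xi>. F' \<xi> x h \<partial>lborel) = (\<integral>\<xi>. (\<Sum>l\<in>UNIV. h $ l *\<^sub>R cscale \<i> (cscale (cis (x \<bullet> \<xi>) * of_real (monomial \<xi> (\<beta>(l := Suc (\<beta> l))))) (E \<xi>))) \<partial>lborel)"
      by simp
    also have "\<dots> = (\<Sum>l\<in>UNIV. h $ l *\<^sub>R (\<integral>\<xi>. cscale \<i> (cscale (cis (x \<bullet> \<xi>) * of_real (monomial \<xi> (\<beta>(l := Suc (\<beta> l))))) (E \<xi>)) \<partial>lborel))"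
      by (subst Bochner_Integration.integral_sum)
         (auto intro!: integrable_scaleR_right integrable_bounded_linear[OF bounded_linear_cscale_right] i)
    also have "\<dots> = (\<Sum>l\<in>UNIV. h $ l *\<^sub>R cscale \<i> (\<integral>\<xi>. cscale (cis (x \<bullet> \<xi>) * of_real (monomial \<xi> (\<beta>(l := Suc (\<beta> l))))) (E \<xi>) \<partial>lborel))"
      by (simp only: integral_bounded_linear[OF bounded_linear_cscale_right i])
    finally show ?thesis .
  qed
  have scale: "cscale \<i> (r *\<^sub>R A) = r *\<^sub>R cscale \<i> A" for r and A :: "complex ^ 'N ^ 'N"
    using linear_cmul[OF bounded_linear.linear[OF bounded_linear_cscale_right]] .
  have "((\<lambda>y. (1 / (2 * pi) ^ CARD('n)) *\<^sub>R (\<integral>\<xi>. F \<xi> y \<partial>lborel)) has_derivative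
     (\<lambda>h. (1 / (2 * pi) ^ CARD('n)) *\<^sub>R (\<integral>\<xi>. F' \<xi> x h \<partial>lborel))) (at x)"
    by (rule has_derivative_scaleR_right[OF D])
  then show ?thesis
    unfolding F'_eq F_def E_def weighted_Z_def[abs_def] scaleR_sum_right scale
    by (simp only: scaleR_left_commute)
qed

text \<open>
  The integrand is odd in \<open>\<xi>\<close>, since the order \<open>2 * b\<close> of the symbol is even.
\<close>

lemma weighted_Z_odd_0:
  fixes a :: "('n::finite \<Rightarrow> nat) \<Rightarrow> complex ^ 'N ^ ('N::finite)"
  assumes "odd (mi_size \<beta>)"
  shows "weighted_Z b a \<beta> s 0 = 0"
proof -
  define f where "f \<xi> = cscale (cis (0 \<bullet> \<xi>) * of_real (monomial \<xi> \<beta>)) (matrix_exp (s *\<^sub>R A0_symbol b a \<xi>))" for \<xi>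
  have "f ((-1) *\<^sub>R \<xi>) = - f \<xi>" for \<xi>
    unfolding f_def monomial_scaleR A0_symbol_scaleR using assms
    by (simp add: vec_eq_iff)
  moreover have "(\<integral>\<xi>. f \<xi> \<partial>lborel) = \<bar>-1\<bar> ^ DIM(real ^ 'n) *\<^sub>R (\<integral>\<xi>. f ((-1) *\<^sub>R \<xi>) \<partial>lborel)"
    unfolding f_def by (rule integral_lborel_scaleR[OF _ borel_measurable_weighted_integrand]) simp
  ultimately have "(\<integral>\<xi>. f \<xi> \<partial>lborel) = - (\<integral>\<xi>. f \<xi> \<partial>lborel)" by simp
  then have "2 *\<^sub>R (\<integral>\<xi>. f \<xi> \<partial>lborel) = 0" unfolding scaleR_2 eq_neg_iff_add_eq_0 .
  then have "(\<integral>\<xi>. f \<xi> \<partial>lborel) = 0" by simp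
  then show ?thesis by (simp add: weighted_Z_def f_def)
qed

text \<open>
  Vanishing at \<open>x = 0\<close> gains a factor \<open>|x|\<close>, by the mean value inequality at time \<open>1\<close>; scaling turns it into
  \<open>|x| * s powr (- 1 / (2 * b))\<close>.
\<close>

lemma weighted_Z_odd_bound:
  fixes \<beta> :: "'n::finite \<Rightarrow> nat"
  assumes b: "b \<ge> 1" and \<delta>: "\<delta> > 0" and K: "K > 0" and odd: "odd (mi_size \<beta>)"
  shows "\<exists>C>0. \<exists>c>0. \<forall>a :: ('n \<Rightarrow> nat) \<Rightarrow> complex ^ 'N ^ ('N::finite). strip_bound b \<delta> K a \<longrightarrow>
    (\<forall>s>0. \<forall>x. norm (weighted_Z b a \<beta> s x) \<le> C * norm x * s powr (- (real (CARD('n) + mi_size \<beta> + 1) / (2 * real b))) *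
      exp (- c * (norm x ^ (2 * b) / s) powr (1 / (2 * real b - 1))))"
proof -
  define p where "p = 1 / (2 * real b - 1)"
  have p: "p > 0" using b by (simp add: p_def)
  obtain C c where Cc: "C > 0" "c > 0" and bd: "\<forall>a :: ('n \<Rightarrow> nat) \<Rightarrow> complex ^ 'N ^ 'N. strip_bound b \<delta> K a \<longrightarrow>
    (\<forall>x. norm (weighted_Z b a \<beta> 1 x) \<le> C * exp (- c * (norm x ^ (2 * b)) powr p))"
    using weighted_Z_unit_bound[OF b \<delta> K, of \<beta>, where 'N = 'N] unfolding p_def by blast
  have "\<forall>l. \<exists>D>0. \<forall>a :: ('n \<Rightarrow> nat) \<Rightarrow> complex ^ 'N ^ 'N. strip_bound b \<delta> K a \<longrightarrow>
    (\<forall>x. norm (weighted_Z b a (\<beta>(l := Suc (\<beta> l))) 1 x) \<le> D)"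
  proof
    fix l
    obtain C c where Cc: "C > 0" "c > 0" and bd: "\<forall>a :: ('n \<Rightarrow> nat) \<Rightarrow> complex ^ 'N ^ 'N. strip_bound b \<delta> K a \<longrightarrow>
      (\<forall>x. norm (weighted_Z b a (\<beta>(l := Suc (\<beta> l))) 1 x) \<le> C * exp (- c * (norm x ^ (2 * b)) powr p))"
      using weighted_Z_unit_bound[OF b \<delta> K, of "\<beta>(l := Suc (\<beta> l))", where 'N = 'N] unfolding p_def by blast
    have "norm (weighted_Z b a (\<beta>(l := Suc (\<beta> l))) 1 x) \<le> C" if "strip_bound b \<delta> K a" for a :: "('n \<Rightarrow> nat) \<Rightarrow> complex ^ 'N ^ 'N" and x
    proof -
      have "C * exp (- c * (norm x ^ (2 * b)) powr p) \<le> C * 1" using Cc by (intro mult_left_mono) auto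
      then show ?thesis using bd[rule_format, OF that, of x] by simp
    qed
    then show "\<exists>D>0. \<forall>a :: ('n \<Rightarrow> nat) \<Rightarrow> complex ^ 'N ^ 'N. strip_bound b \<delta> K a \<longrightarrow>
      (\<forall>x. norm (weighted_Z b a (\<beta>(l := Suc (\<beta> l))) 1 x) \<le> D)" using Cc(1) by blast
  qed
  then obtain D where D: "\<And>l. D l > 0" "\<And>l a x. strip_bound b \<delta> K (a :: ('n \<Rightarrow> nat) \<Rightarrow> complex ^ 'N ^ 'N) \<Longrightarrow>
      norm (weighted_Z b a (\<beta>(l := Suc (\<beta> l))) 1 x) \<le> D l"
    by metis
  define L where "L = (\<Sum>l\<in>UNIV. D l)"
  have L: "L \<ge> 0" unfolding L_def using D(1) by (intro sum_nonneg) (auto intro: less_imp_le)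
  define B where "B = (C + L + 1) * exp c"
  have B: "B > 0" using Cc L by (simp add: B_def add_nonneg_pos)
  have unit: "norm (weighted_Z b a \<beta> 1 x) \<le> B * norm x * exp (- c * (norm x ^ (2 * b)) powr p)"
    if sb: "strip_bound b \<delta> K a" for a :: "('n \<Rightarrow> nat) \<Rightarrow> complex ^ 'N ^ 'N" and x
  proof (cases "norm x \<le> 1")
    case True
    have "norm (weighted_Z b a \<beta> 1 x - weighted_Z b a \<beta> 1 0) \<le> L * norm (x - 0)"
    proof (rule differentiable_bound[where S = UNIV and f = "weighted_Z b a \<beta> 1" and B = L])
      show "(weighted_Z b a \<beta> 1 has_derivative
        (\<lambda>h. \<Sum>l\<in>UNIV. h $ l *\<^sub>R cscale \<i> (weighted_Z b a (\<beta>(l := Suc (\<beta> l))) 1 y))) (at y within UNIV)" for y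
        using weighted_Z_has_derivative[OF b \<delta> zero_less_one sb] by simp
      show "onorm (\<lambda>h. \<Sum>l\<in>UNIV. h $ l *\<^sub>R cscale \<i> (weighted_Z b a (\<beta>(l := Suc (\<beta> l))) 1 y)) \<le> L" for y
      proof (rule onorm_bound[OF L])
        fix h :: "real ^ 'n"
        have "norm (\<Sum>l\<in>UNIV. h $ l *\<^sub>R cscale \<i> (weighted_Z b a (\<beta>(l := Suc (\<beta> l))) 1 y)) \<le> (\<Sum>l\<in>UNIV. norm h * D l)"
          by (intro order_trans[OF norm_sum] sum_mono)
             (simp add: norm_cscale mult_mono component_le_norm_cart D(2)[OF sb])
        then show "norm (\<Sum>l\<in>UNIV. h $ l *\<^sub>R cscale \<i> (weighted_Z b a (\<beta>(l := Suc (\<beta> l))) 1 y)) \<le> L * norm h"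
          by (simp add: L_def sum_distrib_left sum_distrib_right mult.commute)
      qed
    qed auto
    then have "norm (weighted_Z b a \<beta> 1 x) \<le> L * norm x" by (simp add: weighted_Z_odd_0[OF odd])
    also have "\<dots> \<le> ((C + L + 1) * norm x) * (exp c * exp (- c * (norm x ^ (2 * b)) powr p))"
    proof -
      have "(norm x ^ (2 * b)) powr p \<le> 1" using True p by (intro powr_le1) (auto simp: power_le_one)
      then have "c * (norm x ^ (2 * b)) powr p \<le> c * 1" using Cc(2) by (intro mult_left_mono) auto
      then have "1 \<le> exp c * exp (- c * (norm x ^ (2 * b)) powr p)" by (simp add: mult_exp_exp)
      moreover have "L * norm x \<le> (C + L + 1) * norm x" using Cc(1) by (intro mult_right_mono) auto
      ultimately show ?thesis using mult_mono[of "L * norm x" "(C + L + 1) * norm x" 1] Cc(1) L by simp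
    qed
    finally show ?thesis by (simp add: B_def mult_ac)
  next
    case False
    have "norm (weighted_Z b a \<beta> 1 x) \<le> C * exp (- c * (norm x ^ (2 * b)) powr p)" using bd sb by blast
    also have "\<dots> \<le> (B * norm x) * exp (- c * (norm x ^ (2 * b)) powr p)"
    proof (rule mult_right_mono)
      have "(C + L + 1) * 1 \<le> (C + L + 1) * exp c" using Cc L by (intro mult_left_mono) auto
      then have "C \<le> B * 1" using L by (simp add: B_def)
      also have "\<dots> \<le> B * norm x" using False B by (intro mult_left_mono) auto
      finally show "C \<le> B * norm x" .
    qed simp
    finally show ?thesis .
  qed
  have "norm (weighted_Z b a \<beta> s x) \<le> B * norm x * s powr (- (real (CARD('n) + mi_size \<beta> + 1) / (2 * real b))) *
      exp (- c * (norm x ^ (2 * b) / s) powr p)"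
    if sb: "strip_bound b \<delta> K a" and s: "s > 0" for a :: "('n \<Rightarrow> nat) \<Rightarrow> complex ^ 'N ^ 'N" and s x
  proof -
    define X where "X = s powr (- (1 / (2 * real b))) *\<^sub>R x"
    define S where "S = s powr (- (real (CARD('n) + mi_size \<beta>) / (2 * real b)))"
    have "norm (weighted_Z b a \<beta> s x) = S * norm (weighted_Z b a \<beta> 1 X)"
      unfolding weighted_Z_scale[OF b s, of a \<beta> x] X_def S_def by simp
    also have "\<dots> \<le> S * (B * norm X * exp (- c * (norm X ^ (2 * b)) powr p))"
      by (intro mult_left_mono unit[OF sb]) (simp add: S_def)
    also have "norm X ^ (2 * b) = norm x ^ (2 * b) / s"
      unfolding X_def by (rule norm_root_scaled_power[OF b s])
    also have "norm X = s powr (- (1 / (2 * real b))) * norm x" by (simp add: X_def)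
    also have "S * (B * (s powr (- (1 / (2 * real b))) * norm x) * exp (- c * (norm x ^ (2 * b) / s) powr p)) =
        B * norm x * (S * s powr (- (1 / (2 * real b)))) * exp (- c * (norm x ^ (2 * b) / s) powr p)"
      by (simp only: mult_ac)
    also have "S * s powr (- (1 / (2 * real b))) = s powr (- (real (CARD('n) + mi_size \<beta> + 1) / (2 * real b)))"
      using s by (simp add: S_def powr_add[symmetric] add_divide_distrib)
    finally show ?thesis .
  qed
  then show ?thesis unfolding p_def[symmetric] using B Cc(2) by blast
qed

lemma continuous_on_weighted_Z_time:
  fixes a :: "('n::finite \<Rightarrow> nat) \<Rightarrow> complex ^ 'N ^ ('N::finite)"
  assumes b: "b \<ge> 1" and \<delta>: "\<delta> > 0" and sb: "strip_bound b \<delta> K a"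
  shows "continuous_on {0<..} (\<lambda>s. weighted_Z b a \<beta> s x)"
proof -
  have c: "continuous_on UNIV (weighted_Z b a \<beta> 1)"
    by (rule has_derivative_continuous_on)
       (rule has_derivative_at_withinI[OF weighted_Z_has_derivative[OF b \<delta> zero_less_one sb]])
  have "continuous_on {0<..} (\<lambda>s. s powr (- (real (CARD('n) + mi_size \<beta>) / (2 * real b))) *\<^sub>R
    weighted_Z b a \<beta> 1 (s powr (- (1 / (2 * real b))) *\<^sub>R x))"
    by (intro continuous_intros continuous_on_compose2[OF c]) auto
  then show ?thesis
    by (rule continuous_on_eq) (use weighted_Z_scale[OF b, of _ a \<beta> x] in simp)
qed

section \<open>The subordination integral\<close>

text \<open>
  The product of the bounds for the two factors of \<open>frac_kernel\<close> in the variable \<open>z = s * t powr (- \<alpha>)\<close>.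
\<close>

definition subord_integrand :: "real \<Rightarrow> real \<Rightarrow> real \<Rightarrow> real \<Rightarrow> real \<Rightarrow> real \<Rightarrow> real \<Rightarrow> real" where
  "subord_integrand q p c1 c2 \<nu> R z = exp (- c1 * z powr q) * z powr (- \<nu>) * exp (- c2 * (R / z) powr p)"

definition subord_integral :: "real \<Rightarrow> real \<Rightarrow> real \<Rightarrow> real \<Rightarrow> real \<Rightarrow> real \<Rightarrow> real" where
  "subord_integral q p c1 c2 \<nu> R = (\<integral>z. subord_integrand q p c1 c2 \<nu> R z \<partial>halfline)"

lemma borel_measurable_subord_integrand: "subord_integrand q p c1 c2 \<nu> R \<in> borel_measurable halfline"
  unfolding subord_integrand_def[abs_def] by (rule borel_measurable_halfline) measurable

lemma powr_scaled_inverse: "R > (0::real) \<Longrightarrow> z > 0 \<Longrightarrow> (R / z) powr p = R powr p * (1 / z) powr p"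
  by (simp add: powr_divide)

lemma powr_neg_mult_exp_bounded:
  assumes "\<nu> \<ge> 0" "c > 0" "p > 0" "R0 > (0::real)"
  shows "\<exists>C>0. \<forall>R\<ge>R0. \<forall>z>0. z powr (- \<nu>) * exp (- c * (R / z) powr p) \<le> C"
proof -
  have "c * R0 powr p > 0" using assms by simp
  then obtain C where C: "C > 0" "\<And>z. z > 0 \<Longrightarrow> z powr (- \<nu>) * exp (- (c * R0 powr p) * (1 / z) powr p) \<le> C"
    using powr_mult_exp_powr_inverse_bounded[of \<nu> "c * R0 powr p" p] assms by blast
  have "z powr (- \<nu>) * exp (- c * (R / z) powr p) \<le> C" if R: "R \<ge> R0" and z: "z > 0" for R z
  proof -
    have "(R0 / z) powr p \<le> (R / z) powr p"
      using R z assms by (intro powr_mono2 divide_right_mono) auto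
    then have "c * (R0 / z) powr p \<le> c * (R / z) powr p" using assms by (intro mult_left_mono) auto
    then have "exp (- c * (R / z) powr p) \<le> exp (- (c * R0 powr p) * (1 / z) powr p)"
      using powr_scaled_inverse[OF assms(4) z, of p] by simp
    then have "z powr (- \<nu>) * exp (- c * (R / z) powr p) \<le> z powr (- \<nu>) * exp (- (c * R0 powr p) * (1 / z) powr p)"
      by (intro mult_left_mono) auto
    then show ?thesis using C(2)[OF z] by linarith
  qed
  then show ?thesis using C(1) by blast
qed

lemma integrable_subord_integrand:
  assumes q: "q > 0" and p: "p > 0" and c: "c1 > 0" "c2 > 0" and nu: "\<nu> \<ge> 0" and R: "R > 0"
  shows "integrable halfline (subord_integrand q p c1 c2 \<nu> R)"
proof -
  obtain C where C: "C > 0" "\<And>z. z > 0 \<Longrightarrow> z powr (- \<nu>) * exp (- c2 * (R / z) powr p) \<le> C"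
    using powr_neg_mult_exp_bounded[OF nu c(2) p R] by blast
  show ?thesis
  proof (rule Bochner_Integration.integrable_bound)
    show "integrable halfline (\<lambda>z. C * exp (- c1 * z powr q))"
      by (intro integrable_mult_right integrable_halfline_exp_powr c q)
    show "AE z in halfline. norm (subord_integrand q p c1 c2 \<nu> R z) \<le> norm (C * exp (- c1 * z powr q))"
    proof (rule AE_I2)
      fix z assume "z \<in> space halfline"
      then have "exp (- c1 * z powr q) * (z powr (- \<nu>) * exp (- c2 * (R / z) powr p)) \<le> exp (- c1 * z powr q) * C"
        by (intro mult_left_mono C) auto
      then show "norm (subord_integrand q p c1 c2 \<nu> R z) \<le> norm (C * exp (- c1 * z powr q))"
        using C(1) by (simp add: subord_integrand_def abs_mult mult_ac)
    qed
  qed (rule borel_measurable_subord_integrand)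
qed

text \<open>
  The two exponentials balance at \<open>z = R powr (p / (q + p))\<close>: for larger \<open>z\<close> the first, for smaller \<open>z\<close> the second is at most
  \<open>exp (- c * R powr (q * p / (q + p)))\<close>. Half of each is spent on this, the other halves keep the integral
  finite.
\<close>

lemma subord_integral_decay:
  assumes q: "q > 0" and p: "p > 0" and c: "c1 > 0" "c2 > 0" and nu: "\<nu> \<ge> 0"
  shows "\<exists>C>0. \<exists>\<sigma>>0. \<forall>R\<ge>1. subord_integral q p c1 c2 \<nu> R \<le> C * exp (- \<sigma> * R powr (q * p / (q + p)))"
proof -
  obtain C where C: "C > 0" "\<And>R z. R \<ge> 1 \<Longrightarrow> z > 0 \<Longrightarrow> z powr (- \<nu>) * exp (- (c2/2) * (R / z) powr p) \<le> C"
    using powr_neg_mult_exp_bounded[OF nu _ p zero_less_one, of "c2/2"] c by auto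
  define \<sigma> where "\<sigma> = min (c1/2) (c2/2)"
  have s: "\<sigma> > 0" using c by (simp add: \<sigma>_def)
  define r where "r = q * p / (q + p)"
  define I where "I = (\<integral>z. exp (- (c1/2) * z powr q) \<partial>halfline)"
  have Ii: "integrable halfline (\<lambda>z. exp (- (c1/2) * z powr q))"
    using c by (intro integrable_halfline_exp_powr q) simp
  have I: "I \<ge> 0" unfolding I_def by (intro integral_nonneg_AE AE_I2) auto
  have "subord_integral q p c1 c2 \<nu> R \<le> (C * I + 1) * exp (- \<sigma> * R powr r)" if R: "R \<ge> 1" for R
  proof -
    have split: "\<sigma> * R powr r \<le> (c1/2) * z powr q + (c2/2) * (R / z) powr p" if z: "z > 0" for z
    proof (cases "R powr (p / (q + p)) \<le> z")
      case True
      have "R powr r = (R powr (p / (q + p))) powr q" using R by (simp add: r_def powr_powr mult.commute)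
      also have "\<dots> \<le> z powr q" using True q by (intro powr_mono2) auto
      finally have "\<sigma> * R powr r \<le> (c1/2) * z powr q" using s c by (intro mult_mono) (auto simp: \<sigma>_def)
      moreover have "(c2/2) * (R / z) powr p \<ge> 0" using c by simp
      ultimately show ?thesis by linarith
    next
      case False
      have "R powr (q / (q + p)) * R powr (p / (q + p)) = R powr 1"
        unfolding powr_add[symmetric] using q p by (simp add: add_divide_distrib[symmetric])
      then have RR: "R powr (q / (q + p)) * R powr (p / (q + p)) = R" using R by simp
      have "R powr (q / (q + p)) * z \<le> R powr (q / (q + p)) * R powr (p / (q + p))"
        using False by (intro mult_left_mono) auto
      then have "R powr (q / (q + p)) \<le> R / z" using z RR by (simp add: field_simps)
      then have "(R powr (q / (q + p))) powr p \<le> (R / z) powr p" using p by (intro powr_mono2) auto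
      moreover have "(R powr (q / (q + p))) powr p = R powr r" using R by (simp add: r_def powr_powr mult.commute)
      ultimately have "\<sigma> * R powr r \<le> (c2/2) * (R / z) powr p" using s c by (intro mult_mono) (auto simp: \<sigma>_def)
      moreover have "(c1/2) * z powr q \<ge> 0" using c by simp
      ultimately show ?thesis by linarith
    qed
    have "subord_integral q p c1 c2 \<nu> R \<le> (\<integral>z. (C * exp (- \<sigma> * R powr r)) * exp (- (c1/2) * z powr q) \<partial>halfline)"
      unfolding subord_integral_def
    proof (rule integral_mono)
      show "integrable halfline (subord_integrand q p c1 c2 \<nu> R)"
        using R by (intro integrable_subord_integrand q p c nu) auto
      show "integrable halfline (\<lambda>z. (C * exp (- \<sigma> * R powr r)) * exp (- (c1/2) * z powr q))"
        by (intro integrable_mult_right Ii)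
      fix z assume "z \<in> space halfline"
      then have z: "z > 0" by simp
      have e1: "exp (- c1 * z powr q) = exp (- (c1/2) * z powr q) * exp (- (c1/2) * z powr q)"
        by (simp add: mult_exp_exp)
      have e2: "exp (- c2 * (R / z) powr p) = exp (- (c2/2) * (R / z) powr p) * exp (- (c2/2) * (R / z) powr p)"
        by (simp add: mult_exp_exp)
      have "subord_integrand q p c1 c2 \<nu> R z = exp (- (c1/2) * z powr q) *
         ((exp (- (c1/2) * z powr q) * exp (- (c2/2) * (R / z) powr p)) * (z powr (- \<nu>) * exp (- (c2/2) * (R / z) powr p)))"
        unfolding subord_integrand_def e1 e2 by (simp only: mult_ac)
      also have "\<dots> \<le> exp (- (c1/2) * z powr q) * (exp (- \<sigma> * R powr r) * C)"
      proof (intro mult_left_mono mult_mono)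
        show "exp (- (c1/2) * z powr q) * exp (- (c2/2) * (R / z) powr p) \<le> exp (- \<sigma> * R powr r)"
          unfolding mult_exp_exp using split[OF z] by simp
        show "z powr (- \<nu>) * exp (- (c2/2) * (R / z) powr p) \<le> C" by (rule C(2)[OF R z])
      qed auto
      finally show "subord_integrand q p c1 c2 \<nu> R z \<le> (C * exp (- \<sigma> * R powr r)) * exp (- (c1/2) * z powr q)"
        by (simp only: mult_ac)
    qed
    also have "\<dots> = (C * I) * exp (- \<sigma> * R powr r)" by (simp add: I_def)
    also have "\<dots> \<le> (C * I + 1) * exp (- \<sigma> * R powr r)" by (intro mult_right_mono) auto
    finally show ?thesis .
  qed
  moreover have "C * I + 1 > 0" using C(1) I by (simp add: add_nonneg_pos)
  ultimately show ?thesis unfolding r_def[symmetric] using s by blast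
qed

text \<open>
  For \<open>\<nu> < 1\<close> the power is integrable at \<open>0\<close>, so the exponential containing \<open>R\<close> can be dropped.
\<close>

lemma subord_integral_bounded:
  assumes q: "q \<ge> 1" and p: "p > 0" and c: "c1 > 0" "c2 > 0" and nu: "\<nu> \<ge> 0" "\<nu> < 1"
  shows "\<exists>C>0. \<forall>R>0. subord_integral q p c1 c2 \<nu> R \<le> C"
proof -
  define f where "f z = exp c1 * (z powr ((1 - \<nu>) - 1) * exp (- c1 * z))" for z
  have fi: "integrable halfline f" unfolding f_def
    using nu c by (intro integrable_mult_right integrable_halfline_Gamma) auto
  have "subord_integral q p c1 c2 \<nu> R \<le> (\<integral>z. f z \<partial>halfline)" if R: "R > 0" for R
    unfolding subord_integral_def
  proof (rule integral_mono[OF _ fi])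
    show "integrable halfline (subord_integrand q p c1 c2 \<nu> R)"
      using q by (intro integrable_subord_integrand p c nu R) auto
    fix z assume "z \<in> space halfline"
    then have z: "z > 0" by simp
    have "z - 1 \<le> z powr q" by (rule diff_one_le_powr[OF q])
    then have "c1 * (z - 1) \<le> c1 * z powr q" using c by (intro mult_left_mono) auto
    then have e: "exp (- c1 * z powr q) \<le> exp c1 * exp (- c1 * z)"
      unfolding mult_exp_exp by (simp add: right_diff_distrib)
    have "exp (- c2 * (R / z) powr p) \<le> 1" using c by simp
    then have "subord_integrand q p c1 c2 \<nu> R z \<le> (exp c1 * exp (- c1 * z)) * z powr (- \<nu>) * 1"
      unfolding subord_integrand_def using e by (intro mult_mono) auto
    then show "subord_integrand q p c1 c2 \<nu> R z \<le> f z" by (simp add: f_def mult_ac)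
  qed
  moreover have "(\<integral>z. f z \<partial>halfline) \<ge> 0" by (intro integral_nonneg_AE AE_I2) (auto simp: f_def)
  ultimately have "\<forall>R>0. subord_integral q p c1 c2 \<nu> R \<le> (\<integral>z. f z \<partial>halfline) + 1" "(\<integral>z. f z \<partial>halfline) + 1 > 0"
    by (auto intro: add_increasing2 add_nonneg_pos)
  then show ?thesis by blast
qed

text \<open>
  For \<open>\<nu> > 1\<close> the integral lives near \<open>z = R\<close>: drop the first exponential and substitute \<open>z = R * y\<close>.
\<close>

lemma subord_integral_singular:
  assumes q: "q > 0" and p: "p > 0" and c: "c1 > 0" "c2 > 0" and nu: "\<nu> > 1"
  shows "\<exists>C>0. \<forall>R>0. subord_integral q p c1 c2 \<nu> R \<le> C * R powr (1 - \<nu>)"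
proof -
  obtain B where B: "B > 0" "\<And>z. z > 0 \<Longrightarrow> z powr (- \<nu>) * exp (- c2 * (1 / z) powr p) \<le> B"
    using powr_mult_exp_powr_inverse_bounded[of \<nu> c2 p] nu c p by auto
  define g where "g z = z powr (- \<nu>) * exp (- c2 * (1 / z) powr p)" for z
  have gi: "integrable halfline g"
  proof (rule Bochner_Integration.integrable_bound)
    show "integrable halfline (\<lambda>z. (B + 1) * (if z \<le> 1 then 1 else z powr (- \<nu>)))"
      using integrable_halfline_tail[OF nu] by (rule integrable_mult_right)
    show "g \<in> borel_measurable halfline" unfolding g_def[abs_def] by (rule borel_measurable_halfline) measurable
    show "AE z in halfline. norm (g z) \<le> norm ((B + 1) * (if z \<le> 1 then 1 else z powr (- \<nu>)))"
    proof (rule AE_I2)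
      fix z assume "z \<in> space halfline"
      then have z: "z > 0" by simp
      have "g z \<le> B" unfolding g_def by (rule B(2)[OF z])
      moreover have "g z \<le> z powr (- \<nu>) * 1" unfolding g_def using c by (intro mult_left_mono) auto
      moreover have "0 \<le> B * z powr (- \<nu>)" using B(1) by simp
      ultimately have "g z \<le> B + 1" "g z \<le> B * z powr (- \<nu>) + z powr (- \<nu>)" by linarith+
      moreover have "0 \<le> g z" by (simp add: g_def)
      ultimately show "norm (g z) \<le> norm ((B + 1) * (if z \<le> 1 then 1 else z powr (- \<nu>)))"
        using B(1) by (cases "z \<le> 1") (simp_all add: distrib_right abs_mult)
    qed
  qed
  have "subord_integral q p c1 c2 \<nu> R \<le> ((\<integral>z. g z \<partial>halfline) + 1) * R powr (1 - \<nu>)" if R: "R > 0" for R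
  proof -
    have eq: "R powr (- \<nu>) * g (z / R) = z powr (- \<nu>) * exp (- c2 * (R / z) powr p)" if "z > 0" for z
      using that R by (simp add: g_def powr_divide powr_minus field_simps)
    have i: "integrable halfline (\<lambda>z. R powr (- \<nu>) * g (z / R))"
      using integrable_halfline_scale[of "1/R" g] gi R by simp
    have "subord_integral q p c1 c2 \<nu> R \<le> (\<integral>z. R powr (- \<nu>) * g (z / R) \<partial>halfline)"
      unfolding subord_integral_def
    proof (rule integral_mono[OF _ i])
      show "integrable halfline (subord_integrand q p c1 c2 \<nu> R)"
        using nu by (intro integrable_subord_integrand p q c R) auto
      fix z assume "z \<in> space halfline"
      then have z: "z > 0" by simp
      have "exp (- c1 * z powr q) \<le> 1" using c by simp
      then have "exp (- c1 * z powr q) * (z powr (- \<nu>) * exp (- c2 * (R / z) powr p)) \<le> 1 * (z powr (- \<nu>) * exp (- c2 * (R / z) powr p))"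
        by (intro mult_right_mono) auto
      then show "subord_integrand q p c1 c2 \<nu> R z \<le> R powr (- \<nu>) * g (z / R)"
        unfolding eq[OF z] subord_integrand_def by (simp only: mult.assoc mult_1)
    qed
    also have "\<dots> = R powr (- \<nu>) * (\<integral>z. g (z / R) \<partial>halfline)" by simp
    also have "(\<integral>z. g (z / R) \<partial>halfline) = R * (\<integral>z. g z \<partial>halfline)"
      using integral_halfline_scale[of "1/R" g] R by simp
    also have "R powr (- \<nu>) * (R * (\<integral>z. g z \<partial>halfline)) = (\<integral>z. g z \<partial>halfline) * R powr (1 - \<nu>)"
      using R by (simp add: powr_diff powr_minus field_simps)
    also have "\<dots> \<le> ((\<integral>z. g z \<partial>halfline) + 1) * R powr (1 - \<nu>)" by (intro mult_right_mono) auto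
    finally show ?thesis .
  qed
  moreover have "(\<integral>z. g z \<partial>halfline) \<ge> 0" by (intro integral_nonneg_AE AE_I2) (auto simp: g_def)
  ultimately show ?thesis by (intro exI[of _ "(\<integral>z. g z \<partial>halfline) + 1"]) auto
qed

lemma integral_halfline_reciprocal:
  assumes R: "0 < R" "R \<le> 1"
  shows "integrable halfline (\<lambda>z. indicator {R..1} z * (1 / z))"
    and "(\<integral>z. indicator {R..1} z * (1 / z) \<partial>halfline) = - ln R"
proof -
  have F: "has_bochner_integral lborel (\<lambda>z. indicator {R..1} z *\<^sub>R (1 / z)) (ln 1 - ln R)"
    using R by (intro has_bochner_integral_FTC_Icc) (auto intro!: derivative_eq_intros continuous_intros
        simp: has_real_derivative_iff_has_vector_derivative[symmetric])
  have e: "indicator {0<..} z *\<^sub>R (indicator {R..1} z * (1 / z)) = indicator {R..1} z *\<^sub>R (1 / z)" for z :: real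
    using R by (auto simp: indicator_def)
  show "integrable halfline (\<lambda>z. indicator {R..1} z * (1 / z))"
    using F unfolding integrable_halfline set_integrable_def e by (simp add: has_bochner_integral_iff)
  show "(\<integral>z. indicator {R..1} z * (1 / z) \<partial>halfline) = - ln R"
    using F unfolding integral_halfline set_lebesgue_integral_def e by (simp add: has_bochner_integral_iff)
qed

text \<open>
  For \<open>\<nu> = 1\<close> the range \<open>R \<le> z \<le> 1\<close>, where neither exponential helps, contributes the integral of \<open>1 / z\<close>; the ranges
  \<open>z \<le> R\<close> and \<open>z > 1\<close> contribute bounded amounts.
\<close>

lemma subord_integral_log:
  assumes q: "q > 0" and p: "p > 0" and c: "c1 > 0" "c2 > 0"
  shows "\<exists>C>0. \<forall>R. 0 < R \<and> R \<le> 1 \<longrightarrow> subord_integral q p c1 c2 1 R \<le> C * (\<bar>ln R\<bar> + 1)"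
proof -
  obtain B where B: "B > 0" "\<And>z. z > 0 \<Longrightarrow> z powr (- 1) * exp (- c2 * (1 / z) powr p) \<le> B"
    using powr_mult_exp_powr_inverse_bounded[of 1 c2 p] c p by auto
  define I where "I = (\<integral>z. exp (- c1 * z powr q) \<partial>halfline)"
  have Ii: "integrable halfline (\<lambda>z. exp (- c1 * z powr q))" by (rule integrable_halfline_exp_powr[OF c(1) q])
  have I: "I \<ge> 0" unfolding I_def by (intro integral_nonneg_AE AE_I2) auto
  define \<tau> where "\<tau> z = (if z \<le> 1 then 1 else z powr (- 2))" for z :: real
  have two: "integrable halfline \<tau>" unfolding \<tau>_def by (rule integrable_halfline_tail) simp
  define T where "T = (\<integral>z. \<tau> z \<partial>halfline)"
  have tau0: "\<tau> z \<ge> 0" for z by (simp add: \<tau>_def)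
  have T: "T \<ge> 0" unfolding T_def by (intro integral_nonneg_AE AE_I2 tau0)
  define C where "C = B * T + I + 1"
  have C: "C \<ge> 1" using B I T by (simp add: C_def)
  have "subord_integral q p c1 c2 1 R \<le> C * (\<bar>ln R\<bar> + 1)" if R: "0 < R" "R \<le> 1" for R
  proof -
    define h where "h z = (B / R) * \<tau> (z / R) + indicator {R..1} z * (1 / z) + exp (- c1 * z powr q)" for z
    have s: "integrable halfline (\<lambda>z. \<tau> (z / R))"
      using integrable_halfline_scale[of "1/R" \<tau>] two R by simp
    have hi: "integrable halfline h" unfolding h_def
      by (intro Bochner_Integration.integrable_add integrable_mult_right s integral_halfline_reciprocal R Ii)
    have "subord_integral q p c1 c2 1 R \<le> (\<integral>z. h z \<partial>halfline)"
      unfolding subord_integral_def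
    proof (rule integral_mono[OF _ hi])
      show "integrable halfline (subord_integrand q p c1 c2 1 R)"
        by (intro integrable_subord_integrand p q c R) auto
      fix z assume "z \<in> space halfline"
      then have z: "z > 0" by simp
      have e1: "exp (- c1 * z powr q) \<le> 1" using c by simp
      have e2: "exp (- c2 * (R / z) powr p) \<le> 1" using c by simp
      have h0: "(B / R) * \<tau> (z / R) \<ge> 0" using B R tau0[of "z / R"] by simp
      consider "z \<le> R" | "R < z" "z \<le> 1" | "z > 1" by linarith
      then show "subord_integrand q p c1 c2 1 R z \<le> h z"
      proof cases
        case 1
        have "(z / R) powr (- 1) * exp (- c2 * (1 / (z / R)) powr p) \<le> B" using B(2)[of "z / R"] z R by simp
        then have "(R / z) * exp (- c2 * (R / z) powr p) \<le> B" using z R by (simp add: powr_minus)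
        then have "(1 / z) * exp (- c2 * (R / z) powr p) \<le> B / R" using R by (simp add: field_simps)
        then have "exp (- c1 * z powr q) * ((1 / z) * exp (- c2 * (R / z) powr p)) \<le> 1 * (B / R)"
          using e1 z by (intro mult_mono) auto
        then have "subord_integrand q p c1 c2 1 R z \<le> B / R"
          using z by (simp add: subord_integrand_def powr_minus divide_inverse mult_ac)
        also have "\<dots> \<le> h z"
        proof -
          have "\<tau> (z / R) = 1" using 1 R by (simp add: \<tau>_def)
          moreover have "indicator {R..1} z * (1 / z) \<ge> 0" using z by simp
          ultimately show ?thesis using exp_gt_zero[of "- c1 * z powr q"] unfolding h_def by simp
        qed
        finally show ?thesis .
      next
        case 2
        have "subord_integrand q p c1 c2 1 R z \<le> 1 * (1 / z) * 1"
          unfolding subord_integrand_def using e1 e2 z by (intro mult_mono) (auto simp: powr_minus divide_inverse)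
        also have "\<dots> \<le> h z" using 2 h0 exp_gt_zero[of "- c1 * z powr q"] unfolding h_def by simp
        finally show ?thesis .
      next
        case 3
        have "subord_integrand q p c1 c2 1 R z \<le> exp (- c1 * z powr q) * 1 * 1"
          unfolding subord_integrand_def using 3 e2 z by (intro mult_mono) (auto simp: powr_minus field_simps)
        also have "\<dots> \<le> h z"
        proof -
          have "indicator {R..1} z * (1 / z) \<ge> 0" using z by simp
          then show ?thesis using h0 unfolding h_def by simp
        qed
        finally show ?thesis .
      qed
    qed
    also have "\<dots> = (B / R) * (\<integral>z. \<tau> (z / R) \<partial>halfline) + - ln R + I"
      unfolding h_def I_def
      by (simp only: Bochner_Integration.integral_add Bochner_Integration.integrable_add integrable_mult_right s
          integral_halfline_reciprocal[OF R] Ii integral_mult_right_zero)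
    also have "(\<integral>z. \<tau> (z / R) \<partial>halfline) = R * T"
      unfolding T_def using integral_halfline_scale[of "1/R" \<tau>] R by simp
    also have "(B / R) * (R * T) + - ln R + I = B * T + I + \<bar>ln R\<bar>" using R by simp
    also have "\<dots> \<le> C * (\<bar>ln R\<bar> + 1)"
      using C mult_right_mono[of 1 C "\<bar>ln R\<bar>"] by (simp add: distrib_left) (simp add: C_def)
    finally show ?thesis .
  qed
  then show ?thesis using C by (intro exI[of _ C]) auto
qed

section \<open>Smooth functions and iterated partial derivatives\<close>

lemma has_derivative_cong_open:
  assumes "open S" "x \<in> S" "\<And>y. y \<in> S \<Longrightarrow> f y = g y"
  shows "(f has_derivative D) (at x) \<longleftrightarrow> (g has_derivative D) (at x)"
  using assms has_derivative_transform_within_open[of f D x UNIV S g] has_derivative_transform_within_open[of g D x UNIV S f]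
  by auto

lemma C_k_on_cong:
  assumes S: "open S" and eq: "\<And>x. x \<in> S \<Longrightarrow> f x = g x"
  shows "C_k_on k S f \<longleftrightarrow> C_k_on k S g"
  using eq
proof (induction k arbitrary: f g)
  case 0
  then show ?case by (simp cong: continuous_on_cong)
next
  case (Suc k)
  have d: "(f has_derivative D) (at x) \<longleftrightarrow> (g has_derivative D) (at x)" if "x \<in> S" for x D
    by (rule has_derivative_cong_open[OF S that Suc.prems])
  have 1: "f differentiable (at x) \<longleftrightarrow> g differentiable (at x)" if "x \<in> S" for x
    unfolding differentiable_def using d[OF that] by simp
  have 2: "C_k_on k S (\<lambda>x. frechet_derivative f (at x) v) \<longleftrightarrow> C_k_on k S (\<lambda>x. frechet_derivative g (at x) v)" for v
    by (rule Suc.IH) (simp add: frechet_derivative_def d)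
  show ?case using 1 2 by simp
qed

lemma C_infinity_on_cong:
  assumes "open S" "\<And>x. x \<in> S \<Longrightarrow> f x = g x" "C_infinity_on S g"
  shows "C_infinity_on S f"
  using C_k_on_cong[OF assms(1,2)] assms(3) by (auto simp: C_infinity_on_def)

text \<open>
  Any derivative known on the open set \<open>S\<close> can stand in for the \<open>frechet_derivative\<close> of the definition.
\<close>

lemma C_k_on_SucI:
  assumes S: "open S" and der: "\<And>x. x \<in> S \<Longrightarrow> (f has_derivative f' x) (at x)"
    and f': "\<And>v. C_k_on k S (\<lambda>x. f' x v)"
  shows "C_k_on (Suc k) S f"
proof -
  have "C_k_on k S (\<lambda>x. frechet_derivative f (at x) v)" for v
    using f'[of v] frechet_derivative_at[OF der] by (subst C_k_on_cong[OF S, of _ "\<lambda>x. f' x v"]) auto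
  then show ?thesis using der by (auto simp: differentiable_def)
qed

lemma C_k_on_SucD:
  assumes "C_k_on (Suc k) S f" "x \<in> S"
  shows "(f has_derivative frechet_derivative f (at x)) (at x)"
  using assms by (simp add: frechet_derivative_works)

lemma C_k_on_const_0: "C_k_on k S (\<lambda>_. 0)"
  by (induction k) (simp_all add: frechet_derivative_const)

lemma C_k_on_add:
  assumes S: "open S"
  shows "C_k_on k S f \<Longrightarrow> C_k_on k S g \<Longrightarrow> C_k_on k S (\<lambda>x. f x + g x)"
proof (induction k arbitrary: f g)
  case 0
  then show ?case by (simp add: continuous_on_add)
next
  case (Suc k)
  show ?case
  proof (rule C_k_on_SucI[OF S])
    show "((\<lambda>x. f x + g x) has_derivative (\<lambda>v. frechet_derivative f (at x) v + frechet_derivative g (at x) v)) (at x)"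
      if "x \<in> S" for x
      using C_k_on_SucD[OF Suc.prems(1) that] C_k_on_SucD[OF Suc.prems(2) that] by (rule has_derivative_add)
    show "C_k_on k S (\<lambda>x. frechet_derivative f (at x) v + frechet_derivative g (at x) v)" for v
      using Suc.prems by (intro Suc.IH) auto
  qed
qed

lemma C_k_on_bounded_linear:
  assumes S: "open S" and L: "bounded_linear L"
  shows "C_k_on k S f \<Longrightarrow> C_k_on k S (\<lambda>x. L (f x))"
proof (induction k arbitrary: f)
  case 0
  then show ?case using bounded_linear.continuous_on[OF L] by simp
next
  case (Suc k)
  show ?case
  proof (rule C_k_on_SucI[OF S])
    show "((\<lambda>x. L (f x)) has_derivative (\<lambda>v. L (frechet_derivative f (at x) v))) (at x)" if "x \<in> S" for x
      by (rule bounded_linear.has_derivative[OF L C_k_on_SucD[OF Suc.prems that]])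
    show "C_k_on k S (\<lambda>x. L (frechet_derivative f (at x) v))" for v
      using Suc.prems by (intro Suc.IH) auto
  qed
qed

lemma C_k_on_sum:
  assumes "open S" and "\<And>i. i \<in> I \<Longrightarrow> C_k_on k S (f i)"
  shows "C_k_on k S (\<lambda>x. \<Sum>i\<in>I. f i x)"
  using assms(2)
proof (induction I rule: infinite_finite_induct)
  case (insert i I)
  then show ?case by (simp add: C_k_on_add[OF assms(1)])
qed (simp_all add: C_k_on_const_0)

lemma partial_D_cong:
  assumes S: "open S" "x \<in> S" and eq: "\<And>y. y \<in> S \<Longrightarrow> F y = G y"
  shows "partial_D j F x = partial_D j G x"
proof -
  have "((\<lambda>h. x + h *\<^sub>R axis j 1) \<longlongrightarrow> x + 0 *\<^sub>R axis j 1) (nhds 0)"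
    by (intro tendsto_intros) (rule filterlim_ident)
  then have "\<forall>\<^sub>F h in nhds 0. x + h *\<^sub>R axis j 1 \<in> S"
    using S by (intro topological_tendstoD) auto
  then have "vector_derivative (\<lambda>h. F (x + h *\<^sub>R axis j 1)) (at 0) = vector_derivative (\<lambda>h. G (x + h *\<^sub>R axis j 1)) (at 0)"
    by (intro vector_derivative_cong_eq) (auto elim!: eventually_mono simp: eq)
  then show ?thesis by (simp add: partial_D_def)
qed

lemma partial_D_has_derivative:
  assumes "(F has_derivative D) (at x)"
  shows "partial_D j F x = cscale (1 / \<i>) (D (axis j 1))"
proof -
  have "((\<lambda>h. x + h *\<^sub>R axis j 1) has_derivative (\<lambda>h. h *\<^sub>R axis j 1)) (at (0::real))"
    by (auto intro!: derivative_eq_intros)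
  from has_derivative_compose[OF this, of F D] assms
  have "((\<lambda>h. F (x + h *\<^sub>R axis j 1)) has_derivative (\<lambda>h. D (h *\<^sub>R axis j 1))) (at (0::real))" by simp
  then have "((\<lambda>h. F (x + h *\<^sub>R axis j 1)) has_vector_derivative D (axis j 1)) (at 0)"
    using linear_cmul[OF has_derivative_linear[OF assms]] by (simp add: has_vector_derivative_def)
  then show ?thesis by (simp add: partial_D_def vector_derivative_at)
qed

text \<open>
  For a family indexed by multi-indices on which each partial derivative acts by raising the index, the order of the
  differentiations is immaterial.
\<close>

lemma multi_D_family:
  fixes H :: "('n::{finite,linorder} \<Rightarrow> nat) \<Rightarrow> real ^ ('n::{finite,linorder}) \<Rightarrow> complex ^ 'N ^ ('N::finite)"
  assumes S: "open S" and step: "\<And>\<beta> j x. x \<in> S \<Longrightarrow> partial_D j (H \<beta>) x = H (\<beta>(j := Suc (\<beta> j))) x"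
    and F: "\<And>x. x \<in> S \<Longrightarrow> F x = H (\<lambda>_. 0) x" and x: "x \<in> S"
  shows "multi_D \<beta> F x = H \<beta> x"
proof -
  have pow: "(partial_D j ^^ m) G y = H (\<eta>(j := \<eta> j + m)) y"
    if "\<And>y. y \<in> S \<Longrightarrow> G y = H \<eta> y" "y \<in> S" for j m G \<eta> y
    using that(2)
  proof (induction m arbitrary: y)
    case 0
    then show ?case using that(1) by simp
  next
    case (Suc m)
    have "partial_D j ((partial_D j ^^ m) G) y = partial_D j (H (\<eta>(j := \<eta> j + m))) y"
      by (rule partial_D_cong[OF S Suc.prems Suc.IH])
    also have "\<dots> = H ((\<eta>(j := \<eta> j + m))(j := Suc ((\<eta>(j := \<eta> j + m)) j))) y"
      by (rule step[OF Suc.prems])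
    also have "(\<eta>(j := \<eta> j + m))(j := Suc ((\<eta>(j := \<eta> j + m)) j)) = \<eta>(j := \<eta> j + Suc m)"
      by (simp add: fun_eq_iff)
    finally show ?case by simp
  qed
  have "foldr (\<lambda>j. partial_D j ^^ \<beta> j) xs F y = H (\<lambda>j. if j \<in> set xs then \<beta> j else 0) y"
    if "distinct xs" "y \<in> S" for xs y
    using that
  proof (induction xs arbitrary: y)
    case Nil
    then show ?case using F by simp
  next
    case (Cons j xs)
    let ?\<beta> = "\<lambda>j. if j \<in> set xs then \<beta> j else 0"
    have "foldr (\<lambda>j. partial_D j ^^ \<beta> j) (j # xs) F y = H (?\<beta>(j := ?\<beta> j + \<beta> j)) y"
      using Cons pow[where G = "foldr (\<lambda>j. partial_D j ^^ \<beta> j) xs F" and \<eta> = ?\<beta> and j = j and m = "\<beta> j" and y = y] by simp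
    also have "?\<beta>(j := ?\<beta> j + \<beta> j) = (\<lambda>i. if i \<in> set (j # xs) then \<beta> i else 0)"
      using Cons.prems(1) by auto
    finally show ?case .
  qed
  from this[of "sorted_list_of_set UNIV" x] x show ?thesis by (simp add: multi_D_def)
qed

lemma open_positive_time_nonzero: "open {(t, x). t > (0::real) \<and> x \<noteq> (0 :: 'a::real_normed_vector)}"
proof -
  have "{(t, x). t > (0::real) \<and> x \<noteq> (0 :: 'a)} = {0<..} \<times> (- {0})" by auto
  moreover have "open ({0<..} \<times> (- {0 :: 'a}) :: (real \<times> 'a) set)" by (intro open_Times) auto
  ultimately show ?thesis by simp
qed

section \<open>The subordinated kernels\<close>

text \<open>
  Away from \<open>x = 0\<close> the exponential factor beats every negative power of \<open>s\<close>. The exponent \<open>\<eta> = 0\<close> serves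
  the differentiation under the integral, \<open>\<eta> = 1\<close> the fractional integral in time.
\<close>

lemma weighted_Z_dominated:
  fixes a :: "('n::finite \<Rightarrow> nat) \<Rightarrow> complex ^ 'N ^ ('N::finite)"
  assumes b: "b \<ge> 1" and \<delta>: "\<delta> > 0" and K: "K > 0" and sb: "strip_bound b \<delta> K a" and r: "r > 0" and eta: "\<eta> \<ge> 0"
  shows "\<exists>B>0. \<forall>s>0. \<forall>x. norm x \<ge> r \<longrightarrow> norm (weighted_Z b a \<beta> s x) \<le> B * s powr \<eta>"
proof -
  define p where "p = 1 / (2 * real b - 1)"
  have p: "p > 0" using b by (simp add: p_def)
  define \<nu> where "\<nu> = real (CARD('n) + mi_size \<beta>) / (2 * real b)"
  have nu: "\<nu> \<ge> 0" by (simp add: \<nu>_def)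
  obtain C c where Cc: "C > 0" "c > 0" and bd: "\<forall>a :: ('n \<Rightarrow> nat) \<Rightarrow> complex ^ 'N ^ 'N. strip_bound b \<delta> K a \<longrightarrow>
    (\<forall>s>0. \<forall>x. norm (weighted_Z b a \<beta> s x) \<le> C * s powr (- \<nu>) * exp (- c * (norm x ^ (2 * b) / s) powr p))"
    using weighted_Z_bound[OF b \<delta> K, of \<beta>, where 'N = 'N] unfolding p_def \<nu>_def by blast
  obtain D where D: "D > 0" "\<And>R z. R \<ge> r ^ (2 * b) \<Longrightarrow> z > 0 \<Longrightarrow> z powr (- (\<nu> + \<eta>)) * exp (- c * (R / z) powr p) \<le> D"
    using powr_neg_mult_exp_bounded[of "\<nu> + \<eta>" c p "r ^ (2 * b)"] nu eta Cc(2) p r by auto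
  have "norm (weighted_Z b a \<beta> s x) \<le> (C * D) * s powr \<eta>" if s: "s > 0" and x: "norm x \<ge> r" for s x
  proof -
    have "r ^ (2 * b) \<le> norm x ^ (2 * b)" using r x by (intro power_mono) auto
    then have "s powr (- (\<nu> + \<eta>)) * exp (- c * (norm x ^ (2 * b) / s) powr p) \<le> D" by (rule D(2)[OF _ s])
    then have le: "(C * s powr \<eta>) * (s powr (- (\<nu> + \<eta>)) * exp (- c * (norm x ^ (2 * b) / s) powr p)) \<le> (C * s powr \<eta>) * D"
      using Cc(1) by (intro mult_left_mono) auto
    have e: "s powr (- \<nu>) = s powr \<eta> * s powr (- (\<nu> + \<eta>))" using s by (simp add: powr_add[symmetric])
    have "norm (weighted_Z b a \<beta> s x) \<le> (C * s powr \<eta>) * (s powr (- (\<nu> + \<eta>)) * exp (- c * (norm x ^ (2 * b) / s) powr p))"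
      using bd[rule_format, OF sb s, of x] unfolding e by (simp only: mult.assoc)
    also note le
    finally show ?thesis by (simp only: mult_ac)
  qed
  then show ?thesis using Cc(1) D(1) by (intro exI[of _ "C * D"]) auto
qed

lemma borel_measurable_weighted_Z_time:
  fixes a :: "('n::finite \<Rightarrow> nat) \<Rightarrow> complex ^ 'N ^ ('N::finite)"
  assumes "b \<ge> 1" "\<delta> > 0" "strip_bound b \<delta> K a"
  shows "(\<lambda>s. weighted_Z b a \<beta> s x) \<in> borel_measurable halfline"
  by (rule borel_measurable_halflineI[OF continuous_on_weighted_Z_time[OF assms]])

context fractional_order begin

lemma borel_measurable_wright_pair:
  "(\<lambda>(t, s). wright \<gamma> t s) \<in> borel_measurable (lborel \<Otimes>\<^sub>M halfline)"
proof -
  define c where "c = contour 1"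
  define P where "P r = contour 1 r powr of_real \<gamma>" for r
  define Q where "Q r = contour 1 r powr of_real \<alpha>" for r
  define i where "i s = complex_of_real s" for s
  have sub: "\<And>g. continuous_on {0..} g \<Longrightarrow> continuous_on {0<..} (g :: real \<Rightarrow> complex)"
    by (rule continuous_on_subset) auto
  have ci: "continuous_on {0<..} c" unfolding c_def contour_def[abs_def] by (intro continuous_intros)
  have [measurable]: "c \<in> borel_measurable halfline" by (rule borel_measurable_halflineI[OF ci])
  have "continuous_on (- \<real>\<^sub>\<le>\<^sub>0) (\<lambda>z::complex. z powr of_real g)" for g
    by (intro continuous_intros) (auto simp: complex_nonpos_Reals_iff)
  then have "continuous_on {0<..} (\<lambda>r. contour 1 r powr of_real g)" for g
    by (rule continuous_on_compose2[OF _ ci[unfolded c_def]]) (use contour_not_nonpos[of 1] in auto)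
  then have [measurable]: "P \<in> borel_measurable halfline" "Q \<in> borel_measurable halfline"
    unfolding P_def[abs_def] Q_def[abs_def] by (auto intro!: borel_measurable_halflineI)
  have [measurable]: "i \<in> borel_measurable halfline" "i \<in> borel_measurable lborel"
    unfolding i_def[abs_def] by (rule borel_measurable_halfline, measurable, measurable)
  interpret sigma_finite_measure halfline by (rule sigma_finite_halfline)
  have "(\<lambda>(p, r). exp (i (fst p) * c r) * P r * exp (- i (snd p) * Q r) * cis \<omega>)
      \<in> borel_measurable ((lborel \<Otimes>\<^sub>M halfline) \<Otimes>\<^sub>M halfline)"
    by measurable
  then have "(\<lambda>p. \<integral>r. exp (i (fst p) * c r) * P r * exp (- i (snd p) * Q r) * cis \<omega> \<partial>halfline) \<in> borel_measurable (lborel \<Otimes>\<^sub>M halfline)"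
    by (rule borel_measurable_lebesgue_integral)
  then have "(\<lambda>p. Im (\<integral>r. exp (i (fst p) * c r) * P r * exp (- i (snd p) * Q r) * cis \<omega> \<partial>halfline) / pi) \<in> borel_measurable (lborel \<Otimes>\<^sub>M halfline)"
    by (intro borel_measurable_divide borel_measurable_Im) auto
  then show ?thesis
    by (simp add: wright_def wrightc_def kern_def c_def P_def Q_def i_def case_prod_beta')
qed

lemma borel_measurable_wright: "(\<lambda>s. wright \<gamma> t s) \<in> borel_measurable halfline"
  using measurable_Pair2[OF borel_measurable_wright_pair, of t \<gamma>] by simp

lemma wright_dominated:
  assumes t: "0 < t0" "t0 \<le> t1"
  shows "\<exists>W>0. \<exists>k>0. \<forall>t s. t0 \<le> t \<and> t \<le> t1 \<and> 0 \<le> s \<longrightarrow> \<bar>wright \<gamma> t s\<bar> \<le> W * exp (- k * s)"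
proof -
  define q where "q = 1 / (1 - \<alpha>)"
  have q: "q \<ge> 1" using alpha_pos alpha_less by (simp add: q_def)
  obtain C c where Cc: "C > 0" "c > 0" and bd: "\<And>t s. t > 0 \<Longrightarrow> s \<ge> 0 \<Longrightarrow>
      \<bar>wright \<gamma> t s\<bar> \<le> C * t powr (- \<gamma> - 1) * exp (- c * (s * t powr (- \<alpha>)) powr q)"
    using wright_bound[of \<gamma>] unfolding q_def by blast
  define A where "A = t0 powr (- \<gamma> - 1) + t1 powr (- \<gamma> - 1)"
  define k where "k = c * t1 powr (- \<alpha>)"
  have k: "k > 0" using Cc t by (simp add: k_def)
  have "\<bar>wright \<gamma> t s\<bar> \<le> (C * A * exp c) * exp (- k * s)" if h: "t0 \<le> t" "t \<le> t1" "0 \<le> s" for t s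
  proof -
    have tp: "t > 0" using t h by simp
    have A: "t powr (- \<gamma> - 1) \<le> A"
    proof (cases "- \<gamma> - 1 \<ge> 0")
      case True
      then have "t powr (- \<gamma> - 1) \<le> t1 powr (- \<gamma> - 1)" using h tp by (intro powr_mono2) auto
      then show ?thesis by (simp add: A_def add_increasing)
    next
      case False
      then have "t powr (- \<gamma> - 1) \<le> t0 powr (- \<gamma> - 1)" using h t by (intro powr_mono2') auto
      then show ?thesis by (simp add: A_def add_increasing2)
    qed
    define y where "y = s * t powr (- \<alpha>)"
    have y0: "y \<ge> 0" using h by (simp add: y_def)
    have "y - 1 \<le> y powr q" by (rule diff_one_le_powr[OF q])
    then have "c * (y - 1) \<le> c * y powr q" using Cc by (intro mult_left_mono) auto
    moreover have "k * s \<le> c * y"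
    proof -
      have "t1 powr (- \<alpha>) \<le> t powr (- \<alpha>)" using h tp alpha_pos by (intro powr_mono2') auto
      then have "c * (s * t1 powr (- \<alpha>)) \<le> c * (s * t powr (- \<alpha>))" using Cc h by (intro mult_left_mono) auto
      then show ?thesis by (simp add: k_def y_def mult_ac)
    qed
    ultimately have "- c * y powr q \<le> c + - k * s" by (simp add: right_diff_distrib)
    then have "exp (- c * y powr q) \<le> exp c * exp (- k * s)" unfolding mult_exp_exp by simp
    then have "C * t powr (- \<gamma> - 1) * exp (- c * y powr q) \<le> C * A * (exp c * exp (- k * s))"
      using A Cc by (intro mult_mono mult_left_mono) (auto simp: A_def)
    then show ?thesis using bd[OF tp h(3)] by (simp add: y_def mult_ac)
  qed
  moreover have "C * A * exp c > 0" using Cc t by (simp add: A_def add_pos_pos)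
  ultimately show ?thesis using k by blast
qed

definition frac_kernel ::
  "nat \<Rightarrow> (('n::finite \<Rightarrow> nat) \<Rightarrow> complex ^ 'N ^ 'N) \<Rightarrow> real \<Rightarrow> ('n \<Rightarrow> nat) \<Rightarrow> real \<Rightarrow> real ^ 'n \<Rightarrow>
    complex ^ 'N ^ ('N::finite)" where
  "frac_kernel b a \<gamma> \<beta> t x = (\<integral>s. wright \<gamma> t s *\<^sub>R weighted_Z b a \<beta> s x \<partial>halfline)"

lemma integrable_frac_kernel:
  fixes a :: "('n::finite \<Rightarrow> nat) \<Rightarrow> complex ^ 'N ^ ('N::finite)"
  assumes b: "b \<ge> 1" and \<delta>: "\<delta> > 0" and K: "K > 0" and sb: "strip_bound b \<delta> K a" and t: "t > 0" and x: "x \<noteq> 0"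
  shows "integrable halfline (\<lambda>s. wright \<gamma> t s *\<^sub>R weighted_Z b a \<beta> s x)"
proof -
  obtain W k where W: "W > 0" "k > 0" "\<And>s. s \<ge> 0 \<Longrightarrow> \<bar>wright \<gamma> t s\<bar> \<le> W * exp (- k * s)"
    using wright_dominated[OF t order_refl, of \<gamma>] by blast
  have "norm x > 0" using x by simp
  then obtain B where B: "B > 0" "\<And>s. s > 0 \<Longrightarrow> norm (weighted_Z b a \<beta> s x) \<le> B * s powr 0"
    using weighted_Z_dominated[OF b \<delta> K sb, of "norm x" 0 \<beta>] by auto
  show ?thesis
  proof (rule Bochner_Integration.integrable_bound)
    show "integrable halfline (\<lambda>s. (W * B) * exp (- k * s))"
      by (intro integrable_mult_right integrable_halfline_exp W)
    show "(\<lambda>s. wright \<gamma> t s *\<^sub>R weighted_Z b a \<beta> s x) \<in> borel_measurable halfline"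
      by (intro borel_measurable_scaleR borel_measurable_wright borel_measurable_weighted_Z_time[OF b \<delta> sb])
    show "AE s in halfline. norm (wright \<gamma> t s *\<^sub>R weighted_Z b a \<beta> s x) \<le> norm ((W * B) * exp (- k * s))"
    proof (rule AE_I2)
      fix s assume "s \<in> space halfline"
      then have s: "s > 0" by simp
      have "\<bar>wright \<gamma> t s\<bar> * norm (weighted_Z b a \<beta> s x) \<le> (W * exp (- k * s)) * B"
        using W(3)[of s] B(2)[OF s] W(1) s by (intro mult_mono) auto
      then show "norm (wright \<gamma> t s *\<^sub>R weighted_Z b a \<beta> s x) \<le> norm ((W * B) * exp (- k * s))"
        using W(1) B(1) by (simp add: abs_mult mult_ac)
    qed
  qed
qed

text \<open>
  Both factors have integrable majorants near \<open>(t, x)\<close>, so the product rule may be applied under the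
  integral. The result stays in the family.
\<close>

lemma frac_kernel_has_derivative:
  fixes a :: "('n::finite \<Rightarrow> nat) \<Rightarrow> complex ^ 'N ^ ('N::finite)"
  assumes b: "b \<ge> 1" and \<delta>: "\<delta> > 0" and K: "K > 0" and sb: "strip_bound b \<delta> K a" and t: "t > 0" and x: "x \<noteq> 0"
  shows "((\<lambda>(t, x). frac_kernel b a \<gamma> \<beta> t x) has_derivative
    (\<lambda>h. (\<Sum>l\<in>UNIV. snd h $ l *\<^sub>R cscale \<i> (frac_kernel b a \<gamma> (\<beta>(l := Suc (\<beta> l))) t x)) +
      fst h *\<^sub>R frac_kernel b a (\<gamma> + 1) \<beta> t x)) (at (t, x))"
proof -
  define bl where "bl l = \<beta>(l := Suc (\<beta> l))" for l
  define \<rho> where "\<rho> = min (t/2) (norm x / 2)"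
  have \<rho>: "\<rho> > 0" using t x by (simp add: \<rho>_def)
  have t2: "0 < t/2" "t/2 \<le> 2*t" using t by auto
  have x2: "norm x / 2 > 0" using x by simp
  obtain W0 k0 where W0: "W0 > 0" "k0 > 0" "\<And>u s. t/2 \<le> u \<Longrightarrow> u \<le> 2*t \<Longrightarrow> s \<ge> 0 \<Longrightarrow> \<bar>wright \<gamma> u s\<bar> \<le> W0 * exp (- k0 * s)"
    using wright_dominated[OF t2, of \<gamma>] by blast
  obtain W1 k1 where W1: "W1 > 0" "k1 > 0" "\<And>u s. t/2 \<le> u \<Longrightarrow> u \<le> 2*t \<Longrightarrow> s \<ge> 0 \<Longrightarrow> \<bar>wright (\<gamma> + 1) u s\<bar> \<le> W1 * exp (- k1 * s)"
    using wright_dominated[OF t2, of "\<gamma> + 1"] by blast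
  obtain B where B: "B > 0" "\<And>s y. s > 0 \<Longrightarrow> norm y \<ge> norm x / 2 \<Longrightarrow> norm (weighted_Z b a \<beta> s y) \<le> B * s powr 0"
    using weighted_Z_dominated[OF b \<delta> K sb x2 order_refl, of \<beta>] by blast
  have "\<forall>l. \<exists>D>0. \<forall>s>0. \<forall>y. norm y \<ge> norm x / 2 \<longrightarrow> norm (weighted_Z b a (bl l) s y) \<le> D * s powr 0"
    using weighted_Z_dominated[OF b \<delta> K sb x2 order_refl] by blast
  then obtain D where D: "\<And>l. D l > 0" "\<And>l s y. s > 0 \<Longrightarrow> norm y \<ge> norm x / 2 \<Longrightarrow> norm (weighted_Z b a (bl l) s y) \<le> D l * s powr 0"
    by metis
  define L where "L = (\<Sum>l\<in>UNIV. D l)"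
  define g where "g s = W0 * L * exp (- k0 * s) + W1 * B * exp (- k1 * s)" for s
  define F where "F s y = wright \<gamma> (fst y) s *\<^sub>R weighted_Z b a \<beta> s (snd y)" for s y
  define F' where "F' s y h = wright \<gamma> (fst y) s *\<^sub>R (\<Sum>l\<in>UNIV. snd h $ l *\<^sub>R cscale \<i> (weighted_Z b a (bl l) s (snd y)))
     + (fst h * wright (\<gamma> + 1) (fst y) s) *\<^sub>R weighted_Z b a \<beta> s (snd y)" for s y h
  have near: "t/2 \<le> fst y" "fst y \<le> 2*t" "fst y > 0" "norm (snd y) \<ge> norm x / 2" "snd y \<noteq> 0" if "y \<in> ball (t, x) \<rho>" for y
  proof -
    have d1: "\<bar>fst y - t\<bar> < t/2"
      using dist_fst_le[of "(t, x)" y] that by (simp add: \<rho>_def dist_real_def abs_minus_commute)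
    have d2: "norm (x - snd y) < norm x / 2"
      using dist_snd_le[of "(t, x)" y] that by (simp add: \<rho>_def dist_norm)
    show 1: "t/2 \<le> fst y" "fst y \<le> 2*t" "fst y > 0" using d1 t by linarith+
    show "norm (snd y) \<ge> norm x / 2" using d2 norm_triangle_ineq2[of x "snd y"] by linarith
    then show "snd y \<noteq> 0" using x2 by auto
  qed
  have L0: "L \<ge> 0" unfolding L_def using D(1) by (intro sum_nonneg) (auto intro: less_imp_le)
  have "((\<lambda>y. \<integral>s. F s y \<partial>halfline) has_derivative (\<lambda>h. \<integral>s. F' s (t, x) h \<partial>halfline)) (at (t, x))"
  proof (rule integral_has_derivative_dominated(1)[where r = \<rho> and g = g])
    show "\<rho> > 0" by fact
    show "integrable halfline (\<lambda>s. F s y)" if "y \<in> ball (t, x) \<rho>" for y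
      unfolding F_def by (intro integrable_frac_kernel[OF b \<delta> K sb] near[OF that])
    show "integrable halfline g" unfolding g_def
      by (intro Bochner_Integration.integrable_add integrable_mult_right integrable_halfline_exp W0 W1)
    show "g s \<ge> 0" for s using W0(1) W1(1) B(1) L0 by (simp add: g_def)
    fix s y assume "s \<in> space halfline" and y: "y \<in> ball (t, x) \<rho>"
    then have s: "s > 0" by simp
    have "((\<lambda>u. wright \<gamma> u s) has_derivative (\<lambda>v. v * wright (\<gamma> + 1) (fst y) s)) (at (fst y))"
      using wright_has_derivative[OF near(3)[OF y], of s \<gamma>] s by (simp add: has_vector_derivative_def)
    from has_derivative_compose[OF has_derivative_fst[OF has_derivative_ident] this]
    have 1: "((\<lambda>y. wright \<gamma> (fst y) s) has_derivative (\<lambda>h. fst h * wright (\<gamma> + 1) (fst y) s)) (at y)" .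
    from has_derivative_compose[OF has_derivative_snd[OF has_derivative_ident] weighted_Z_has_derivative[OF b \<delta> s sb]]
    have 2: "((\<lambda>y. weighted_Z b a \<beta> s (snd y)) has_derivative (\<lambda>h. \<Sum>l\<in>UNIV. snd h $ l *\<^sub>R cscale \<i> (weighted_Z b a (bl l) s (snd y)))) (at y)"
      unfolding bl_def .
    show "(F s has_derivative F' s y) (at y)"
      unfolding F_def[abs_def] F'_def[abs_def] by (rule has_derivative_scaleR[OF 1 2])
    fix h :: "real \<times> (real ^ 'n)"
    have n1: "norm (\<Sum>l\<in>UNIV. snd h $ l *\<^sub>R cscale \<i> (weighted_Z b a (bl l) s (snd y))) \<le> norm h * L"
    proof -
      have "norm (snd h $ l *\<^sub>R cscale \<i> (weighted_Z b a (bl l) s (snd y))) \<le> norm h * D l" for l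
      proof -
        have "\<bar>snd h $ l\<bar> \<le> norm h"
          using component_le_norm_cart[of "snd h" l] norm_snd_le[of "snd h" "fst h"] by simp
        moreover have "norm (weighted_Z b a (bl l) s (snd y)) \<le> D l" using D(2)[OF s near(4)[OF y], of l] s by simp
        ultimately show ?thesis by (simp add: norm_cscale mult_mono)
      qed
      then show ?thesis unfolding L_def sum_distrib_left by (intro order_trans[OF norm_sum] sum_mono)
    qed
    have n2: "norm (weighted_Z b a \<beta> s (snd y)) \<le> B" using B(2)[OF s near(4)[OF y]] s by simp
    have n3: "\<bar>fst h\<bar> \<le> norm h" using norm_fst_le[of "fst h" "snd h"] by simp
    have "norm (F' s y h) \<le> \<bar>wright \<gamma> (fst y) s\<bar> * norm (\<Sum>l\<in>UNIV. snd h $ l *\<^sub>R cscale \<i> (weighted_Z b a (bl l) s (snd y)))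
        + \<bar>fst h\<bar> * \<bar>wright (\<gamma> + 1) (fst y) s\<bar> * norm (weighted_Z b a \<beta> s (snd y))"
      unfolding F'_def by (rule order_trans[OF norm_triangle_ineq]) (simp add: abs_mult)
    also have "\<dots> \<le> (W0 * exp (- k0 * s)) * (norm h * L) + norm h * (W1 * exp (- k1 * s)) * B"
      using n1 n2 n3 W0(3)[OF near(1,2)[OF y], of s] W1(3)[OF near(1,2)[OF y], of s] s W0(1) W1(1)
      by (intro add_mono mult_mono) auto
    also have "\<dots> = g s * norm h" by (simp add: g_def algebra_simps)
    finally show "norm (F' s y h) \<le> g s * norm h" .
  qed
  moreover have "(\<integral>s. F' s (t, x) h \<partial>halfline) =
    (\<Sum>l\<in>UNIV. snd h $ l *\<^sub>R cscale \<i> (frac_kernel b a \<gamma> (bl l) t x)) + fst h *\<^sub>R frac_kernel b a (\<gamma> + 1) \<beta> t x" for h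
  proof -
    have i1: "integrable halfline (\<lambda>s. wright \<gamma> t s *\<^sub>R weighted_Z b a (bl l) s x)" for l
      by (rule integrable_frac_kernel[OF b \<delta> K sb t x])
    have i2: "integrable halfline (\<lambda>s. wright (\<gamma> + 1) t s *\<^sub>R weighted_Z b a \<beta> s x)"
      by (rule integrable_frac_kernel[OF b \<delta> K sb t x])
    have i3: "integrable halfline (\<lambda>s. snd h $ l *\<^sub>R cscale \<i> (wright \<gamma> t s *\<^sub>R weighted_Z b a (bl l) s x))" for l
      by (intro integrable_scaleR_right integrable_bounded_linear[OF bounded_linear_cscale_right] i1)
    have "F' s (t, x) h = (\<Sum>l\<in>UNIV. snd h $ l *\<^sub>R cscale \<i> (wright \<gamma> t s *\<^sub>R weighted_Z b a (bl l) s x))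
        + fst h *\<^sub>R (wright (\<gamma> + 1) t s *\<^sub>R weighted_Z b a \<beta> s x)" for s
      by (simp add: F'_def linear_cmul[OF bounded_linear.linear[OF bounded_linear_cscale_right]] scaleR_sum_right mult.commute)
    then have "(\<integral>s. F' s (t, x) h \<partial>halfline) = (\<integral>s. (\<Sum>l\<in>UNIV. snd h $ l *\<^sub>R cscale \<i> (wright \<gamma> t s *\<^sub>R weighted_Z b a (bl l) s x))
        + fst h *\<^sub>R (wright (\<gamma> + 1) t s *\<^sub>R weighted_Z b a \<beta> s x) \<partial>halfline)"
      by (simp only:)
    also have "\<dots> = (\<integral>s. (\<Sum>l\<in>UNIV. snd h $ l *\<^sub>R cscale \<i> (wright \<gamma> t s *\<^sub>R weighted_Z b a (bl l) s x)) \<partial>halfline)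
        + (\<integral>s. fst h *\<^sub>R (wright (\<gamma> + 1) t s *\<^sub>R weighted_Z b a \<beta> s x) \<partial>halfline)"
      by (intro Bochner_Integration.integral_add Bochner_Integration.integrable_sum i3 integrable_scaleR_right i2)
    also have "(\<integral>s. (\<Sum>l\<in>UNIV. snd h $ l *\<^sub>R cscale \<i> (wright \<gamma> t s *\<^sub>R weighted_Z b a (bl l) s x)) \<partial>halfline) =
        (\<Sum>l\<in>UNIV. (\<integral>s. snd h $ l *\<^sub>R cscale \<i> (wright \<gamma> t s *\<^sub>R weighted_Z b a (bl l) s x) \<partial>halfline))"
      by (intro Bochner_Integration.integral_sum i3)
    finally show ?thesis
      unfolding integral_scaleR_right integral_bounded_linear[OF bounded_linear_cscale_right i1] frac_kernel_def .
  qed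
  moreover have "(\<lambda>(t, x). frac_kernel b a \<gamma> \<beta> t x) = (\<lambda>y. \<integral>s. F s y \<partial>halfline)"
    by (simp add: frac_kernel_def F_def case_prod_beta')
  ultimately show ?thesis by (simp add: bl_def)
qed

text \<open>
  Induction on the order, simultaneously for all members of the family.
\<close>

lemma C_infinity_on_frac_kernel:
  fixes a :: "('n::finite \<Rightarrow> nat) \<Rightarrow> complex ^ 'N ^ ('N::finite)"
  assumes b: "b \<ge> 1" and \<delta>: "\<delta> > 0" and K: "K > 0" and sb: "strip_bound b \<delta> K a"
  shows "C_infinity_on {(t, x). t > 0 \<and> x \<noteq> 0} (\<lambda>(t, x). frac_kernel b a \<gamma> \<beta> t x)"
proof -
  define S where "S = {(t, x :: real ^ 'n). t > (0::real) \<and> x \<noteq> 0}"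
  have S: "open S" unfolding S_def by (rule open_positive_time_nonzero)
  have der: "((\<lambda>(t, x). frac_kernel b a \<gamma> \<beta> t x) has_derivative
    (\<lambda>h. (\<Sum>l\<in>UNIV. snd h $ l *\<^sub>R cscale \<i> (frac_kernel b a \<gamma> (\<beta>(l := Suc (\<beta> l))) (fst y) (snd y))) +
      fst h *\<^sub>R frac_kernel b a (\<gamma> + 1) \<beta> (fst y) (snd y))) (at y)" if "y \<in> S" for y \<gamma> \<beta>
    using frac_kernel_has_derivative[OF b \<delta> K sb, of "fst y" "snd y" \<gamma> \<beta>] that by (auto simp: S_def)
  have "C_k_on k S (\<lambda>(t, x). frac_kernel b a \<gamma> \<beta> t x)" for k
  proof (induction k arbitrary: \<gamma> \<beta>)
    case 0
    have "continuous_on S (\<lambda>(t, x). frac_kernel b a \<gamma> \<beta> t x)"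
      by (rule has_derivative_continuous_on) (rule has_derivative_at_withinI[OF der])
    then show ?case by simp
  next
    case (Suc k)
    show ?case
    proof (rule C_k_on_SucI[OF S der])
      fix v :: "real \<times> (real ^ 'n)"
      have 1: "C_k_on k S (\<lambda>y. frac_kernel b a \<gamma> \<beta> (fst y) (snd y))" for \<gamma> \<beta>
        using Suc.IH[of \<gamma> \<beta>] by (simp add: case_prod_beta')
      have "C_k_on k S (\<lambda>y. snd v $ l *\<^sub>R cscale \<i> (frac_kernel b a \<gamma> (\<beta>(l := Suc (\<beta> l))) (fst y) (snd y)))" for l
        by (rule C_k_on_bounded_linear[OF S bounded_linear_compose[OF bounded_linear_scaleR_right bounded_linear_cscale_right] 1])
      moreover have "C_k_on k S (\<lambda>y. fst v *\<^sub>R frac_kernel b a (\<gamma> + 1) \<beta> (fst y) (snd y))"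
        by (rule C_k_on_bounded_linear[OF S bounded_linear_scaleR_right 1])
      ultimately show "C_k_on k S (\<lambda>y. (\<Sum>l\<in>UNIV. snd v $ l *\<^sub>R cscale \<i> (frac_kernel b a \<gamma> (\<beta>(l := Suc (\<beta> l))) (fst y) (snd y))) +
          fst v *\<^sub>R frac_kernel b a (\<gamma> + 1) \<beta> (fst y) (snd y))"
        by (intro C_k_on_add[OF S] C_k_on_sum[OF S])
    qed
  qed
  then show ?thesis unfolding C_infinity_on_def S_def by blast
qed

lemma partial_D_frac_kernel:
  fixes a :: "('n::finite \<Rightarrow> nat) \<Rightarrow> complex ^ 'N ^ ('N::finite)"
  assumes b: "b \<ge> 1" and \<delta>: "\<delta> > 0" and K: "K > 0" and sb: "strip_bound b \<delta> K a" and t: "t > 0" and x: "x \<noteq> 0"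
  shows "partial_D j (frac_kernel b a \<gamma> \<beta> t) x = frac_kernel b a \<gamma> (\<beta>(j := Suc (\<beta> j))) t x"
proof -
  have "((\<lambda>x. (t, x)) has_derivative (\<lambda>h. (0, h))) (at x)" by (auto intro!: derivative_eq_intros)
  from has_derivative_compose[OF this frac_kernel_has_derivative[OF b \<delta> K sb t x, of \<gamma> \<beta>]]
  have "(frac_kernel b a \<gamma> \<beta> t has_derivative
      (\<lambda>h. \<Sum>l\<in>UNIV. h $ l *\<^sub>R cscale \<i> (frac_kernel b a \<gamma> (\<beta>(l := Suc (\<beta> l))) t x))) (at x)" by simp
  from partial_D_has_derivative[OF this, of j]
  have "partial_D j (frac_kernel b a \<gamma> \<beta> t) x =
      cscale (1 / \<i>) (\<Sum>l\<in>UNIV. (if l = j then cscale \<i> (frac_kernel b a \<gamma> (\<beta>(l := Suc (\<beta> l))) t x) else 0))"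
    by (simp add: axis_def if_distrib[of "\<lambda>c. c *\<^sub>R _"] cong: if_cong)
  also have "\<dots> = frac_kernel b a \<gamma> (\<beta>(j := Suc (\<beta> j))) t x" by (simp add: vec_eq_iff)
  finally show ?thesis .
qed

lemma multi_D_frac_kernel:
  fixes a :: "('n::{finite,linorder} \<Rightarrow> nat) \<Rightarrow> complex ^ 'N ^ ('N::finite)"
  assumes b: "b \<ge> 1" and \<delta>: "\<delta> > 0" and K: "K > 0" and sb: "strip_bound b \<delta> K a" and t: "t > 0" and x: "x \<noteq> 0"
    and F: "\<And>x. x \<noteq> 0 \<Longrightarrow> F x = frac_kernel b a \<gamma> (\<lambda>_. 0) t x"
  shows "multi_D \<beta> F x = frac_kernel b a \<gamma> \<beta> t x"
proof (rule multi_D_family[where S = "- {0}" and H = "\<lambda>\<beta>. frac_kernel b a \<gamma> \<beta> t"])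
  show "partial_D j (frac_kernel b a \<gamma> \<beta> t) x = frac_kernel b a \<gamma> (\<beta>(j := Suc (\<beta> j))) t x" if "x \<in> - {0}" for \<beta> j x
    using partial_D_frac_kernel[OF b \<delta> K sb t] that by simp
qed (use F x in auto)

lemma frac_kernel_has_time_derivative:
  fixes a :: "('n::finite \<Rightarrow> nat) \<Rightarrow> complex ^ 'N ^ ('N::finite)"
  assumes b: "b \<ge> 1" and \<delta>: "\<delta> > 0" and K: "K > 0" and sb: "strip_bound b \<delta> K a" and t: "t > 0" and x: "x \<noteq> 0"
  shows "((\<lambda>t. frac_kernel b a \<gamma> \<beta> t x) has_vector_derivative frac_kernel b a (\<gamma> + 1) \<beta> t x) (at t)"
proof -
  have "((\<lambda>t. (t, x)) has_derivative (\<lambda>h. (h, 0))) (at t)" by (auto intro!: derivative_eq_intros)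
  from has_derivative_compose[OF this frac_kernel_has_derivative[OF b \<delta> K sb t x, of \<gamma> \<beta>]]
  show ?thesis by (simp add: has_vector_derivative_def)
qed

lemma Z_frac_eq_frac_kernel:
  "t > 0 \<Longrightarrow> Z_frac \<alpha> b a t x = frac_kernel b a (\<alpha> - 1) (\<lambda>_. 0) t x"
  unfolding Z_frac_def frac_kernel_def integral_halfline[symmetric]
  by (auto intro!: Bochner_Integration.integral_cong simp: phi_eq_wright Z_kernel_eq_weighted_Z)

lemma Z_frac_dt_eq_frac_kernel:
  fixes a :: "('n::finite \<Rightarrow> nat) \<Rightarrow> complex ^ 'N ^ ('N::finite)"
  assumes b: "b \<ge> 1" and \<delta>: "\<delta> > 0" and K: "K > 0" and sb: "strip_bound b \<delta> K a" and t: "t > 0" and x: "x \<noteq> 0"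
  shows "Z_frac_dt \<alpha> b a t x = frac_kernel b a \<alpha> (\<lambda>_. 0) t x"
proof -
  have "((\<lambda>t. frac_kernel b a (\<alpha> - 1) (\<lambda>_. 0) t x) has_vector_derivative frac_kernel b a \<alpha> (\<lambda>_. 0) t x) (at t)"
    using frac_kernel_has_time_derivative[OF assms, of "\<alpha> - 1" "\<lambda>_. 0"] by simp
  then have "((\<lambda>t. Z_frac \<alpha> b a t x) has_vector_derivative frac_kernel b a \<alpha> (\<lambda>_. 0) t x) (at t)"
    by (rule has_vector_derivative_transform_within_open[of _ _ _ "{0<..}"]) (use t in \<open>auto simp: Z_frac_eq_frac_kernel\<close>)
  then show ?thesis unfolding Z_frac_dt_def by (rule vector_derivative_at)
qed

text \<open>
  The factor \<open>t powr (- \<alpha>)\<close> of \<open>wright_bound\<close> is singular at \<open>t = 0\<close>. Writing it as \<open>y / s\<close> with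
  \<open>y = s * t powr (- \<alpha>)\<close>, the \<open>y\<close> is absorbed by the exponential; there remains \<open>1 / s\<close>, harmless in front of
  \<open>weighted_Z\<close> by \<open>weighted_Z_dominated\<close> with \<open>\<eta> = 1\<close>.
\<close>

lemma wright_dominated_initial:
  assumes T: "T > 0"
  shows "\<exists>W>0. \<exists>k>0. \<forall>t s. 0 < t \<and> t \<le> T \<and> 0 < s \<longrightarrow> \<bar>wright (\<alpha> - 1) t s\<bar> \<le> W / s * exp (- k * s)"
proof -
  define q where "q = 1 / (1 - \<alpha>)"
  have q: "q \<ge> 1" using alpha_pos alpha_less by (simp add: q_def)
  obtain C c where Cc: "C > 0" "c > 0" and bd: "\<And>t s. t > 0 \<Longrightarrow> s \<ge> 0 \<Longrightarrow>
      \<bar>wright (\<alpha> - 1) t s\<bar> \<le> C * t powr (- (\<alpha> - 1) - 1) * exp (- c * (s * t powr (- \<alpha>)) powr q)"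
    using wright_bound[of "\<alpha> - 1"] unfolding q_def by blast
  obtain D where D: "D > 0" "\<And>y. y \<ge> 0 \<Longrightarrow> y powr 1 * exp (- (c/2) * y powr q) \<le> D"
    using powr_mult_exp_powr_bounded[of 1 "c/2" q] Cc q by auto
  define k where "k = c / 2 * T powr (- \<alpha>)"
  have k: "k > 0" using Cc T by (simp add: k_def)
  have "\<bar>wright (\<alpha> - 1) t s\<bar> \<le> (C * D * exp (c/2)) / s * exp (- k * s)" if h: "0 < t" "t \<le> T" "0 < s" for t s
  proof -
    define y where "y = s * t powr (- \<alpha>)"
    have y0: "y > 0" using h by (simp add: y_def)
    have ty: "t powr (- \<alpha>) = y / s" using h by (simp add: y_def)
    have "y - 1 \<le> y powr q" by (rule diff_one_le_powr[OF q])
    then have "(c/2) * (y - 1) \<le> (c/2) * y powr q" using Cc by (intro mult_left_mono) auto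
    moreover have "k * s \<le> (c/2) * y"
    proof -
      have "T powr (- \<alpha>) \<le> t powr (- \<alpha>)" using h alpha_pos by (intro powr_mono2') auto
      then have "(c/2) * (s * T powr (- \<alpha>)) \<le> (c/2) * (s * t powr (- \<alpha>))" using Cc h by (intro mult_left_mono) auto
      then show ?thesis by (simp add: k_def y_def mult_ac)
    qed
    ultimately have "- (c/2) * y powr q \<le> c/2 + - k * s" by (simp add: right_diff_distrib)
    then have e: "exp (- (c/2) * y powr q) \<le> exp (c/2) * exp (- k * s)" unfolding mult_exp_exp by simp
    have "exp (- c * y powr q) = exp (- (c/2) * y powr q) * exp (- (c/2) * y powr q)" by (simp add: mult_exp_exp)
    then have "y * exp (- c * y powr q) = (y powr 1 * exp (- (c/2) * y powr q)) * exp (- (c/2) * y powr q)"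
      using y0 by simp
    also have "\<dots> \<le> D * (exp (c/2) * exp (- k * s))"
      using D(2)[of y] D(1) y0 e by (intro mult_mono) auto
    finally have f: "y * exp (- c * y powr q) \<le> D * (exp (c/2) * exp (- k * s))" .
    have "\<bar>wright (\<alpha> - 1) t s\<bar> \<le> C * t powr (- \<alpha>) * exp (- c * y powr q)"
      using bd[of t s] h by (simp add: y_def)
    also have "\<dots> = (C / s) * (y * exp (- c * y powr q))" unfolding ty by simp
    also have "\<dots> \<le> (C / s) * (D * (exp (c/2) * exp (- k * s)))" using f Cc h by (intro mult_left_mono) auto
    finally show ?thesis by (simp add: mult_ac)
  qed
  moreover have "C * D * exp (c/2) > 0" using Cc D by simp
  ultimately show ?thesis using k by blast
qed

text \<open>
  Fubini reduces this to the scalar identity \<open>fractional_integral_wright\<close>.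
\<close>

lemma fractional_integral_Z_frac:
  fixes a :: "('n::finite \<Rightarrow> nat) \<Rightarrow> complex ^ 'N ^ ('N::finite)"
  assumes b: "b \<ge> 1" and \<delta>: "\<delta> > 0" and K: "K > 0" and sb: "strip_bound b \<delta> K a" and T: "T > 0" and x: "x \<noteq> 0"
  shows "(LINT \<tau>:{0<..<T}|lborel. (T - \<tau>) powr (- (1 - \<alpha>)) *\<^sub>R Z_frac \<alpha> b a \<tau> x) =
    Gamma \<alpha> *\<^sub>R frac_kernel b a (- 1) (\<lambda>_. 0) T x"
proof -
  define V where "V s = weighted_Z b a (\<lambda>_. 0) s x" for s
  define g where "g \<tau> = indicator {0<..<T} \<tau> * (T - \<tau>) powr (\<alpha> - 1)" for \<tau> :: real
  have g0: "g \<tau> \<ge> 0" for \<tau> by (simp add: g_def)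
  have gi: "integrable lborel g" unfolding g_def by (rule integrable_powr_left_of[OF alpha_pos T])
  obtain W k where W: "W > 0" "k > 0" "\<And>t s. 0 < t \<Longrightarrow> t \<le> T \<Longrightarrow> 0 < s \<Longrightarrow> \<bar>wright (\<alpha> - 1) t s\<bar> \<le> W / s * exp (- k * s)"
    using wright_dominated_initial[OF T] by blast
  have "norm x > 0" using x by simp
  then obtain B where B: "B > 0" "\<And>s. s > 0 \<Longrightarrow> norm (V s) \<le> B * s powr 1"
    using weighted_Z_dominated[OF b \<delta> K sb, of "norm x" 1 "\<lambda>_. 0"] unfolding V_def by auto
  define f where "f \<tau> s = (g \<tau> * wright (\<alpha> - 1) \<tau> s) *\<^sub>R V s" for \<tau> s
  interpret P: pair_sigma_finite "lborel :: real measure" halfline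
    by (intro pair_sigma_finite.intro sigma_finite_lborel sigma_finite_halfline)
  have fi: "integrable (lborel \<Otimes>\<^sub>M halfline) (\<lambda>(\<tau>, s). f \<tau> s)"
  proof (rule Bochner_Integration.integrable_bound)
    show "integrable (lborel \<Otimes>\<^sub>M halfline) (\<lambda>(\<tau>, s). g \<tau> * ((W * B) * exp (- k * s)))"
      by (intro integrable_pair_mult sigma_finite_lborel sigma_finite_halfline gi integrable_mult_right integrable_halfline_exp W)
    define w where "w p = (case p of (t, s) \<Rightarrow> wright (\<alpha> - 1) t s)" for p
    have [measurable]: "w \<in> borel_measurable (lborel \<Otimes>\<^sub>M halfline)"
      unfolding w_def[abs_def] using borel_measurable_wright_pair by simp
    have [measurable]: "g \<in> borel_measurable lborel" using gi by auto
    have [measurable]: "V \<in> borel_measurable halfline"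
      unfolding V_def[abs_def] by (rule borel_measurable_weighted_Z_time[OF b \<delta> sb])
    have "(\<lambda>p. (g (fst p) * w p) *\<^sub>R V (snd p)) \<in> borel_measurable (lborel \<Otimes>\<^sub>M halfline)" by measurable
    then show "(\<lambda>(\<tau>, s). f \<tau> s) \<in> borel_measurable (lborel \<Otimes>\<^sub>M halfline)"
      by (simp add: f_def w_def case_prod_beta')
    show "AE y in (lborel :: real measure) \<Otimes>\<^sub>M halfline. norm (case y of (\<tau>, s) \<Rightarrow> f \<tau> s) \<le>
        norm (case y of (\<tau>, s) \<Rightarrow> g \<tau> * ((W * B) * exp (- k * s)))"
    proof (rule AE_I2)
      fix y assume "y \<in> space ((lborel :: real measure) \<Otimes>\<^sub>M halfline)"
      then obtain \<tau> s where y: "y = (\<tau>, s)" and s: "s > 0" by (auto simp: space_pair_measure)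
      have "norm (f \<tau> s) \<le> g \<tau> * ((W * B) * exp (- k * s))"
      proof (cases "\<tau> \<in> {0<..<T}")
        case True
        have "\<bar>wright (\<alpha> - 1) \<tau> s\<bar> * norm (V s) \<le> (W / s * exp (- k * s)) * (B * s)"
          using W(3)[of \<tau> s] B(2)[OF s] True s W(1) by (intro mult_mono) auto
        also have "\<dots> = (W * B) * exp (- k * s)" using s by simp
        finally have "g \<tau> * (\<bar>wright (\<alpha> - 1) \<tau> s\<bar> * norm (V s)) \<le> g \<tau> * ((W * B) * exp (- k * s))"
          by (intro mult_left_mono g0)
        then show ?thesis by (simp add: f_def abs_mult g0 mult.assoc)
      qed (simp add: f_def g_def)
      then show "norm (case y of (\<tau>, s) \<Rightarrow> f \<tau> s) \<le> norm (case y of (\<tau>, s) \<Rightarrow> g \<tau> * ((W * B) * exp (- k * s)))"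
        unfolding y by (simp add: order_trans[OF _ abs_ge_self])
    qed
  qed
  have "(LINT \<tau>:{0<..<T}|lborel. (T - \<tau>) powr (- (1 - \<alpha>)) *\<^sub>R Z_frac \<alpha> b a \<tau> x) = (\<integral>\<tau>. (\<integral>s. f \<tau> s \<partial>halfline) \<partial>lborel)"
    unfolding set_lebesgue_integral_def
  proof (intro Bochner_Integration.integral_cong refl)
    fix \<tau> :: real
    have "(\<integral>s. f \<tau> s \<partial>halfline) = g \<tau> *\<^sub>R frac_kernel b a (\<alpha> - 1) (\<lambda>_. 0) \<tau> x"
      unfolding f_def frac_kernel_def V_def scaleR_scaleR[symmetric] by (rule integral_scaleR_right)
    then show "indicator {0<..<T} \<tau> *\<^sub>R (T - \<tau>) powr (- (1 - \<alpha>)) *\<^sub>R Z_frac \<alpha> b a \<tau> x = (\<integral>s. f \<tau> s \<partial>halfline)"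
      by (cases "\<tau> \<in> {0<..<T}") (simp_all add: g_def Z_frac_eq_frac_kernel)
  qed
  also have "\<dots> = (\<integral>s. (\<integral>\<tau>. f \<tau> s \<partial>lborel) \<partial>halfline)"
    using P.Fubini_integral[OF fi] by simp
  also have "\<dots> = (\<integral>s. Gamma \<alpha> *\<^sub>R (wright (- 1) T s *\<^sub>R V s) \<partial>halfline)"
  proof (intro Bochner_Integration.integral_cong refl)
    fix s assume "s \<in> space halfline"
    then have s: "s > 0" by simp
    have "(\<integral>\<tau>. g \<tau> * wright (\<alpha> - 1) \<tau> s \<partial>lborel) = Gamma \<alpha> * wright (- 1) T s"
      unfolding g_def by (rule fractional_integral_wright[OF T s])
    moreover have "integrable lborel (\<lambda>\<tau>. g \<tau> * wright (\<alpha> - 1) \<tau> s)"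
    proof (rule Bochner_Integration.integrable_bound)
      show "integrable lborel (\<lambda>\<tau>. g \<tau> * (W / s * exp (- k * s)))" by (intro integrable_mult_left gi)
      have "(\<lambda>\<tau>. wright (\<alpha> - 1) \<tau> s) \<in> borel_measurable lborel"
        using measurable_Pair1[OF borel_measurable_wright_pair, of s "\<alpha> - 1"] s by simp
      then show "(\<lambda>\<tau>. g \<tau> * wright (\<alpha> - 1) \<tau> s) \<in> borel_measurable lborel"
        using gi by (intro borel_measurable_times) auto
      show "AE \<tau> in lborel. norm (g \<tau> * wright (\<alpha> - 1) \<tau> s) \<le> norm (g \<tau> * (W / s * exp (- k * s)))"
      proof (rule AE_I2)
        fix \<tau> :: real
        show "norm (g \<tau> * wright (\<alpha> - 1) \<tau> s) \<le> norm (g \<tau> * (W / s * exp (- k * s)))"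
        proof (cases "\<tau> \<in> {0<..<T}")
          case True
          then have "\<bar>wright (\<alpha> - 1) \<tau> s\<bar> \<le> \<bar>W / s * exp (- k * s)\<bar>"
            using W(3)[of \<tau> s] s by (intro order_trans[OF _ abs_ge_self[of "W / s * exp (- k * s)"]]) auto
          then have "\<bar>g \<tau>\<bar> * \<bar>wright (\<alpha> - 1) \<tau> s\<bar> \<le> \<bar>g \<tau>\<bar> * \<bar>W / s * exp (- k * s)\<bar>"
            by (rule mult_left_mono) simp
          then show ?thesis by (simp only: real_norm_def abs_mult[of "g \<tau>"])
        qed (simp add: g_def)
      qed
    qed
    ultimately have "(\<integral>\<tau>. f \<tau> s \<partial>lborel) = (Gamma \<alpha> * wright (- 1) T s) *\<^sub>R V s"
      unfolding f_def by (subst integral_scaleR_left) simp_all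
    then show "(\<integral>\<tau>. f \<tau> s \<partial>lborel) = Gamma \<alpha> *\<^sub>R (wright (- 1) T s *\<^sub>R V s)" by simp
  qed
  also have "\<dots> = Gamma \<alpha> *\<^sub>R frac_kernel b a (- 1) (\<lambda>_. 0) T x"
    unfolding frac_kernel_def V_def by (rule integral_scaleR_right)
  finally show ?thesis .
qed

text \<open>
  The Caputo derivative of order \<open>1 - \<alpha>\<close> differentiates the fractional integral of order \<open>\<alpha>\<close>; its initial
  term vanishes because \<open>Z_frac\<close> is \<open>0\<close> at time \<open>0\<close>.
\<close>

lemma Y_frac_eq_frac_kernel:
  fixes a :: "('n::finite \<Rightarrow> nat) \<Rightarrow> complex ^ 'N ^ ('N::finite)"
  assumes b: "b \<ge> 1" and \<delta>: "\<delta> > 0" and K: "K > 0" and sb: "strip_bound b \<delta> K a" and t: "t > 0" and x: "x \<noteq> 0"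
  shows "Y_frac \<alpha> b a t x = frac_kernel b a 0 (\<lambda>_. 0) t x"
proof -
  have "((\<lambda>T. Gamma \<alpha> *\<^sub>R frac_kernel b a (- 1) (\<lambda>_. 0) T x) has_vector_derivative Gamma \<alpha> *\<^sub>R frac_kernel b a 0 (\<lambda>_. 0) t x) (at t)"
    using bounded_linear.has_vector_derivative[OF bounded_linear_scaleR_right frac_kernel_has_time_derivative[OF assms, of "- 1" "\<lambda>_. 0"]]
    by simp
  then have "((\<lambda>T. LINT \<tau>:{0<..<T}|lborel. (T - \<tau>) powr (- (1 - \<alpha>)) *\<^sub>R Z_frac \<alpha> b a \<tau> x)
      has_vector_derivative Gamma \<alpha> *\<^sub>R frac_kernel b a 0 (\<lambda>_. 0) t x) (at t)"
  proof (rule has_vector_derivative_transform_within_open[of _ _ _ "{0<..}"])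
    show "Gamma \<alpha> *\<^sub>R frac_kernel b a (- 1) (\<lambda>_. 0) T x =
        (LINT \<tau>:{0<..<T}|lborel. (T - \<tau>) powr (- (1 - \<alpha>)) *\<^sub>R Z_frac \<alpha> b a \<tau> x)" if "T \<in> {0<..}" for T
      using that by (intro fractional_integral_Z_frac[OF b \<delta> K sb _ x, symmetric]) simp
  qed (use t in auto)
  from vector_derivative_at[OF this]
  have "Y_frac \<alpha> b a t x = (1 / Gamma \<alpha>) *\<^sub>R Gamma \<alpha> *\<^sub>R frac_kernel b a 0 (\<lambda>_. 0) t x"
    unfolding Y_frac_def caputo_def by (simp add: Z_frac_def)
  then show ?thesis using Gamma_real_pos[OF alpha_pos] by simp
qed

end

section \<open>The estimates\<close>

text \<open>
  The substitution \<open>s = t powr \<alpha> * z\<close> separates the dependence on \<open>t\<close> from that on \<open>R\<close>.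
\<close>

lemma norm_subordination_le:
  fixes F :: "real \<Rightarrow> 'a::{banach, second_countable_topology}" and w :: "real \<Rightarrow> real"
    and \<alpha> q p c1 c2 \<nu> X t A B :: real
  assumes q: "q > 0" and p: "p > 0" and c: "c1 > 0" "c2 > 0" and nu: "\<nu> \<ge> 0" and X: "X > 0" and t: "t > 0"
    and A: "A \<ge> 0" and B: "B \<ge> 0"
    and w: "\<And>s. s > 0 \<Longrightarrow> \<bar>w s\<bar> \<le> A * exp (- c1 * (s * t powr (- \<alpha>)) powr q)"
    and F: "\<And>s. s > 0 \<Longrightarrow> norm (F s) \<le> B * s powr (- \<nu>) * exp (- c2 * (X / s) powr p)"
  shows "norm (\<integral>s. w s *\<^sub>R F s \<partial>halfline) \<le>
    A * B * t powr (\<alpha> * (1 - \<nu>)) * subord_integral q p c1 c2 \<nu> (t powr (- \<alpha>) * X)"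
proof -
  define R where "R = t powr (- \<alpha>) * X"
  have R: "R > 0" using X t by (simp add: R_def)
  define c where "c = t powr \<alpha>"
  have cp: "c > 0" using t by (simp add: c_def)
  define G where "G s = A * B * (exp (- c1 * (s * t powr (- \<alpha>)) powr q) * s powr (- \<nu>) * exp (- c2 * (X / s) powr p))" for s
  have G: "G (c * z) = A * B * t powr (- \<alpha> * \<nu>) * subord_integrand q p c1 c2 \<nu> R z" if "z \<in> space halfline" for z
  proof -
    have z: "z > 0" using that by simp
    have 1: "c * z * t powr (- \<alpha>) = z" using t by (simp add: c_def powr_minus)
    have 2: "(c * z) powr (- \<nu>) = t powr (- \<alpha> * \<nu>) * z powr (- \<nu>)"
      using z cp by (simp add: powr_mult) (simp add: c_def powr_powr)
    have 3: "X / (c * z) = R / z" using t by (simp add: c_def R_def powr_minus field_simps)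
    show ?thesis unfolding G_def 1 2 3 subord_integrand_def by (simp only: mult_ac)
  qed
  have i: "integrable halfline (\<lambda>z. A * B * t powr (- \<alpha> * \<nu>) * subord_integrand q p c1 c2 \<nu> R z)"
    by (intro integrable_mult_right integrable_subord_integrand q p c nu R)
  then have "integrable halfline (\<lambda>z. G (c * z))"
    by (rule Bochner_Integration.integrable_cong[THEN iffD1, rotated -1]) (simp_all only: G)
  then have Gi: "integrable halfline G" using integrable_halfline_scale[OF cp, of G] by simp
  have "norm (\<integral>s. w s *\<^sub>R F s \<partial>halfline) \<le> (\<integral>s. G s \<partial>halfline)"
  proof (rule norm_integral_le[OF Gi])
    fix s assume "s \<in> space halfline"
    then have s: "s > 0" by simp
    have "norm (w s *\<^sub>R F s) \<le> (A * exp (- c1 * (s * t powr (- \<alpha>)) powr q)) * (B * s powr (- \<nu>) * exp (- c2 * (X / s) powr p))"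
      unfolding norm_scaleR using w[OF s] F[OF s] A by (intro mult_mono) auto
    then show "norm (w s *\<^sub>R F s) \<le> G s" unfolding G_def by (simp only: mult_ac)
  qed
  also have "(\<integral>s. G s \<partial>halfline) = c * (\<integral>z. G (c * z) \<partial>halfline)"
    using integral_halfline_scale[OF cp, of G] by simp
  also have "(\<integral>z. G (c * z) \<partial>halfline) = (\<integral>z. A * B * t powr (- \<alpha> * \<nu>) * subord_integrand q p c1 c2 \<nu> R z \<partial>halfline)"
    by (intro Bochner_Integration.integral_cong refl G)
  also have "\<dots> = A * B * t powr (- \<alpha> * \<nu>) * subord_integral q p c1 c2 \<nu> R"
    unfolding subord_integral_def by (rule integral_mult_right_zero)
  also have "c * (A * B * t powr (- \<alpha> * \<nu>) * subord_integral q p c1 c2 \<nu> R) =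
      A * B * (t powr \<alpha> * t powr (- \<alpha> * \<nu>)) * subord_integral q p c1 c2 \<nu> R"
    unfolding c_def by (simp only: mult_ac)
  also have "t powr \<alpha> * t powr (- \<alpha> * \<nu>) = t powr (\<alpha> * (1 - \<nu>))"
    unfolding powr_add[symmetric] by (simp add: algebra_simps)
  finally show ?thesis by (simp add: R_def)
qed

context fractional_order begin

lemma R_var_pos: "t > 0 \<Longrightarrow> x \<noteq> 0 \<Longrightarrow> R_var \<alpha> b t x > 0"
  by (simp add: R_var_def)

lemma R_var_powr:
  assumes t: "t > 0" and x: "x \<noteq> 0" and b: "b \<ge> 1"
  shows "R_var \<alpha> b t x powr e = t powr (- \<alpha> * e) * norm x powr (2 * real b * e)"
proof -
  have "norm x ^ (2 * b) = norm x powr (2 * real b)" using x by (simp add: powr_realpow[symmetric])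
  then show ?thesis using t x by (simp add: R_var_def powr_mult powr_powr)
qed

text \<open>
  The four regimes of the estimates for one member of the family, with constants common to all coefficients that satisfy the
  strip bound. The argument of type \<open>itself\<close> makes the size \<open>'N\<close> of the matrices, which otherwise occurs in a bound
  variable only, a parameter.
\<close>

definition kernel_estimates ::
  "nat \<Rightarrow> real \<Rightarrow> real \<Rightarrow> real \<Rightarrow> ('n::finite \<Rightarrow> nat) \<Rightarrow> 'N::finite itself \<Rightarrow> real \<Rightarrow> real \<Rightarrow> bool" where
  "kernel_estimates b \<delta> K \<gamma> \<beta> _ C \<sigma> \<longleftrightarrow>
    (\<forall>a :: ('n \<Rightarrow> nat) \<Rightarrow> complex ^ 'N ^ 'N. \<forall>t x. strip_bound b \<delta> K a \<and> t > 0 \<and> x \<noteq> 0 \<longrightarrow>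
      (R_var \<alpha> b t x \<ge> 1 \<longrightarrow> norm (frac_kernel b a \<gamma> \<beta> t x) \<le>
        C * t powr (- \<gamma> - 1 + \<alpha> - \<alpha> * (real (CARD('n) + mi_size \<beta>) / (2 * real b))) * exp (- \<sigma> * rho \<alpha> b t x)) \<and>
      (CARD('n) + mi_size \<beta> < 2 * b \<longrightarrow> norm (frac_kernel b a \<gamma> \<beta> t x) \<le>
        C * t powr (- \<gamma> - 1 + \<alpha> - \<alpha> * (real (CARD('n) + mi_size \<beta>) / (2 * real b)))) \<and>
      (CARD('n) + mi_size \<beta> > 2 * b \<longrightarrow> norm (frac_kernel b a \<gamma> \<beta> t x) \<le>
        C * t powr (- \<gamma> - 1) * norm x powr (- real CARD('n) + 2 * real b - real (mi_size \<beta>))) \<and>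
      (CARD('n) + mi_size \<beta> = 2 * b \<and> R_var \<alpha> b t x \<le> 1 \<longrightarrow> norm (frac_kernel b a \<gamma> \<beta> t x) \<le>
        C * t powr (- \<gamma> - 1) * (\<bar>ln (R_var \<alpha> b t x)\<bar> + 1)))"

lemma kernel_estimates_mono:
  assumes e: "kernel_estimates b \<delta> K \<gamma> \<beta> TYPE('N::finite) C \<sigma>" and C: "C \<le> C'" and s: "\<sigma>' \<le> \<sigma>" "0 \<le> C"
  shows "kernel_estimates b \<delta> K \<gamma> (\<beta> :: 'n::finite \<Rightarrow> nat) TYPE('N) C' \<sigma>'"
proof -
  have m: "Y \<le> C' * P" if "Y \<le> C * P" "P \<ge> 0" for Y P
    using mult_right_mono[OF C that(2)] that(1) by linarith
  have m2: "Y \<le> C' * P * exp (- \<sigma>' * \<rho>)" if "Y \<le> C * P * exp (- \<sigma> * \<rho>)" "P \<ge> 0" "\<rho> \<ge> 0" for Y P \<rho>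
  proof -
    have "exp (- \<sigma> * \<rho>) \<le> exp (- \<sigma>' * \<rho>)" using s that by (simp add: mult_right_mono)
    then have "C * P * exp (- \<sigma> * \<rho>) \<le> C' * P * exp (- \<sigma>' * \<rho>)" using C s that by (intro mult_mono) auto
    then show ?thesis using that(1) by linarith
  qed
  have rho: "rho \<alpha> b t x \<ge> 0" for t and x :: "real ^ 'n" by (simp add: rho_def)
  show ?thesis
    unfolding kernel_estimates_def
  proof (intro allI impI conjI)
    fix a :: "('n \<Rightarrow> nat) \<Rightarrow> complex ^ 'N ^ 'N" and t :: real and x :: "real ^ 'n"
    assume h: "strip_bound b \<delta> K a \<and> t > 0 \<and> x \<noteq> 0"
    note est = e[unfolded kernel_estimates_def, rule_format, OF h]
    show "norm (frac_kernel b a \<gamma> \<beta> t x) \<le>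
        C' * t powr (- \<gamma> - 1 + \<alpha> - \<alpha> * (real (CARD('n) + mi_size \<beta>) / (2 * real b))) * exp (- \<sigma>' * rho \<alpha> b t x)"
      if "R_var \<alpha> b t x \<ge> 1" using est that by (intro m2 rho) auto
    show "norm (frac_kernel b a \<gamma> \<beta> t x) \<le>
        C' * t powr (- \<gamma> - 1 + \<alpha> - \<alpha> * (real (CARD('n) + mi_size \<beta>) / (2 * real b)))"
      if "CARD('n) + mi_size \<beta> < 2 * b" using est that by (intro m) auto
    show "norm (frac_kernel b a \<gamma> \<beta> t x) \<le>
        C' * t powr (- \<gamma> - 1) * norm x powr (- real CARD('n) + 2 * real b - real (mi_size \<beta>))"
      if "2 * b < CARD('n) + mi_size \<beta>" using est that unfolding mult.assoc by (intro m) auto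
    show "norm (frac_kernel b a \<gamma> \<beta> t x) \<le> C' * t powr (- \<gamma> - 1) * (\<bar>ln (R_var \<alpha> b t x)\<bar> + 1)"
      if "CARD('n) + mi_size \<beta> = 2 * b \<and> R_var \<alpha> b t x \<le> 1" using est that unfolding mult.assoc by (intro m) auto
  qed
qed

text \<open>
  The bounds for the two factors and the four bounds for \<open>subord_integral\<close>. The powers of \<open>t\<close> combine with
  those in \<open>R powr (1 - \<nu>)\<close> to \<open>t powr (- \<gamma> - 1)\<close> in the singular case.
\<close>

lemma kernel_estimates_exist:
  fixes \<beta> :: "'n::finite \<Rightarrow> nat"
  assumes b: "b \<ge> 1" and \<delta>: "\<delta> > 0" and K: "K > 0"
  shows "\<exists>C>0. \<exists>\<sigma>>0. kernel_estimates b \<delta> K \<gamma> \<beta> TYPE('N::finite) C \<sigma>"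
proof -
  define q where "q = 1 / (1 - \<alpha>)"
  define p where "p = 1 / (2 * real b - 1)"
  define \<nu> where "\<nu> = real (CARD('n) + mi_size \<beta>) / (2 * real b)"
  have q: "q \<ge> 1" "q > 0" using alpha_pos alpha_less by (auto simp: q_def)
  have p: "p > 0" using b by (simp add: p_def)
  have nu: "\<nu> \<ge> 0" by (simp add: \<nu>_def)
  have qp: "q * p / (q + p) = 1 / (2 * real b - \<alpha>)"
  proof -
    have "q * p / (q + p) = 1 / (1 / p + 1 / q)" using q p by (simp add: field_simps)
    then show ?thesis by (simp add: q_def p_def)
  qed
  obtain Cw cw where w: "Cw > 0" "cw > 0" "\<And>t s. t > 0 \<Longrightarrow> s \<ge> 0 \<Longrightarrow>
      \<bar>wright \<gamma> t s\<bar> \<le> Cw * t powr (- \<gamma> - 1) * exp (- cw * (s * t powr (- \<alpha>)) powr q)"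
    using wright_bound[of \<gamma>] unfolding q_def by blast
  obtain Cz cz where z: "Cz > 0" "cz > 0" and bz: "\<forall>a :: ('n \<Rightarrow> nat) \<Rightarrow> complex ^ 'N ^ 'N. strip_bound b \<delta> K a \<longrightarrow>
    (\<forall>s>0. \<forall>x. norm (weighted_Z b a \<beta> s x) \<le> Cz * s powr (- \<nu>) * exp (- cz * (norm x ^ (2 * b) / s) powr p))"
    using weighted_Z_bound[OF b \<delta> K, of \<beta>, where 'N = 'N] unfolding p_def \<nu>_def by blast
  define J where "J = subord_integral q p cw cz \<nu>"
  have master: "norm (frac_kernel b a \<gamma> \<beta> t x) \<le> (Cw * Cz) * (t powr (- \<gamma> - 1 + \<alpha> - \<alpha> * \<nu>) * J (R_var \<alpha> b t x))"
    if sb: "strip_bound b \<delta> K a" and t: "t > 0" and x: "x \<noteq> 0" for a :: "('n \<Rightarrow> nat) \<Rightarrow> complex ^ 'N ^ 'N" and t x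
  proof -
    have "norm (frac_kernel b a \<gamma> \<beta> t x) \<le>
        (Cw * t powr (- \<gamma> - 1)) * Cz * t powr (\<alpha> * (1 - \<nu>)) * subord_integral q p cw cz \<nu> (t powr (- \<alpha>) * norm x ^ (2 * b))"
      unfolding frac_kernel_def
    proof (rule norm_subordination_le[OF q(2) p w(2) z(2) nu])
      show "norm x ^ (2 * b) > 0" using x by simp
      show "\<bar>wright \<gamma> t s\<bar> \<le> Cw * t powr (- \<gamma> - 1) * exp (- cw * (s * t powr (- \<alpha>)) powr q)" if "s > 0" for s
        using w(3)[OF t, of s] that by simp
      show "norm (weighted_Z b a \<beta> s x) \<le> Cz * s powr (- \<nu>) * exp (- cz * (norm x ^ (2 * b) / s) powr p)" if "s > 0" for s
        using bz[rule_format, OF sb that] .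
    qed (use t w z in auto)
    also have "\<dots> = (Cw * Cz) * ((t powr (- \<gamma> - 1) * t powr (\<alpha> * (1 - \<nu>))) * J (R_var \<alpha> b t x))"
      unfolding J_def R_var_def by (simp only: mult_ac)
    also have "t powr (- \<gamma> - 1) * t powr (\<alpha> * (1 - \<nu>)) = t powr (- \<gamma> - 1 + \<alpha> - \<alpha> * \<nu>)"
      unfolding powr_add[symmetric] by (simp add: algebra_simps)
    finally show ?thesis .
  qed
  have Cwz: "Cw * Cz > 0" using w z by simp
  obtain C1 \<sigma> where C1: "C1 > 0" "\<sigma> > 0" "\<And>R. R \<ge> 1 \<Longrightarrow> J R \<le> C1 * exp (- \<sigma> * R powr (1 / (2 * real b - \<alpha>)))"
    using subord_integral_decay[OF q(2) p w(2) z(2) nu] unfolding J_def qp by blast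
  have "\<exists>C2>0. \<nu> < 1 \<longrightarrow> (\<forall>R>0. J R \<le> C2)"
    using subord_integral_bounded[OF q(1) p w(2) z(2) nu] unfolding J_def by (cases "\<nu> < 1") (auto intro: exI[of _ 1])
  then obtain C2 where C2: "C2 > 0" "\<And>R. \<nu> < 1 \<Longrightarrow> R > 0 \<Longrightarrow> J R \<le> C2" by blast
  have "\<exists>C3>0. \<nu> > 1 \<longrightarrow> (\<forall>R>0. J R \<le> C3 * R powr (1 - \<nu>))"
    using subord_integral_singular[OF q(2) p w(2) z(2)] unfolding J_def by (cases "\<nu> > 1") (auto intro: exI[of _ 1])
  then obtain C3 where C3: "C3 > 0" "\<And>R. \<nu> > 1 \<Longrightarrow> R > 0 \<Longrightarrow> J R \<le> C3 * R powr (1 - \<nu>)" by blast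
  have "\<exists>C4>0. \<nu> = 1 \<longrightarrow> (\<forall>R. 0 < R \<and> R \<le> 1 \<longrightarrow> J R \<le> C4 * (\<bar>ln R\<bar> + 1))"
    using subord_integral_log[OF q(2) p w(2) z(2)] unfolding J_def by (cases "\<nu> = 1") (auto intro: exI[of _ 1])
  then obtain C4 where C4: "C4 > 0" "\<And>R. \<nu> = 1 \<Longrightarrow> 0 < R \<Longrightarrow> R \<le> 1 \<Longrightarrow> J R \<le> C4 * (\<bar>ln R\<bar> + 1)" by blast
  define C where "C = (Cw * Cz) * (C1 + C2 + C3 + C4)"
  have C: "C > 0" using Cwz C1(1) C2(1) C3(1) C4(1) by (simp add: C_def)
  have up: "norm (frac_kernel b a \<gamma> \<beta> t x) \<le> C * (t powr (- \<gamma> - 1 + \<alpha> - \<alpha> * \<nu>) * Q)"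
    if "strip_bound b \<delta> K a" "t > 0" "x \<noteq> 0" "J (R_var \<alpha> b t x) \<le> Ci * Q" "Q \<ge> 0" "Ci \<le> C1 + C2 + C3 + C4"
    for a :: "('n \<Rightarrow> nat) \<Rightarrow> complex ^ 'N ^ 'N" and t x Q Ci
  proof -
    have "J (R_var \<alpha> b t x) \<le> (C1 + C2 + C3 + C4) * Q"
      using that(4) mult_right_mono[OF that(6,5)] by linarith
    then have "(Cw * Cz) * (t powr (- \<gamma> - 1 + \<alpha> - \<alpha> * \<nu>) * J (R_var \<alpha> b t x)) \<le>
        (Cw * Cz) * (t powr (- \<gamma> - 1 + \<alpha> - \<alpha> * \<nu>) * ((C1 + C2 + C3 + C4) * Q))"
      using Cwz by (intro mult_left_mono) auto
    also have "\<dots> = C * (t powr (- \<gamma> - 1 + \<alpha> - \<alpha> * \<nu>) * Q)" unfolding C_def by (simp only: mult_ac)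
    finally show ?thesis using master[OF that(1,2,3)] by linarith
  qed
  have "kernel_estimates b \<delta> K \<gamma> \<beta> TYPE('N) C \<sigma>"
    unfolding kernel_estimates_def
  proof (intro allI impI)
    fix a :: "('n \<Rightarrow> nat) \<Rightarrow> complex ^ 'N ^ 'N" and t :: real and x :: "real ^ 'n"
    assume h: "strip_bound b \<delta> K a \<and> t > 0 \<and> x \<noteq> 0"
    then have sb: "strip_bound b \<delta> K a" and t: "t > 0" and x: "x \<noteq> 0" by auto
    note up' = up[OF sb t x]
    have R: "R_var \<alpha> b t x > 0" using R_var_pos[OF t x] .
    have rho: "rho \<alpha> b t x = R_var \<alpha> b t x powr (1 / (2 * real b - \<alpha>))" by (simp add: rho_def R_var_def)
    have 1: "norm (frac_kernel b a \<gamma> \<beta> t x) \<le> C * t powr (- \<gamma> - 1 + \<alpha> - \<alpha> * \<nu>) * exp (- \<sigma> * rho \<alpha> b t x)"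
      if "R_var \<alpha> b t x \<ge> 1"
      using up'[OF C1(3)[OF that]] C1(1) C2(1) C3(1) C4(1) unfolding rho mult.assoc by simp
    have 2: "norm (frac_kernel b a \<gamma> \<beta> t x) \<le> C * t powr (- \<gamma> - 1 + \<alpha> - \<alpha> * \<nu>)" if "CARD('n) + mi_size \<beta> < 2 * b"
    proof -
      have "real (CARD('n) + mi_size \<beta>) < real (2 * b)" using that by (simp only: of_nat_less_iff)
      then have "\<nu> < 1" using b by (simp add: \<nu>_def divide_less_eq)
      then show ?thesis using up'[of C2 1] C2(2)[OF _ R] C1(1) C2(1) C3(1) C4(1) by simp
    qed
    have 3: "norm (frac_kernel b a \<gamma> \<beta> t x) \<le> C * t powr (- \<gamma> - 1) * norm x powr (- real CARD('n) + 2 * real b - real (mi_size \<beta>))"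
      if "CARD('n) + mi_size \<beta> > 2 * b"
    proof -
      have "real (CARD('n) + mi_size \<beta>) > real (2 * b)" using that by (simp only: of_nat_less_iff)
      then have n1: "\<nu> > 1" using b by (simp add: \<nu>_def less_divide_eq)
      have "norm (frac_kernel b a \<gamma> \<beta> t x) \<le> C * (t powr (- \<gamma> - 1 + \<alpha> - \<alpha> * \<nu>) * R_var \<alpha> b t x powr (1 - \<nu>))"
        using up'[OF C3(2)[OF n1 R]] C1(1) C2(1) C3(1) C4(1) by simp
      also have "t powr (- \<gamma> - 1 + \<alpha> - \<alpha> * \<nu>) * R_var \<alpha> b t x powr (1 - \<nu>) =
          (t powr (- \<gamma> - 1 + \<alpha> - \<alpha> * \<nu>) * t powr (- \<alpha> * (1 - \<nu>))) * norm x powr (2 * real b * (1 - \<nu>))"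
        unfolding R_var_powr[OF t x b] by (simp only: mult.assoc)
      also have "t powr (- \<gamma> - 1 + \<alpha> - \<alpha> * \<nu>) * t powr (- \<alpha> * (1 - \<nu>)) = t powr (- \<gamma> - 1)"
        unfolding powr_add[symmetric] by (rule arg_cong[where f = "(powr) t"]) (simp add: algebra_simps)
      also have "2 * real b * (1 - \<nu>) = - real CARD('n) + 2 * real b - real (mi_size \<beta>)"
        using b by (simp add: \<nu>_def field_simps)
      finally show ?thesis by (simp only: mult.assoc)
    qed
    have 4: "norm (frac_kernel b a \<gamma> \<beta> t x) \<le> C * t powr (- \<gamma> - 1) * (\<bar>ln (R_var \<alpha> b t x)\<bar> + 1)"
      if "CARD('n) + mi_size \<beta> = 2 * b \<and> R_var \<alpha> b t x \<le> 1"
    proof -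
      have "real (CARD('n) + mi_size \<beta>) = real (2 * b)" using that by (simp only: of_nat_eq_iff)
      then have n1: "\<nu> = 1" using b by (simp add: \<nu>_def)
      have "norm (frac_kernel b a \<gamma> \<beta> t x) \<le> C * (t powr (- \<gamma> - 1 + \<alpha> - \<alpha> * \<nu>) * (\<bar>ln (R_var \<alpha> b t x)\<bar> + 1))"
        using up'[OF C4(2)[OF n1 R]] that C1(1) C2(1) C3(1) C4(1) by simp
      moreover have "- \<gamma> - 1 + \<alpha> - \<alpha> * \<nu> = - \<gamma> - 1" by (simp add: n1)
      ultimately show ?thesis by (simp only: mult.assoc)
    qed
    show "(R_var \<alpha> b t x \<ge> 1 \<longrightarrow> norm (frac_kernel b a \<gamma> \<beta> t x) \<le>
        C * t powr (- \<gamma> - 1 + \<alpha> - \<alpha> * (real (CARD('n) + mi_size \<beta>) / (2 * real b))) * exp (- \<sigma> * rho \<alpha> b t x)) \<and>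
      (CARD('n) + mi_size \<beta> < 2 * b \<longrightarrow> norm (frac_kernel b a \<gamma> \<beta> t x) \<le>
        C * t powr (- \<gamma> - 1 + \<alpha> - \<alpha> * (real (CARD('n) + mi_size \<beta>) / (2 * real b)))) \<and>
      (CARD('n) + mi_size \<beta> > 2 * b \<longrightarrow> norm (frac_kernel b a \<gamma> \<beta> t x) \<le>
        C * t powr (- \<gamma> - 1) * norm x powr (- real CARD('n) + 2 * real b - real (mi_size \<beta>))) \<and>
      (CARD('n) + mi_size \<beta> = 2 * b \<and> R_var \<alpha> b t x \<le> 1 \<longrightarrow> norm (frac_kernel b a \<gamma> \<beta> t x) \<le>
        C * t powr (- \<gamma> - 1) * (\<bar>ln (R_var \<alpha> b t x)\<bar> + 1))"
      using 1 2 3 4 unfolding \<nu>_def by (intro conjI impI)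
  qed
  then show ?thesis using C C1(2) by blast
qed

text \<open>
  By \<open>wright_0\<close> the weight contains a factor \<open>s\<close>, which cancels the \<open>1 / s\<close> in the bound of \<open>weighted_Z\<close>.
\<close>

lemma frac_kernel_critical_gamma_0:
  fixes \<beta> :: "'n::finite \<Rightarrow> nat"
  assumes b: "b \<ge> 1" and \<delta>: "\<delta> > 0" and K: "K > 0" and crit: "CARD('n) + mi_size \<beta> = 2 * b"
  shows "\<exists>C>0. \<forall>a :: ('n \<Rightarrow> nat) \<Rightarrow> complex ^ 'N ^ ('N::finite). \<forall>t x. strip_bound b \<delta> K a \<and> t > 0 \<and> x \<noteq> 0 \<longrightarrow>
    norm (frac_kernel b a 0 \<beta> t x) \<le> C * t powr (- 1)"
proof -
  define q where "q = 1 / (1 - \<alpha>)"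
  define p where "p = 1 / (2 * real b - 1)"
  have q: "q \<ge> 1" "q > 0" using alpha_pos alpha_less by (auto simp: q_def)
  have p: "p > 0" using b by (simp add: p_def)
  have "real (CARD('n) + mi_size \<beta>) = real (2 * b)" using crit by (simp only: of_nat_eq_iff)
  then have n1: "real (CARD('n) + mi_size \<beta>) / (2 * real b) = 1" using b by simp
  obtain Cw cw where w: "Cw > 0" "cw > 0" "\<And>t s. t > 0 \<Longrightarrow> s \<ge> 0 \<Longrightarrow>
      \<bar>wright (\<alpha> - 1) t s\<bar> \<le> Cw * t powr (- (\<alpha> - 1) - 1) * exp (- cw * (s * t powr (- \<alpha>)) powr q)"
    using wright_bound[of "\<alpha> - 1"] unfolding q_def by blast
  obtain Cz cz where z: "Cz > 0" "cz > 0" and bz: "\<forall>a :: ('n \<Rightarrow> nat) \<Rightarrow> complex ^ 'N ^ 'N. strip_bound b \<delta> K a \<longrightarrow>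
    (\<forall>s>0. \<forall>x. norm (weighted_Z b a \<beta> s x) \<le> Cz * s powr (- 1) * exp (- cz * (norm x ^ (2 * b) / s) powr p))"
    using weighted_Z_bound[OF b \<delta> K, of \<beta>, where 'N = 'N] unfolding p_def n1 by blast
  obtain CJ where J: "CJ > 0" "\<And>R. R > 0 \<Longrightarrow> subord_integral q p cw cz 0 R \<le> CJ"
    using subord_integral_bounded[OF q(1) p w(2) z(2) order_refl] by auto
  define C where "C = (\<alpha> * Cw) * Cz * CJ"
  have C: "C > 0" using alpha_pos w z J by (simp add: C_def)
  have "norm (frac_kernel b a 0 \<beta> t x) \<le> C * t powr (- 1)"
    if sb: "strip_bound b \<delta> K a" and t: "t > 0" and x: "x \<noteq> 0" for a :: "('n \<Rightarrow> nat) \<Rightarrow> complex ^ 'N ^ 'N" and t x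
  proof -
    have "frac_kernel b a 0 \<beta> t x = (\<integral>s. (\<alpha> / t * wright (\<alpha> - 1) t s) *\<^sub>R (s *\<^sub>R weighted_Z b a \<beta> s x) \<partial>halfline)"
      unfolding frac_kernel_def using t by (intro Bochner_Integration.integral_cong refl) (simp add: wright_0 mult_ac)
    also have "norm \<dots> \<le> (\<alpha> * Cw / t * t powr (- \<alpha>)) * Cz * t powr (\<alpha> * (1 - 0)) *
        subord_integral q p cw cz 0 (t powr (- \<alpha>) * norm x ^ (2 * b))"
    proof (rule norm_subordination_le[OF q(2) p w(2) z(2) order_refl])
      show "norm x ^ (2 * b) > 0" using x by simp
      show "\<bar>\<alpha> / t * wright (\<alpha> - 1) t s\<bar> \<le> \<alpha> * Cw / t * t powr (- \<alpha>) * exp (- cw * (s * t powr (- \<alpha>)) powr q)" if "s > 0" for s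
      proof -
        have "\<bar>\<alpha> / t * wright (\<alpha> - 1) t s\<bar> = \<alpha> / t * \<bar>wright (\<alpha> - 1) t s\<bar>" using alpha_pos t by (simp add: abs_mult)
        also have "\<dots> \<le> \<alpha> / t * (Cw * t powr (- (\<alpha> - 1) - 1) * exp (- cw * (s * t powr (- \<alpha>)) powr q))"
          using w(3)[OF t, of s] that alpha_pos t by (intro mult_left_mono) auto
        finally show ?thesis by simp
      qed
      show "norm (s *\<^sub>R weighted_Z b a \<beta> s x) \<le> Cz * s powr (- 0) * exp (- cz * (norm x ^ (2 * b) / s) powr p)" if "s > 0" for s
      proof -
        have "s * norm (weighted_Z b a \<beta> s x) \<le> s * (Cz * s powr (- 1) * exp (- cz * (norm x ^ (2 * b) / s) powr p))"
          using bz[rule_format, OF sb that] that by (intro mult_left_mono) auto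
        also have "\<dots> = (s * s powr (- 1)) * (Cz * exp (- cz * (norm x ^ (2 * b) / s) powr p))" by (simp only: mult_ac)
        finally show ?thesis using that by (simp add: powr_minus)
      qed
    qed (use t w z alpha_pos in auto)
    also have "\<dots> \<le> (\<alpha> * Cw / t * t powr (- \<alpha>)) * Cz * t powr (\<alpha> * (1 - 0)) * CJ"
      using J(2)[of "t powr (- \<alpha>) * norm x ^ (2 * b)"] t x alpha_pos w z by (intro mult_left_mono) auto
    also have "\<dots> = C * t powr (- 1)" using t by (simp add: C_def powr_minus field_simps)
    finally show ?thesis .
  qed
  then show ?thesis using C by blast
qed

text \<open>
  The gain \<open>|x| * s powr (- 1 / (2 * b))\<close> of the odd case moves \<open>\<nu>\<close> from \<open>1\<close> to \<open>1 + 1 / (2 * b)\<close>. The resulting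
  \<open>R powr (- 1 / (2 * b))\<close> is \<open>t powr (\<alpha> / (2 * b)) / |x|\<close>, so that \<open>|x|\<close> and the extra power of \<open>t\<close> cancel and no
  logarithm arises.
\<close>

lemma frac_kernel_critical_odd:
  fixes \<beta> :: "'n::finite \<Rightarrow> nat"
  assumes b: "b \<ge> 1" and \<delta>: "\<delta> > 0" and K: "K > 0" and crit: "CARD('n) + mi_size \<beta> = 2 * b" and odd: "odd (mi_size \<beta>)"
  shows "\<exists>C>0. \<forall>a :: ('n \<Rightarrow> nat) \<Rightarrow> complex ^ 'N ^ ('N::finite). \<forall>t x. strip_bound b \<delta> K a \<and> t > 0 \<and> x \<noteq> 0 \<longrightarrow>
    norm (frac_kernel b a \<gamma> \<beta> t x) \<le> C * t powr (- \<gamma> - 1)"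
proof -
  define q where "q = 1 / (1 - \<alpha>)"
  define p where "p = 1 / (2 * real b - 1)"
  define \<nu> where "\<nu> = 1 + 1 / (2 * real b)"
  have q: "q \<ge> 1" "q > 0" using alpha_pos alpha_less by (auto simp: q_def)
  have p: "p > 0" using b by (simp add: p_def)
  have nu: "\<nu> > 1" "\<nu> \<ge> 0" using b by (auto simp: \<nu>_def)
  have "real (CARD('n) + mi_size \<beta> + 1) = 2 * real b + 1" using crit by simp
  then have n1: "real (CARD('n) + mi_size \<beta> + 1) / (2 * real b) = \<nu>" using b by (simp add: \<nu>_def add_divide_distrib)
  obtain Cw cw where w: "Cw > 0" "cw > 0" "\<And>t s. t > 0 \<Longrightarrow> s \<ge> 0 \<Longrightarrow>
      \<bar>wright \<gamma> t s\<bar> \<le> Cw * t powr (- \<gamma> - 1) * exp (- cw * (s * t powr (- \<alpha>)) powr q)"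
    using wright_bound[of \<gamma>] unfolding q_def by blast
  obtain Cz cz where z: "Cz > 0" "cz > 0" and bz: "\<forall>a :: ('n \<Rightarrow> nat) \<Rightarrow> complex ^ 'N ^ 'N. strip_bound b \<delta> K a \<longrightarrow>
    (\<forall>s>0. \<forall>x. norm (weighted_Z b a \<beta> s x) \<le> Cz * norm x * s powr (- \<nu>) * exp (- cz * (norm x ^ (2 * b) / s) powr p))"
    using weighted_Z_odd_bound[OF b \<delta> K odd, where 'N = 'N] unfolding p_def n1 by blast
  obtain CJ where J: "CJ > 0" "\<And>R. R > 0 \<Longrightarrow> subord_integral q p cw cz \<nu> R \<le> CJ * R powr (1 - \<nu>)"
    using subord_integral_singular[OF q(2) p w(2) z(2) nu(1)] by blast
  define C where "C = Cw * Cz * CJ"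
  have C: "C > 0" using w z J by (simp add: C_def)
  have "norm (frac_kernel b a \<gamma> \<beta> t x) \<le> C * t powr (- \<gamma> - 1)"
    if sb: "strip_bound b \<delta> K a" and t: "t > 0" and x: "x \<noteq> 0" for a :: "('n \<Rightarrow> nat) \<Rightarrow> complex ^ 'N ^ 'N" and t x
  proof -
    have "norm (frac_kernel b a \<gamma> \<beta> t x) \<le> (Cw * t powr (- \<gamma> - 1)) * (Cz * norm x) * t powr (\<alpha> * (1 - \<nu>)) *
        subord_integral q p cw cz \<nu> (t powr (- \<alpha>) * norm x ^ (2 * b))"
      unfolding frac_kernel_def
    proof (rule norm_subordination_le[OF q(2) p w(2) z(2) nu(2)])
      show "norm x ^ (2 * b) > 0" using x by simp
      show "\<bar>wright \<gamma> t s\<bar> \<le> Cw * t powr (- \<gamma> - 1) * exp (- cw * (s * t powr (- \<alpha>)) powr q)" if "s > 0" for s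
        using w(3)[OF t, of s] that by simp
      show "norm (weighted_Z b a \<beta> s x) \<le> Cz * norm x * s powr (- \<nu>) * exp (- cz * (norm x ^ (2 * b) / s) powr p)" if "s > 0" for s
        using bz[rule_format, OF sb that] .
    qed (use t w z in auto)
    also have "\<dots> \<le> (Cw * t powr (- \<gamma> - 1)) * (Cz * norm x) * t powr (\<alpha> * (1 - \<nu>)) * (CJ * R_var \<alpha> b t x powr (1 - \<nu>))"
      using J(2)[OF R_var_pos[OF t x]] w z unfolding R_var_def by (intro mult_left_mono) auto
    also have "\<dots> = C * t powr (- \<gamma> - 1) * ((t powr (\<alpha> * (1 - \<nu>)) * t powr (- \<alpha> * (1 - \<nu>))) * (norm x * norm x powr (2 * real b * (1 - \<nu>))))"
      unfolding C_def R_var_powr[OF t x b] by (simp only: mult_ac)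
    also have "t powr (\<alpha> * (1 - \<nu>)) * t powr (- \<alpha> * (1 - \<nu>)) = 1"
      unfolding powr_add[symmetric] using t by simp
    also have "2 * real b * (1 - \<nu>) = - 1" using b by (simp add: \<nu>_def)
    also have "norm x * norm x powr (- 1) = 1" using x by (simp add: powr_minus)
    finally show ?thesis by simp
  qed
  then show ?thesis using C by blast
qed

end

section \<open>Smoothness and estimates of the fundamental solution\<close>

theorem theorem1:
  fixes \<alpha> \<delta> M :: real and b :: nat
  assumes "0 < \<alpha>" and "\<alpha> < 1" and "b \<ge> 1" and "\<delta> > 0"
  shows
  "(\<forall>a :: ('n::{finite,linorder} \<Rightarrow> nat) \<Rightarrow> complex ^ 'N ^ ('N::finite).
      strongly_parabolic b \<delta> a \<longrightarrow>
        C_infinity_on {(t, x). t > 0 \<and> x \<noteq> 0} (\<lambda>(t, x). Z_frac \<alpha> b a t x) \<and>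
        C_infinity_on {(t, x). t > 0 \<and> x \<noteq> 0} (\<lambda>(t, x). Y_frac \<alpha> b a t x))
   \<and>
   (\<forall>\<beta> :: 'n \<Rightarrow> nat. \<exists>C>0. \<exists>\<sigma>>0.
      \<forall>a :: ('n \<Rightarrow> nat) \<Rightarrow> complex ^ 'N ^ 'N.
      strongly_parabolic b \<delta> a \<and> coeff_max b a = M \<longrightarrow>
      (\<forall>t x. t > 0 \<and> x \<noteq> 0 \<longrightarrow>
        (R_var \<alpha> b t x \<ge> 1 \<longrightarrow>
           norm (multi_D \<beta> (Z_frac \<alpha> b a t) x)
             \<le> C * t powr (- \<alpha> * (real CARD('n) + real (mi_size \<beta>)) / (2 * real b))
                 * exp (- \<sigma> * rho \<alpha> b t x) \<and>
           norm (multi_D \<beta> (Y_frac \<alpha> b a t) x)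
             \<le> C * t powr (- \<alpha> * (real CARD('n) + real (mi_size \<beta>)) / (2 * real b) + \<alpha> - 1)
                 * exp (- \<sigma> * rho \<alpha> b t x)) \<and>
        (R_var \<alpha> b t x \<le> 1 \<and> CARD('n) + mi_size \<beta> < 2 * b \<longrightarrow>
           norm (multi_D \<beta> (Z_frac \<alpha> b a t) x)
             \<le> C * t powr (- \<alpha> * (real CARD('n) + real (mi_size \<beta>)) / (2 * real b)) \<and>
           norm (multi_D \<beta> (Y_frac \<alpha> b a t) x)
             \<le> C * t powr (- \<alpha> * (real CARD('n) + real (mi_size \<beta>)) / (2 * real b) + \<alpha> - 1)) \<and>
        (R_var \<alpha> b t x \<le> 1 \<and> CARD('n) + mi_size \<beta> > 2 * b \<longrightarrow>
           norm (multi_D \<beta> (Z_frac \<alpha> b a t) x)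
             \<le> C * t powr (- \<alpha>)
                 * norm x powr (- real CARD('n) + 2 * real b - real (mi_size \<beta>)) \<and>
           norm (multi_D \<beta> (Y_frac \<alpha> b a t) x)
             \<le> C * t powr (- 1)
                 * norm x powr (- real CARD('n) + 2 * real b - real (mi_size \<beta>))) \<and>
        (R_var \<alpha> b t x \<le> 1 \<and> CARD('n) + mi_size \<beta> = 2 * b \<longrightarrow>
           (CARD('n) = 1 \<longrightarrow>
              norm (multi_D \<beta> (Z_frac \<alpha> b a t) x) \<le> C * t powr (- \<alpha>)) \<and>
           (CARD('n) \<ge> 2 \<longrightarrow>
              norm (multi_D \<beta> (Z_frac \<alpha> b a t) x)
                \<le> C * t powr (- \<alpha>) * (\<bar>ln (t powr (- \<alpha>) * norm x ^ (2 * b))\<bar> + 1)) \<and>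
           norm (multi_D \<beta> (Y_frac \<alpha> b a t) x) \<le> C * t powr (- 1))))
   \<and>
   (\<exists>C>0. \<exists>\<sigma>>0.
      \<forall>a :: ('n \<Rightarrow> nat) \<Rightarrow> complex ^ 'N ^ 'N.
      strongly_parabolic b \<delta> a \<and> coeff_max b a = M \<longrightarrow>
      (\<forall>t x. t > 0 \<and> x \<noteq> 0 \<longrightarrow>
        (R_var \<alpha> b t x \<ge> 1 \<longrightarrow>
           norm (Z_frac_dt \<alpha> b a t x)
             \<le> C * t powr (- \<alpha> * real CARD('n) / (2 * real b) - 1)
                 * exp (- \<sigma> * rho \<alpha> b t x)) \<and>
        (R_var \<alpha> b t x \<le> 1 \<longrightarrow>
           (CARD('n) < 2 * b \<longrightarrow>
              norm (Z_frac_dt \<alpha> b a t x)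
                \<le> C * t powr (- \<alpha> * real CARD('n) / (2 * real b) - 1)) \<and>
           (CARD('n) > 2 * b \<longrightarrow>
              norm (Z_frac_dt \<alpha> b a t x)
                \<le> C * t powr (- \<alpha> - 1) * norm x powr (- real CARD('n) + 2 * real b)) \<and>
           (CARD('n) = 2 * b \<longrightarrow>
              norm (Z_frac_dt \<alpha> b a t x)
                \<le> C * t powr (- \<alpha> - 1) * (\<bar>ln (t powr (- \<alpha>) * norm x ^ (2 * b))\<bar> + 1)))))"
proof -
  interpret fractional_order \<alpha> by unfold_locales (use assms in auto)
  note b = assms(3) and \<delta> = assms(4)
  have smooth: "C_infinity_on {(t, x). t > 0 \<and> x \<noteq> 0} (\<lambda>(t, x). Z_frac \<alpha> b a t x) \<and>
      C_infinity_on {(t, x). t > 0 \<and> x \<noteq> 0} (\<lambda>(t, x). Y_frac \<alpha> b a t x)"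
    if sp: "strongly_parabolic b \<delta> a" for a :: "('n \<Rightarrow> nat) \<Rightarrow> complex ^ 'N ^ 'N"
  proof -
    obtain K where K: "K > 0" and sb: "strip_bound b \<delta> K a"
      using strip_bound_admissible[OF b \<delta>, of "coeff_max b a", where 'n = 'n and 'N = 'N] admissible_coeff_max[OF sp] by blast
    have Z: "C_infinity_on {(t, x). t > 0 \<and> x \<noteq> 0} (\<lambda>(t, x). Z_frac \<alpha> b a t x)"
      by (rule C_infinity_on_cong[OF open_positive_time_nonzero _ C_infinity_on_frac_kernel[OF b \<delta> K sb]])
        (auto simp: Z_frac_eq_frac_kernel)
    have Y: "C_infinity_on {(t, x). t > 0 \<and> x \<noteq> 0} (\<lambda>(t, x). Y_frac \<alpha> b a t x)"
      by (rule C_infinity_on_cong[OF open_positive_time_nonzero _ C_infinity_on_frac_kernel[OF b \<delta> K sb]])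
        (auto simp: Y_frac_eq_frac_kernel[OF b \<delta> K sb])
    show ?thesis using Z Y by blast
  qed
  \<comment> \<open>\<open>K\<close> is chosen before the coefficients and depends on them only through \<open>\<delta>\<close> and \<open>M\<close>.\<close>
  obtain K where K: "K > 0" and K_adm: "\<forall>a :: ('n \<Rightarrow> nat) \<Rightarrow> complex ^ 'N ^ 'N. admissible b \<delta> M a \<longrightarrow> strip_bound b \<delta> K a"
    using strip_bound_admissible[OF b \<delta>, of M, where 'n = 'n and 'N = 'N] by blast
  have sb: "strip_bound b \<delta> K a" if "strongly_parabolic b \<delta> a \<and> coeff_max b a = M"
    for a :: "('n \<Rightarrow> nat) \<Rightarrow> complex ^ 'N ^ 'N"
    using that K_adm admissible_coeff_max[of b \<delta> a] by blast
  show ?thesis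
  proof (intro conjI, goal_cases)
    case 1
    show ?case using smooth by blast
  next
    case 2
    show ?case
    proof (rule allI)
      fix \<beta> :: "'n \<Rightarrow> nat"
      obtain C1 \<sigma>1 where 1: "C1 > 0" "\<sigma>1 > 0" "kernel_estimates b \<delta> K (\<alpha> - 1) \<beta> TYPE('N) C1 \<sigma>1"
        using kernel_estimates_exist[OF b \<delta> K] by blast
      obtain C2 \<sigma>2 where 2: "C2 > 0" "\<sigma>2 > 0" "kernel_estimates b \<delta> K 0 \<beta> TYPE('N) C2 \<sigma>2"
        using kernel_estimates_exist[OF b \<delta> K] by blast
      obtain C3 where 3: "C3 > 0" "\<And>(a :: ('n \<Rightarrow> nat) \<Rightarrow> complex ^ 'N ^ 'N) t x. CARD('n) + mi_size \<beta> = 2 * b \<Longrightarrow>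
          strip_bound b \<delta> K a \<Longrightarrow> t > 0 \<Longrightarrow> x \<noteq> 0 \<Longrightarrow> norm (frac_kernel b a 0 \<beta> t x) \<le> C3 * t powr (- 1)"
      proof (cases "CARD('n) + mi_size \<beta> = 2 * b")
        case True
        then show thesis using frac_kernel_critical_gamma_0[OF b \<delta> K True, where 'N = 'N] that by blast
      qed (use that[of 1] in simp)
      \<comment> \<open>In dimension one the critical case has \<open>|\<beta>| = 2 * b - 1\<close>, which is odd.\<close>
      obtain C4 where 4: "C4 > 0" "\<And>(a :: ('n \<Rightarrow> nat) \<Rightarrow> complex ^ 'N ^ 'N) t x. CARD('n) + mi_size \<beta> = 2 * b \<Longrightarrow>
          CARD('n) = 1 \<Longrightarrow> strip_bound b \<delta> K a \<Longrightarrow> t > 0 \<Longrightarrow> x \<noteq> 0 \<Longrightarrow>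
          norm (frac_kernel b a (\<alpha> - 1) \<beta> t x) \<le> C4 * t powr (- (\<alpha> - 1) - 1)"
      proof (cases "CARD('n) + mi_size \<beta> = 2 * b \<and> CARD('n) = 1")
        case True
        then have crit: "CARD('n) + mi_size \<beta> = 2 * b" and "mi_size \<beta> + 1 = 2 * b" by auto
        then have "even (mi_size \<beta> + 1)" by simp
        then have odd: "odd (mi_size \<beta>)" by simp
        show thesis
          using frac_kernel_critical_odd[OF b \<delta> K crit odd, of "\<alpha> - 1", where 'N = 'N] that by blast
      qed (use that[of 1] in auto)
      define C where "C = C1 + C2 + C3 + C4"
      define \<sigma> where "\<sigma> = min \<sigma>1 \<sigma>2"
      have C: "C > 0" "C1 \<le> C" "C2 \<le> C" "C3 \<le> C" "C4 \<le> C" using 1(1) 2(1) 3(1) 4(1) by (simp_all add: C_def)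
      have \<sigma>: "\<sigma> > 0" using 1 2 by (simp add: \<sigma>_def)
      have Z: "kernel_estimates b \<delta> K (\<alpha> - 1) \<beta> TYPE('N) C \<sigma>"
        using kernel_estimates_mono[OF 1(3) C(2)] 1 by (simp add: \<sigma>_def)
      have Y: "kernel_estimates b \<delta> K 0 \<beta> TYPE('N) C \<sigma>"
        using kernel_estimates_mono[OF 2(3) C(3)] 2 by (simp add: \<sigma>_def)
      have eZ: "- (\<alpha> - 1) - 1 + \<alpha> - \<alpha> * (real (CARD('n) + mi_size \<beta>) / (2 * real b)) =
          - \<alpha> * (real CARD('n) + real (mi_size \<beta>)) / (2 * real b)" by simp
      have eY: "- 0 - 1 + \<alpha> - \<alpha> * (real (CARD('n) + mi_size \<beta>) / (2 * real b)) =
          - \<alpha> * (real CARD('n) + real (mi_size \<beta>)) / (2 * real b) + \<alpha> - 1" by simp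
      have e0: "- (\<alpha> - 1) - 1 = - \<alpha>" "- 0 - 1 = (- 1 :: real)" by simp_all
      show 
"\<exists>C>0. \<exists>\<sigma>>0.
      \<forall>a :: ('n \<Rightarrow> nat) \<Rightarrow> complex ^ 'N ^ 'N.
      strongly_parabolic b \<delta> a \<and> coeff_max b a = M \<longrightarrow>
      (\<forall>t x. t > 0 \<and> x \<noteq> 0 \<longrightarrow>
        (R_var \<alpha> b t x \<ge> 1 \<longrightarrow>
           norm (multi_D \<beta> (Z_frac \<alpha> b a t) x)
             \<le> C * t powr (- \<alpha> * (real CARD('n) + real (mi_size \<beta>)) / (2 * real b))
                 * exp (- \<sigma> * rho \<alpha> b t x) \<and>
           norm (multi_D \<beta> (Y_frac \<alpha> b a t) x)
             \<le> C * t powr (- \<alpha> * (real CARD('n) + real (mi_size \<beta>)) / (2 * real b) + \<alpha> - 1)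
                 * exp (- \<sigma> * rho \<alpha> b t x)) \<and>
        (R_var \<alpha> b t x \<le> 1 \<and> CARD('n) + mi_size \<beta> < 2 * b \<longrightarrow>
           norm (multi_D \<beta> (Z_frac \<alpha> b a t) x)
             \<le> C * t powr (- \<alpha> * (real CARD('n) + real (mi_size \<beta>)) / (2 * real b)) \<and>
           norm (multi_D \<beta> (Y_frac \<alpha> b a t) x)
             \<le> C * t powr (- \<alpha> * (real CARD('n) + real (mi_size \<beta>)) / (2 * real b) + \<alpha> - 1)) \<and>
        (R_var \<alpha> b t x \<le> 1 \<and> CARD('n) + mi_size \<beta> > 2 * b \<longrightarrow>
           norm (multi_D \<beta> (Z_frac \<alpha> b a t) x)
             \<le> C * t powr (- \<alpha>)
                 * norm x powr (- real CARD('n) + 2 * real b - real (mi_size \<beta>)) \<and>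
           norm (multi_D \<beta> (Y_frac \<alpha> b a t) x)
             \<le> C * t powr (- 1)
                 * norm x powr (- real CARD('n) + 2 * real b - real (mi_size \<beta>))) \<and>
        (R_var \<alpha> b t x \<le> 1 \<and> CARD('n) + mi_size \<beta> = 2 * b \<longrightarrow>
           (CARD('n) = 1 \<longrightarrow>
              norm (multi_D \<beta> (Z_frac \<alpha> b a t) x) \<le> C * t powr (- \<alpha>)) \<and>
           (CARD('n) \<ge> 2 \<longrightarrow>
              norm (multi_D \<beta> (Z_frac \<alpha> b a t) x)
                \<le> C * t powr (- \<alpha>) * (\<bar>ln (t powr (- \<alpha>) * norm x ^ (2 * b))\<bar> + 1)) \<and>
           norm (multi_D \<beta> (Y_frac \<alpha> b a t) x) \<le> C * t powr (- 1)))"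
      proof (rule exI[of _ C], rule conjI[OF C(1)], rule exI[of _ \<sigma>], rule conjI[OF \<sigma>], intro allI impI, goal_cases)
        case (1 a t x)
        note a = sb[OF 1(1)]
        have t: "t > 0" and x: "x \<noteq> 0" using 1(2) by auto
        have DZ: "multi_D \<beta> (Z_frac \<alpha> b a t) x = frac_kernel b a (\<alpha> - 1) \<beta> t x"
          by (rule multi_D_frac_kernel[OF b \<delta> K a t x]) (rule Z_frac_eq_frac_kernel[OF t])
        have DY: "multi_D \<beta> (Y_frac \<alpha> b a t) x = frac_kernel b a 0 \<beta> t x"
          by (rule multi_D_frac_kernel[OF b \<delta> K a t x]) (rule Y_frac_eq_frac_kernel[OF b \<delta> K a t])
        have h: "strip_bound b \<delta> K a \<and> t > 0 \<and> x \<noteq> 0" using a t x by blast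
        note estZ = Z[unfolded kernel_estimates_def, unfolded eZ, unfolded e0, rule_format, OF h]
        note estY = Y[unfolded kernel_estimates_def, unfolded eY, unfolded e0, rule_format, OF h]
        have logZ: "norm (frac_kernel b a (\<alpha> - 1) \<beta> t x) \<le> C * t powr (- \<alpha>) * (\<bar>ln (t powr (- \<alpha>) * norm x ^ (2 * b))\<bar> + 1)"
          if "R_var \<alpha> b t x \<le> 1 \<and> CARD('n) + mi_size \<beta> = 2 * b"
          using estZ that unfolding R_var_def by blast
        have critY: "norm (frac_kernel b a 0 \<beta> t x) \<le> C * t powr (- 1)" if "CARD('n) + mi_size \<beta> = 2 * b"
          by (rule order_trans[OF 3(2)[OF that a t x]]) (intro mult_right_mono C powr_ge_zero)
        have critZ: "norm (frac_kernel b a (\<alpha> - 1) \<beta> t x) \<le> C * t powr (- \<alpha>)"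
          if "CARD('n) + mi_size \<beta> = 2 * b" "CARD('n) = 1"
          by (rule order_trans[OF 4(2)[OF that a t x, unfolded e0]]) (intro mult_right_mono C powr_ge_zero)
        show ?case unfolding DZ DY using estZ estY logZ critY critZ by blast
      qed
    qed
  next
    case 3
    obtain C \<sigma> where C: "C > 0" and \<sigma>: "\<sigma> > 0" and E: "kernel_estimates b \<delta> K \<alpha> (\<lambda>_ :: 'n. 0) TYPE('N) C \<sigma>"
      using kernel_estimates_exist[OF b \<delta> K] by blast
    have m: "mi_size (\<lambda>_ :: 'n. 0) = 0" by (simp add: mi_size_def)
    have e: "- \<alpha> - 1 + \<alpha> - \<alpha> * (real (CARD('n) + 0) / (2 * real b)) = - \<alpha> * real CARD('n) / (2 * real b) - 1"
      "- real CARD('n) + 2 * real b - real 0 = - real CARD('n) + 2 * real b" by simp_all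
    show ?case
    proof (rule exI[of _ C], rule conjI[OF C], rule exI[of _ \<sigma>], rule conjI[OF \<sigma>], intro allI impI, goal_cases)
      case (1 a t x)
      note a = sb[OF 1(1)]
      have t: "t > 0" and x: "x \<noteq> 0" using 1(2) by auto
      have h: "strip_bound b \<delta> K a \<and> t > 0 \<and> x \<noteq> 0" using a t x by blast
      note est = E[unfolded kernel_estimates_def m, unfolded e, unfolded add_0_right, rule_format, OF h]
      have log: "norm (frac_kernel b a \<alpha> (\<lambda>_. 0) t x) \<le>
          C * t powr (- \<alpha> - 1) * (\<bar>ln (t powr (- \<alpha>) * norm x ^ (2 * b))\<bar> + 1)"
        if "R_var \<alpha> b t x \<le> 1" "CARD('n) = 2 * b"
        using est that unfolding R_var_def by blast
      show ?case unfolding Z_frac_dt_eq_frac_kernel[OF b \<delta> K a t x] using est log by blast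
    qed
  qed
qed

end
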